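(* Let $\Upsilon_1\subset\mathbb{R}^2$ be a bounded curvilinear polygonal domain which either has no reentrant corner, or has exactly one reentrant corner, of opening $2\theta_0=\pi/\alpha$ with $1/2<\alpha<1$, such that the two sides meeting there are locally straight and $\Upsilon_1$ is contained in its tangent cone at that corner. For $\epsilon>0$ let $\phi_\epsilon$ be the solution of $$-\Delta\phi_\epsilon=\epsilon^{-2}\mathrm{e}^{-\phi_\epsilon}\ \text{ in }\Upsilon_1,\qquad\phi_\epsilon=0\ \text{ on }\partial\Upsilon_1,$$ and let $M_\epsilon=\int_{\Upsilon_1}\epsilon^{-2}\mathrm{e}^{-\phi_\epsilon}$. Let $|\partial\Upsilon_1|$ be the perimeter of $\Upsilon_1$. Then $$M_\epsilon\sim\sqrt2\,|\partial\Upsilon_1|\,\epsilon^{-1}\quad\text{as }\epsilon\to0.$$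
   Context: A curvilinear polygon is an open set $\mathcal{O}\subset\mathbb{R}^2$ such that for any $\boldsymbol{x}_0\in\overline{\mathcal{O}}$ and $\eta$ small enough, $\mathcal{O}\cap B(\boldsymbol{x}_0,\eta)$ is $C^2$-diffeomorphic (up to the boundary, near $\boldsymbol{x}_0$) either to $\mathbb{R}^2$ or to a sector $\{(r\cos\theta,r\sin\theta):r>0,\ |\theta|<\theta_{\boldsymbol{x}_0}\}$ with $0<\theta_{\boldsymbol{x}_0}<\pi$; this includes smooth domains and straight polygons and excludes cusps and cracks. A corner of opening $2\theta_{\boldsymbol{c}}$ is reentrant if $2\theta_{\boldsymbol{c}}>\pi$. The function $\phi_\epsilon\in H^1_0(\Upsilon_1)$ is the unique variational solution. The notation $f\sim g$ means $f/g\to1$. *)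

theory Defs
  imports "HOL-Analysis.Analysis" "HOL-Library.Landau_Symbols"
begin

section \<open>Differentiability classes\<close>

text \<open>The class \<open>C\<^sup>k\<close> on an open set \<open>U\<close>, by recursion on directional derivatives: in finite
  dimension \<open>f\<close> is \<open>C\<^sup>k\<^sup>+\<^sup>1\<close> iff it is differentiable and \<open>x \<mapsto> Df(x)v\<close> is \<open>C\<^sup>k\<close> for every \<open>v\<close>.
  Only meant for open \<open>U\<close>, since the derivatives are full ones.\<close>

primrec Ck_on :: "nat \<Rightarrow> ('a::euclidean_space \<Rightarrow> 'b::euclidean_space) \<Rightarrow> 'a set \<Rightarrow> bool" where
  "Ck_on 0 f U \<longleftrightarrow> continuous_on U f"
| "Ck_on (Suc k) f U \<longleftrightarrow>
     (\<forall>x\<in>U. f differentiable (at x)) \<and>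
     (\<forall>v. Ck_on k (\<lambda>x. frechet_derivative f (at x) v) U)"

definition C2_diffeomorphism ::
    "('a::euclidean_space) set \<Rightarrow> 'a set \<Rightarrow> ('a \<Rightarrow> 'a) \<Rightarrow> ('a \<Rightarrow> 'a) \<Rightarrow> bool" where
  "C2_diffeomorphism U V \<Phi> \<Psi> \<longleftrightarrow>
     open U \<and> open V \<and> homeomorphism U V \<Phi> \<Psi> \<and> Ck_on 2 \<Phi> U \<and> Ck_on 2 \<Psi> V"

section \<open>Curvilinear polygons, corners and openings\<close>

definition sector :: "real \<Rightarrow> (real^2) set" where
  "sector \<theta> = {vector [r * cos t, r * sin t] | r t. 0 < r \<and> \<bar>t\<bar> < \<theta>}"

text \<open>``Diffeomorphic up to the boundary, near \<open>x\<^sub>0\<close>'' is expressed by a \<open>C\<^sup>2\<close> diffeomorphism of the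
  whole ball \<open>B(x\<^sub>0, \<eta>)\<close> onto an open neighbourhood \<open>V\<close> of the origin that sends \<open>x\<^sub>0\<close> to the origin
  and the part of the set in the ball to the part of the model \<open>K\<close> in \<open>V\<close>.\<close>

definition curvilinear_polygon :: "(real^2) set \<Rightarrow> bool" where
  "curvilinear_polygon \<O> \<longleftrightarrow> open \<O> \<and>
     (\<forall>x0\<in>closure \<O>. \<exists>K.
        (K = UNIV \<or> (\<exists>\<theta>. 0 < \<theta> \<and> \<theta> < pi \<and> K = sector \<theta>)) \<and>
        (\<forall>\<^sub>F \<eta> in at_right 0. \<exists>V \<Phi> \<Psi>.
            C2_diffeomorphism (ball x0 \<eta>) V \<Phi> \<Psi> \<and> \<Phi> x0 = 0 \<and>
            \<Phi> ` (\<O> \<inter> ball x0 \<eta>) = K \<inter> V))"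

text \<open>The tangent (contingent) cone, with its vertex translated to the origin. It is a closed set. At
  a boundary point of a curvilinear polygon it is a closed sector whose interior is the open tangent
  sector, and an open set lies in the closed sector iff it lies in the open one.\<close>

definition tangent_cone :: "'a::real_normed_vector set \<Rightarrow> 'a \<Rightarrow> 'a set" where
  "tangent_cone S x = {v. \<exists>y t. (\<forall>n. y n \<in> S \<and> 0 < t n) \<and> y \<longlonglongrightarrow> x \<and>
     (\<lambda>n. t n *\<^sub>R (y n - x)) \<longlonglongrightarrow> v}"

text \<open>The diffeomorphisms above need not preserve angles, so the opening is read off from the tangent
  cone, which has to be congruent to the model sector. Smooth boundary points have opening \<open>\<pi>\<close>.\<close>

definition has_opening :: "(real^2) set \<Rightarrow> real^2 \<Rightarrow> real \<Rightarrow> bool" where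
  "has_opening \<O> c \<omega> \<longleftrightarrow> c \<in> frontier \<O> \<and>
     (\<exists>\<theta> R. \<omega> = 2 * \<theta> \<and> 0 < \<theta> \<and> \<theta> < pi \<and> orthogonal_transformation R \<and>
        tangent_cone \<O> c = R ` closure (sector \<theta>))"

definition reentrant_corner :: "(real^2) set \<Rightarrow> real^2 \<Rightarrow> bool" where
  "reentrant_corner \<O> c \<longleftrightarrow> (\<exists>\<omega>. has_opening \<O> c \<omega> \<and> pi < \<omega>)"

definition sides_locally_straight :: "(real^2) set \<Rightarrow> real^2 \<Rightarrow> bool" where
  "sides_locally_straight \<O> c \<longleftrightarrow>
     (\<exists>\<eta>>0. \<exists>a b. a \<noteq> c \<and> b \<noteq> c \<and>
        frontier \<O> \<inter> ball c \<eta> = (closed_segment c a \<union> closed_segment c b) \<inter> ball c \<eta>)"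

section \<open>Perimeter\<close>

text \<open>One-dimensional Hausdorff (outer) measure.\<close>

definition hausdorff_length :: "'a::metric_space set \<Rightarrow> ennreal" where
  "hausdorff_length A =
     (SUP \<delta>\<in>{0<..}.
        INF C\<in>{C :: nat \<Rightarrow> 'a set. A \<subseteq> (\<Union>i. C i) \<and> (\<forall>i. bounded (C i) \<and> diameter (C i) \<le> \<delta>)}.
          \<Sum>i. ennreal (diameter (C i)))"

definition perimeter :: "'a::metric_space set \<Rightarrow> real" where
  "perimeter S = enn2real (hausdorff_length (frontier S))"

section \<open>Sobolev spaces\<close>

definition test_functions :: "'a::euclidean_space set \<Rightarrow> ('a \<Rightarrow> real) set" where
  "test_functions \<Omega> = {\<psi>. (\<forall>k. Ck_on k \<psi> UNIV) \<and>
     compact (closure {x. \<psi> x \<noteq> 0}) \<and> closure {x. \<psi> x \<noteq> 0} \<subseteq> \<Omega>}"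

definition square_integrable_on :: "('a::euclidean_space \<Rightarrow> 'b::euclidean_space) \<Rightarrow> 'a set \<Rightarrow> bool"
  where "square_integrable_on f \<Omega> \<longleftrightarrow> f \<in> borel_measurable (lebesgue_on \<Omega>) \<and>
     integrable (lebesgue_on \<Omega>) (\<lambda>x. (norm (f x))\<^sup>2)"

definition has_weak_gradient ::
    "'a::euclidean_space set \<Rightarrow> ('a \<Rightarrow> real) \<Rightarrow> ('a \<Rightarrow> 'a) \<Rightarrow> bool" where
  "has_weak_gradient \<Omega> u G \<longleftrightarrow>
     (\<forall>K. compact K \<and> K \<subseteq> \<Omega> \<longrightarrow> integrable (lebesgue_on K) u \<and> integrable (lebesgue_on K) G) \<and>
     (\<forall>\<psi>\<in>test_functions \<Omega>. \<forall>v.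
        (\<integral>x. u x * frechet_derivative \<psi> (at x) v \<partial>lebesgue_on \<Omega>) =
        - (\<integral>x. (G x \<bullet> v) * \<psi> x \<partial>lebesgue_on \<Omega>))"

text \<open>Functions are representatives, not classes; for open \<open>\<Omega>\<close> the weak gradient is unique up to a
  null set of \<open>\<Omega>\<close>, so the choice below does not affect any integral over \<open>\<Omega>\<close>.\<close>

definition weak_gradient :: "'a::euclidean_space set \<Rightarrow> ('a \<Rightarrow> real) \<Rightarrow> 'a \<Rightarrow> 'a" where
  "weak_gradient \<Omega> u = (SOME G. has_weak_gradient \<Omega> u G)"

definition sobolev_H1 :: "'a::euclidean_space set \<Rightarrow> ('a \<Rightarrow> real) set" where
  "sobolev_H1 \<Omega> = {u. square_integrable_on u \<Omega> \<and>
     (\<exists>G. has_weak_gradient \<Omega> u G \<and> square_integrable_on G \<Omega>)}"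

definition H1_norm :: "'a::euclidean_space set \<Rightarrow> ('a \<Rightarrow> real) \<Rightarrow> real" where
  "H1_norm \<Omega> u = sqrt ((\<integral>x. (u x)\<^sup>2 \<partial>lebesgue_on \<Omega>) +
     (\<integral>x. (norm (weak_gradient \<Omega> u x))\<^sup>2 \<partial>lebesgue_on \<Omega>))"

definition sobolev_H10 :: "'a::euclidean_space set \<Rightarrow> ('a \<Rightarrow> real) set" where
  "sobolev_H10 \<Omega> = {u \<in> sobolev_H1 \<Omega>.
     \<exists>\<psi>. (\<forall>n. \<psi> n \<in> test_functions \<Omega>) \<and> (\<lambda>n. H1_norm \<Omega> (\<lambda>x. \<psi> n x - u x)) \<longlonglongrightarrow> 0}"

section \<open>The boundary value problem\<close>

text \<open>Variational form of \<open>-\<Delta>\<phi> = \<epsilon>\<^sup>-\<^sup>2 e\<^sup>-\<^sup>\<phi>\<close> in \<open>\<Omega>\<close>, \<open>\<phi> = 0\<close> on \<open>\<partial>\<Omega>\<close>. The integrability clause keeps the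
  right-hand side from being the default value of a divergent integral; in the plane it costs
  nothing, as \<open>e\<^sup>-\<^sup>\<phi>\<close> is in every \<open>L\<^sup>p\<close>, \<open>p < \<infinity>\<close>, on bounded sets by the Moser-Trudinger inequality.\<close>

definition variational_solution :: "(real^2) set \<Rightarrow> real \<Rightarrow> (real^2 \<Rightarrow> real) \<Rightarrow> bool" where
  "variational_solution \<Omega> \<epsilon> \<phi> \<longleftrightarrow> \<phi> \<in> sobolev_H10 \<Omega> \<and>
     (\<forall>v\<in>sobolev_H10 \<Omega>.
        integrable (lebesgue_on \<Omega>) (\<lambda>x. exp (- \<phi> x) / \<epsilon>\<^sup>2 * v x) \<and>
        (\<integral>x. weak_gradient \<Omega> \<phi> x \<bullet> weak_gradient \<Omega> v x \<partial>lebesgue_on \<Omega>) =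
        (\<integral>x. exp (- \<phi> x) / \<epsilon>\<^sup>2 * v x \<partial>lebesgue_on \<Omega>))"

end

theory Submission
  imports Defs "HOL-Computational_Algebra.Polynomial"
begin

text \<open>
  The solution minimises the convex energy \<open>J\<^sub>\<lambda>(u) = 1/2 \<integral>|\<nabla>u|\<^sup>2 + \<lambda> \<integral>e\<^sup>-\<^sup>u\<close>, \<open>\<lambda> = \<epsilon>\<^sup>-\<^sup>2\<close>, over \<open>H\<^sup>1\<^sub>0\<close>.
  As an infimum of affine functions of \<open>\<lambda>\<close>, the minimal energy \<open>m(\<lambda>)\<close> is concave with
  \<open>m'(\<lambda>) = \<integral>e\<^sup>-\<^sup>\<phi>\<close>, so its asymptotics \<open>m(\<lambda>) \<sim> 2\<surd>2 |\<partial>\<Upsilon>| \<surd>\<lambda>\<close> may be differentiated, which is the claim.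

  The upper bound for \<open>m\<close> comes from the boundary layer \<open>2 ln (1 + d / (\<surd>2 \<epsilon>))\<close>, \<open>d\<close> being the distance to
  the boundary, and the area of the layers \<open>{d < t}\<close>. The lower bound is the Modica-Mortola inequality
  tested with vector fields of norm at most 1 whose outward flux is almost \<open>-|\<partial>\<Upsilon>|\<close>. Both need only
  that the boundary consists, up to small discs around finitely many corners, of finitely many pieces
  that are almost flat graphs; on each of them the Hausdorff length, the area of the layer and the flux
  are all close to the length of the projection (\<open>shadow\<close>) to the tangent. The openings of the corners
  play no role at this order.
\<close>

section \<open>Smooth functions and mollification\<close>

text \<open>The two energy bounds meet because the one-dimensional layer attains equality in Young's
  inequality. With a = \<surd>2 \<epsilon>, the profile w(s) = 2 ln (1 + s / a) solves -w'' =
  \<epsilon>^-2 exp (-w), both terms of its energy density equal 2 / (a + s)^2, and its energy per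
  unit length is 4 / a = 2 \<surd>2 / \<epsilon>. From below, the density is at least \<surd>2 /
  \<epsilon> times the length of the gradient of 2 - 2 exp (-u / 2), a quantity that climbs from 0
  to almost 2 across the layer. The geometric obstacle is that the charts give no arc-length
  parametrisation, while the perimeter is a Hausdorff measure. Flat pieces overlap, so two families
  are kept: covering pieces, whose shadows bound length and layer area from above, and disjoint
  pieces, whose shadows bound length and flux from below. Regularity of Lebesgue measure on the line
  makes the two total shadows as close as desired.\<close>

lemma Ck_on_coinduct:
  fixes S :: "('a::euclidean_space \<Rightarrow> 'b::euclidean_space) set"
  assumes "\<And>f. f \<in> S \<Longrightarrow> \<exists>f'. (\<forall>x. (f has_derivative f' x) (at x)) \<and> (\<forall>v. (\<lambda>x. f' x v) \<in> S)"
    and "f \<in> S"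
  shows "Ck_on k f UNIV"
  using assms(2)
proof (induction k arbitrary: f)
  case 0
  then obtain f' where "\<forall>x. (f has_derivative f' x) (at x)" using assms(1) by blast
  then show ?case by (auto intro!: continuous_at_imp_continuous_on has_derivative_continuous)
next
  case (Suc k)
  then obtain f' where f': "\<And>x. (f has_derivative f' x) (at x)" "\<And>v. (\<lambda>x. f' x v) \<in> S"
    using assms(1) by blast
  have "frechet_derivative f (at x) = f' x" for x
    using f'(1) frechet_derivative_at by metis
  with f' Suc.IH show ?case by (auto simp: differentiable_def)
qed

abbreviation smooth :: "('a::euclidean_space \<Rightarrow> 'b::euclidean_space) \<Rightarrow> bool"
  where "smooth f \<equiv> \<forall>k. Ck_on k f UNIV"

lemma smooth_derivative:
  assumes "smooth f"
  shows "(f has_derivative frechet_derivative f (at x)) (at x)"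
    and "smooth (\<lambda>x. frechet_derivative f (at x) v)"
    and "continuous_on A f" and "continuous_on A (\<lambda>x. frechet_derivative f (at x) v)"
proof -
  have 1: "Ck_on (Suc k) f UNIV" for k using assms by blast
  then show "(f has_derivative frechet_derivative f (at x)) (at x)" 
    using frechet_derivative_works by (metis Ck_on.simps(2) UNIV_I)
  from 1 show 2: "smooth (\<lambda>x. frechet_derivative f (at x) v)" by simp
  have "Ck_on 0 f UNIV" "Ck_on 0 (\<lambda>x. frechet_derivative f (at x) v) UNIV" using assms 2 by blast+
  then show "continuous_on A f" "continuous_on A (\<lambda>x. frechet_derivative f (at x) v)"
    using continuous_on_subset by auto
qed

text \<open>The polynomial factor closes the family under differentiation: the derivative of p(1/x)
  exp (-1/x) is (1/x)^2 (p - p')(1/x) exp (-1/x), which is again of this shape.\<close>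

definition exp_bump :: "real poly \<Rightarrow> real \<Rightarrow> real" where
  "exp_bump p x = (if x \<le> 0 then 0 else poly p (1/x) * exp (- (1/x)))"

lemma poly_exp_tendsto_0: "((\<lambda>y. poly p y * exp (-y)) \<longlongrightarrow> (0::real)) at_top"
proof -
  have "((\<lambda>y. \<Sum>i\<le>degree p. coeff p i * (y ^ i / exp y)) \<longlongrightarrow> (\<Sum>i\<le>degree p. coeff p i * 0)) at_top"
    by (intro tendsto_intros tendsto_power_div_exp_0)
  then show ?thesis
    by (simp add: poly_altdef exp_minus field_simps sum_distrib_left sum_divide_distrib)
qed

lemma exp_bump_tendsto_0: "(exp_bump p \<longlongrightarrow> 0) (at 0)"
proof -
  have "((\<lambda>x. poly p (1/x) * exp (-(1/x))) \<longlongrightarrow> 0) (at_right 0)"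
    using filterlim_compose[OF poly_exp_tendsto_0 filterlim_inverse_at_top_right, of p]
    by (simp add: field_simps)
  then have "(exp_bump p \<longlongrightarrow> 0) (at_right 0)"
    by (rule Lim_transform_eventually) (auto simp: eventually_at_filter exp_bump_def)
  moreover have "(exp_bump p \<longlongrightarrow> 0) (at_left 0)"
    by (rule Lim_transform_eventually[OF tendsto_const]) (auto simp: eventually_at_filter exp_bump_def)
  ultimately show ?thesis using filterlim_at_split by blast
qed

lemma exp_bump_derivative:
  "(exp_bump p has_real_derivative exp_bump (pCons 0 (pCons 0 (p - pderiv p))) x) (at x)"
proof (cases "x = 0")
  case True
  \<comment> \<open>Dividing by h multiplies the polynomial by its variable, so the difference
    quotient at 0 is itself a member of the family and tends to 0.\<close>
  have "(\<lambda>h. (exp_bump p (0 + h) - exp_bump p 0) / h) = exp_bump (pCons 0 p)"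
    by (auto simp: exp_bump_def fun_eq_iff)
  then have "((\<lambda>h. (exp_bump p (0 + h) - exp_bump p 0) / h) \<longlongrightarrow> 0) (at 0)"
    using exp_bump_tendsto_0[of "pCons 0 p"] by metis
  then show ?thesis using True by (simp add: DERIV_def exp_bump_def)
next
  case False
  show ?thesis
  proof (cases "x < 0")
    case True
    have "(exp_bump p has_real_derivative 0) (at x)"
      by (rule has_field_derivative_transform_within_open[of "\<lambda>x. 0" _ _ "{..<0}"])
        (use True in \<open>auto simp: exp_bump_def\<close>)
    then show ?thesis using True by (simp add: exp_bump_def)
  next
    case F: False
    then have x: "0 < x" using False by simp
    have "((\<lambda>x. poly p (1/x) * exp (- (1/x))) has_real_derivative
       exp_bump (pCons 0 (pCons 0 (p - pderiv p))) x) (at x)"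
      using x by (auto intro!: derivative_eq_intros DERIV_chain2[OF poly_DERIV]
          simp: exp_bump_def field_simps power2_eq_square)
    then show ?thesis
      using x by (auto elim!: has_field_derivative_transform_within_open[of _ _ _ "{0<..}"] simp: exp_bump_def)
  qed
qed

text \<open>A class containing the radial bumps and closed under directional derivatives, which is
  the input of \<open>Ck_on_coinduct\<close>. The chain rule for r - |x|^2 produces only the factors
  \<open>x \<bullet> v\<close>; sums and products absorb the rest.\<close>

inductive_set bump_algebra :: "real \<Rightarrow> ('a::euclidean_space \<Rightarrow> real) set" for r where
  const: "(\<lambda>x. c) \<in> bump_algebra r"
| inner: "(\<lambda>x. x \<bullet> v) \<in> bump_algebra r"
| bump: "(\<lambda>x. exp_bump p (r - x \<bullet> x)) \<in> bump_algebra r"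
| add: "f \<in> bump_algebra r \<Longrightarrow> g \<in> bump_algebra r \<Longrightarrow> (\<lambda>x. f x + g x) \<in> bump_algebra r"
| mult: "f \<in> bump_algebra r \<Longrightarrow> g \<in> bump_algebra r \<Longrightarrow> (\<lambda>x. f x * g x) \<in> bump_algebra r"

lemma bump_algebra_derivative:
  assumes "f \<in> bump_algebra r"
  shows "\<exists>f'. (\<forall>x. (f has_derivative f' x) (at x)) \<and> (\<forall>v. (\<lambda>x. f' x v) \<in> bump_algebra r)"
  using assms
proof induction
  case (const c)
  show ?case by (rule exI[of _ "\<lambda>_ _. 0"]) (auto intro: bump_algebra.intros)
next
  case (inner v)
  show ?case 
    by (rule exI[of _ "\<lambda>_ w. w \<bullet> v"]) (auto intro!: bump_algebra.const derivative_eq_intros)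
next
  case (bump p)
  let ?q = "pCons 0 (pCons 0 (p - pderiv p))"
  have "((\<lambda>x. exp_bump p (r - x \<bullet> x)) has_derivative (\<lambda>w. exp_bump ?q (r - x \<bullet> x) * (-2 * (x \<bullet> w)))) (at x)"
    for x :: 'a
    by (rule has_derivative_eq_rhs[OF DERIV_compose_FDERIV[where f = "exp_bump p" and g = "\<lambda>x. r - x \<bullet> x",
          OF exp_bump_derivative]])
      (auto simp: inner_commute intro!: derivative_eq_intros)
  moreover have "(\<lambda>x. exp_bump ?q (r - x \<bullet> x) * (-2 * (x \<bullet> w))) \<in> bump_algebra r" for w :: 'a
    by (intro bump_algebra.intros)
  ultimately show ?case 
    by (intro exI[of _ "\<lambda>x w. exp_bump ?q (r - x \<bullet> x) * (-2 * (x \<bullet> w))"]) auto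
next
  case (add f g)
  then obtain f' g' where "\<And>x. (f has_derivative f' x) (at x)" "\<And>v. (\<lambda>x. f' x v) \<in> bump_algebra r"
    "\<And>x. (g has_derivative g' x) (at x)" "\<And>v. (\<lambda>x. g' x v) \<in> bump_algebra r" by metis
  then show ?case
    by (intro exI[of _ "\<lambda>x v. f' x v + g' x v"]) (auto intro!: bump_algebra.add derivative_eq_intros)
next
  case (mult f g)
  then obtain f' g' where "\<And>x. (f has_derivative f' x) (at x)" "\<And>v. (\<lambda>x. f' x v) \<in> bump_algebra r"
    "\<And>x. (g has_derivative g' x) (at x)" "\<And>v. (\<lambda>x. g' x v) \<in> bump_algebra r" by metis
  with mult.hyps show ?case
    by (intro exI[of _ "\<lambda>x v. f x * g' x v + f' x v * g x"]) 
      (auto intro!: bump_algebra.add bump_algebra.mult derivative_eq_intros)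
qed

lemma smooth_bump_exists:
  fixes \<rho> :: real
  assumes "0 < \<rho>"
  obtains \<kappa> :: "'a::euclidean_space \<Rightarrow> real" where "smooth \<kappa>" "\<And>x. 0 \<le> \<kappa> x" "\<And>x. \<rho> \<le> norm x \<Longrightarrow> \<kappa> x = 0"
    "integrable lborel \<kappa>" "(\<integral>x. \<kappa> x \<partial>lborel) = 1"
proof -
  define b :: "'a \<Rightarrow> real" where "b = (\<lambda>x. exp_bump 1 (\<rho>\<^sup>2 - x \<bullet> x))"
  have b0: "0 \<le> b x" for x by (auto simp: b_def exp_bump_def)
  have bz: "b x = 0" if "\<rho> \<le> norm x" for x
    using that assms by (auto simp: b_def exp_bump_def dot_square_norm abs_le_square_iff[symmetric])
  have bp: "b x > 0" if "norm x < \<rho>" for x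
    using that assms by (auto simp: b_def exp_bump_def dot_square_norm not_le abs_le_square_iff[symmetric])
  have mem: "b \<in> bump_algebra (\<rho>\<^sup>2)" unfolding b_def by (rule bump_algebra.bump)
  have sm: "smooth g" if "g \<in> bump_algebra (\<rho>\<^sup>2)" for g :: "'a \<Rightarrow> real"
    using Ck_on_coinduct[OF bump_algebra_derivative that] by blast
  have c: "continuous_on UNIV b" using smooth_derivative(3)[OF sm[OF mem]] by blast
  have supp: "(\<lambda>x. indicat_real (cball 0 \<rho>) x *\<^sub>R b x) = b" using bz by (auto simp: indicator_def fun_eq_iff)
  have int: "integrable lborel b"
    using borel_integrable_compact[OF compact_cball[of 0 \<rho>] continuous_on_subset[OF c]] 
    supp by (simp add: mult.commute if_distrib indicator_def)
  \<comment> \<open>Otherwise \<open>b\<close> would vanish almost everywhere, yet it is positive on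
    a ball, which has positive measure.\<close>
  have "(\<integral>x. b x \<partial>lborel) \<noteq> 0"
  proof
    assume "(\<integral>x. b x \<partial>lborel) = 0"
    then have "AE x in lborel. b x = 0" using integral_nonneg_eq_0_iff_AE[OF int] b0 by simp
    then have "AE x in lborel. x \<notin> ball (0::'a) \<rho>"
      by (rule eventually_mono) (use bp in force)
    then have "emeasure lborel (ball (0::'a) \<rho>) = 0"
      by (simp add: AE_iff_measurable[OF _ refl] ball_def)
    then show False using assms by (simp add: emeasure_lborel_ball_finite emeasure_ball unit_ball_vol_pos[of "real DIM('a)", THEN order.strict_implies_not_eq, symmetric])
  qed
  moreover have "(\<integral>x. b x \<partial>lborel) \<ge> 0" using b0 by simp
  ultimately have I: "(\<integral>x. b x \<partial>lborel) > 0" by linarith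
  let ?c = "1 / (\<integral>x. b x \<partial>lborel)"
  show thesis
  proof
    show "smooth (\<lambda>x. ?c * b x)" by (intro sm bump_algebra.intros mem)
  qed (use int I b0 bz in auto)
qed

text \<open>Differentiation under the integral sign moves the derivative onto the kernel, so the
  convolutions of \<open>f\<close> with smooth kernels form a class closed under directional
  derivatives. Integrating over a box brings the Leibniz rule for compact domains into play.\<close>

lemma smooth_convolution:
  fixes \<kappa> f :: "'a::euclidean_space \<Rightarrow> real"
  assumes "smooth \<kappa>" and f: "continuous_on UNIV f"
  shows "smooth (\<lambda>x. integral (cbox a b) (\<lambda>y. \<kappa> (x - y) * f y))"
proof -
  define S where "S = {(\<lambda>x. integral (cbox a b) (\<lambda>y. \<kappa> (x - y) * f y)) | \<kappa>. smooth \<kappa>}"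
  have "\<exists>f'. (\<forall>x. (g has_derivative f' x) (at x)) \<and> (\<forall>v. (\<lambda>x. f' x v) \<in> S)" if "g \<in> S" for g
  proof -
    from that obtain \<kappa> where \<kappa>: "smooth \<kappa>" "g = (\<lambda>x. integral (cbox a b) (\<lambda>y. \<kappa> (x - y) * f y))"
      by (auto simp: S_def)
    note c = continuous_on_compose2[OF smooth_derivative(3)[OF \<kappa>(1), of UNIV]]
       continuous_on_compose2[OF smooth_derivative(4)[OF \<kappa>(1), of UNIV]] continuous_on_compose2[OF f]
    \<comment> \<open>The Leibniz rule asks for a jointly continuous family of bounded linear maps;
      continuity in operator norm is checked on basis vectors.\<close>
    define D where "D = (\<lambda>x t. Blinfun (\<lambda>w. frechet_derivative \<kappa> (at (x - t)) w * f t))"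
    have bl: "bounded_linear (\<lambda>w. frechet_derivative \<kappa> (at z) w * c)" for z c
      using smooth_derivative(1)[OF \<kappa>(1), of z] 
      by (intro bounded_linear_mult_left[THEN bounded_linear_compose] has_derivative_bounded_linear)
    have D: "blinfun_apply (D x t) = (\<lambda>w. frechet_derivative \<kappa> (at (x - t)) w * f t)" for x t
      unfolding D_def by (rule bounded_linear_Blinfun_apply[OF bl])
    have cD: "continuous_on (UNIV \<times> cbox a b) (\<lambda>(x, t). D x t)"
    proof (rule continuous_on_blinfun_componentwise)
      show "continuous_on (UNIV \<times> cbox a b) (\<lambda>p. (case p of (x, t) \<Rightarrow> D x t) i)" for i
        unfolding case_prod_unfold D by (intro continuous_intros c) auto
    qed
    have cDx: "continuous_on (cbox a b) (D x)" for x
      using continuous_on_compose2[OF cD, of "cbox a b" "\<lambda>t. (x, t)"] by (simp add: continuous_on_Pair image_subset_iff)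
    have "(g has_derivative blinfun_apply (integral (cbox a b) (D x))) (at x)" for x
      unfolding \<kappa>(2)
    proof (rule leibniz_rule[where U = UNIV])
      fix x t
      show "((\<lambda>x. \<kappa> (x - t) * f t) has_derivative blinfun_apply (D x t)) (at x within UNIV)"
        unfolding D 
        by (rule has_derivative_eq_rhs[OF has_derivative_mult_left[OF has_derivative_compose[OF _ smooth_derivative(1)[OF \<kappa>(1)]]]])
           (auto intro!: derivative_eq_intros)
      show "(\<lambda>y. \<kappa> (x - y) * f y) integrable_on cbox a b"
        by (intro integrable_continuous continuous_intros c) auto
    qed (use cD in auto)
    moreover have "blinfun_apply (integral (cbox a b) (D x)) v = 
        integral (cbox a b) (\<lambda>y. frechet_derivative \<kappa> (at (x - y)) v * f y)" for x v
      using integral_linear[OF integrable_continuous[OF cDx, of x] blinfun.bounded_linear_left[of v]]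
      by (simp add: o_def D)
    moreover have "(\<lambda>x. integral (cbox a b) (\<lambda>y. frechet_derivative \<kappa> (at (x - y)) v * f y)) \<in> S" for v
      unfolding S_def using smooth_derivative(2)[OF \<kappa>(1), of v]
      by (intro CollectI exI[of _ "\<lambda>z. frechet_derivative \<kappa> (at z) v"] conjI refl)
    ultimately show ?thesis
      by (intro exI[of _ "\<lambda>x. blinfun_apply (integral (cbox a b) (D x))"]) simp
  qed
  from Ck_on_coinduct[of S, OF this] show ?thesis
    using assms(1) unfolding S_def by blast
qed

section \<open>Mollification and cutoffs\<close>

lemma integral_lborel_reflect:
  fixes g :: "'a::euclidean_space \<Rightarrow> real"
  assumes [measurable]: "g \<in> borel_measurable borel"
  shows "(\<integral>y. g (x - y) \<partial>lborel) = (\<integral>y. g y \<partial>lborel)"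
  by (subst (2) lborel_affine[of "-1" x]) (auto simp: integral_density integral_distr density_1)

lemma derivative_bound:
  fixes \<psi> :: "'a::real_normed_vector \<Rightarrow> 'b::real_normed_vector"
  assumes d: "(\<psi> has_derivative D) (at x)" and "0 < r"
    and L: "\<And>y. y \<in> ball x r \<Longrightarrow> norm (\<psi> y - \<psi> x) \<le> L * norm (y - x)"
  shows "norm (D v) \<le> L * norm v"
proof (cases "v = 0")
  case True
  then show ?thesis using has_derivative_bounded_linear[OF d] by (simp add: linear_simps)
next
  case False
  interpret D: bounded_linear D using has_derivative_bounded_linear[OF d] .
  show ?thesis
  proof (rule field_le_epsilon)
    fix e :: real assume "0 < e"
    have "((\<lambda>y. norm (\<psi> y - \<psi> x - D (y - x)) / norm (y - x)) \<longlongrightarrow> 0) (at x)"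
      using d by (simp add: has_derivative_iff_norm)
    then have "\<forall>\<^sub>F y in at x. norm (\<psi> y - \<psi> x - D (y - x)) / norm (y - x) < e / norm v"
      using False \<open>0 < e\<close> by (intro order_tendstoD(2)[where y=0]) auto
    then obtain d where d: "d > 0" "\<And>y. y \<noteq> x \<Longrightarrow> dist y x < d \<Longrightarrow> 
       norm (\<psi> y - \<psi> x - D (y - x)) / norm (y - x) < e / norm v"
      unfolding eventually_at by auto
    define s where "s = min d r / (2 * norm v)"
    have s: "0 < s" "s * norm v < d" "s * norm v < r" using d False \<open>0 < r\<close> by (auto simp: s_def)
    let ?y = "x + s *\<^sub>R v"
    have 1: "norm (\<psi> ?y - \<psi> x - D (?y - x)) < (e / norm v) * norm (?y - x)"
      using d(2)[of ?y] s False by (simp add: dist_norm pos_divide_less_eq)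
    have 2: "norm (\<psi> ?y - \<psi> x) \<le> L * norm (?y - x)" using L[of ?y] s by (simp add: dist_norm)
    have "norm (D (?y - x)) \<le> norm (\<psi> ?y - \<psi> x) + norm (\<psi> ?y - \<psi> x - D (?y - x))"
      by (metis norm_minus_commute norm_triangle_sub)
    then have "norm (D (?y - x)) \<le> L * norm (?y - x) + (e / norm v) * norm (?y - x)" using 1 2 by linarith
    then have "s * norm (D v) \<le> s * (L * norm v + e)" using s False by (simp add: D.scaleR algebra_simps)
    then show "norm (D v) \<le> L * norm v + e" using s by simp
  qed
qed

text \<open>Averaging against a probability density supported in the ball of radius
  \<open>\<rho>\<close> preserves every bound that holds on \<open>cball x \<rho>\<close> and every
  Lipschitz constant that holds on a slightly larger ball. The conclusions are local because the
  gradient of the boundary layer decays with the distance to the boundary, and the estimate has to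
  follow this decay.\<close>

lemma mollifier:
  fixes f :: "'a::euclidean_space \<Rightarrow> real"
  assumes f: "continuous_on UNIV f" and b: "bounded {x. f x \<noteq> 0}" and "0 < \<rho>"
  obtains \<psi> where "smooth \<psi>"
    "\<And>x c. \<forall>y\<in>cball x \<rho>. f y \<le> c \<Longrightarrow> \<psi> x \<le> c"
    "\<And>x c. \<forall>y\<in>cball x \<rho>. c \<le> f y \<Longrightarrow> c \<le> \<psi> x"
    "\<And>x L r v. \<rho> < r \<Longrightarrow> L-lipschitz_on (ball x r) f \<Longrightarrow> \<bar>frechet_derivative \<psi> (at x) v\<bar> \<le> L * norm v"
proof -
  obtain \<kappa> :: "'a \<Rightarrow> real" where \<kappa>: "smooth \<kappa>" "\<And>x. 0 \<le> \<kappa> x" "\<And>x. \<rho> \<le> norm x \<Longrightarrow> \<kappa> x = 0"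
    "integrable lborel \<kappa>" "(\<integral>x. \<kappa> x \<partial>lborel) = 1" by (rule smooth_bump_exists[OF \<open>0 < \<rho>\<close>]) (rule that)
  obtain a where "{x. f x \<noteq> 0} \<subseteq> cbox (-a) a" by (rule bounded_subset_cbox_symmetric[OF b])
  then have supp: "f x = 0" if "x \<notin> cbox (-a) a" for x using that by blast
  define \<psi> where "\<psi> = (\<lambda>x. integral (cbox (-a) a) (\<lambda>y. \<kappa> (x - y) * f y))"
  have sm: "smooth \<psi>" unfolding \<psi>_def by (rule smooth_convolution[OF \<kappa>(1) f])
  note c\<kappa> = smooth_derivative(3)[OF \<kappa>(1), of UNIV]
  note c = continuous_on_compose2[OF c\<kappa>] continuous_on_compose2[OF f]
  have [measurable]: "f \<in> borel_measurable borel" "\<kappa> \<in> borel_measurable borel"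
    using f c\<kappa> by (auto intro: borel_measurable_continuous_onI)
  have int: "integrable lborel (\<lambda>z. \<kappa> z * f (x - z))" for x
  proof -
    have "continuous_on (cball 0 \<rho>) (\<lambda>z. \<kappa> z * f (x - z))" by (intro continuous_intros c) auto
    note borel_integrable_compact[OF compact_cball this]
    moreover have "(\<lambda>z. indicator (cball 0 \<rho>) z *\<^sub>R (\<kappa> z * f (x - z))) = (\<lambda>z. \<kappa> z * f (x - z))"
      using \<kappa>(3) by (auto simp: indicator_def fun_eq_iff)
    ultimately show ?thesis by simp
  qed
  have \<psi>: "\<psi> x = (\<integral>z. \<kappa> z * f (x - z) \<partial>lborel)" for x
  proof -
    let ?g = "\<lambda>y. \<kappa> (x - y) * f y"
    have g: "?g = (\<lambda>y. if y \<in> cbox (-a) a then ?g y else 0)" using supp by auto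
    have g': "?g = (\<lambda>y. indicator (cbox (-a) a) y *\<^sub>R ?g y)" using supp by (auto simp: indicator_def fun_eq_iff)
    have "continuous_on (cbox (-a) a) ?g" by (intro continuous_intros c) auto
    from borel_integrable_compact[OF compact_cbox this]
    have "integrable lborel ?g" by (subst g')
    from has_integral_integral_lborel[OF this] have "(\<integral>y. ?g y \<partial>lborel) = integral UNIV ?g"
      by (simp add: integral_unique)
    also have "\<dots> = \<psi> x" unfolding \<psi>_def by (subst g) (rule integral_restrict_UNIV)
    finally show ?thesis using integral_lborel_reflect[of "\<lambda>z. \<kappa> z * f (x - z)" x] by simp
  qed
  have avg: "(\<integral>z. \<kappa> z * d \<partial>lborel) = d" for d using \<kappa>(4,5) by simp
  have zero: "\<kappa> z \<noteq> 0 \<Longrightarrow> norm z < \<rho>" for z using \<kappa>(3)[of z] by force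
  show thesis
  proof (rule that[OF sm])
    fix x d assume *: "\<forall>y\<in>cball x \<rho>. f y \<le> d"
    have "\<psi> x \<le> (\<integral>z. \<kappa> z * d \<partial>lborel)" unfolding \<psi> 
    proof (intro integral_mono int)
      show "\<kappa> z * f (x - z) \<le> \<kappa> z * d" for z
        using zero[of z] *[rule_format, of "x - z"] \<kappa>(2)[of z] by (cases "\<kappa> z = 0") (auto simp: dist_norm intro!: mult_left_mono)
    qed (use \<kappa> in auto)
    then show "\<psi> x \<le> d" unfolding avg .
  next
    fix x d assume *: "\<forall>y\<in>cball x \<rho>. d \<le> f y"
    have "(\<integral>z. \<kappa> z * d \<partial>lborel) \<le> \<psi> x" unfolding \<psi> 
    proof (intro integral_mono int)
      show "\<kappa> z * d \<le> \<kappa> z * f (x - z)" for z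
        using zero[of z] *[rule_format, of "x - z"] \<kappa>(2)[of z] by (cases "\<kappa> z = 0") (auto simp: dist_norm intro!: mult_left_mono)
    qed (use \<kappa> in auto)
    then show "d \<le> \<psi> x" unfolding avg .
  next
    fix x L r v assume r: "\<rho> < r" and L: "L-lipschitz_on (ball x r) f"
    have "norm (frechet_derivative \<psi> (at x) v) \<le> L * norm v"
    proof (rule derivative_bound[OF smooth_derivative(1)[OF sm]])
      show "0 < r - \<rho>" using r by simp
      fix y assume y: "y \<in> ball x (r - \<rho>)"
      have "\<psi> y - \<psi> x = (\<integral>z. \<kappa> z * f (y - z) - \<kappa> z * f (x - z) \<partial>lborel)"
        unfolding \<psi> by (rule Bochner_Integration.integral_diff[symmetric, OF int int])
      also have "norm \<dots> \<le> (\<integral>z. norm (\<kappa> z * f (y - z) - \<kappa> z * f (x - z)) \<partial>lborel)"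
        by (rule integral_norm_bound)
      also have "\<dots> \<le> (\<integral>z. \<kappa> z * (L * norm (y - x)) \<partial>lborel)"
      proof (intro integral_mono integrable_norm Bochner_Integration.integrable_diff int)
        fix z
        show "norm (\<kappa> z * f (y - z) - \<kappa> z * f (x - z)) \<le> \<kappa> z * (L * norm (y - x))"
        proof (cases "\<kappa> z = 0")
          case False
          have "norm z < \<rho>" using zero False by blast
          moreover have "dist x (y - z) \<le> dist x y + norm z" 
            using dist_triangle[of x "y - z" y] by (simp add: dist_norm)
          ultimately have "x - z \<in> ball x r" "y - z \<in> ball x r"
            using y r by (auto simp: dist_norm)
          then have "\<bar>f (y - z) - f (x - z)\<bar> \<le> L * norm (y - x)"
            using lipschitz_onD[OF L, of "y - z" "x - z"] by (simp add: dist_norm)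
          then have "\<kappa> z * \<bar>f (y - z) - f (x - z)\<bar> \<le> \<kappa> z * (L * norm (y - x))"
            using \<kappa>(2) by (intro mult_left_mono)
          then show ?thesis using \<kappa>(2)[of z] by (simp add: abs_mult right_diff_distrib[symmetric])
        qed simp
      qed (use \<kappa> in auto)
      finally show "norm (\<psi> y - \<psi> x) \<le> L * norm (y - x)" unfolding avg .
    qed
    then show "\<bar>frechet_derivative \<psi> (at x) v\<bar> \<le> L * norm v" by simp
  qed
qed

lemma smooth_cutoff:
  fixes K :: "'a::euclidean_space set"
  assumes "bounded K" "K \<noteq> {}" "0 < \<sigma>"
  obtains \<zeta> :: "'a \<Rightarrow> real" where "smooth \<zeta>" "\<And>x. 0 \<le> \<zeta> x" "\<And>x. \<zeta> x \<le> 1"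
    "\<And>x. infdist x K \<le> \<sigma> \<Longrightarrow> \<zeta> x = 1" "\<And>x. 4 * \<sigma> \<le> infdist x K \<Longrightarrow> \<zeta> x = 0"
proof -
  \<comment> \<open>This ramp is 1 up to distance 2 \<open>\<sigma>\<close> and 0 from distance 3
    \<open>\<sigma>\<close> on; mollifying at scale \<open>\<sigma>\<close> uses up the margin left
    on either side.\<close>
  define f where "f = (\<lambda>x. min 1 (max 0 (3 - infdist x K / \<sigma>)))"
  have c: "continuous_on UNIV f" unfolding f_def using assms by (intro continuous_intros) auto
  have f: "0 \<le> f x" "f x \<le> 1" "infdist x K \<le> 2 * \<sigma> \<Longrightarrow> f x = 1" "3 * \<sigma> \<le> infdist x K \<Longrightarrow> f x = 0" for x
    using assms by (auto simp: f_def field_simps min_def max_def)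
  obtain M where M: "\<And>x. x \<in> K \<Longrightarrow> norm x \<le> M" using assms(1) by (auto simp: bounded_iff)
  have "norm x \<le> M + 4 * \<sigma>" if "f x \<noteq> 0" for x
  proof -
    have "infdist x K < 4 * \<sigma>" using f(4)[of x] that assms by force
    then obtain y where "y \<in> K" "dist x y < 4 * \<sigma>" 
      using assms(2) cInf_lessD[of "dist x ` K" "4 * \<sigma>"] by (auto simp: infdist_notempty)
    then show ?thesis using M[of y] norm_triangle_sub[of x y] by (simp add: dist_norm)
  qed
  then have "bounded {x. f x \<noteq> 0}" by (auto simp: bounded_iff)
  then obtain \<psi> where \<psi>: "smooth \<psi>"
    "\<And>x c. \<forall>y\<in>cball x \<sigma>. f y \<le> c \<Longrightarrow> \<psi> x \<le> c"
    "\<And>x c. \<forall>y\<in>cball x \<sigma>. c \<le> f y \<Longrightarrow> c \<le> \<psi> x"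
    using mollifier[OF c _ \<open>0 < \<sigma>\<close>] by metis
  have d: "\<bar>infdist y K - infdist x K\<bar> \<le> \<sigma>" if "y \<in> cball x \<sigma>" for x y
    using infdist_triangle_abs[of y K x] that by (auto simp: dist_commute)
  show thesis
  proof (rule that[OF \<psi>(1)])
    fix x
    show 0: "0 \<le> \<psi> x" using \<psi>(3)[of x 0] f by blast
    show 1: "\<psi> x \<le> 1" using \<psi>(2)[of x 1] f by blast
    show "\<psi> x = 1" if "infdist x K \<le> \<sigma>"
    proof -
      have "f y = 1" if "y \<in> cball x \<sigma>" for y using f(3)[of y] d[OF that] \<open>infdist x K \<le> \<sigma>\<close> by force
      then show ?thesis using \<psi>(3)[of x 1] 1 by force
    qed
    show "\<psi> x = 0" if "4 * \<sigma> \<le> infdist x K"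
    proof -
      have "f y = 0" if "y \<in> cball x \<sigma>" for y using f(4)[of y] d[OF that] \<open>4 * \<sigma> \<le> infdist x K\<close> by force
      then show ?thesis using \<psi>(2)[of x 0] 0 by force
    qed
  qed
qed

section \<open>Integrals of compactly supported derivatives\<close>

lemma integrable_continuous_compact_support:
  fixes f :: "'a::euclidean_space \<Rightarrow> 'b::{banach, second_countable_topology}"
  assumes "continuous_on UNIV f" "compact K" "\<And>x. x \<notin> K \<Longrightarrow> f x = 0"
  shows "integrable lborel f"
proof -
  have "integrable lborel (\<lambda>x. indicator K x *\<^sub>R f x)"
    by (rule borel_integrable_compact[OF assms(2) continuous_on_subset[OF assms(1)]]) simp
  moreover have "(\<lambda>x. indicator K x *\<^sub>R f x) = f" using assms(3) by (auto simp: indicator_def fun_eq_iff)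
  ultimately show ?thesis by simp
qed

lemma integrable_lebesgue_on_support:
  fixes f :: "'a::euclidean_space \<Rightarrow> 'b::{banach, second_countable_topology}"
  assumes "integrable lborel f" "\<Omega> \<in> sets lebesgue"
  shows "integrable (lebesgue_on \<Omega>) f"
  using integrable_restrict_UNIV integrable_mult_indicator[OF assms(2), of f] assms
  by (subst integrable_restrict_space) (auto simp: integrable_completion)

lemma integral_lebesgue_on_support:
  fixes f :: "'a::euclidean_space \<Rightarrow> 'b::{banach, second_countable_topology}"
  assumes "f \<in> borel_measurable borel" "\<Omega> \<in> sets lebesgue" "\<And>x. x \<notin> \<Omega> \<Longrightarrow> f x = 0"
  shows "(\<integral>x. f x \<partial>lebesgue_on \<Omega>) = (\<integral>x. f x \<partial>lborel)"
proof -
  have "(\<lambda>x. indicator \<Omega> x *\<^sub>R f x) = f" using assms(3) by (auto simp: indicator_def fun_eq_iff)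
  then show ?thesis using assms(1,2) by (subst integral_restrict_space) (auto simp: integral_completion)
qed

lemma derivative_eq_0_of_support:
  assumes "(w has_derivative D) (at x)" "closed K" "\<And>x. x \<notin> K \<Longrightarrow> w x = 0" "x \<notin> K"
  shows "D v = 0"
proof -
  have "(w has_derivative (\<lambda>_. 0)) (at x)"
    by (rule has_derivative_transform_within_open[of "\<lambda>_. 0" _ _ _ "-K"]) (use assms in auto)
  then show ?thesis using has_derivative_unique[OF assms(1)] by metis
qed

text \<open>Dominated convergence: the mean value theorem bounds the quotients by the maximum of the
  derivative, and steps of size at most 1 keep all supports in one ball. The bounded weight
  \<open>g\<close> is constant in \<open>integral_derivative_eq_0\<close> and the indicator of the
  domain in the flux estimate.\<close>

lemma difference_quotient_integral_tendsto:
  fixes w :: "'a::euclidean_space \<Rightarrow> real"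
  assumes d: "\<And>x. (w has_derivative w' x) (at x)" and c: "continuous_on UNIV (\<lambda>x. w' x v)"
    and K: "compact K" "\<And>x. x \<notin> K \<Longrightarrow> w x = 0"
    and g[measurable]: "g \<in> borel_measurable borel" and g1: "\<And>x. \<bar>g x\<bar> \<le> 1"
    and h: "\<And>n. 0 < h n" "\<And>n. h n \<le> 1" "h \<longlonglongrightarrow> 0"
  shows "(\<lambda>n. \<integral>x. g x * ((w (x + h n *\<^sub>R v) - w x) / h n) \<partial>lborel) \<longlonglongrightarrow> (\<integral>x. g x * w' x v \<partial>lborel)"
proof -
  have cw: "continuous_on UNIV w" using d by (auto intro!: continuous_at_imp_continuous_on has_derivative_continuous)
  have [measurable]: "w \<in> borel_measurable borel" "(\<lambda>x. w' x v) \<in> borel_measurable borel"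
    using cw c by (auto intro: borel_measurable_continuous_onI)
  obtain R where R: "\<And>x. x \<in> K \<Longrightarrow> norm x \<le> R" using compact_imp_bounded[OF K(1)] by (auto simp: bounded_iff)
  have z: "w' x v = 0" if "x \<notin> K" for x
    using derivative_eq_0_of_support[OF d compact_imp_closed[OF K(1)] K(2) that] .
  have "bounded ((\<lambda>x. w' x v) ` K)"
    using K(1) c by (intro compact_imp_bounded compact_continuous_image) (auto intro: continuous_on_subset)
  then obtain M0 where M0: "\<And>x. x \<in> K \<Longrightarrow> \<bar>w' x v\<bar> \<le> M0" by (auto simp: bounded_iff)
  define M where "M = max 0 M0"
  have M: "\<bar>w' x v\<bar> \<le> M" for x using M0[of x] z[of x] by (cases "x \<in> K") (auto simp: M_def)
  define q where "q = (\<lambda>n x. (w (x + h n *\<^sub>R v) - w x) / h n)"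
  have dv: "((\<lambda>s. w (x + s *\<^sub>R v)) has_real_derivative w' (x + s *\<^sub>R v) v) (at s)" for x s
  proof -
    have "((\<lambda>s. w (x + s *\<^sub>R v)) has_derivative (\<lambda>t. w' (x + s *\<^sub>R v) (t *\<^sub>R v))) (at s)"
      by (rule has_derivative_compose[where f = "\<lambda>s. x + s *\<^sub>R v" and g = w, OF _ d]) (auto intro!: derivative_eq_intros)
    then show ?thesis
      using has_derivative_bounded_linear[OF d, of "x + s *\<^sub>R v"]
      by (simp add: has_field_derivative_def linear_simps mult_commute_abs)
  qed
  have qb: "\<bar>q n x\<bar> \<le> M * indicator (cball 0 (R + norm v)) x" for n x
  proof (cases "norm x \<le> R + norm v")
    case True
    have "\<exists>s. 0 < s \<and> s < h n \<and> w (x + h n *\<^sub>R v) - w (x + 0 *\<^sub>R v) = (h n - 0) * w' (x + s *\<^sub>R v) v"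
      by (rule MVT2) (use h dv in auto)
    then obtain s where "q n x = w' (x + s *\<^sub>R v) v" using h(1)[of n] by (auto simp: q_def field_simps)
    then show ?thesis using M True by simp
  next
    case False
    have "norm x \<le> norm (x + h n *\<^sub>R v) + norm (h n *\<^sub>R v)" 
      using norm_triangle_sub[of x "x + h n *\<^sub>R v"] by simp
    also have "norm (h n *\<^sub>R v) \<le> norm v" using h(1,2)[of n] by (simp add: mult_left_le_one_le)
    finally have "x \<notin> K" "x + h n *\<^sub>R v \<notin> K" using R[of x] R[of "x + h n *\<^sub>R v"] False norm_ge_zero[of v] by fastforce+
    then show ?thesis using False by (simp add: q_def K(2))
  qed
  have "(\<lambda>n. \<integral>x. g x * q n x \<partial>lborel) \<longlonglongrightarrow> (\<integral>x. g x * w' x v \<partial>lborel)"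
  proof (rule integral_dominated_convergence)
    show "integrable lborel (\<lambda>x. M * indicator (cball (0::'a) (R + norm v)) x)"
      by (intro integrable_mult_right integrable_real_indicator) 
        (use emeasure_bounded_finite[OF bounded_cball] in \<open>auto simp: top.not_eq_extremum\<close>)
    show "AE x in lborel. norm (g x * q n x) \<le> M * indicator (cball 0 (R + norm v)) x" for n
    proof (rule AE_I2)
      fix x
      have "\<bar>g x\<bar> * \<bar>q n x\<bar> \<le> 1 * (M * indicator (cball 0 (R + norm v)) x)"
        using g1 qb by (intro mult_mono) auto
      then show "norm (g x * q n x) \<le> M * indicator (cball 0 (R + norm v)) x" by (simp add: abs_mult)
    qed
    show "AE x in lborel. (\<lambda>n. g x * q n x) \<longlonglongrightarrow> g x * w' x v"
    proof (intro AE_I2 tendsto_mult tendsto_const)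
      fix x
      have "((\<lambda>s. (w (x + s *\<^sub>R v) - w x) / s) \<longlongrightarrow> w' x v) (at 0)" using dv[of x 0] by (simp add: DERIV_def)
      moreover have "filterlim h (at 0) sequentially"
        unfolding filterlim_at using h(3) h(1) by (auto intro: always_eventually simp: less_imp_neq[symmetric])
      ultimately show "(\<lambda>n. q n x) \<longlonglongrightarrow> w' x v" unfolding q_def by (rule filterlim_compose)
    qed
  qed (auto simp: q_def)
  then show ?thesis by (simp add: q_def)
qed

text \<open>The integral is translation invariant, so all difference quotients integrate to zero.\<close>

lemma integral_derivative_eq_0:
  fixes w :: "'a::euclidean_space \<Rightarrow> real"
  assumes d: "\<And>x. (w has_derivative w' x) (at x)" and c: "continuous_on UNIV (\<lambda>x. w' x v)"
    and K: "compact K" "\<And>x. x \<notin> K \<Longrightarrow> w x = 0"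
  shows "(\<integral>x. w' x v \<partial>lborel) = 0"
proof -
  have cw: "continuous_on UNIV w" using d by (auto intro!: continuous_at_imp_continuous_on has_derivative_continuous)
  define h where "h = (\<lambda>n. inverse (real (Suc n)))"
  have h: "0 < h n" "h n \<le> 1" for n by (auto simp: h_def field_simps)
  have h0: "h \<longlonglongrightarrow> 0" unfolding h_def by (rule LIMSEQ_inverse_real_of_nat)
  have int: "integrable lborel w" using integrable_continuous_compact_support[OF cw K] .
  have int_t: "integrable lborel (\<lambda>x. w (x + t))" and eq_t: "(\<integral>x. w (x + t) \<partial>lborel) = (\<integral>x. w x \<partial>lborel)" for t
    using int integrable_distr_eq[of "(+) t" lborel borel w] integral_distr[of "(+) t" lborel borel w]
      borel_measurable_continuous_onI[OF cw] by (auto simp: lborel_distr_plus add.commute)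
  have q0: "(\<integral>x. 1 * ((w (x + h n *\<^sub>R v) - w x) / h n) \<partial>lborel) = 0" for n
    using int int_t eq_t by simp
  have "(\<lambda>n. \<integral>x. 1 * ((w (x + h n *\<^sub>R v) - w x) / h n) \<partial>lborel) \<longlonglongrightarrow> (\<integral>x. 1 * w' x v \<partial>lborel)"
    by (rule difference_quotient_integral_tendsto[OF d c K _ _ h h0]) auto
  from LIMSEQ_unique[OF this[unfolded q0] tendsto_const] show ?thesis by simp
qed

section \<open>Test functions and their classical gradients\<close>

lemma test_functionI:
  assumes "smooth \<psi>" "compact K" "K \<subseteq> \<Omega>" "\<And>x. x \<notin> K \<Longrightarrow> \<psi> x = 0"
  shows "\<psi> \<in> test_functions \<Omega>"
proof -
  have "{x. \<psi> x \<noteq> 0} \<subseteq> K" using assms(4) by blast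
  then have "closure {x. \<psi> x \<noteq> 0} \<subseteq> K" by (rule closure_minimal[OF _ compact_imp_closed[OF assms(2)]])
  then show ?thesis using assms closed_Int_compact[OF closed_closure assms(2), of "{x. \<psi> x \<noteq> 0}"]
    unfolding test_functions_def by (auto simp: Int_absorb2)
qed

lemma test_functionD:
  fixes \<psi> :: "'a::euclidean_space \<Rightarrow> real"
  assumes "\<psi> \<in> test_functions \<Omega>"
  obtains K where "smooth \<psi>" "compact K" "K \<subseteq> \<Omega>" "\<And>x. x \<notin> K \<Longrightarrow> \<psi> x = 0"
    "\<And>x v. x \<notin> K \<Longrightarrow> frechet_derivative \<psi> (at x) v = 0"
proof -
  let ?K = "closure {x. \<psi> x \<noteq> 0}"
  have a: "smooth \<psi>" "compact ?K" "?K \<subseteq> \<Omega>" using assms by (auto simp: test_functions_def)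
  have b: "\<psi> x = 0" if "x \<notin> ?K" for x using that closure_subset[of "{x. \<psi> x \<noteq> 0}"] by blast
  show thesis
    by (rule that[OF a b]) 
      (auto intro: derivative_eq_0_of_support[OF smooth_derivative(1)[OF a(1)] closed_closure b])
qed

text \<open>The classical counterpart of \<open>weak_gradient\<close>, whose values are a choice; on
  test functions of an open set the two agree almost everywhere.\<close>

definition grad :: "('a::euclidean_space \<Rightarrow> real) \<Rightarrow> 'a \<Rightarrow> 'a" where
  "grad \<psi> x = (\<Sum>b\<in>Basis. frechet_derivative \<psi> (at x) b *\<^sub>R b)"

lemma grad_inner:
  assumes "smooth \<psi>"
  shows "grad \<psi> x \<bullet> v = frechet_derivative \<psi> (at x) v"
proof -
  interpret bounded_linear "frechet_derivative \<psi> (at x)"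
    using smooth_derivative(1)[OF assms] has_derivative_bounded_linear by blast
  have "frechet_derivative \<psi> (at x) v = frechet_derivative \<psi> (at x) (\<Sum>b\<in>Basis. (v \<bullet> b) *\<^sub>R b)"
    by (simp add: euclidean_representation)
  also have "\<dots> = (\<Sum>b\<in>Basis. (v \<bullet> b) * frechet_derivative \<psi> (at x) b)" by (simp add: sum scaleR)
  finally show ?thesis by (simp add: grad_def inner_sum_left inner_commute[of v] mult.commute)
qed

lemma continuous_on_grad:
  assumes "smooth \<psi>"
  shows "continuous_on A (grad \<psi>)"
  unfolding grad_def by (intro continuous_intros smooth_derivative(4)[OF assms])

section \<open>Weak gradients\<close>

text \<open>The fundamental lemma of the calculus of variations. Smooth cutoffs shrinking to a
  closed box show that \<open>f\<close> integrates to 0 over every box in \<Omega>; Lebesgue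
  differentiation along shrinking cubes then gives the claim.\<close>

lemma integral_zero_AE_zero:
  fixes f :: "'a::euclidean_space \<Rightarrow> real"
  assumes \<Omega>: "open \<Omega>" and f: "\<And>K. compact K \<Longrightarrow> K \<subseteq> \<Omega> \<Longrightarrow> integrable (lebesgue_on K) f"
    and z: "\<And>\<psi>. \<psi> \<in> test_functions \<Omega> \<Longrightarrow> (\<integral>x. f x * \<psi> x \<partial>lebesgue_on \<Omega>) = 0"
  shows "AE x in lebesgue_on \<Omega>. f x = 0"
proof -
  have box0: "integral (cbox a b) f = 0" if ab: "cbox a b \<subseteq> \<Omega>" for a b
  proof (cases "cbox a b = {}")
    case False
    obtain e where e: "e > 0" "(\<Union>x\<in>cbox a b. cball x e) \<subseteq> \<Omega>"
      using compact_subset_open_imp_cball_epsilon_subset[OF compact_cbox \<Omega> ab] by blast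
    define K where "K = {x. infdist x (cbox a b) \<le> e}"
    have K: "compact K" "K \<subseteq> \<Omega>"
    proof -
      show "compact K" unfolding K_def using compact_infdist_le[OF False compact_cbox e(1)] .
      show "K \<subseteq> \<Omega>"
      proof
        fix x assume "x \<in> K"
        moreover obtain y where "y \<in> cbox a b" "infdist x (cbox a b) = dist x y"
          using infdist_attains_inf[OF closed_cbox False] by blast
        ultimately show "x \<in> \<Omega>" using e(2) by (force simp: K_def dist_commute)
      qed
    qed
    \<comment> \<open>A cutoff of scale \<open>s n\<close> lives within distance 4
      \<open>s n\<close> of the box, so this choice keeps all supports in \<open>K\<close> while
      they shrink to the box.\<close>
    define s where "s = (\<lambda>n. e / (4 * real (Suc n)))"
    have s: "0 < s n" "4 * s n \<le> e" for n using e(1) by (auto simp: s_def field_simps)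
    have "\<exists>\<zeta> :: 'a \<Rightarrow> real. smooth \<zeta> \<and> (\<forall>x. 0 \<le> \<zeta> x) \<and> (\<forall>x. \<zeta> x \<le> 1) \<and> (\<forall>x. infdist x (cbox a b) \<le> s n \<longrightarrow> \<zeta> x = 1)
        \<and> (\<forall>x. 4 * s n \<le> infdist x (cbox a b) \<longrightarrow> \<zeta> x = 0)" for n
      using smooth_cutoff[OF bounded_cbox False s(1)[of n]] by metis
    then obtain \<zeta> :: "nat \<Rightarrow> 'a \<Rightarrow> real" where \<zeta>: "\<And>n. smooth (\<zeta> n)" "\<And>n x. 0 \<le> \<zeta> n x" "\<And>n x. \<zeta> n x \<le> 1"
      "\<And>n x. infdist x (cbox a b) \<le> s n \<Longrightarrow> \<zeta> n x = 1" "\<And>n x. 4 * s n \<le> infdist x (cbox a b) \<Longrightarrow> \<zeta> n x = 0"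
      by metis
    have \<zeta>0: "\<zeta> n x = 0" if "x \<notin> K" for n x using \<zeta>(5)[where n=n and x=x] s[of n] that by (auto simp: K_def)
    have fK: "integrable lebesgue (\<lambda>x. indicator K x *\<^sub>R f x)"
      using f[OF K] K(1) integrable_restrict_space[of K lebesgue f] by (auto simp: lmeasurable_compact fmeasurableD)
    have \<Omega>L: "\<Omega> \<in> sets lebesgue" using \<Omega> by simp
    have fKm: "(\<lambda>x. indicator K x * f x) \<in> borel_measurable lebesgue" using borel_measurable_integrable[OF fK] by simp
    have im: "(indicator (cbox a b) :: 'a \<Rightarrow> real) \<in> borel_measurable lebesgue" by (rule borel_measurable_indicator) simp
    have \<zeta>m: "\<zeta> n \<in> borel_measurable lebesgue" for n
      using smooth_derivative(3)[OF \<zeta>(1), of UNIV] by (simp add: borel_measurable_continuous_onI measurable_completion)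
    have lim: "(\<lambda>n. \<integral>x. \<zeta> n x * (indicator K x * f x) \<partial>lebesgue) \<longlonglongrightarrow> (\<integral>x. indicator (cbox a b) x * (indicator K x * f x) \<partial>lebesgue)"
    proof (rule integral_dominated_convergence)
      show "(\<lambda>x. indicator (cbox a b) x * (indicator K x * f x)) \<in> borel_measurable lebesgue"
        by (rule borel_measurable_times[OF im fKm])
      show "(\<lambda>x. \<zeta> n x * (indicator K x * f x)) \<in> borel_measurable lebesgue" for n
        by (rule borel_measurable_times[OF \<zeta>m fKm])
      show "integrable lebesgue (\<lambda>x. \<bar>indicator K x * f x\<bar>)" using fK by simp
      show "AE x in lebesgue. norm (\<zeta> n x * (indicator K x * f x)) \<le> \<bar>indicator K x * f x\<bar>" for n
        using \<zeta>(2,3) by (auto simp: abs_mult mult_left_le_one_le)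
      show "AE x in lebesgue. (\<lambda>n. \<zeta> n x * (indicator K x * f x)) \<longlonglongrightarrow> indicator (cbox a b) x * (indicator K x * f x)"
      proof (intro AE_I2 tendsto_mult tendsto_const)
        fix x
        show "(\<lambda>n. \<zeta> n x) \<longlonglongrightarrow> indicator (cbox a b) x"
        proof (cases "x \<in> cbox a b")
          case True
          then have "\<zeta> n x = 1" for n using \<zeta>(4)[where n=n and x=x] s(1)[of n] by simp
          then show ?thesis using True by simp
        next
          case x: False
          then have "infdist x (cbox a b) > 0"
            using infdist_pos_not_in_closed[OF closed_cbox False] by blast
          moreover have "(\<lambda>n. 4 * s n) = (\<lambda>n. e * inverse (real (Suc n)))" by (auto simp: s_def field_simps)
          then have "(\<lambda>n. 4 * s n) \<longlonglongrightarrow> 0"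
            using tendsto_mult_right_zero[OF LIMSEQ_inverse_real_of_nat, of e] by simp
          ultimately have "\<forall>\<^sub>F n in sequentially. 4 * s n < infdist x (cbox a b)" by (rule order_tendstoD(2)[rotated])
          then have "\<forall>\<^sub>F n in sequentially. \<zeta> n x = indicator (cbox a b) x"
            by (rule eventually_mono) (use \<zeta>(5) x in \<open>simp add: less_imp_le\<close>)
          then show ?thesis by (rule tendsto_eventually)
        qed
      qed
    qed
    have zero: "(\<integral>x. \<zeta> n x * (indicator K x * f x) \<partial>lebesgue) = 0" for n
    proof -
      have "\<zeta> n \<in> test_functions \<Omega>" using test_functionI[OF \<zeta>(1) K \<zeta>0] .
      from z[OF this] have "(\<integral>x. indicator \<Omega> x *\<^sub>R (f x * \<zeta> n x) \<partial>lebesgue) = 0"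
        by (subst (asm) integral_restrict_space) (use \<Omega>L in auto)
      moreover have "(\<lambda>x. indicator \<Omega> x *\<^sub>R (f x * \<zeta> n x)) = (\<lambda>x. \<zeta> n x * (indicator K x * f x))"
        using \<zeta>0 K(2) by (auto simp: indicator_def fun_eq_iff)
      ultimately show ?thesis by simp
    qed
    have "(\<integral>x. indicator (cbox a b) x * (indicator K x * f x) \<partial>lebesgue) = 0"
      using lim unfolding zero by (rule LIMSEQ_unique[OF _ tendsto_const])
    moreover have "(\<lambda>x. indicator (cbox a b) x * (indicator K x * f x)) = (\<lambda>x. indicator (cbox a b) x *\<^sub>R f x)"
    proof
      fix x
      have "x \<in> K" if "x \<in> cbox a b" using that e(1) by (simp add: K_def)
      then show "indicator (cbox a b) x * (indicator K x * f x) = indicator (cbox a b) x *\<^sub>R f x"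
        by (simp add: indicator_def)
    qed
    ultimately have "(\<integral>x. f x \<partial>lebesgue_on (cbox a b)) = 0"
      by (subst integral_restrict_space) auto
    then show ?thesis using lebesgue_integral_eq_integral[OF f[OF compact_cbox ab]] by simp
  qed simp
  obtain D where D: "countable D" "D \<subseteq> Pow \<Omega>" "\<And>X. X \<in> D \<Longrightarrow> \<exists>a b. X = cbox a b" "\<Union>D = \<Omega>"
    using open_countable_Union_open_cbox[OF \<Omega>] by metis
  have "negligible {x \<in> X. f x \<noteq> 0}" if "X \<in> D" for X
  proof -
    obtain a b where X: "X = cbox a b" using D(3)[OF \<open>X \<in> D\<close>] by blast
    have ab: "cbox a b \<subseteq> \<Omega>" using D(2) that X by blast
    \<comment> \<open>Extension by zero makes \<open>g\<close> integrable over all boxes, as the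
      differentiation theorem requires; near an interior point the cubes stay in the box and only
      see \<open>f\<close>.\<close>
    define g where "g = (\<lambda>x. if x \<in> cbox a b then f x else 0)"
    have "f absolutely_integrable_on cbox a b" 
      using f[OF compact_cbox ab] integrable_restrict_space[of "cbox a b" lebesgue f]
      by (auto simp: set_integrable_def)
    then have "g integrable_on UNIV" unfolding g_def integrable_restrict_UNIV
      by (rule set_lebesgue_integral_eq_integral(1))
    then have "g integrable_on cbox c d" for c d by (rule integrable_on_subcbox) simp
    from integrable_ccontinuous_explicit[of g, OF this] obtain N where N: "negligible N"
       "\<And>x e. x \<notin> N \<Longrightarrow> 0 < e \<Longrightarrow> \<exists>d>0. \<forall>h. 0 < h \<and> h < d \<longrightarrow>
         norm(integral (cbox x (x + h *\<^sub>R One)) g /\<^sub>R h ^ DIM('a) - g x) < e" by blast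
    have "f x = 0" if x: "x \<in> box a b" "x \<notin> N" for x
    proof (rule ccontr)
      assume "f x \<noteq> 0"
      have gx: "g x = f x" using x box_subset_cbox[of a b] by (auto simp: g_def)
      obtain d where d: "d > 0" "\<And>h. 0 < h \<Longrightarrow> h < d \<Longrightarrow>
         norm(integral (cbox x (x + h *\<^sub>R One)) g /\<^sub>R h ^ DIM('a) - g x) < \<bar>f x\<bar>"
        using N(2)[OF x(2), of "\<bar>f x\<bar>"] \<open>f x \<noteq> 0\<close> by auto
      obtain r where r: "r > 0" "ball x r \<subseteq> box a b" using x(1) open_box openE by blast
      define h where "h = min (d/2) (r / (2 * norm (One :: 'a)))"
      have O: "norm (One :: 'a) > 0" by (simp only: zero_less_norm_iff One_neq_0 not_False_eq_True)
      have h: "0 < h" "h < d" "h * norm (One :: 'a) < r" using d(1) r(1) O 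
        by (auto simp: h_def min_def field_simps split: if_splits)
      have "cbox x (x + h *\<^sub>R One) \<subseteq> cbox a b"
      proof -
        have "x + h *\<^sub>R One \<in> ball x r" using h by (simp add: dist_norm)
        then have "x + h *\<^sub>R One \<in> cbox a b" using r box_subset_cbox by blast
        moreover have "x \<in> cbox a b" using x(1) box_subset_cbox by blast
        ultimately show ?thesis by (metis (no_types, lifting) mem_box(2) subset_box(1))
      qed
      then have "integral (cbox x (x + h *\<^sub>R One)) g = integral (cbox x (x + h *\<^sub>R One)) f"
        by (intro integral_cong) (auto simp: g_def)
      also have "\<dots> = 0" using \<open>cbox x (x + h *\<^sub>R One) \<subseteq> cbox a b\<close> ab by (intro box0) blast
      finally show False using d(2)[OF h(1,2)] gx by simp
    qed
    then have "{x \<in> X. f x \<noteq> 0} \<subseteq> N \<union> (cbox a b - box a b)" using X by blast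
    then show ?thesis using N(1) negligible_frontier_interval negligible_Un negligible_subset by blast
  qed
  then have "negligible (\<Union>X\<in>D. {x \<in> X. f x \<noteq> 0})" using D(1) by (intro negligible_countable_Union) auto
  moreover have "(\<Union>X\<in>D. {x \<in> X. f x \<noteq> 0}) = {x \<in> \<Omega>. f x \<noteq> 0}" using D(4) by blast
  ultimately have "negligible {x \<in> \<Omega>. f x \<noteq> 0}" by simp
  then have "{x \<in> \<Omega>. f x \<noteq> 0} \<in> null_sets lebesgue" by (simp add: negligible_iff_null_sets)
  then have "AE x in lebesgue. x \<in> \<Omega> \<longrightarrow> f x = 0"
    by (rule AE_I') auto
  then show ?thesis using \<Omega> by (subst AE_restrict_space_iff) auto
qed

lemma integrable_scaleR_support:
  fixes f :: "'a::euclidean_space \<Rightarrow> 'b::{banach, second_countable_topology}"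
  assumes f: "integrable (lebesgue_on K) f" and K: "compact K" "K \<subseteq> \<Omega>" and \<Omega>: "\<Omega> \<in> sets lebesgue"
    and \<psi>: "continuous_on UNIV \<psi>" "\<And>x. x \<notin> K \<Longrightarrow> \<psi> x = (0::real)"
  shows "integrable (lebesgue_on \<Omega>) (\<lambda>x. \<psi> x *\<^sub>R f x)"
proof -
  have KL: "K \<in> sets lebesgue" using K(1) by (simp add: lmeasurable_compact fmeasurableD)
  have "bounded (\<psi> ` K)" using K(1) \<psi>(1)
    by (intro compact_imp_bounded compact_continuous_image) (auto intro: continuous_on_subset)
  then obtain M where M: "\<And>x. x \<in> K \<Longrightarrow> \<bar>\<psi> x\<bar> \<le> M" by (auto simp: bounded_iff)
  have fK: "integrable lebesgue (\<lambda>x. indicator K x *\<^sub>R f x)"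
    using f KL by (subst (asm) integrable_restrict_space) auto
  have \<psi>m: "\<psi> \<in> borel_measurable lebesgue" 
    using \<psi>(1) by (simp add: borel_measurable_continuous_onI measurable_completion)
  have "integrable lebesgue (\<lambda>x. \<psi> x *\<^sub>R (indicator K x *\<^sub>R f x))"
  proof (rule Bochner_Integration.integrable_bound)
    show "integrable lebesgue (\<lambda>x. M *\<^sub>R (indicator K x *\<^sub>R f x))" using fK by (rule integrable_scaleR_right)
    show "AE x in lebesgue. norm (\<psi> x *\<^sub>R (indicator K x *\<^sub>R f x)) \<le> norm (M *\<^sub>R (indicator K x *\<^sub>R f x))"
    proof (rule AE_I2)
      fix x show "norm (\<psi> x *\<^sub>R (indicator K x *\<^sub>R f x)) \<le> norm (M *\<^sub>R (indicator K x *\<^sub>R f x))"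
        using M[of x] by (cases "x \<in> K") (auto intro!: mult_right_mono)
    qed
  qed (rule borel_measurable_scaleR[OF \<psi>m borel_measurable_integrable[OF fK]])
  moreover have "(\<lambda>x. \<psi> x *\<^sub>R (indicator K x *\<^sub>R f x)) = (\<lambda>x. indicator \<Omega> x *\<^sub>R (\<psi> x *\<^sub>R f x))"
    using \<psi>(2) K(2) by (auto simp: indicator_def fun_eq_iff)
  ultimately show ?thesis using \<Omega> by (subst integrable_restrict_space) auto
qed

text \<open>Each component of the difference is orthogonal to all test functions. As
  \<open>weak_gradient\<close> is a choice, uniqueness almost everywhere is what allows an
  explicitly computed gradient to be substituted under the integral.\<close>

lemma has_weak_gradient_unique:
  fixes u :: "'a::euclidean_space \<Rightarrow> real"
  assumes \<Omega>: "open \<Omega>" and G: "has_weak_gradient \<Omega> u G" and H: "has_weak_gradient \<Omega> u H"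
  shows "AE x in lebesgue_on \<Omega>. G x = H x"
proof -
  have comp: "AE x in lebesgue_on \<Omega>. (G x - H x) \<bullet> b = 0" for b
  proof (rule integral_zero_AE_zero[OF \<Omega>])
    have GH: "integrable (lebesgue_on K) G" "integrable (lebesgue_on K) H" if "compact K" "K \<subseteq> \<Omega>" for K
      using G[unfolded has_weak_gradient_def, THEN conjunct1] H[unfolded has_weak_gradient_def, THEN conjunct1] that by auto
    have i: "integrable (lebesgue_on K) (\<lambda>x. (G x - H x) \<bullet> b)" 
      "integrable (lebesgue_on K) (\<lambda>x. G x \<bullet> b)" "integrable (lebesgue_on K) (\<lambda>x. H x \<bullet> b)"
      if "compact K" "K \<subseteq> \<Omega>" for K
      using GH[OF that] by auto
    show "integrable (lebesgue_on K) (\<lambda>x. (G x - H x) \<bullet> b)" if "compact K" "K \<subseteq> \<Omega>" for K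
      by (rule i(1)[OF that])
    fix \<psi> assume \<psi>: "\<psi> \<in> test_functions \<Omega>"
    obtain K where K: "smooth \<psi>" "compact K" "K \<subseteq> \<Omega>" "\<And>x. x \<notin> K \<Longrightarrow> \<psi> x = 0"
      "\<And>x v. x \<notin> K \<Longrightarrow> frechet_derivative \<psi> (at x) v = 0"
      using test_functionD[OF \<psi>] by metis
    have L: "integrable (lebesgue_on \<Omega>) (\<lambda>x. (G x \<bullet> b) * \<psi> x)" "integrable (lebesgue_on \<Omega>) (\<lambda>x. (H x \<bullet> b) * \<psi> x)"
      using integrable_scaleR_support[OF i(2)[OF K(2,3)] K(2,3) _ smooth_derivative(3)[OF K(1)] K(4)] 
        integrable_scaleR_support[OF i(3)[OF K(2,3)] K(2,3) _ smooth_derivative(3)[OF K(1)] K(4)] \<Omega>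
      by (simp_all add: mult.commute)
    have e: "(\<integral>x. u x * frechet_derivative \<psi> (at x) b \<partial>lebesgue_on \<Omega>) = - (\<integral>x. (F x \<bullet> b) * \<psi> x \<partial>lebesgue_on \<Omega>)"
      if "has_weak_gradient \<Omega> u F" for F
    proof -
      from that have "\<forall>\<psi>\<in>test_functions \<Omega>. \<forall>v. (\<integral>x. u x * frechet_derivative \<psi> (at x) v \<partial>lebesgue_on \<Omega>) =
        - (\<integral>x. (F x \<bullet> v) * \<psi> x \<partial>lebesgue_on \<Omega>)"
        unfolding has_weak_gradient_def by (rule conjunct2)
      from this[THEN bspec, OF \<psi>, THEN spec] show ?thesis .
    qed
    have "(\<integral>x. (G x - H x) \<bullet> b * \<psi> x \<partial>lebesgue_on \<Omega>) = 
       (\<integral>x. (G x \<bullet> b) * \<psi> x - (H x \<bullet> b) * \<psi> x \<partial>lebesgue_on \<Omega>)"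
      by (simp only: inner_diff_left left_diff_distrib)
    also have "\<dots> = (\<integral>x. (G x \<bullet> b) * \<psi> x \<partial>lebesgue_on \<Omega>) - (\<integral>x. (H x \<bullet> b) * \<psi> x \<partial>lebesgue_on \<Omega>)"
      by (rule Bochner_Integration.integral_diff[OF L])
    finally show "(\<integral>x. (G x - H x) \<bullet> b * \<psi> x \<partial>lebesgue_on \<Omega>) = 0"
      using neg_equal_iff_equal[THEN iffD1, OF trans[OF e[OF G, symmetric] e[OF H]]] by simp
  qed
  have "AE x in lebesgue_on \<Omega>. \<forall>b\<in>Basis. (G x - H x) \<bullet> b = 0"
  proof (rule AE_finite_allI[OF finite_Basis])
    fix b :: 'a
    show "AE x in lebesgue_on \<Omega>. (G x - H x) \<bullet> b = 0" by (rule comp)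
  qed
  then show ?thesis
  proof (rule eventually_mono)
    fix x assume z: "\<forall>b\<in>Basis. (G x - H x) \<bullet> b = 0"
    show "G x = H x"
    proof (rule euclidean_eqI)
      fix b :: 'a assume "b \<in> Basis"
      then have "(G x - H x) \<bullet> b = 0" using z by blast
      then show "G x \<bullet> b = H x \<bullet> b" by (simp add: inner_diff_left)
    qed
  qed
qed

lemma weak_gradient_AE:
  assumes "open \<Omega>" "has_weak_gradient \<Omega> u G"
  shows "has_weak_gradient \<Omega> u (weak_gradient \<Omega> u)" "AE x in lebesgue_on \<Omega>. weak_gradient \<Omega> u x = G x"
proof -
  show "has_weak_gradient \<Omega> u (weak_gradient \<Omega> u)"
    unfolding weak_gradient_def using assms(2) by (rule someI[of "has_weak_gradient \<Omega> u"])
  then show "AE x in lebesgue_on \<Omega>. weak_gradient \<Omega> u x = G x"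
    using has_weak_gradient_unique[OF assms(1) _ assms(2)] by blast
qed

lemma test_function_integrable:
  fixes \<psi> :: "'a::euclidean_space \<Rightarrow> real"
  assumes \<psi>: "\<psi> \<in> test_functions \<Omega>" and A: "A \<in> sets lebesgue"
  shows "integrable (lebesgue_on A) \<psi>" "integrable (lebesgue_on A) (grad \<psi>)"
    "square_integrable_on \<psi> A" "square_integrable_on (grad \<psi>) A"
proof -
  obtain K where K: "smooth \<psi>" "compact K" "K \<subseteq> \<Omega>" "\<And>x. x \<notin> K \<Longrightarrow> \<psi> x = 0"
    "\<And>x v. x \<notin> K \<Longrightarrow> frechet_derivative \<psi> (at x) v = 0"
    using test_functionD[OF \<psi>] by metis
  have g0: "x \<notin> K \<Longrightarrow> grad \<psi> x = 0" for x using K(5) by (simp add: grad_def)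
  note c = smooth_derivative(3)[OF K(1), of UNIV] continuous_on_grad[OF K(1), of UNIV]
  show "integrable (lebesgue_on A) \<psi>" "integrable (lebesgue_on A) (grad \<psi>)"
    using integrable_continuous_compact_support[OF c(1) K(2,4)] integrable_continuous_compact_support[OF c(2) K(2) g0]
    by (auto intro: integrable_lebesgue_on_support[OF _ A])
  moreover have "integrable (lebesgue_on A) (\<lambda>x. (norm (\<psi> x))\<^sup>2)" "integrable (lebesgue_on A) (\<lambda>x. (norm (grad \<psi> x))\<^sup>2)"
    by (rule integrable_lebesgue_on_support[OF integrable_continuous_compact_support[OF _ K(2)] A];
        use K(4) g0 in \<open>auto intro!: continuous_intros c\<close>)+
  ultimately show "square_integrable_on \<psi> A" "square_integrable_on (grad \<psi>) A" 
    unfolding square_integrable_on_def by auto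
qed

lemma has_weak_gradient_test_function:
  fixes \<psi> :: "'a::euclidean_space \<Rightarrow> real"
  assumes \<Omega>: "open \<Omega>" and \<psi>: "\<psi> \<in> test_functions \<Omega>"
  shows "has_weak_gradient \<Omega> \<psi> (grad \<psi>)"
  unfolding has_weak_gradient_def
proof (intro conjI allI impI ballI)
  fix K :: "'a set" assume "compact K \<and> K \<subseteq> \<Omega>"
  then have K: "K \<in> sets lebesgue" by (simp add: lmeasurable_compact fmeasurableD)
  show "integrable (lebesgue_on K) \<psi>" "integrable (lebesgue_on K) (grad \<psi>)"
    using test_function_integrable[OF \<psi> K] by auto
next
  fix \<eta> v assume \<eta>: "\<eta> \<in> test_functions \<Omega>"
  obtain K where K: "smooth \<psi>" "compact K" "K \<subseteq> \<Omega>" "\<And>x. x \<notin> K \<Longrightarrow> \<psi> x = 0"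
    "\<And>x v. x \<notin> K \<Longrightarrow> frechet_derivative \<psi> (at x) v = 0" using test_functionD[OF \<psi>] by metis
  obtain L where L: "smooth \<eta>" "compact L" "L \<subseteq> \<Omega>" "\<And>x. x \<notin> L \<Longrightarrow> \<eta> x = 0"
    "\<And>x v. x \<notin> L \<Longrightarrow> frechet_derivative \<eta> (at x) v = 0" using test_functionD[OF \<eta>] by metis
  have \<Omega>L: "\<Omega> \<in> sets lebesgue" using \<Omega> by simp
  define A where "A = (\<lambda>x. \<psi> x * frechet_derivative \<eta> (at x) v)"
  define B where "B = (\<lambda>x. (grad \<psi> x \<bullet> v) * \<eta> x)"
  note c = smooth_derivative(3)[OF K(1), of UNIV] smooth_derivative(4)[OF K(1), of UNIV]
    smooth_derivative(3)[OF L(1), of UNIV] smooth_derivative(4)[OF L(1), of UNIV]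
  have cA: "continuous_on UNIV A" and cB: "continuous_on UNIV B"
    unfolding A_def B_def grad_inner[OF K(1)] by (intro continuous_intros c)+
  have A0: "x \<notin> K \<Longrightarrow> A x = 0" and B0: "x \<notin> K \<Longrightarrow> B x = 0" for x
    using K(4,5) by (auto simp: A_def B_def grad_inner[OF K(1)])
  have i: "integrable lborel A" "integrable lborel B"
    using integrable_continuous_compact_support[OF cA K(2) A0] integrable_continuous_compact_support[OF cB K(2) B0] by auto
  \<comment> \<open>The integrand is the derivative along \<open>v\<close> of the compactly
    supported product \<open>\<psi> x * \<eta> x\<close>.\<close>
  have "(\<integral>x. A x + B x \<partial>lborel) = 0"
    unfolding A_def B_def grad_inner[OF K(1)]
  proof (rule integral_derivative_eq_0[where w = "\<lambda>x. \<psi> x * \<eta> x" and K = K and 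
        w' = "\<lambda>x v. \<psi> x * frechet_derivative \<eta> (at x) v + frechet_derivative \<psi> (at x) v * \<eta> x"])
    show "((\<lambda>x. \<psi> x * \<eta> x) has_derivative (\<lambda>v. \<psi> x * frechet_derivative \<eta> (at x) v + frechet_derivative \<psi> (at x) v * \<eta> x)) (at x)" for x
      by (rule has_derivative_mult[OF smooth_derivative(1)[OF K(1)] smooth_derivative(1)[OF L(1)]])
  qed (use K in \<open>auto intro!: continuous_intros c\<close>)
  then have "(\<integral>x. A x \<partial>lborel) = - (\<integral>x. B x \<partial>lborel)" using i by simp
  moreover have "(\<integral>x. A x \<partial>lebesgue_on \<Omega>) = (\<integral>x. A x \<partial>lborel)" "(\<integral>x. B x \<partial>lebesgue_on \<Omega>) = (\<integral>x. B x \<partial>lborel)"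
    by (rule integral_lebesgue_on_support[OF _ \<Omega>L]; use i A0 B0 K(3) in auto)+
  ultimately show "(\<integral>x. \<psi> x * frechet_derivative \<eta> (at x) v \<partial>lebesgue_on \<Omega>) = - (\<integral>x. (grad \<psi> x \<bullet> v) * \<eta> x \<partial>lebesgue_on \<Omega>)"
    unfolding A_def B_def by simp
qed

text \<open>\<open>sobolev_H10\<close> measures differences by \<open>H1_norm\<close>, whose
  gradient term is a separate choice for each function; this identifies it with the difference of
  the two gradients.\<close>

lemma has_weak_gradient_diff:
  fixes u w :: "'a::euclidean_space \<Rightarrow> real"
  assumes \<Omega>: "open \<Omega>" and G: "has_weak_gradient \<Omega> u G" and H: "has_weak_gradient \<Omega> w H"
  shows "has_weak_gradient \<Omega> (\<lambda>x. u x - w x) (\<lambda>x. G x - H x)"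
  unfolding has_weak_gradient_def
proof (intro conjI allI impI ballI)
  fix K assume "compact K \<and> K \<subseteq> \<Omega>"
  then show "integrable (lebesgue_on K) (\<lambda>x. u x - w x)" "integrable (lebesgue_on K) (\<lambda>x. G x - H x)"
    using G H unfolding has_weak_gradient_def by auto
next
  fix \<eta> v assume \<eta>: "\<eta> \<in> test_functions \<Omega>"
  obtain L where L: "smooth \<eta>" "compact L" "L \<subseteq> \<Omega>" "\<And>x. x \<notin> L \<Longrightarrow> \<eta> x = 0"
    "\<And>x v. x \<notin> L \<Longrightarrow> frechet_derivative \<eta> (at x) v = 0" using test_functionD[OF \<eta>] by metis
  have \<Omega>L: "\<Omega> \<in> sets lebesgue" using \<Omega> by simp
  have i: "integrable (lebesgue_on L) u" "integrable (lebesgue_on L) w"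
    "integrable (lebesgue_on L) (\<lambda>x. G x \<bullet> v)" "integrable (lebesgue_on L) (\<lambda>x. H x \<bullet> v)"
    using G H L(2,3) unfolding has_weak_gradient_def by auto
  have 1: "integrable (lebesgue_on \<Omega>) (\<lambda>x. f x * frechet_derivative \<eta> (at x) v)" 
    and 2: "integrable (lebesgue_on \<Omega>) (\<lambda>x. f x * \<eta> x)" if "integrable (lebesgue_on L) f" for f :: "'a \<Rightarrow> real"
    using integrable_scaleR_support[OF that L(2,3) \<Omega>L smooth_derivative(4)[OF L(1)] L(5)] 
      integrable_scaleR_support[OF that L(2,3) \<Omega>L smooth_derivative(3)[OF L(1)] L(4)] by (simp_all add: mult.commute)
  show "(\<integral>x. (u x - w x) * frechet_derivative \<eta> (at x) v \<partial>lebesgue_on \<Omega>) = 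
      - (\<integral>x. ((G x - H x) \<bullet> v) * \<eta> x \<partial>lebesgue_on \<Omega>)"
    using G H \<eta> 1[OF i(1)] 1[OF i(2)] 2[OF i(3)] 2[OF i(4)] unfolding has_weak_gradient_def
    by (simp add: left_diff_distrib inner_diff_left)
qed

section \<open>Square integrable functions and their products\<close>

lemma borel_measurable_lebesgue_on_cong_AE:
  fixes f g :: "'a::euclidean_space \<Rightarrow> 'b::euclidean_space"
  assumes "AE x in lebesgue_on \<Omega>. f x = g x" "g \<in> borel_measurable (lebesgue_on \<Omega>)" and \<Omega>: "\<Omega> \<in> sets lebesgue"
  shows "f \<in> borel_measurable (lebesgue_on \<Omega>)"
proof -
  have "(\<lambda>x. if x \<in> \<Omega> then g x else 0) \<in> borel_measurable lebesgue" 
    using assms(2) borel_measurable_if[OF \<Omega>] by blast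
  moreover have "AE x in lebesgue. (if x \<in> \<Omega> then g x else 0) = (if x \<in> \<Omega> then f x else 0)"
  proof -
    have "AE x in lebesgue. x \<in> \<Omega> \<longrightarrow> f x = g x"
      using assms(1) \<Omega> by (subst (asm) AE_restrict_space_iff) auto
    then show ?thesis by (rule eventually_mono) simp
  qed
  ultimately have "(\<lambda>x. if x \<in> \<Omega> then f x else 0) \<in> borel_measurable lebesgue" by (rule borel_measurable_AE)
  then show ?thesis using borel_measurable_if[OF \<Omega>] by blast
qed

lemma square_integrable_on_cong_AE:
  fixes f g :: "'a::euclidean_space \<Rightarrow> 'b::euclidean_space"
  assumes ae: "AE x in lebesgue_on \<Omega>. f x = g x" and g: "square_integrable_on g \<Omega>" and \<Omega>: "\<Omega> \<in> sets lebesgue"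
  shows "square_integrable_on f \<Omega>"
proof -
  have f: "f \<in> borel_measurable (lebesgue_on \<Omega>)" 
    using borel_measurable_lebesgue_on_cong_AE[OF ae _ \<Omega>] g by (simp add: square_integrable_on_def)
  moreover have "integrable (lebesgue_on \<Omega>) (\<lambda>x. (norm (f x))\<^sup>2)"
  proof (rule integrable_cong_AE_imp)
    show "integrable (lebesgue_on \<Omega>) (\<lambda>x. (norm (g x))\<^sup>2)" using g by (simp add: square_integrable_on_def)
    show "(\<lambda>x. (norm (f x))\<^sup>2) \<in> borel_measurable (lebesgue_on \<Omega>)" using f by simp
    show "AE x in lebesgue_on \<Omega>. (norm (g x))\<^sup>2 = (norm (f x))\<^sup>2" using ae by (rule eventually_mono) simp
  qed
  ultimately show ?thesis by (simp add: square_integrable_on_def)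
qed

lemma square_integrable_on_diff:
  assumes "square_integrable_on f \<Omega>" "square_integrable_on g \<Omega>"
  shows "square_integrable_on (\<lambda>x. f x - g x) \<Omega>"
proof -
  have [measurable]: "f \<in> borel_measurable (lebesgue_on \<Omega>)" "g \<in> borel_measurable (lebesgue_on \<Omega>)"
    using assms by (auto simp: square_integrable_on_def)
  have "integrable (lebesgue_on \<Omega>) (\<lambda>x. (norm (f x - g x))\<^sup>2)"
  proof (rule Bochner_Integration.integrable_bound)
    show "integrable (lebesgue_on \<Omega>) (\<lambda>x. 2 * (norm (f x))\<^sup>2 + 2 * (norm (g x))\<^sup>2)"
      using assms by (auto simp: square_integrable_on_def)
    have "(norm (f x - g x))\<^sup>2 \<le> 2 * (norm (f x))\<^sup>2 + 2 * (norm (g x))\<^sup>2" for x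
    proof -
      have "(norm (f x - g x))\<^sup>2 \<le> (norm (f x) + norm (g x))\<^sup>2"
        by (intro power_mono norm_triangle_ineq4) auto
      also have "\<dots> \<le> 2 * (norm (f x))\<^sup>2 + 2 * (norm (g x))\<^sup>2"
        using sum_squares_bound[of "norm (f x)" "norm (g x)"] by (simp add: power2_sum)
      finally show ?thesis .
    qed
    then show "AE x in lebesgue_on \<Omega>. norm ((norm (f x - g x))\<^sup>2) \<le> norm (2 * (norm (f x))\<^sup>2 + 2 * (norm (g x))\<^sup>2)"
      by (intro AE_I2) simp
  qed simp
  then show ?thesis by (simp add: square_integrable_on_def)
qed

lemma square_integrable_on_prod:
  fixes f g :: "'a::euclidean_space \<Rightarrow> real"
  assumes f: "square_integrable_on f \<Omega>" and g: "square_integrable_on g \<Omega>"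
    and h: "h \<in> borel_measurable (lebesgue_on \<Omega>)" "\<And>x. \<bar>h x\<bar> \<le> f x * g x"
  shows "integrable (lebesgue_on \<Omega>) h"
proof (rule Bochner_Integration.integrable_bound)
  show "integrable (lebesgue_on \<Omega>) (\<lambda>x. (f x)\<^sup>2 + (g x)\<^sup>2)"
    using f g by (auto simp: square_integrable_on_def)
  have "\<bar>h x\<bar> \<le> (f x)\<^sup>2 + (g x)\<^sup>2" for x
    using h(2)[of x] sum_squares_bound[of "f x" "g x"] zero_le_power2[of "f x"] zero_le_power2[of "g x"] by linarith
  then show "AE x in lebesgue_on \<Omega>. norm (h x) \<le> norm ((f x)\<^sup>2 + (g x)\<^sup>2)" by (intro AE_I2) simp
qed (use h in simp)

text \<open>A form of the Cauchy-Schwarz inequality, by Young's inequality with a small parameter.\<close>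

lemma L2_product_tendsto_0:
  fixes a :: "nat \<Rightarrow> 'a::euclidean_space \<Rightarrow> real"
  assumes a: "\<And>n. square_integrable_on (a n) \<Omega>" "(\<lambda>n. \<integral>x. (a n x)\<^sup>2 \<partial>lebesgue_on \<Omega>) \<longlonglongrightarrow> 0"
    and b: "square_integrable_on b \<Omega>"
    and h: "\<And>n. h n \<in> borel_measurable (lebesgue_on \<Omega>)" "\<And>n x. \<bar>h n x\<bar> \<le> a n x * b x"
  shows "(\<lambda>n. \<integral>x. h n x \<partial>lebesgue_on \<Omega>) \<longlonglongrightarrow> 0"
proof (rule LIMSEQ_I)
  fix r :: real assume r: "0 < r"
  define B where "B = (\<integral>x. (b x)\<^sup>2 \<partial>lebesgue_on \<Omega>)"
  have B: "0 \<le> B" unfolding B_def by simp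
  \<comment> \<open>Young's inequality bounds a b by a^2 / (2 t) + t b^2 / 2. With this
    \<open>t\<close> the second term integrates to less than r / 2, and the first does so once the
    integral of a^2 is below r t; the added 1 covers B = 0.\<close>
  define t where "t = r / (B + 1)"
  have t: "0 < t" "t * B < r" using r B by (auto simp: t_def field_simps)
  have "\<forall>\<^sub>F n in sequentially. (\<integral>x. (a n x)\<^sup>2 \<partial>lebesgue_on \<Omega>) < r * t"
    using r t by (intro order_tendstoD(2)[OF a(2)]) auto
  then obtain N where N: "\<And>n. n \<ge> N \<Longrightarrow> (\<integral>x. (a n x)\<^sup>2 \<partial>lebesgue_on \<Omega>) < r * t"
    unfolding eventually_sequentially by blast
  have ia: "integrable (lebesgue_on \<Omega>) (\<lambda>x. (a n x)\<^sup>2)" and ib: "integrable (lebesgue_on \<Omega>) (\<lambda>x. (b x)\<^sup>2)" for n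
    using a(1)[of n] b by (auto simp: square_integrable_on_def)
  have "norm ((\<integral>x. h n x \<partial>lebesgue_on \<Omega>) - 0) < r" if "n \<ge> N" for n
  proof -
    have ih: "integrable (lebesgue_on \<Omega>) (h n)" by (rule square_integrable_on_prod[OF a(1) b h])
    have "norm (\<integral>x. h n x \<partial>lebesgue_on \<Omega>) \<le> (\<integral>x. norm (h n x) \<partial>lebesgue_on \<Omega>)" by (rule integral_norm_bound)
    also have "\<dots> \<le> (\<integral>x. (a n x)\<^sup>2 * (1 / (2 * t)) + (b x)\<^sup>2 * (t / 2) \<partial>lebesgue_on \<Omega>)"
    proof (rule integral_mono)
      fix x
      have "0 \<le> (a n x - t * b x)\<^sup>2" by simp
      then have "t * (2 * (a n x * b x)) \<le> (a n x)\<^sup>2 + t * (t * (b x)\<^sup>2)" 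
        by (simp add: power2_diff power_mult_distrib power2_eq_square algebra_simps)
      then have "a n x * b x \<le> (a n x)\<^sup>2 * (1 / (2 * t)) + (b x)\<^sup>2 * (t / 2)"
        using t(1) by (simp add: field_simps power2_eq_square)
      then show "norm (h n x) \<le> (a n x)\<^sup>2 * (1 / (2 * t)) + (b x)\<^sup>2 * (t / 2)" using h(2)[of n x] by simp
    qed (use ih ia ib in auto)
    also have "\<dots> = (\<integral>x. (a n x)\<^sup>2 \<partial>lebesgue_on \<Omega>) * (1 / (2 * t)) + B * (t / 2)"
      using ia ib by (simp add: B_def)
    also have "\<dots> < r * t * (1 / (2 * t)) + r / 2"
      using N[OF that] t by (intro add_less_le_mono mult_strict_right_mono) (auto simp: mult.commute)
    also have "\<dots> = r" using t by simp
    finally show ?thesis by simp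
  qed
  then show "\<exists>N. \<forall>n\<ge>N. norm ((\<integral>x. h n x \<partial>lebesgue_on \<Omega>) - 0) < r" by blast
qed

lemma square_integrable_on_const:
  assumes "bounded \<Omega>" "open \<Omega>"
  shows "square_integrable_on (\<lambda>_. c::real) \<Omega>" "integrable (lebesgue_on \<Omega>) (\<lambda>_. c::real)"
proof -
  have "\<Omega> \<in> lmeasurable" using assms by (simp add: bounded_set_imp_lmeasurable)
  then have i: "integrable (lebesgue_on \<Omega>) (\<lambda>_. c::real)" for c 
    by (intro finite_measure.integrable_const finite_measure_lebesgue_on)
  show "integrable (lebesgue_on \<Omega>) (\<lambda>_. c)" "square_integrable_on (\<lambda>_. c) \<Omega>" 
    unfolding square_integrable_on_def using i by auto
qed

section \<open>Gradients and approximation in \<open>sobolev_H10\<close>\<close>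

lemma sobolev_H10_weak_gradient:
  fixes u :: "'a::euclidean_space \<Rightarrow> real"
  assumes \<Omega>: "open \<Omega>" and u: "u \<in> sobolev_H10 \<Omega>"
  shows "square_integrable_on u \<Omega>" "has_weak_gradient \<Omega> u (weak_gradient \<Omega> u)"
    "square_integrable_on (weak_gradient \<Omega> u) \<Omega>"
proof -
  from u obtain G where G: "has_weak_gradient \<Omega> u G" "square_integrable_on G \<Omega>" and "square_integrable_on u \<Omega>"
    by (auto simp: sobolev_H10_def sobolev_H1_def)
  then show "square_integrable_on u \<Omega>" "has_weak_gradient \<Omega> u (weak_gradient \<Omega> u)"
    "square_integrable_on (weak_gradient \<Omega> u) \<Omega>"
    using weak_gradient_AE[OF \<Omega> G(1)] square_integrable_on_cong_AE[OF _ G(2)] \<Omega> by auto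
qed

text \<open>Unpacks convergence in \<open>H1_norm\<close> into two separate mean square limits, in
  which the approximants carry their classical gradients instead of chosen weak ones.\<close>

lemma sobolev_H10_approx:
  fixes u :: "'a::euclidean_space \<Rightarrow> real"
  assumes \<Omega>: "open \<Omega>" and u: "u \<in> sobolev_H10 \<Omega>"
  obtains \<psi> where "\<And>n. \<psi> n \<in> test_functions \<Omega>"
    "(\<lambda>n. \<integral>x. (\<psi> n x - u x)\<^sup>2 \<partial>lebesgue_on \<Omega>) \<longlonglongrightarrow> 0"
    "(\<lambda>n. \<integral>x. (norm (grad (\<psi> n) x - weak_gradient \<Omega> u x))\<^sup>2 \<partial>lebesgue_on \<Omega>) \<longlonglongrightarrow> 0"
proof -
  have \<Omega>L: "\<Omega> \<in> sets lebesgue" using \<Omega> by simp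
  note w = sobolev_H10_weak_gradient[OF \<Omega> u]
  obtain \<psi> where \<psi>: "\<And>n. \<psi> n \<in> test_functions \<Omega>" "(\<lambda>n. H1_norm \<Omega> (\<lambda>x. \<psi> n x - u x)) \<longlonglongrightarrow> 0"
    using u by (auto simp: sobolev_H10_def)
  define A where "A = (\<lambda>n. \<integral>x. (\<psi> n x - u x)\<^sup>2 \<partial>lebesgue_on \<Omega>)"
  define B where "B = (\<lambda>n. \<integral>x. (norm (grad (\<psi> n) x - weak_gradient \<Omega> u x))\<^sup>2 \<partial>lebesgue_on \<Omega>)"
  have "(\<integral>x. (norm (weak_gradient \<Omega> (\<lambda>x. \<psi> n x - u x) x))\<^sup>2 \<partial>lebesgue_on \<Omega>) = B n" for n
    unfolding B_def
  proof (rule integral_cong_AE)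
    let ?D = "\<lambda>x. grad (\<psi> n) x - weak_gradient \<Omega> u x"
    have ae: "AE x in lebesgue_on \<Omega>. weak_gradient \<Omega> (\<lambda>x. \<psi> n x - u x) x = ?D x"
      by (rule weak_gradient_AE[OF \<Omega> has_weak_gradient_diff[OF \<Omega> has_weak_gradient_test_function[OF \<Omega> \<psi>(1)] w(2)]])
    then show "AE x in lebesgue_on \<Omega>. (norm (weak_gradient \<Omega> (\<lambda>x. \<psi> n x - u x) x))\<^sup>2 = (norm (?D x))\<^sup>2"
      by eventually_elim simp
    have D: "square_integrable_on ?D \<Omega>"
      by (rule square_integrable_on_diff[OF test_function_integrable(4)[OF \<psi>(1) \<Omega>L] w(3)])
    then show "(\<lambda>x. (norm (?D x))\<^sup>2) \<in> borel_measurable (lebesgue_on \<Omega>)" 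
      by (auto simp: square_integrable_on_def)
    show "(\<lambda>x. (norm (weak_gradient \<Omega> (\<lambda>x. \<psi> n x - u x) x))\<^sup>2) \<in> borel_measurable (lebesgue_on \<Omega>)"
      using square_integrable_on_cong_AE[OF ae D \<Omega>L] by (auto simp: square_integrable_on_def)
  qed
  then have "(\<lambda>n. sqrt (A n + B n)) \<longlonglongrightarrow> 0" using \<psi>(2) by (simp add: H1_norm_def A_def)
  from tendsto_power[OF this, of 2] have AB: "(\<lambda>n. A n + B n) \<longlonglongrightarrow> 0"
    by (simp add: A_def B_def)
  have "A \<longlonglongrightarrow> 0" "B \<longlonglongrightarrow> 0"
    by (rule tendsto_sandwich[OF _ _ tendsto_const AB]; simp add: A_def B_def)+
  then show thesis using that \<psi>(1) unfolding A_def B_def by blast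
qed

lemma test_functions_subset_sobolev_H10:
  assumes \<Omega>: "open \<Omega>" and \<psi>: "\<psi> \<in> test_functions \<Omega>"
  shows "\<psi> \<in> sobolev_H10 \<Omega>"
proof -
  have \<Omega>L: "\<Omega> \<in> sets lebesgue" using \<Omega> by simp
  note g = has_weak_gradient_test_function[OF \<Omega> \<psi>]
  have "AE x in lebesgue_on \<Omega>. weak_gradient \<Omega> (\<lambda>x. \<psi> x - \<psi> x) x = grad \<psi> x - grad \<psi> x"
    by (rule weak_gradient_AE[OF \<Omega> has_weak_gradient_diff[OF \<Omega> g g]])
  then have "(\<integral>x. (norm (weak_gradient \<Omega> (\<lambda>x. \<psi> x - \<psi> x) x))\<^sup>2 \<partial>lebesgue_on \<Omega>) = 0"
    by (intro integral_eq_zero_AE) (auto elim: eventually_mono)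
  then have "H1_norm \<Omega> (\<lambda>x. \<psi> x - \<psi> x) = 0" by (simp add: H1_norm_def)
  then show ?thesis unfolding sobolev_H10_def sobolev_H1_def
    using test_function_integrable[OF \<psi> \<Omega>L] g \<psi> by (auto intro!: exI[of _ "\<lambda>_. \<psi>"])
qed

section \<open>Energy of the solution\<close>

definition energy :: "(real^2) set \<Rightarrow> real \<Rightarrow> (real^2 \<Rightarrow> real) \<Rightarrow> real" where
  "energy \<Omega> \<epsilon> u = (\<integral>x. (norm (weak_gradient \<Omega> u x))\<^sup>2 / 2 \<partial>lebesgue_on \<Omega>) + (\<integral>x. exp (- u x) / \<epsilon>\<^sup>2 \<partial>lebesgue_on \<Omega>)"

text \<open>The solution may be tested against itself, which makes exp (-u) u integrable; this
  dominates exp (-u) where |u| is at least 1, and elsewhere exp (-u) is at most e on a bounded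
  set.\<close>

lemma variational_solution_integrable:
  assumes \<Omega>: "open \<Omega>" "bounded \<Omega>" and u: "variational_solution \<Omega> \<epsilon> u" "0 < \<epsilon>"
  shows "integrable (lebesgue_on \<Omega>) (\<lambda>x. exp (- u x))"
proof -
  have uH: "u \<in> sobolev_H10 \<Omega>" using u by (simp add: variational_solution_def)
  have um[measurable]: "u \<in> borel_measurable (lebesgue_on \<Omega>)"
    using sobolev_H10_weak_gradient(1)[OF \<Omega>(1) uH] by (simp add: square_integrable_on_def)
  have "integrable (lebesgue_on \<Omega>) (\<lambda>x. \<epsilon>\<^sup>2 * (exp (- u x) / \<epsilon>\<^sup>2 * u x))"
    using u uH by (intro integrable_mult_right) (auto simp: variational_solution_def)
  then have i: "integrable (lebesgue_on \<Omega>) (\<lambda>x. exp (- u x) * u x)" using u(2) by simp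
  show ?thesis
  proof (rule Bochner_Integration.integrable_bound)
    show "integrable (lebesgue_on \<Omega>) (\<lambda>x. exp 1 + \<bar>exp (- u x) * u x\<bar>)"
      using i square_integrable_on_const[OF \<Omega>(2,1)] by auto
    have "exp (- t) \<le> exp 1 + \<bar>exp (- t) * t\<bar>" for t :: real
    proof (cases "\<bar>t\<bar> \<ge> 1")
      case True
      then have "exp (- t) * 1 \<le> exp (- t) * \<bar>t\<bar>" by (intro mult_left_mono) auto
      then show ?thesis by (simp add: abs_mult add_increasing)
    next
      case False
      then have "exp (- t) \<le> exp 1" by simp
      then show ?thesis by (simp add: add_increasing2)
    qed
    then show "AE x in lebesgue_on \<Omega>. norm (exp (- u x)) \<le> norm (exp 1 + \<bar>exp (- u x) * u x\<bar>)"
      by (intro AE_I2) (simp add: add_nonneg_nonneg)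
  qed simp
qed

text \<open>By convexity of the energy, the Euler-Lagrange equation characterises its minimiser.\<close>

lemma variational_solution_minimizes:
  assumes \<Omega>: "open \<Omega>" "bounded \<Omega>" and u: "variational_solution \<Omega> \<epsilon> u" "0 < \<epsilon>"
    and w: "w \<in> sobolev_H10 \<Omega>" "integrable (lebesgue_on \<Omega>) (\<lambda>x. exp (- w x))"
  shows "energy \<Omega> \<epsilon> u \<le> energy \<Omega> \<epsilon> w"
proof -
  let ?M = "lebesgue_on \<Omega>" and ?Du = "weak_gradient \<Omega> u" and ?Dw = "weak_gradient \<Omega> w"
  have uH: "u \<in> sobolev_H10 \<Omega>" using u by (simp add: variational_solution_def)
  note iu = variational_solution_integrable[OF \<Omega> u]
  have E: "integrable ?M (\<lambda>x. exp (- u x) / \<epsilon>\<^sup>2 * v x)"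
    "(\<integral>x. ?Du x \<bullet> weak_gradient \<Omega> v x \<partial>?M) = (\<integral>x. exp (- u x) / \<epsilon>\<^sup>2 * v x \<partial>?M)"
    if "v \<in> sobolev_H10 \<Omega>" for v using u that by (auto simp: variational_solution_def)
  have sq: "square_integrable_on ?Du \<Omega>" "square_integrable_on ?Dw \<Omega>"
    using sobolev_H10_weak_gradient(3)[OF \<Omega>(1)] uH w(1) by auto
  then have m[measurable]: "?Du \<in> borel_measurable ?M" "?Dw \<in> borel_measurable ?M"
    and i2: "integrable ?M (\<lambda>x. (norm (?Du x))\<^sup>2 / 2)" "integrable ?M (\<lambda>x. (norm (?Dw x))\<^sup>2 / 2)"
    by (auto simp: square_integrable_on_def)
  have sqn: "square_integrable_on (\<lambda>x. norm (?Du x)) \<Omega>" "square_integrable_on (\<lambda>x. norm (?Dw x)) \<Omega>"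
    using sq by (auto simp: square_integrable_on_def)
  have ip: "integrable ?M (\<lambda>x. ?Du x \<bullet> ?Dw x)"
    by (rule square_integrable_on_prod[OF sqn]) (auto simp: Cauchy_Schwarz_ineq2)
  have ipu: "integrable ?M (\<lambda>x. ?Du x \<bullet> ?Du x)" using sq(1) by (simp add: square_integrable_on_def dot_square_norm)
  \<comment> \<open>The tangent inequality of the convex function |p|^2 / 2 at the gradient of
    \<open>u\<close>.\<close>
  have grad: "(\<integral>x. ?Du x \<bullet> ?Dw x - ?Du x \<bullet> ?Du x \<partial>?M) \<le> (\<integral>x. (norm (?Dw x))\<^sup>2 / 2 - (norm (?Du x))\<^sup>2 / 2 \<partial>?M)"
  proof (rule integral_mono)
    fix x
    have "0 \<le> (?Dw x - ?Du x) \<bullet> (?Dw x - ?Du x)" by simp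
    then show "?Du x \<bullet> ?Dw x - ?Du x \<bullet> ?Du x \<le> (norm (?Dw x))\<^sup>2 / 2 - (norm (?Du x))\<^sup>2 / 2"
      by (simp add: dot_square_norm[symmetric] inner_diff_left inner_diff_right inner_commute field_simps)
  qed (use ip ipu i2 in auto)
  \<comment> \<open>The tangent inequality of the convex function exp (-t) at \<open>u\<close>,
    scaled by 1 / \<open>\<epsilon>\<^sup>2\<close>.\<close>
  have ex: "(\<integral>x. exp (- u x) / \<epsilon>\<^sup>2 * u x - exp (- u x) / \<epsilon>\<^sup>2 * w x \<partial>?M) \<le> (\<integral>x. exp (- w x) / \<epsilon>\<^sup>2 - exp (- u x) / \<epsilon>\<^sup>2 \<partial>?M)"
  proof (rule integral_mono)
    fix x
    have "exp (- u x) * (1 + (u x - w x)) \<le> exp (- u x) * exp (u x - w x)"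
      by (intro mult_left_mono exp_ge_add_one_self) auto
    also have "\<dots> = exp (- w x)" by (simp add: exp_add[symmetric])
    finally have "exp (- u x) * u x - exp (- u x) * w x \<le> exp (- w x) - exp (- u x)" by (simp add: algebra_simps)
    then show "exp (- u x) / \<epsilon>\<^sup>2 * u x - exp (- u x) / \<epsilon>\<^sup>2 * w x \<le> exp (- w x) / \<epsilon>\<^sup>2 - exp (- u x) / \<epsilon>\<^sup>2"
      using u(2) by (simp add: diff_divide_distrib[symmetric] divide_right_mono)
  qed (use E(1)[OF uH] E(1)[OF w(1)] iu w(2) in auto)
  \<comment> \<open>The weak equation, tested with \<open>w\<close> and with \<open>u\<close> and
    subtracted, cancels the two first order terms.\<close>
  have "(\<integral>x. ?Du x \<bullet> ?Dw x - ?Du x \<bullet> ?Du x \<partial>?M) + (\<integral>x. exp (- u x) / \<epsilon>\<^sup>2 * u x - exp (- u x) / \<epsilon>\<^sup>2 * w x \<partial>?M) = 0"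
    using E[OF uH] E[OF w(1)] ip ipu by simp
  then show ?thesis using grad ex i2 iu w(2) by (simp add: energy_def)
qed

text \<open>For a fixed function the energy is affine in 1 / \<epsilon>^2, with slope the integral
  of exp (-u). Combined with minimality at the new parameter this yields the supergradient
  inequality behind the concavity.\<close>

lemma energy_parameter_change:
  assumes "0 < \<epsilon>" "0 < \<mu>"
  shows "energy \<Omega> \<mu> u = energy \<Omega> \<epsilon> u + (1 / \<mu>\<^sup>2 - 1 / \<epsilon>\<^sup>2) * (\<integral>x. exp (- u x) \<partial>lebesgue_on \<Omega>)"
  unfolding energy_def by (simp add: field_simps)

lemma energy_test_function:
  assumes \<Omega>: "open \<Omega>" and \<psi>: "\<psi> \<in> test_functions \<Omega>"
  shows "energy \<Omega> \<epsilon> \<psi> = (\<integral>x. (norm (grad \<psi> x))\<^sup>2 / 2 \<partial>lebesgue_on \<Omega>) + (\<integral>x. exp (- \<psi> x) / \<epsilon>\<^sup>2 \<partial>lebesgue_on \<Omega>)"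
proof -
  have \<Omega>L: "\<Omega> \<in> sets lebesgue" using \<Omega> by simp
  have ae: "AE x in lebesgue_on \<Omega>. weak_gradient \<Omega> \<psi> x = grad \<psi> x"
    by (rule weak_gradient_AE[OF \<Omega> has_weak_gradient_test_function[OF \<Omega> \<psi>]])
  have "square_integrable_on (weak_gradient \<Omega> \<psi>) \<Omega>" "square_integrable_on (grad \<psi>) \<Omega>"
    using sobolev_H10_weak_gradient(3)[OF \<Omega> test_functions_subset_sobolev_H10[OF \<Omega> \<psi>]]
      test_function_integrable(4)[OF \<psi> \<Omega>L] by auto
  then have "(\<integral>x. (norm (weak_gradient \<Omega> \<psi> x))\<^sup>2 / 2 \<partial>lebesgue_on \<Omega>) = (\<integral>x. (norm (grad \<psi> x))\<^sup>2 / 2 \<partial>lebesgue_on \<Omega>)"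
    by (intro integral_cong_AE) (auto simp: square_integrable_on_def intro: eventually_mono[OF ae])
  then show ?thesis by (simp add: energy_def)
qed

section \<open>Integration by parts up to the boundary\<close>

lemma chain_rule_by_parts_smooth:
  fixes \<psi> :: "'a::euclidean_space \<Rightarrow> real"
  assumes \<Omega>: "open \<Omega>" and \<psi>: "\<psi> \<in> test_functions \<Omega>" and \<zeta>: "smooth \<zeta>"
    and k: "\<And>s. (K has_real_derivative k s) (at s)" "K 0 = 0" "continuous_on UNIV k"
  shows "(\<integral>x. K (\<psi> x) * frechet_derivative \<zeta> (at x) e \<partial>lebesgue_on \<Omega>) = 
    - (\<integral>x. \<zeta> x * k (\<psi> x) * (grad \<psi> x \<bullet> e) \<partial>lebesgue_on \<Omega>)"
proof -
  obtain L where L: "smooth \<psi>" "compact L" "L \<subseteq> \<Omega>" "\<And>x. x \<notin> L \<Longrightarrow> \<psi> x = 0"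
    "\<And>x v. x \<notin> L \<Longrightarrow> frechet_derivative \<psi> (at x) v = 0" using test_functionD[OF \<psi>] by metis
  have \<Omega>L: "\<Omega> \<in> sets lebesgue" using \<Omega> by simp
  define A where "A = (\<lambda>x. K (\<psi> x) * frechet_derivative \<zeta> (at x) e)"
  define B where "B = (\<lambda>x. \<zeta> x * k (\<psi> x) * (grad \<psi> x \<bullet> e))"
  have cK: "continuous_on UNIV K" using k(1) DERIV_isCont by (metis continuous_at_imp_continuous_on)
  note c = smooth_derivative(3)[OF L(1), of UNIV] smooth_derivative(4)[OF L(1), of UNIV]
    smooth_derivative(3)[OF \<zeta>, of UNIV] smooth_derivative(4)[OF \<zeta>, of UNIV] 
    continuous_on_compose2[OF cK smooth_derivative(3)[OF L(1), of UNIV]]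
    continuous_on_compose2[OF k(3) smooth_derivative(3)[OF L(1), of UNIV]]
  have cA: "continuous_on UNIV A" and cB: "continuous_on UNIV B"
    unfolding A_def B_def grad_inner[OF L(1)] by (intro continuous_intros c; simp)+
  have A0: "x \<notin> L \<Longrightarrow> A x = 0" and B0: "x \<notin> L \<Longrightarrow> B x = 0" for x
    using L(4,5) k(2) by (auto simp: A_def B_def grad_inner[OF L(1)])
  have i: "integrable lborel A" "integrable lborel B"
    using integrable_continuous_compact_support[OF cA L(2) A0] integrable_continuous_compact_support[OF cB L(2) B0] by auto
  have "(\<integral>x. A x + B x \<partial>lborel) = 0"
  proof -
    have AB: "A x + B x = K (\<psi> x) * frechet_derivative \<zeta> (at x) e + frechet_derivative \<psi> (at x) e * k (\<psi> x) * \<zeta> x" for x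
      by (simp add: A_def B_def grad_inner[OF L(1)])
    show ?thesis unfolding AB
    proof (rule integral_derivative_eq_0[where w = "\<lambda>x. K (\<psi> x) * \<zeta> x" and K = L and 
          w' = "\<lambda>x v. K (\<psi> x) * frechet_derivative \<zeta> (at x) v + frechet_derivative \<psi> (at x) v * k (\<psi> x) * \<zeta> x"])
      show "((\<lambda>x. K (\<psi> x) * \<zeta> x) has_derivative (\<lambda>v. K (\<psi> x) * frechet_derivative \<zeta> (at x) v + 
          frechet_derivative \<psi> (at x) v * k (\<psi> x) * \<zeta> x)) (at x)" for x
        by (rule has_derivative_mult[OF DERIV_compose_FDERIV[OF k(1) smooth_derivative(1)[OF L(1)]] smooth_derivative(1)[OF \<zeta>]])
      show "continuous_on UNIV (\<lambda>x. K (\<psi> x) * frechet_derivative \<zeta> (at x) e + frechet_derivative \<psi> (at x) e * k (\<psi> x) * \<zeta> x)"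
        by (intro continuous_intros c; simp)
      show "K (\<psi> x) * \<zeta> x = 0" if "x \<notin> L" for x using that L(4) k(2) by simp
    qed (rule L(2))
  qed
  then have "(\<integral>x. A x \<partial>lborel) = - (\<integral>x. B x \<partial>lborel)" using i by simp
  moreover have "(\<integral>x. A x \<partial>lebesgue_on \<Omega>) = (\<integral>x. A x \<partial>lborel)"
    by (rule integral_lebesgue_on_support[OF _ \<Omega>L]) (use i A0 L(3) in auto)
  moreover have "(\<integral>x. B x \<partial>lebesgue_on \<Omega>) = (\<integral>x. B x \<partial>lborel)"
    by (rule integral_lebesgue_on_support[OF _ \<Omega>L]) (use i B0 L(3) in auto)
  ultimately show ?thesis unfolding A_def B_def by simp
qed

lemma test_function_bounded:
  fixes \<zeta> :: "'a::euclidean_space \<Rightarrow> real"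
  assumes \<zeta>: "\<zeta> \<in> test_functions \<Omega>"
  obtains C where "0 \<le> C" "\<And>x. \<bar>\<zeta> x\<bar> \<le> C" "\<And>x. \<bar>frechet_derivative \<zeta> (at x) e\<bar> \<le> C"
proof -
  obtain L where L: "smooth \<zeta>" "compact L" "L \<subseteq> \<Omega>" "\<And>x. x \<notin> L \<Longrightarrow> \<zeta> x = 0"
    "\<And>x v. x \<notin> L \<Longrightarrow> frechet_derivative \<zeta> (at x) v = 0" using test_functionD[OF \<zeta>] by metis
  have "bounded (\<zeta> ` L)" "bounded ((\<lambda>x. frechet_derivative \<zeta> (at x) e) ` L)"
    by (intro compact_imp_bounded compact_continuous_image smooth_derivative[OF L(1)] L(2))+
  then obtain C1 C2 where C: "\<And>x. x \<in> L \<Longrightarrow> \<bar>\<zeta> x\<bar> \<le> C1" "\<And>x. x \<in> L \<Longrightarrow> \<bar>frechet_derivative \<zeta> (at x) e\<bar> \<le> C2"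
    unfolding bounded_iff by auto
  show thesis
  proof (rule that[of "max 0 (max C1 C2)"])
    show "\<bar>\<zeta> x\<bar> \<le> max 0 (max C1 C2)" for x using C(1)[of x] L(4)[of x] by (cases "x \<in> L") auto
    show "\<bar>frechet_derivative \<zeta> (at x) e\<bar> \<le> max 0 (max C1 C2)" for x 
      using C(2)[of x] L(5)[of x e] by (cases "x \<in> L") auto
  qed simp
qed

text \<open>The factor \<open>\<zeta>\<close> may be nonzero on the boundary of \<Omega>: the
  boundary term disappears because \<open>K\<close> vanishes at 0 and \<open>u\<close> has zero
  boundary values. The identity passes from test functions to \<open>u\<close> because
  \<open>K\<close> and \<open>k\<close> are Lipschitz and \<open>k\<close> is bounded, which makes
  the nonlinear terms converge along with the gradients.\<close>

lemma chain_rule_by_parts: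
  fixes u :: "'a::euclidean_space \<Rightarrow> real"
  assumes \<Omega>: "open \<Omega>" "bounded \<Omega>" and u: "u \<in> sobolev_H10 \<Omega>" and \<zeta>: "\<zeta> \<in> test_functions UNIV"
    and k: "\<And>s. (K has_real_derivative k s) (at s)" "K 0 = 0" "\<And>s t. \<bar>k s - k t\<bar> \<le> \<bar>s - t\<bar>" "\<And>s. \<bar>k s\<bar> \<le> 1"
  shows "integrable (lebesgue_on \<Omega>) (\<lambda>x. K (u x) * frechet_derivative \<zeta> (at x) e)"
    "integrable (lebesgue_on \<Omega>) (\<lambda>x. \<zeta> x * k (u x) * (weak_gradient \<Omega> u x \<bullet> e))"
    "(\<integral>x. K (u x) * frechet_derivative \<zeta> (at x) e \<partial>lebesgue_on \<Omega>) = 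
    - (\<integral>x. \<zeta> x * k (u x) * (weak_gradient \<Omega> u x \<bullet> e) \<partial>lebesgue_on \<Omega>)"
proof -
  let ?M = "lebesgue_on \<Omega>" and ?D = "\<lambda>x. frechet_derivative \<zeta> (at x) e" and ?w = "weak_gradient \<Omega> u"
  have \<Omega>L: "\<Omega> \<in> sets lebesgue" using \<Omega> by simp
  note uw = sobolev_H10_weak_gradient[OF \<Omega>(1) u]
  have \<zeta>s: "smooth \<zeta>" using \<zeta> by (simp add: test_functions_def)
  have ck: "continuous_on UNIV k" 
    by (rule lipschitz_on_continuous_on[of 1]) (auto simp: lipschitz_on_def dist_real_def k(3))
  have cK: "continuous_on UNIV K" using k(1) DERIV_isCont by (metis continuous_at_imp_continuous_on)
  have KL: "\<bar>K s - K t\<bar> \<le> \<bar>s - t\<bar>" for s t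
    using field_differentiable_bound[of UNIV K k 1 s t] k(1,4) by simp
  obtain C where C: "0 \<le> C" "\<And>x. \<bar>\<zeta> x\<bar> \<le> C" "\<And>x. \<bar>?D x\<bar> \<le> C" using test_function_bounded[OF \<zeta>] by metis
  obtain \<psi> where \<psi>: "\<And>n. \<psi> n \<in> test_functions \<Omega>"
    "(\<lambda>n. \<integral>x. (\<psi> n x - u x)\<^sup>2 \<partial>?M) \<longlonglongrightarrow> 0"
    "(\<lambda>n. \<integral>x. (norm (grad (\<psi> n) x - ?w x))\<^sup>2 \<partial>?M) \<longlonglongrightarrow> 0"
    using sobolev_H10_approx[OF \<Omega>(1) u] by blast
  have [measurable]: "K \<in> borel_measurable borel" "k \<in> borel_measurable borel"
    using cK ck by (auto intro: borel_measurable_continuous_onI)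
  have [measurable]: "\<zeta> \<in> borel_measurable ?M" "?D \<in> borel_measurable ?M"
    using smooth_derivative(3,4)[OF \<zeta>s, of UNIV] 
    by (auto intro!: measurable_restrict_space1 measurable_completion borel_measurable_continuous_onI)
  have [measurable]: "u \<in> borel_measurable ?M" "?w \<in> borel_measurable ?M" "\<psi> n \<in> borel_measurable ?M"
    "grad (\<psi> n) \<in> borel_measurable ?M" for n
    using uw test_function_integrable[OF \<psi>(1) \<Omega>L] by (auto simp: square_integrable_on_def)
  have sq1: "square_integrable_on (\<lambda>x. \<bar>\<psi> n x - u x\<bar>) \<Omega>" "square_integrable_on (\<lambda>x. norm (grad (\<psi> n) x - ?w x)) \<Omega>" for n
    using square_integrable_on_diff[OF test_function_integrable(3)[OF \<psi>(1) \<Omega>L] uw(1), of n]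
      square_integrable_on_diff[OF test_function_integrable(4)[OF \<psi>(1) \<Omega>L] uw(3), of n]
    by (auto simp: square_integrable_on_def)
  have sq2: "square_integrable_on (\<lambda>x. \<bar>u x\<bar>) \<Omega>" "square_integrable_on (\<lambda>x. norm (?w x)) \<Omega>"
    "square_integrable_on (\<lambda>x. C * norm (?w x)) \<Omega>"
    using uw by (auto simp: square_integrable_on_def power_mult_distrib)
  note sqC = square_integrable_on_const(1)[OF \<Omega>(2,1), of C]
  show I1: "integrable ?M (\<lambda>x. K (u x) * ?D x)"
  proof (rule square_integrable_on_prod[OF sq2(1) sqC])
    show "\<bar>K (u x) * ?D x\<bar> \<le> \<bar>u x\<bar> * C" for x
      using KL[of "u x" 0] k(2) C(3)[of x] by (auto simp: abs_mult intro: mult_mono)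
  qed measurable
  have kb: "\<bar>\<zeta> x * k t * s\<bar> \<le> \<bar>s\<bar> * C" for x t s
  proof -
    have "\<bar>\<zeta> x\<bar> * \<bar>k t\<bar> * \<bar>s\<bar> \<le> C * 1 * \<bar>s\<bar>" using C k(4) by (intro mult_mono) auto
    then show ?thesis by (simp add: abs_mult mult.commute)
  qed
  have ip: "\<bar>v \<bullet> e\<bar> \<le> norm v * norm e" for v using Cauchy_Schwarz_ineq2 .
  have sqCe: "square_integrable_on (\<lambda>_. norm e * C) \<Omega>" using square_integrable_on_const(1)[OF \<Omega>(2,1)] .
  have kb': "\<bar>\<zeta> x * k t * (v \<bullet> e)\<bar> \<le> norm v * (norm e * C)" for x t v
    using kb[of x t "v \<bullet> e"] mult_right_mono[OF ip[of v] C(1)] by (simp add: mult.assoc)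
  show I2: "integrable ?M (\<lambda>x. \<zeta> x * k (u x) * (?w x \<bullet> e))"
    by (rule square_integrable_on_prod[OF sq2(2) sqCe _ kb']) measurable
  have J1: "integrable ?M (\<lambda>x. (K (\<psi> n x) - K (u x)) * ?D x)" 
    and J2: "integrable ?M (\<lambda>x. \<zeta> x * k (\<psi> n x) * ((grad (\<psi> n) x - ?w x) \<bullet> e))"
    and J3: "integrable ?M (\<lambda>x. \<zeta> x * (k (\<psi> n x) - k (u x)) * (?w x \<bullet> e))" 
    and b1: "\<bar>(K (\<psi> n x) - K (u x)) * ?D x\<bar> \<le> \<bar>\<psi> n x - u x\<bar> * C"
    and b3: "\<bar>\<zeta> x * (k (\<psi> n x) - k (u x)) * (?w x \<bullet> e)\<bar> \<le> \<bar>\<psi> n x - u x\<bar> * (norm e * (C * norm (?w x)))" for n x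
  proof -
    show b1: "\<bar>(K (\<psi> n x) - K (u x)) * ?D x\<bar> \<le> \<bar>\<psi> n x - u x\<bar> * C" for x
      using KL C(3)[of x] by (auto simp: abs_mult intro: mult_mono)
    show "integrable ?M (\<lambda>x. (K (\<psi> n x) - K (u x)) * ?D x)"
      by (rule square_integrable_on_prod[OF sq1(1) sqC _ b1]) measurable
    show "integrable ?M (\<lambda>x. \<zeta> x * k (\<psi> n x) * ((grad (\<psi> n) x - ?w x) \<bullet> e))"
      by (rule square_integrable_on_prod[OF sq1(2) sqCe _ kb']) measurable
    show b3: "\<bar>\<zeta> x * (k (\<psi> n x) - k (u x)) * (?w x \<bullet> e)\<bar> \<le> \<bar>\<psi> n x - u x\<bar> * (norm e * (C * norm (?w x)))" for x
    proof -
      have "\<bar>\<zeta> x\<bar> * \<bar>k (\<psi> n x) - k (u x)\<bar> * \<bar>?w x \<bullet> e\<bar> \<le> C * \<bar>\<psi> n x - u x\<bar> * (norm (?w x) * norm e)"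
        using C k(3) ip by (intro mult_mono) auto
      then show ?thesis by (simp add: abs_mult mult_ac)
    qed
    have "square_integrable_on (\<lambda>x. norm e * (C * norm (?w x))) \<Omega>"
      using uw by (auto simp: square_integrable_on_def power_mult_distrib)
    then show "integrable ?M (\<lambda>x. \<zeta> x * (k (\<psi> n x) - k (u x)) * (?w x \<bullet> e))"
      by (rule square_integrable_on_prod[OF sq1(1) _ _ b3]) measurable
  qed
  have sqw: "square_integrable_on (\<lambda>x. norm e * (C * norm (?w x))) \<Omega>"
    using uw by (auto simp: square_integrable_on_def power_mult_distrib)
  have t1: "(\<lambda>n. \<integral>x. (K (\<psi> n x) - K (u x)) * ?D x \<partial>?M) \<longlonglongrightarrow> 0"
    by (rule L2_product_tendsto_0[OF sq1(1) _ sqC _ b1]) (use \<psi>(2) in auto)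
  have t2: "(\<lambda>n. \<integral>x. \<zeta> x * k (\<psi> n x) * ((grad (\<psi> n) x - ?w x) \<bullet> e) \<partial>?M) \<longlonglongrightarrow> 0"
    by (rule L2_product_tendsto_0[OF sq1(2) _ sqCe _ kb']) (use \<psi>(3) in auto)
  have t3: "(\<lambda>n. \<integral>x. \<zeta> x * (k (\<psi> n x) - k (u x)) * (?w x \<bullet> e) \<partial>?M) \<longlonglongrightarrow> 0"
    by (rule L2_product_tendsto_0[OF sq1(1) _ sqw _ b3]) (use \<psi>(2) in auto)
  define A where "A = (\<integral>x. K (u x) * ?D x \<partial>?M)"
  define B where "B = (\<integral>x. \<zeta> x * k (u x) * (?w x \<bullet> e) \<partial>?M)"
  \<comment> \<open>The three integrals tend to 0, while the smooth identity shows that their sum is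
    the constant -(A + B).\<close>
  have zero: "(\<integral>x. (K (\<psi> n x) - K (u x)) * ?D x \<partial>?M) + (\<integral>x. \<zeta> x * k (\<psi> n x) * ((grad (\<psi> n) x - ?w x) \<bullet> e) \<partial>?M)
     + (\<integral>x. \<zeta> x * (k (\<psi> n x) - k (u x)) * (?w x \<bullet> e) \<partial>?M) = - (A + B)" for n
  proof -
    have "(\<integral>x. K (\<psi> n x) * ?D x \<partial>?M) = (\<integral>x. (K (\<psi> n x) - K (u x)) * ?D x + K (u x) * ?D x \<partial>?M)"
      by (rule Bochner_Integration.integral_cong) (auto simp: algebra_simps)
    also have "\<dots> = (\<integral>x. (K (\<psi> n x) - K (u x)) * ?D x \<partial>?M) + A"
      unfolding A_def by (rule Bochner_Integration.integral_add[OF J1 I1])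
    finally have 1: "(\<integral>x. K (\<psi> n x) * ?D x \<partial>?M) = (\<integral>x. (K (\<psi> n x) - K (u x)) * ?D x \<partial>?M) + A" .
    have "(\<integral>x. \<zeta> x * k (\<psi> n x) * (grad (\<psi> n) x \<bullet> e) \<partial>?M) = 
      (\<integral>x. (\<zeta> x * k (\<psi> n x) * ((grad (\<psi> n) x - ?w x) \<bullet> e) + \<zeta> x * (k (\<psi> n x) - k (u x)) * (?w x \<bullet> e)) 
         + \<zeta> x * k (u x) * (?w x \<bullet> e) \<partial>?M)"
      by (rule Bochner_Integration.integral_cong) (auto simp: algebra_simps inner_diff_left)
    also have "\<dots> = (\<integral>x. \<zeta> x * k (\<psi> n x) * ((grad (\<psi> n) x - ?w x) \<bullet> e) \<partial>?M)
     + (\<integral>x. \<zeta> x * (k (\<psi> n x) - k (u x)) * (?w x \<bullet> e) \<partial>?M) + B"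
      unfolding B_def using Bochner_Integration.integral_add[OF Bochner_Integration.integrable_add[OF J2 J3] I2]
        Bochner_Integration.integral_add[OF J2 J3] by simp
    finally show ?thesis using 1 chain_rule_by_parts_smooth[OF \<Omega>(1) \<psi>(1) \<zeta>s k(1,2) ck, of n e] by linarith
  qed
  have "(\<lambda>n::nat. - (A + B)) \<longlonglongrightarrow> 0 + 0 + 0"
    using tendsto_add[OF tendsto_add[OF t1 t2] t3] unfolding zero .
  then have "- (A + B) = 0" using LIMSEQ_unique[OF tendsto_const] by fastforce
  then show "A = - B" by linarith
qed

text \<open>The function exp (-t / 2), capped at 1 on negative arguments so as to be bounded and
  Lipschitz without information on the sign of the solution; it stays below exp (-t / 2), the
  direction that the lower bound requires. \<open>profile\<close> is its primitive vanishing at 0;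
  its limit 2 at infinity is the height of the transition across the layer.\<close>

definition slope :: "real \<Rightarrow> real" where "slope t = exp (- max t 0 / 2)"
definition profile :: "real \<Rightarrow> real" where "profile t = (if t \<le> 0 then t else 2 - 2 * exp (- t / 2))"

lemma profile_derivative: "(profile has_real_derivative slope t) (at t)"
proof -
  have r: "((\<lambda>t. 2 - 2 * exp (- t / 2)) has_real_derivative exp (- t / 2)) (at t)" for t :: real
    by (auto intro!: derivative_eq_intros)
  consider "t < 0" | "t > 0" | "t = 0" by linarith
  then show ?thesis
  proof cases
    case 1
    have "(profile has_real_derivative 1) (at t)"
      by (rule has_field_derivative_transform_within_open[of "\<lambda>t. t" _ _ "{..<0}"]) (use 1 in \<open>auto simp: profile_def\<close>)
    then show ?thesis using 1 by (simp add: slope_def)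
  next
    case 2
    have "(profile has_real_derivative exp (- t / 2)) (at t)"
      by (rule has_field_derivative_transform_within_open[OF r, where S = "{0<..}"]) (use 2 in \<open>auto simp: profile_def\<close>)
    then show ?thesis using 2 by (simp add: slope_def)
  next
    case 3
    have "((\<lambda>h. (profile (0 + h) - profile 0) / h) \<longlongrightarrow> 1) (at_left 0)"
      by (rule Lim_transform_eventually[OF tendsto_const]) (auto simp: eventually_at_filter profile_def)
    moreover have "((\<lambda>h::real. (2 - 2 * exp (- h / 2) - (2 - 2 * exp (- 0 / 2))) / h) \<longlongrightarrow> 1) (at_right 0)"
      using r[of 0] by (auto simp: DERIV_def intro: filterlim_mono at_le)
    then have "((\<lambda>h. (profile (0 + h) - profile 0) / h) \<longlongrightarrow> 1) (at_right 0)"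
      by (rule Lim_transform_eventually) (auto simp: eventually_at_filter profile_def)
    ultimately have "((\<lambda>h. (profile (0 + h) - profile 0) / h) \<longlongrightarrow> 1) (at 0)"
      using filterlim_at_split by blast
    then show ?thesis using 3 by (simp add: DERIV_def slope_def)
  qed
qed

lemma abs_exp_half_diff:
  fixes s t :: real
  assumes "0 \<le> s" "0 \<le> t"
  shows "\<bar>exp (- s / 2) - exp (- t / 2)\<bar> \<le> \<bar>s - t\<bar>"
proof -
  have *: "exp (- s / 2) - exp (- t / 2) \<le> t - s" if "0 \<le> s" "s \<le> t" for s t :: real
  proof -
    have "exp (- s / 2) * (1 + (s - t) / 2) \<le> exp (- s / 2) * exp ((s - t) / 2)"
      by (intro mult_left_mono exp_ge_add_one_self) auto
    also have "\<dots> = exp (- t / 2)" by (simp add: exp_add[symmetric] field_simps)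
    finally have "exp (- s / 2) - exp (- t / 2) \<le> exp (- s / 2) * ((t - s) / 2)" by (simp add: algebra_simps diff_divide_distrib)
    also have "\<dots> \<le> 1 * (t - s)" using that by (intro mult_mono) auto
    finally show ?thesis by simp
  qed
  show ?thesis
  proof (cases "s \<le> t")
    case True
    then show ?thesis using *[of s t] assms by (simp add: abs_if)
  next
    case False
    then show ?thesis using *[of t s] assms by (simp add: abs_if)
  qed
qed

lemma slope_lipschitz: "\<bar>slope s - slope t\<bar> \<le> \<bar>s - t\<bar>"
proof -
  have "\<bar>slope s - slope t\<bar> \<le> \<bar>max s 0 - max t 0\<bar>" unfolding slope_def by (rule abs_exp_half_diff) auto
  also have "\<dots> \<le> \<bar>s - t\<bar>" by (auto simp: max_def)
  finally show ?thesis .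
qed

lemma slope_le: "slope t \<le> exp (- t / 2)" "0 \<le> slope t" "\<bar>slope t\<bar> \<le> 1"
  by (auto simp: slope_def)

text \<open>The quantity 2 - profile is what is missing from the full transition; its bound by 2 exp
  (-t / 2) lets the integral of exp (-u) control the error.\<close>

lemma profile_le: "0 \<le> 2 - profile t" "2 - profile t \<le> 2 * exp (- t / 2)"
proof -
  show "0 \<le> 2 - profile t" by (auto simp: profile_def)
  show "2 - profile t \<le> 2 * exp (- t / 2)" using exp_ge_add_one_self[of "- t / 2"] by (auto simp: profile_def)
qed

text \<open>The Modica-Mortola trick: completing the square bounds the energy density from below by a total
  derivative, which a unit vector field close to the inner normal turns into a boundary term.\<close>

lemma energy_lower_bound:
  fixes \<zeta> :: "'j \<Rightarrow> real^2 \<Rightarrow> real" and e :: "'j \<Rightarrow> real^2"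
  assumes \<Omega>: "open \<Omega>" "bounded \<Omega>" and u: "u \<in> sobolev_H10 \<Omega>" "integrable (lebesgue_on \<Omega>) (\<lambda>x. exp (- u x))"
    and \<epsilon>: "0 < \<epsilon>" and J: "finite J" "\<And>j. j \<in> J \<Longrightarrow> \<zeta> j \<in> test_functions UNIV"
    and X: "\<And>x. norm (\<Sum>j\<in>J. \<zeta> j x *\<^sub>R e j) \<le> 1"
    and C: "\<And>x. \<bar>\<Sum>j\<in>J. frechet_derivative (\<zeta> j) (at x) (e j)\<bar> \<le> C" and s: "0 < s"
  shows "sqrt 2 / \<epsilon> * (- 2 * (\<Sum>j\<in>J. \<integral>x. frechet_derivative (\<zeta> j) (at x) (e j) \<partial>lebesgue_on \<Omega>)
      - 2 * C * (s * measure lebesgue \<Omega> + (\<integral>x. exp (- u x) \<partial>lebesgue_on \<Omega>) / (4 * s))) \<le> energy \<Omega> \<epsilon> u"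
proof -
  let ?M = "lebesgue_on \<Omega>" and ?D = "\<lambda>j x. frechet_derivative (\<zeta> j) (at x) (e j)" and ?w = "weak_gradient \<Omega> u"
  have \<Omega>L: "\<Omega> \<in> sets lebesgue" using \<Omega> by simp
  note uw = sobolev_H10_weak_gradient[OF \<Omega>(1) u(1)]
  have iw: "integrable ?M (\<lambda>x. (norm (?w x))\<^sup>2 / 2)" using uw(3) by (simp add: square_integrable_on_def)
  have p0: "profile 0 = 0" by (simp add: profile_def)
  note ch = chain_rule_by_parts[OF \<Omega> u(1) J(2) profile_derivative p0 slope_lipschitz slope_le(3)]
  have iD: "integrable ?M (?D j)" if "j \<in> J" for j
    using test_function_integrable(2)[OF J(2)[OF that] \<Omega>L] grad_inner[of "\<zeta> j" _ "e j"] J(2)[OF that]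
    by (simp add: test_functions_def flip: grad_inner)
  \<comment> \<open>The divergence of the field
    \<open>\<Sum>j\<in>J. \<zeta> j x *\<^sub>R e j\<close>, as each \<open>e j\<close> is
    constant.\<close>
  define R where "R = (\<lambda>x. \<Sum>j\<in>J. ?D j x)"
  have C0: "0 \<le> C" using C abs_ge_zero order_trans by blast
  have iKR: "integrable ?M (\<lambda>x. \<Sum>j\<in>J. profile (u x) * ?D j x)" by (rule Bochner_Integration.integrable_sum[OF ch(1)])
  have iR: "integrable ?M R" unfolding R_def by (rule Bochner_Integration.integrable_sum[OF iD])
  have ib: "integrable ?M (\<lambda>x. 2 * (s + exp (- u x) / (4 * s)) * C)"
    using u(2) square_integrable_on_const(2)[OF \<Omega>(2,1)] by auto
  have vol: "measure ?M \<Omega> = measure lebesgue \<Omega>" by (simp add: measure_restrict_space \<Omega>L)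
  have "(\<integral>x. (\<Sum>j\<in>J. \<zeta> j x * slope (u x) * (?w x \<bullet> e j)) \<partial>?M) * (sqrt 2 / \<epsilon>)
      \<le> (\<integral>x. (norm (?w x))\<^sup>2 / 2 + exp (- u x) / \<epsilon>\<^sup>2 \<partial>?M)"
  proof (subst integral_mult_left_zero[symmetric], rule integral_mono)
    fix x
    define p where "p = norm (?w x)"
    define y where "y = exp (- u x / 2) / \<epsilon>"
    have y2: "y\<^sup>2 = exp (- u x) / \<epsilon>\<^sup>2" by (simp add: y_def power_divide exp_double[symmetric])
    have y0: "0 \<le> y" "0 \<le> p" using \<epsilon> by (auto simp: y_def p_def)
    have "(\<Sum>j\<in>J. \<zeta> j x * slope (u x) * (?w x \<bullet> e j)) = slope (u x) * (?w x \<bullet> (\<Sum>j\<in>J. \<zeta> j x *\<^sub>R e j))"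
      by (simp add: inner_sum_right sum_distrib_left mult_ac)
    also have "\<dots> \<le> exp (- u x / 2) * (p * 1)"
    proof (rule order_trans[OF mult_left_mono])
      show "?w x \<bullet> (\<Sum>j\<in>J. \<zeta> j x *\<^sub>R e j) \<le> p * 1"
        using norm_cauchy_schwarz[of "?w x" "\<Sum>j\<in>J. \<zeta> j x *\<^sub>R e j"] mult_left_mono[OF X[of x] y0(2)]
        by (simp add: p_def)
      show "slope (u x) * (p * 1) \<le> exp (- u x / 2) * (p * 1)"
        using slope_le(1)[of "u x"] y0 by (intro mult_right_mono) auto
    qed (rule slope_le)
    finally have "(\<Sum>j\<in>J. \<zeta> j x * slope (u x) * (?w x \<bullet> e j)) * (sqrt 2 / \<epsilon>) \<le> exp (- u x / 2) * (p * 1) * (sqrt 2 / \<epsilon>)"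
      using \<epsilon> by (intro mult_right_mono) auto
    also have "\<dots> = sqrt 2 * p * y" by (simp add: y_def)
    also have "\<dots> \<le> p\<^sup>2 / 2 + y\<^sup>2"
    proof -
      have "0 \<le> (p / sqrt 2 - y)\<^sup>2" by simp
      also have "\<dots> = p\<^sup>2 / 2 + y\<^sup>2 - 2 * (p / sqrt 2) * y" by (simp add: power2_diff power_divide)
      also have "2 * (p / sqrt 2) * y = sqrt 2 * p * y" by (simp add: field_simps)
      finally show ?thesis by simp
    qed
    finally show "(\<Sum>j\<in>J. \<zeta> j x * slope (u x) * (?w x \<bullet> e j)) * (sqrt 2 / \<epsilon>) \<le> (norm (?w x))\<^sup>2 / 2 + exp (- u x) / \<epsilon>\<^sup>2"
      unfolding y2 p_def .
  qed (use ch(2) iw u(2) in auto)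
  also have "\<dots> = energy \<Omega> \<epsilon> u" using iw u(2) by (simp add: energy_def)
  finally have low: "(\<integral>x. (\<Sum>j\<in>J. \<zeta> j x * slope (u x) * (?w x \<bullet> e j)) \<partial>?M) * (sqrt 2 / \<epsilon>) \<le> energy \<Omega> \<epsilon> u" .
  have "(\<integral>x. (\<Sum>j\<in>J. \<zeta> j x * slope (u x) * (?w x \<bullet> e j)) \<partial>?M) = - (\<integral>x. (\<Sum>j\<in>J. profile (u x) * ?D j x) \<partial>?M)"
    using ch by (simp add: Bochner_Integration.integral_sum sum_negf)
  \<comment> \<open>Splitting off the limit 2 of the profile leaves twice the integral of the
    divergence, a pure boundary flux, and a remainder that is small where \<open>u\<close> is
    large.\<close>
  also have "\<dots> = - (\<integral>x. 2 * R x - (2 - profile (u x)) * R x \<partial>?M)"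
    by (simp add: R_def sum_distrib_left[symmetric] algebra_simps)
  also have "\<dots> \<ge> - (\<integral>x. 2 * R x + 2 * (s + exp (- u x) / (4 * s)) * C \<partial>?M)"
  proof (subst neg_le_iff_le, rule integral_mono)
    show "integrable ?M (\<lambda>x. 2 * R x - (2 - profile (u x)) * R x)"
      using iKR by (simp add: R_def sum_distrib_left[symmetric] algebra_simps)
    fix x
    have "\<bar>(2 - profile (u x)) * R x\<bar> \<le> (2 * (s + exp (- u x) / (4 * s))) * C" unfolding abs_mult
    proof (rule mult_mono)
      \<comment> \<open>Trades exp (-u / 2) for exp (-u) with a free weight; \<open>s\<close> will
        be the square root of \<open>\<epsilon>\<close>, which makes both contributions
        small.\<close>
      have "0 \<le> (exp (- u x / 2) - 2 * s)\<^sup>2" by simp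
      also have "\<dots> = exp (- u x) + 4 * s\<^sup>2 - 4 * s * exp (- u x / 2)" 
        by (simp add: power2_diff exp_double[symmetric] power_mult_distrib)
      finally have "exp (- u x / 2) \<le> s + exp (- u x) / (4 * s)"
        using s by (simp add: field_simps power2_eq_square)
      then show "\<bar>2 - profile (u x)\<bar> \<le> 2 * (s + exp (- u x) / (4 * s))" 
        using profile_le[of "u x"] by (simp add: abs_of_nonneg order_trans[OF _ mult_left_mono])
      show "\<bar>R x\<bar> \<le> C" using C by (simp add: R_def)
    qed (use s in auto)
    then show "2 * R x - (2 - profile (u x)) * R x \<le> 2 * R x + 2 * (s + exp (- u x) / (4 * s)) * C" by linarith
  qed (use iR ib in auto)
  also have "(\<integral>x. 2 * R x + 2 * (s + exp (- u x) / (4 * s)) * C \<partial>?M) = 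
     2 * (\<integral>x. R x \<partial>?M) + 2 * (s * measure lebesgue \<Omega> + (\<integral>x. exp (- u x) \<partial>?M) / (4 * s)) * C"
    using iR ib u(2) square_integrable_on_const(2)[OF \<Omega>(2,1)] by (simp add: vol)
  also have "(\<integral>x. R x \<partial>?M) = (\<Sum>j\<in>J. \<integral>x. ?D j x \<partial>?M)" unfolding R_def using iD by (rule Bochner_Integration.integral_sum)
  finally have "- 2 * (\<Sum>j\<in>J. \<integral>x. ?D j x \<partial>?M) - 2 * C * (s * measure lebesgue \<Omega> + (\<integral>x. exp (- u x) \<partial>?M) / (4 * s))
     \<le> (\<integral>x. (\<Sum>j\<in>J. \<zeta> j x * slope (u x) * (?w x \<bullet> e j)) \<partial>?M)" by (simp add: mult_ac)
  then have "sqrt 2 / \<epsilon> * (- 2 * (\<Sum>j\<in>J. \<integral>x. ?D j x \<partial>?M) - 2 * C * (s * measure lebesgue \<Omega> + (\<integral>x. exp (- u x) \<partial>?M) / (4 * s)))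
     \<le> sqrt 2 / \<epsilon> * (\<integral>x. (\<Sum>j\<in>J. \<zeta> j x * slope (u x) * (?w x \<bullet> e j)) \<partial>?M)"
    using \<epsilon> by (intro mult_left_mono) auto
  then show ?thesis using low by (simp add: mult.commute)
qed

text \<open>Differentiating the asymptotics of the minimal energy with respect to the parameter, which is
  legitimate because the minimal energy is a concave function of \<open>\<epsilon>\<^sup>-\<^sup>2\<close>.\<close>

lemma mass_from_energy_asymptotics:
  fixes E N :: "real \<Rightarrow> real"
  assumes conc: "\<And>\<epsilon> \<mu>. 0 < \<epsilon> \<Longrightarrow> 0 < \<mu> \<Longrightarrow> E \<mu> \<le> E \<epsilon> + (1 / \<mu>\<^sup>2 - 1 / \<epsilon>\<^sup>2) * N \<epsilon>"
    and lim: "((\<lambda>\<epsilon>. \<epsilon> * E \<epsilon>) \<longlongrightarrow> 2 * L) (at_right 0)"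
  shows "((\<lambda>\<epsilon>. N \<epsilon> / \<epsilon>) \<longlongrightarrow> L) (at_right 0)"
proof -
  \<comment> \<open>A difference quotient of the energy in the variable 1 /
    \<open>\<epsilon>\<^sup>2\<close>, which passing to \<open>\<epsilon> / \<tau>\<close>
    multiplies by \<open>\<tau>\<^sup>2\<close>, divided once more by \<epsilon>. Its limit 2 L /
    (\<tau> + 1) tends to L as \<tau> tends to 1.\<close>
  define Q where "Q = (\<lambda>\<tau> \<epsilon>. (\<tau> * (\<epsilon> / \<tau> * E (\<epsilon> / \<tau>)) - \<epsilon> * E \<epsilon>) / (\<tau>\<^sup>2 - 1))"
  have Q: "(Q \<tau> \<longlongrightarrow> 2 * L / (\<tau> + 1)) (at_right 0)" if "0 < \<tau>" "\<tau> \<noteq> 1" for \<tau>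
  proof -
    have "filterlim (\<lambda>\<epsilon>. \<epsilon> / \<tau>) (at_right 0) (at_right 0)"
      unfolding filterlim_at using that
      by (auto simp: eventually_at_filter intro!: tendsto_eq_intros)
    from filterlim_compose[OF lim this] have "((\<lambda>\<epsilon>. \<epsilon> / \<tau> * E (\<epsilon> / \<tau>)) \<longlongrightarrow> 2 * L) (at_right 0)" .
    from tendsto_divide[OF tendsto_diff[OF tendsto_mult[OF tendsto_const[of \<tau>] this] lim] tendsto_const[of "\<tau>\<^sup>2 - 1"]]
    have "(Q \<tau> \<longlongrightarrow> (\<tau> * (2 * L) - 2 * L) / (\<tau>\<^sup>2 - 1)) (at_right 0)"
      unfolding Q_def using that by (auto simp: power2_eq_1_iff)
    moreover have "(\<tau> * (2 * L) - 2 * L) / (\<tau>\<^sup>2 - 1) = 2 * L / (\<tau> + 1)"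
    proof -
      have "\<tau>\<^sup>2 - 1 = (\<tau> - 1) * (\<tau> + 1)" by (simp add: power2_eq_square algebra_simps)
      moreover have "\<tau> * (2 * L) - 2 * L = (\<tau> - 1) * (2 * L)" by (simp add: algebra_simps)
      ultimately show ?thesis using that by simp
    qed
    ultimately show ?thesis by simp
  qed
  \<comment> \<open>Division by \<open>\<tau>\<^sup>2 - 1\<close> makes
    \<open>Q \<tau> \<epsilon>\<close> a lower bound for \<open>N \<epsilon> / \<epsilon>\<close>
    when \<tau> > 1 and an upper bound when \<tau> < 1, so the limit is squeezed from both
    sides.\<close>
  have key: "\<tau> * (\<epsilon> / \<tau> * E (\<epsilon> / \<tau>)) - \<epsilon> * E \<epsilon> \<le> (\<tau>\<^sup>2 - 1) * (N \<epsilon> / \<epsilon>)" if "0 < \<epsilon>" "0 < \<tau>" for \<epsilon> \<tau>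
  proof -
    have "E (\<epsilon> / \<tau>) \<le> E \<epsilon> + (1 / (\<epsilon> / \<tau>)\<^sup>2 - 1 / \<epsilon>\<^sup>2) * N \<epsilon>" using conc[of \<epsilon> "\<epsilon> / \<tau>"] that by simp
    also have "1 / (\<epsilon> / \<tau>)\<^sup>2 - 1 / \<epsilon>\<^sup>2 = (\<tau>\<^sup>2 - 1) / \<epsilon>\<^sup>2" by (simp add: power_divide diff_divide_distrib)
    finally have "\<epsilon> * E (\<epsilon> / \<tau>) \<le> \<epsilon> * (E \<epsilon> + (\<tau>\<^sup>2 - 1) / \<epsilon>\<^sup>2 * N \<epsilon>)" using that by (intro mult_left_mono) auto
    also have "\<dots> = \<epsilon> * E \<epsilon> + (\<tau>\<^sup>2 - 1) * (N \<epsilon> / \<epsilon>)" using that by (simp add: field_simps power2_eq_square)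
    finally show ?thesis using that by simp
  qed
  have cont: "((\<lambda>\<tau>. 2 * L / (\<tau> + 1)) \<longlongrightarrow> L) (at 1)" by (auto intro!: tendsto_eq_intros)
  show ?thesis
  proof (rule order_tendstoI)
    fix a assume a: "a < L"
    have "((\<lambda>\<tau>. 2 * L / (\<tau> + 1)) \<longlongrightarrow> L) (at_right 1)" by (rule filterlim_mono[OF cont order_refl]) (simp add: at_le)
    from order_tendstoD(1)[OF this a] have "\<forall>\<^sub>F \<tau> in at_right 1. a < 2 * L / (\<tau> + 1) \<and> 1 < \<tau>"
      by (intro eventually_conj) (auto simp: eventually_at_filter)
    then obtain \<tau> where \<tau>: "a < 2 * L / (\<tau> + 1)" "1 < \<tau>"
      using eventually_happens[of _ "at_right (1::real)"] trivial_limit_at_right_real by blast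
    then have "\<forall>\<^sub>F \<epsilon> in at_right 0. a < Q \<tau> \<epsilon>" by (intro order_tendstoD(1)[OF Q]) auto
    moreover have "\<forall>\<^sub>F \<epsilon> in at_right 0. (0::real) < \<epsilon>" by (simp add: eventually_at_filter)
    ultimately show "\<forall>\<^sub>F \<epsilon> in at_right 0. a < N \<epsilon> / \<epsilon>"
    proof eventually_elim
      case (elim \<epsilon>)
      have "0 < \<tau>\<^sup>2 - 1" using \<tau> by simp
      then have "Q \<tau> \<epsilon> \<le> N \<epsilon> / \<epsilon>" using key[of \<epsilon> \<tau>] elim \<tau> unfolding Q_def by (simp add: pos_divide_le_eq mult.commute)
      then show ?case using elim by linarith
    qed
  next
    fix a assume a: "L < a"
    have "((\<lambda>\<tau>. 2 * L / (\<tau> + 1)) \<longlongrightarrow> L) (at_left 1)" by (rule filterlim_mono[OF cont order_refl]) (simp add: at_le)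
    from order_tendstoD(2)[OF this a] have "\<forall>\<^sub>F \<tau> in at_left 1. 2 * L / (\<tau> + 1) < a \<and> \<tau> < 1 \<and> 0 < \<tau>"
      using eventually_at_left_real[of 0 1] by (auto intro: eventually_elim2)
    then obtain \<tau> where \<tau>: "2 * L / (\<tau> + 1) < a" "\<tau> < 1" "0 < \<tau>"
      using eventually_happens[of _ "at_left (1::real)"] trivial_limit_at_left_real by blast
    then have "\<forall>\<^sub>F \<epsilon> in at_right 0. Q \<tau> \<epsilon> < a" by (intro order_tendstoD(2)[OF Q]) auto
    moreover have "\<forall>\<^sub>F \<epsilon> in at_right 0. (0::real) < \<epsilon>" by (simp add: eventually_at_filter)
    ultimately show "\<forall>\<^sub>F \<epsilon> in at_right 0. N \<epsilon> / \<epsilon> < a"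
    proof eventually_elim
      case (elim \<epsilon>)
      have "\<tau>\<^sup>2 - 1 < 0" using \<tau> abs_square_less_1[of \<tau>] by simp
      then have "N \<epsilon> / \<epsilon> \<le> Q \<tau> \<epsilon>" using key[of \<epsilon> \<tau>] elim \<tau> unfolding Q_def by (simp add: neg_le_divide_eq mult.commute)
      then show ?case using elim by linarith
    qed
  qed
qed

section \<open>The boundary-layer competitor\<close>

lemma norm_grad_le:
  assumes "smooth \<psi>" "\<And>v. \<bar>frechet_derivative \<psi> (at x) v\<bar> \<le> L * norm v" "0 \<le> L"
  shows "norm (grad \<psi> x) \<le> L"
proof (cases "grad \<psi> x = 0")
  case False
  have "norm (grad \<psi> x) * norm (grad \<psi> x) = frechet_derivative \<psi> (at x) (grad \<psi> x)"
    by (simp add: grad_inner[OF assms(1), symmetric] dot_square_norm power2_eq_square)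
  also have "\<dots> \<le> L * norm (grad \<psi> x)" using assms(2)[of "grad \<psi> x"] by simp
  finally show ?thesis using False by simp
qed (use assms in simp)

text \<open>For \<open>a = sqrt 2 * \<epsilon>\<close> and \<open>\<delta> = 0\<close> this is the
  solution of the half-line problem whose slope tends to 0 at infinity. The dead zone of width
  \<open>\<delta>\<close> leaves room for mollifying without losing compact support.\<close>

definition boundary_profile :: "real \<Rightarrow> real \<Rightarrow> real \<Rightarrow> real" where
  "boundary_profile a \<delta> s = 2 * ln (1 + max 0 (s - \<delta>) / a)"

lemma boundary_profile_mono:
  assumes "0 < a" "s \<le> t"
  shows "boundary_profile a \<delta> s \<le> boundary_profile a \<delta> t"
  unfolding boundary_profile_def using assms
  by (intro mult_left_mono) (auto simp: divide_right_mono add_pos_nonneg max_def)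

text \<open>The inequality ln x \<le> x - 1 gives a constant that decays with the lower end
  \<open>s0\<close> of the range; this decay keeps the gradient part of the energy comparable to its
  one-dimensional value.\<close>

lemma boundary_profile_lipschitz:
  assumes a: "0 < a" and s: "s0 \<le> s" "s0 \<le> t"
  shows "\<bar>boundary_profile a \<delta> t - boundary_profile a \<delta> s\<bar> \<le> 2 / (a + max 0 (s0 - \<delta>)) * \<bar>t - s\<bar>"
proof -
  have *: "boundary_profile a \<delta> t - boundary_profile a \<delta> s \<le> 2 / (a + max 0 (s0 - \<delta>)) * (t - s)"
    if "s0 \<le> s" "s \<le> t" for s t
  proof -
    define m where "m = max 0 (s - \<delta>)"
    define n where "n = max 0 (t - \<delta>)"
    have mn: "0 \<le> m" "m \<le> n" "n - m \<le> t - s" "max 0 (s0 - \<delta>) \<le> m" using that by (auto simp: m_def n_def)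
    have pos: "0 < 1 + m / a" "0 < 1 + n / a" using mn a by (auto simp: add_pos_nonneg)
    have "boundary_profile a \<delta> t - boundary_profile a \<delta> s = 2 * (ln (1 + n / a) - ln (1 + m / a))"
      by (simp add: boundary_profile_def m_def n_def)
    also have "ln (1 + n / a) - ln (1 + m / a) = ln ((1 + n / a) / (1 + m / a))" using pos by (simp add: ln_div)
    also have "\<dots> \<le> (1 + n / a) / (1 + m / a) - 1" using pos by (intro ln_le_minus_one) simp
    also have "\<dots> = (n - m) / (a + m)" 
    proof -
      have "(1 + n / a) / (1 + m / a) = (a + n) / (a + m)" 
      proof -
        have "1 + n / a = (a + n) / a" "1 + m / a = (a + m) / a" using a by (auto simp: field_simps)
        then show ?thesis using a by simp
      qed
      then show ?thesis using a mn by (simp add: field_simps)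
    qed
    also have "\<dots> \<le> (t - s) / (a + max 0 (s0 - \<delta>))" using mn a by (intro frac_le) auto
    finally show ?thesis by simp
  qed
  show ?thesis
  proof (cases "s \<le> t")
    case True
    then show ?thesis using *[of s t] s boundary_profile_mono[OF a True, of \<delta>] by simp
  next
    case False
    then show ?thesis using *[of t s] s boundary_profile_mono[OF a, of t s \<delta>] by (simp add: abs_if)
  qed
qed

text \<open>The competitor is the one-dimensional boundary layer, evaluated at the distance to the boundary,
  cut off at distance of order \<open>\<sigma> a\<close> and mollified.\<close>

lemma competitor:
  assumes \<Omega>: "open \<Omega>" "bounded \<Omega>" and \<epsilon>: "0 < \<epsilon>" and \<sigma>: "0 < \<sigma>" "\<sigma> < 1"
  obtains \<psi> where "\<psi> \<in> test_functions \<Omega>" "integrable (lebesgue_on \<Omega>) (\<lambda>x. exp (- \<psi> x))"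
    "energy \<Omega> \<epsilon> \<psi> \<le> (\<integral>x. 4 / (sqrt 2 * \<epsilon> + infdist x (- \<Omega>))\<^sup>2 \<partial>lebesgue_on \<Omega>) / (1 - \<sigma>)\<^sup>2"
proof -
  define d where "d = (\<lambda>x. infdist x (- \<Omega>))"
  define a where "a = sqrt 2 * \<epsilon>"
  have a: "0 < a" and a2: "a\<^sup>2 = 2 * \<epsilon>\<^sup>2" using \<epsilon> by (auto simp: a_def power_mult_distrib)
  \<comment> \<open>A budget of five \<open>\<rho>\<close>: a dead zone of 3 \<open>\<rho>\<close>,
    and 2 \<open>\<rho>\<close> for the variation of the distance over the balls used for
    mollification and for the Lipschitz bound. In total \<open>d\<close> is replaced by d - 5
    \<open>\<rho>\<close> = d - \<open>\<sigma> * a\<close>.\<close>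
  define \<rho> where "\<rho> = \<sigma> * a / 5"
  have \<rho>: "0 < \<rho>" "5 * \<rho> = \<sigma> * a" using \<sigma> a by (auto simp: \<rho>_def)
  have ne: "- \<Omega> \<noteq> {}"
  proof
    assume "- \<Omega> = {}"
    then have "\<Omega> = UNIV" by blast
    then show False using \<Omega>(2) not_bounded_UNIV by simp
  qed
  have dL: "\<bar>d x - d y\<bar> \<le> dist x y" for x y
    using infdist_triangle_abs[of x "- \<Omega>" y] by (simp add: d_def)
  have d0: "0 \<le> d x" "x \<notin> \<Omega> \<Longrightarrow> d x = 0" for x by (auto simp: d_def infdist_nonneg)
  define f where "f = (\<lambda>x. boundary_profile a (3 * \<rho>) (d x))"
  have fL: "(2 / (a + max 0 (s0 - 3 * \<rho>)))-lipschitz_on {x. s0 \<le> d x} f" for s0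
  proof (rule lipschitz_onI)
    fix x y assume "x \<in> {x. s0 \<le> d x}" "y \<in> {x. s0 \<le> d x}"
    then have "\<bar>f x - f y\<bar> \<le> 2 / (a + max 0 (s0 - 3 * \<rho>)) * \<bar>d x - d y\<bar>"
      unfolding f_def by (intro boundary_profile_lipschitz a) auto
    also have "\<dots> \<le> 2 / (a + max 0 (s0 - 3 * \<rho>)) * dist x y"
      using a by (intro mult_left_mono dL) auto
    finally show "dist (f x) (f y) \<le> 2 / (a + max 0 (s0 - 3 * \<rho>)) * dist x y" by (simp add: dist_real_def)
  qed (use a in auto)
  have cf: "continuous_on UNIV f"
    using lipschitz_on_continuous_on[OF fL[of 0]] d0 by simp
  have f0: "f x = 0" if "d x \<le> 3 * \<rho>" for x using that by (simp add: f_def boundary_profile_def max_def)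
  have "{x. f x \<noteq> 0} \<subseteq> \<Omega>" using f0 d0(2) \<rho>(1) by force
  then have bf: "bounded {x. f x \<noteq> 0}" using \<Omega>(2) bounded_subset by blast
  obtain \<psi> where \<psi>: "smooth \<psi>" "\<And>x c. \<forall>y\<in>cball x \<rho>. f y \<le> c \<Longrightarrow> \<psi> x \<le> c"
    "\<And>x c. \<forall>y\<in>cball x \<rho>. c \<le> f y \<Longrightarrow> c \<le> \<psi> x"
    "\<And>x L r v. \<rho> < r \<Longrightarrow> L-lipschitz_on (ball x r) f \<Longrightarrow> \<bar>frechet_derivative \<psi> (at x) v\<bar> \<le> L * norm v"
    using mollifier[OF cf bf \<rho>(1)] by metis
  have near: "d x - r \<le> d y" "d y \<le> d x + r" if "dist x y \<le> r" for x y r using dL[of x y] that by linarith+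
  \<comment> \<open>Below distance 2 \<open>\<rho>\<close> the mollification ball stays within the
    dead zone, so \<open>\<psi>\<close> vanishes outside \<open>K\<close>.\<close>
  define K where "K = {x. 2 * \<rho> \<le> d x}"
  have K\<Omega>: "K \<subseteq> \<Omega>" using d0(2) \<rho>(1) by (force simp: K_def)
  have cd: "continuous_on UNIV d" unfolding d_def by (intro continuous_intros)
  have "closed K" unfolding K_def by (intro closed_Collect_le continuous_on_const cd)
  then have K: "compact K" using bounded_subset[OF \<Omega>(2) K\<Omega>] by (simp add: compact_eq_bounded_closed)
  have \<psi>0: "\<psi> x = 0" if "x \<notin> K" for x
  proof -
    have "f y = 0" if "y \<in> cball x \<rho>" for y
      using near(2)[of x y \<rho>] that \<open>x \<notin> K\<close> by (intro f0) (auto simp: K_def)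
    then show ?thesis using \<psi>(2)[where x=x and c=0] \<psi>(3)[where x=x and c=0] by force
  qed
  have tf: "\<psi> \<in> test_functions \<Omega>" by (rule test_functionI[OF \<psi>(1) K K\<Omega> \<psi>0])
  define m where "m = (\<lambda>x. max 0 (d x - 5 * \<rho>))"
  have m0: "0 \<le> m x" for x by (simp add: m_def)
  have low: "2 * ln (1 + m x / a) \<le> \<psi> x" for x
  proof (rule \<psi>(3), rule ballI)
    fix y assume "y \<in> cball x \<rho>"
    then have "d x - 2 * \<rho> \<le> d y" using near(1)[of x y \<rho>] \<rho>(1) by simp
    from boundary_profile_mono[OF a this, of "3 * \<rho>"] show "2 * ln (1 + m x / a) \<le> f y"
      by (simp add: f_def m_def boundary_profile_def)
  qed
  have gr: "norm (grad \<psi> x) \<le> 2 / (a + m x)" for x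
  proof (rule norm_grad_le[OF \<psi>(1)])
    have "(2 / (a + m x))-lipschitz_on (ball x (2 * \<rho>)) f"
    proof (rule lipschitz_on_subset)
      show "(2 / (a + m x))-lipschitz_on {y. d x - 2 * \<rho> \<le> d y} f"
        using fL[of "d x - 2 * \<rho>"] by (simp add: m_def)
      show "ball x (2 * \<rho>) \<subseteq> {y. d x - 2 * \<rho> \<le> d y}" using near(1)[of x _ "2 * \<rho>"] by auto
    qed
    then show "\<bar>frechet_derivative \<psi> (at x) v\<bar> \<le> 2 / (a + m x) * norm v" for v
      using \<rho>(1) by (intro \<psi>(4)[of "2 * \<rho>"]) auto
    show "0 \<le> 2 / (a + m x)" using a m0[of x] by simp
  qed
  have \<Omega>L: "\<Omega> \<in> sets lebesgue" using \<Omega> by simp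
  have \<psi>m[measurable]: "\<psi> \<in> borel_measurable (lebesgue_on \<Omega>)"
    using test_function_integrable(1)[OF tf \<Omega>L] by simp
  have "integrable (lebesgue_on \<Omega>) (\<lambda>x. exp (- \<psi> x))"
  proof (rule Bochner_Integration.integrable_bound)
    show "integrable (lebesgue_on \<Omega>) (\<lambda>_. 1::real)" by (rule square_integrable_on_const[OF \<Omega>(2,1)])
    have "0 \<le> \<psi> x" for x
    proof -
      have "0 \<le> 2 * ln (1 + m x / a)" using m0[of x] a by simp
      then show ?thesis using low[of x] by linarith
    qed
    then show "AE x in lebesgue_on \<Omega>. norm (exp (- \<psi> x)) \<le> norm (1::real)" by (intro AE_I2) simp
  qed simp
  note ie = this
  have ig: "integrable (lebesgue_on \<Omega>) (\<lambda>x. (norm (grad \<psi> x))\<^sup>2 / 2)"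
    using test_function_integrable(4)[OF tf \<Omega>L] by (simp add: square_integrable_on_def)
  have im: "integrable (lebesgue_on \<Omega>) (\<lambda>x. 4 / (a + d x)\<^sup>2 / (1 - \<sigma>)\<^sup>2)"
  proof (rule Bochner_Integration.integrable_bound)
    show "integrable (lebesgue_on \<Omega>) (\<lambda>_. 4 / a\<^sup>2 / (1 - \<sigma>)\<^sup>2)" by (rule square_integrable_on_const[OF \<Omega>(2,1)])
    have "4 / (a + d x)\<^sup>2 \<le> 4 / a\<^sup>2" for x using a d0(1)[of x] by (intro divide_left_mono power_mono) auto
    then have "4 / (a + d x)\<^sup>2 / (1 - \<sigma>)\<^sup>2 \<le> 4 / a\<^sup>2 / (1 - \<sigma>)\<^sup>2" for x by (rule divide_right_mono) simp
    then show "AE x in lebesgue_on \<Omega>. norm (4 / (a + d x)\<^sup>2 / (1 - \<sigma>)\<^sup>2) \<le> norm (4 / a\<^sup>2 / (1 - \<sigma>)\<^sup>2)"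
      by (intro AE_I2) simp
    have "d \<in> borel_measurable (lebesgue_on \<Omega>)"
      using cd by (auto intro!: measurable_restrict_space1 measurable_completion borel_measurable_continuous_onI)
    then show "(\<lambda>x. 4 / (a + d x)\<^sup>2 / (1 - \<sigma>)\<^sup>2) \<in> borel_measurable (lebesgue_on \<Omega>)" by measurable
  qed
  \<comment> \<open>Both terms are at most 2 / (a + m)^2, the equipartition of the exact profile;
    replacing m by d costs the factor \<open>(1 - \<sigma>)\<^sup>2\<close>.\<close>
  have pt: "(norm (grad \<psi> x))\<^sup>2 / 2 + exp (- \<psi> x) / \<epsilon>\<^sup>2 \<le> 4 / (a + d x)\<^sup>2 / (1 - \<sigma>)\<^sup>2" for x
  proof -
    have am: "0 < a + m x" using a m0[of x] by simp
    have "(norm (grad \<psi> x))\<^sup>2 \<le> (2 / (a + m x))\<^sup>2" using gr by (intro power_mono) auto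
    then have 1: "(norm (grad \<psi> x))\<^sup>2 / 2 \<le> 2 / (a + m x)\<^sup>2" by (simp add: power_divide)
    have p1: "0 < 1 + m x / a" using a m0[of x] by (simp add: add_pos_nonneg)
    have "exp (- \<psi> x) \<le> exp (- (2 * ln (1 + m x / a)))" using low[of x] by simp
    also have "\<dots> = 1 / (1 + m x / a)\<^sup>2"
      using p1 by (simp add: exp_minus exp_double inverse_eq_divide)
    also have "\<dots> = a\<^sup>2 / (a + m x)\<^sup>2"
    proof -
      have "1 + m x / a = (a + m x) / a" using a by (simp add: field_simps)
      then show ?thesis by (simp add: power_divide)
    qed
    finally have "exp (- \<psi> x) / \<epsilon>\<^sup>2 \<le> a\<^sup>2 / (a + m x)\<^sup>2 / \<epsilon>\<^sup>2" by (rule divide_right_mono) simp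
    also have "\<dots> = 2 / (a + m x)\<^sup>2" using \<epsilon> by (simp add: a2)
    finally have 2: "exp (- \<psi> x) / \<epsilon>\<^sup>2 \<le> 2 / (a + m x)\<^sup>2" .
    have "(1 - \<sigma>) * (a + d x) \<le> a + m x"
    proof (cases "d x \<le> \<sigma> * a")
      case True
      then have "(1 - \<sigma>) * (a + d x) \<le> (1 - \<sigma>) * (a + \<sigma> * a)" using \<sigma> by (intro mult_left_mono) auto
      also have "\<dots> = a - \<sigma>\<^sup>2 * a" by (simp add: algebra_simps power2_eq_square)
      also have "\<dots> \<le> a + m x"
      proof -
        have "0 \<le> \<sigma>\<^sup>2 * a" using a by simp
        then show ?thesis using m0[of x] by linarith
      qed
      finally show ?thesis .
    next
      case False
      then have "m x = d x - \<sigma> * a" by (simp add: m_def \<rho>(2))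
      moreover have "0 \<le> \<sigma> * d x" using \<sigma> d0(1)[of x] by simp
      ultimately show ?thesis by (simp add: algebra_simps)
    qed
    moreover have "0 < (1 - \<sigma>) * (a + d x)" using \<sigma> a d0(1)[of x] by (intro mult_pos_pos) auto
    ultimately have "4 / (a + m x)\<^sup>2 \<le> 4 / ((1 - \<sigma>) * (a + d x))\<^sup>2"
      using am by (intro divide_left_mono power_mono mult_pos_pos[OF zero_less_power zero_less_power]) auto
    then show ?thesis using 1 2 by (simp add: power_mult_distrib mult.commute)
  qed
  have "energy \<Omega> \<epsilon> \<psi> = (\<integral>x. (norm (grad \<psi> x))\<^sup>2 / 2 + exp (- \<psi> x) / \<epsilon>\<^sup>2 \<partial>lebesgue_on \<Omega>)"
    unfolding energy_test_function[OF \<Omega>(1) tf] using ig ie by simp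
  also have "\<dots> \<le> (\<integral>x. 4 / (a + d x)\<^sup>2 / (1 - \<sigma>)\<^sup>2 \<partial>lebesgue_on \<Omega>)"
    using ig ie im pt by (intro integral_mono) auto
  finally have "energy \<Omega> \<epsilon> \<psi> \<le> (\<integral>x. 4 / (a + d x)\<^sup>2 \<partial>lebesgue_on \<Omega>) / (1 - \<sigma>)\<^sup>2"
    by (simp only: integral_divide_zero)
  then show thesis using that[OF tf ie] by (simp add: a_def d_def)
qed

section \<open>Integration over the boundary layers\<close>

lemma inverse_power_shift_derivative:
  fixes a t :: real
  assumes "0 < a + t"
  shows "((\<lambda>t. 1 / (a + t)) has_real_derivative - (1 / (a + t)\<^sup>2)) (at t within S)"
    "((\<lambda>t. 1 / (a + t)\<^sup>2) has_real_derivative - (2 / (a + t) ^ 3)) (at t within S)"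
proof -
  have "((\<lambda>c. 1 / c) has_real_derivative - (1 / c\<^sup>2)) (at c)" 
    "((\<lambda>c. 1 / c\<^sup>2) has_real_derivative - (2 / c ^ 3)) (at c)" if "0 < c" for c :: real
    using that by (auto intro!: derivative_eq_intros simp: field_simps power2_eq_square power3_eq_cube)
  from this[OF assms] show "((\<lambda>t. 1 / (a + t)) has_real_derivative - (1 / (a + t)\<^sup>2)) (at t within S)"
    "((\<lambda>t. 1 / (a + t)\<^sup>2) has_real_derivative - (2 / (a + t) ^ 3)) (at t within S)"
    using DERIV_shift[of "\<lambda>c. 1 / c" _ t a] DERIV_shift[of "\<lambda>c. 1 / c\<^sup>2" _ t a] 
    by (auto simp: add.commute intro: has_field_derivative_at_within)
qed

text \<open>Writing 4 / (a + d)^2 as the integral of 8 / (a + t)^3 over t > d and exchanging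
  integrals produces an integral of layer areas; with areas at most A t, the integral of 8 A t / (a
  + t)^3 over the half-line is 4 A / a. The area bound is available only up to \<open>t0\<close>,
  and 4 / \<open>t0\<^sup>2\<close> bounds what the truncation discards.\<close>

lemma layer_cake_bound:
  fixes \<Omega> :: "'a::euclidean_space set"
  assumes \<Omega>: "open \<Omega>" "bounded \<Omega>" and a: "0 < a" and t0: "0 < t0" and A: "0 \<le> A"
    and V: "\<And>t. 0 < t \<Longrightarrow> t \<le> t0 \<Longrightarrow> measure lebesgue {x\<in>\<Omega>. infdist x (- \<Omega>) \<le> t} \<le> A * t"
  shows "a * (\<integral>x. 4 / (a + infdist x (- \<Omega>))\<^sup>2 \<partial>lebesgue_on \<Omega>) \<le> 4 * A + 4 * a * measure lebesgue \<Omega> / t0\<^sup>2"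
proof -
  define d where "d = (\<lambda>x. infdist x (- \<Omega>))"
  have ne: "- \<Omega> \<noteq> {}"
  proof
    assume "- \<Omega> = {}"
    then have "\<Omega> = UNIV" by blast
    then show False using \<Omega>(2) not_bounded_UNIV by simp
  qed
  have d0: "0 \<le> d x" for x by (simp add: d_def infdist_nonneg)
  have dpos: "0 < d x" if "x \<in> \<Omega>" for x
    using infdist_pos_not_in_closed[of "- \<Omega>" x] \<Omega>(1) ne that by (simp add: d_def closed_Compl)
  have cd: "continuous_on UNIV d" unfolding d_def by (intro continuous_intros)
  have [measurable]: "d \<in> borel_measurable borel" using cd by (rule borel_measurable_continuous_onI)
  have [measurable]: "\<Omega> \<in> sets borel" using \<Omega>(1) by simp
  have \<Omega>L: "\<Omega> \<in> sets lebesgue" using \<Omega> by simp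
  have fin: "emeasure lborel \<Omega> < \<infinity>" using emeasure_bounded_finite[OF \<Omega>(2)] .
  define f where "f = (\<lambda>x. 4 / (a + d x)\<^sup>2)"
  have f0: "0 \<le> f x" for x by (simp add: f_def)
  have [measurable]: "f \<in> borel_measurable borel" unfolding f_def by measurable
  have if': "integrable (lebesgue_on \<Omega>) f"
  proof (rule Bochner_Integration.integrable_bound)
    show "integrable (lebesgue_on \<Omega>) (\<lambda>_. 4 / a\<^sup>2)" by (rule square_integrable_on_const[OF \<Omega>(2,1)])
    have "4 / (a + d x)\<^sup>2 \<le> 4 / a\<^sup>2" for x using a d0[of x] by (intro divide_left_mono power_mono) auto
    then show "AE x in lebesgue_on \<Omega>. norm (f x) \<le> norm (4 / a\<^sup>2)" by (intro AE_I2) (simp add: f_def)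
    show "f \<in> borel_measurable (lebesgue_on \<Omega>)" by (intro measurable_restrict_space1 measurable_completion) simp
  qed
  define g where "g = (\<lambda>x t. if x \<in> \<Omega> \<and> d x \<le> t \<and> t \<le> t0 then ennreal (8 / (a + t) ^ 3) else 0)"
  have [measurable]: "case_prod g \<in> borel_measurable (lborel \<Otimes>\<^sub>M lborel)" unfolding g_def by measurable
  have pt: "ennreal (f x) * indicator \<Omega> x \<le> ennreal (4 / t0\<^sup>2) * indicator \<Omega> x + (\<integral>\<^sup>+t. g x t \<partial>lborel)" for x
  proof (cases "x \<in> \<Omega>")
    case x: True
    show ?thesis
    proof (cases "d x \<le> t0")
      case True
      have "(\<integral>\<^sup>+t. g x t \<partial>lborel) = (\<integral>\<^sup>+t. ennreal (8 / (a + t) ^ 3) * indicator {d x..t0} t \<partial>lborel)"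
        using x by (intro nn_integral_cong) (auto simp: g_def indicator_def)
      also have "\<dots> = ennreal (- 4 * (1 / (a + t0)\<^sup>2) - (- 4 * (1 / (a + d x)\<^sup>2)))"
      proof (rule nn_integral_FTC_Icc)
        fix t assume "t \<in> {d x..t0}"
        then have "0 < a + t" using a d0[of x] by auto
        from DERIV_cmult[OF inverse_power_shift_derivative(2)[OF this], of "- 4"]
        show "((\<lambda>t. - 4 * (1 / (a + t)\<^sup>2)) has_real_derivative 8 / (a + t) ^ 3) (at t)" by simp
        show "0 \<le> 8 / (a + t) ^ 3" using \<open>0 < a + t\<close> by simp
      qed (use True in auto)
      finally have "ennreal (4 / t0\<^sup>2) + (\<integral>\<^sup>+t. g x t \<partial>lborel) = ennreal (4 / t0\<^sup>2) + ennreal (f x - 4 / (a + t0)\<^sup>2)"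
        by (simp add: f_def)
      also have "\<dots> \<ge> ennreal (4 / (a + t0)\<^sup>2) + ennreal (f x - 4 / (a + t0)\<^sup>2)"
        using a t0 by (intro add_right_mono ennreal_leI divide_left_mono power_mono) auto
      also have "ennreal (4 / (a + t0)\<^sup>2) + ennreal (f x - 4 / (a + t0)\<^sup>2) = ennreal (f x)"
      proof -
        have "4 / (a + t0)\<^sup>2 \<le> f x" unfolding f_def using True a d0[of x] by (intro divide_left_mono power_mono) auto
        then show ?thesis by (subst ennreal_plus[symmetric]) auto
      qed
      finally show ?thesis using x by simp
    next
      case False
      then have "f x \<le> 4 / t0\<^sup>2" unfolding f_def using a t0 by (intro divide_left_mono power_mono) auto
      then show ?thesis using x by (simp add: add_increasing2 ennreal_leI)
    qed
  qed simp
  \<comment> \<open>The value t = 0 is outside the hypothesis \<open>V\<close>; there the layer is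
    empty since \<Omega> is open.\<close>
  have Vt: "emeasure lborel {x\<in>\<Omega>. d x \<le> t} \<le> ennreal (A * t)" if "0 \<le> t" "t \<le> t0" for t
  proof (cases "t = 0")
    case True
    then have e: "{x\<in>\<Omega>. d x \<le> t} = {}" using dpos by force
    show ?thesis unfolding e by simp
  next
    case False
    have [measurable]: "{x\<in>\<Omega>. d x \<le> t} \<in> sets borel" by measurable
    have "emeasure lborel {x\<in>\<Omega>. d x \<le> t} \<le> emeasure lborel \<Omega>" by (rule emeasure_mono) auto
    then have "emeasure lborel {x\<in>\<Omega>. d x \<le> t} \<noteq> \<infinity>" using fin by auto
    then have "emeasure lborel {x\<in>\<Omega>. d x \<le> t} = ennreal (measure lebesgue {x\<in>\<Omega>. d x \<le> t})"
      by (subst emeasure_eq_ennreal_measure) (auto simp: measure_completion)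
    then show ?thesis using V[of t] False that by (simp add: d_def ennreal_leI)
  qed
  have "(\<integral>\<^sup>+x. (\<integral>\<^sup>+t. g x t \<partial>lborel) \<partial>lborel) = (\<integral>\<^sup>+t. (\<integral>\<^sup>+x. g x t \<partial>lborel) \<partial>lborel)"
    by (rule lborel_pair.Fubini'[symmetric]) simp
  also have "\<dots> \<le> (\<integral>\<^sup>+t. ennreal (8 * A * t / (a + t) ^ 3) * indicator {0..t0} t \<partial>lborel)"
  proof (rule nn_integral_mono)
    fix t
    show "(\<integral>\<^sup>+x. g x t \<partial>lborel) \<le> ennreal (8 * A * t / (a + t) ^ 3) * indicator {0..t0} t"
    proof (cases "0 \<le> t \<and> t \<le> t0")
      case True
      have "(\<integral>\<^sup>+x. g x t \<partial>lborel) = (\<integral>\<^sup>+x. ennreal (8 / (a + t) ^ 3) * indicator {x\<in>\<Omega>. d x \<le> t} x \<partial>lborel)"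
        using True by (intro nn_integral_cong) (auto simp: g_def indicator_def)
      also have "\<dots> = ennreal (8 / (a + t) ^ 3) * emeasure lborel {x\<in>\<Omega>. d x \<le> t}"
        by (rule nn_integral_cmult_indicator) measurable
      also have "\<dots> \<le> ennreal (8 / (a + t) ^ 3) * ennreal (A * t)" using True by (intro mult_left_mono Vt) auto
      also have "\<dots> = ennreal (8 * A * t / (a + t) ^ 3)" using True a by (subst ennreal_mult'[symmetric]) (auto simp: A)
      finally show ?thesis using True by simp
    next
      case False
      have "g x t = 0" for x using False d0[of x] by (auto simp: g_def)
      then show ?thesis by simp
    qed
  qed
  \<comment> \<open>The primitive comes from t / (a + t)^3 = 1 / (a + t)^2 - a / (a + t)^3.\<close>
  also have "\<dots> = ennreal (A * (- 8 * (1 / (a + t0)) + 4 * a * (1 / (a + t0)\<^sup>2)) - A * (- 8 * (1 / (a + 0)) + 4 * a * (1 / (a + 0)\<^sup>2)))"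
  proof (rule nn_integral_FTC_Icc)
    fix t assume "t \<in> {0..t0}"
    then have t: "0 < a + t" "0 \<le> t" using a by auto
    from DERIV_cmult[OF DERIV_add[OF DERIV_cmult[OF inverse_power_shift_derivative(1)[OF t(1)]]
          DERIV_cmult[OF inverse_power_shift_derivative(2)[OF t(1)]]]]
    have "((\<lambda>t. A * (- 8 * (1 / (a + t)) + 4 * a * (1 / (a + t)\<^sup>2))) has_real_derivative
       A * (- 8 * - (1 / (a + t)\<^sup>2) + 4 * a * - (2 / (a + t) ^ 3))) (at t)" .
    moreover have "A * (- 8 * - (1 / c\<^sup>2) + 4 * a * - (2 / c ^ 3)) = 8 * A * (c - a) / c ^ 3" if "0 < c" for c
      using that by (simp add: field_simps power2_eq_square power3_eq_cube)
    note this[OF t(1)]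
    ultimately show "((\<lambda>t. A * (- 8 * (1 / (a + t)) + 4 * a * (1 / (a + t)\<^sup>2))) has_real_derivative
       8 * A * t / (a + t) ^ 3) (at t)" by simp
    show "0 \<le> 8 * A * t / (a + t) ^ 3" using t A by simp
  qed (use t0 in auto)
  also have "\<dots> \<le> ennreal (4 * A / a)"
  proof (rule ennreal_leI)
    have "4 * a / (a + t0) \<le> 4" using a t0 by (simp add: field_simps)
    then have "(- 8 + 4 * a / (a + t0)) / (a + t0) \<le> 0" using a t0 by (intro divide_nonpos_pos) auto
    then have "- 8 * (1 / (a + t0)) + 4 * a * (1 / (a + t0)\<^sup>2) \<le> 0" by (simp add: add_divide_distrib power2_eq_square diff_divide_distrib)
    then have "A * (- 8 * (1 / (a + t0)) + 4 * a * (1 / (a + t0)\<^sup>2)) \<le> 0" using A by (simp only: mult_nonneg_nonpos)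
    moreover have "A * (- 8 * (1 / (a + 0)) + 4 * a * (1 / (a + 0)\<^sup>2)) = - (4 * A / a)"
      using a by (simp add: field_simps power2_eq_square)
    ultimately show "A * (- 8 * (1 / (a + t0)) + 4 * a * (1 / (a + t0)\<^sup>2)) - A * (- 8 * (1 / (a + 0)) + 4 * a * (1 / (a + 0)\<^sup>2)) \<le> 4 * A / a" by linarith
  qed
  finally have gb: "(\<integral>\<^sup>+x. (\<integral>\<^sup>+t. g x t \<partial>lborel) \<partial>lborel) \<le> ennreal (4 * A / a)" .
  have eL: "emeasure lborel \<Omega> = ennreal (measure lebesgue \<Omega>)"
    using fin by (subst emeasure_eq_ennreal_measure) (auto simp: measure_completion)
  have "ennreal (\<integral>x. f x \<partial>lebesgue_on \<Omega>) = (\<integral>\<^sup>+x. f x \<partial>lebesgue_on \<Omega>)"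
    by (rule nn_integral_eq_integral[symmetric]) (use if' f0 in auto)
  also have "\<dots> = (\<integral>\<^sup>+x. ennreal (f x) * indicator \<Omega> x \<partial>lebesgue)" using \<Omega>L by (simp add: nn_integral_restrict_space)
  also have "\<dots> = (\<integral>\<^sup>+x. ennreal (f x) * indicator \<Omega> x \<partial>lborel)" by (rule nn_integral_completion) 
  also have "\<dots> \<le> (\<integral>\<^sup>+x. ennreal (4 / t0\<^sup>2) * indicator \<Omega> x + (\<integral>\<^sup>+t. g x t \<partial>lborel) \<partial>lborel)"
    by (rule nn_integral_mono) (rule pt)
  also have "\<dots> = ennreal (4 / t0\<^sup>2) * emeasure lborel \<Omega> + (\<integral>\<^sup>+x. (\<integral>\<^sup>+t. g x t \<partial>lborel) \<partial>lborel)"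
    by (subst nn_integral_add) (auto intro!: nn_integral_cmult_indicator)
  also have "\<dots> \<le> ennreal (4 / t0\<^sup>2) * ennreal (measure lebesgue \<Omega>) + ennreal (4 * A / a)"
    unfolding eL by (intro add_left_mono gb)
  also have "\<dots> = ennreal (4 / t0\<^sup>2 * measure lebesgue \<Omega> + 4 * A / a)"
    by (subst ennreal_mult[symmetric]) (use A a in \<open>auto simp: ennreal_plus[symmetric] simp del: ennreal_plus\<close>)
  finally have "(\<integral>x. f x \<partial>lebesgue_on \<Omega>) \<le> 4 / t0\<^sup>2 * measure lebesgue \<Omega> + 4 * A / a"
    using A a by (subst (asm) ennreal_le_iff) auto
  then have "a * (\<integral>x. f x \<partial>lebesgue_on \<Omega>) \<le> a * (4 / t0\<^sup>2 * measure lebesgue \<Omega> + 4 * A / a)"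
    using a by (intro mult_left_mono) auto
  also have "\<dots> = 4 * A + 4 * a * measure lebesgue \<Omega> / t0\<^sup>2" using a by (simp add: distrib_left)
  finally show ?thesis by (simp add: f_def d_def)
qed

section \<open>Asymptotics of the minimal energy and of the mass\<close>

lemma energy_nonneg_bound:
  assumes "0 < \<epsilon>"
  shows "(\<integral>x. exp (- u x) \<partial>lebesgue_on \<Omega>) \<le> \<epsilon>\<^sup>2 * energy \<Omega> \<epsilon> u"
proof -
  have "0 \<le> (\<integral>x. (norm (weak_gradient \<Omega> u x))\<^sup>2 / 2 \<partial>lebesgue_on \<Omega>)" by (rule Bochner_Integration.integral_nonneg) simp
  then have "(\<integral>x. exp (- u x) / \<epsilon>\<^sup>2 \<partial>lebesgue_on \<Omega>) \<le> energy \<Omega> \<epsilon> u" by (simp add: energy_def)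
  then show ?thesis using assms by (simp add: divide_le_eq mult.commute)
qed

lemma energy_upper_limit:
  assumes \<Omega>: "open \<Omega>" "bounded \<Omega>" and P: "0 \<le> P"
    and up: "\<And>\<eta>. 0 < \<eta> \<Longrightarrow> \<exists>t0>0. \<forall>t. 0 < t \<and> t \<le> t0 \<longrightarrow> measure lebesgue {x\<in>\<Omega>. infdist x (- \<Omega>) \<le> t} \<le> (P + \<eta>) * t"
    and \<phi>: "\<And>\<epsilon>. 0 < \<epsilon> \<Longrightarrow> variational_solution \<Omega> \<epsilon> (\<phi> \<epsilon>)"
    and b: "2 * (sqrt 2 * P) < b"
  shows "\<forall>\<^sub>F \<epsilon> in at_right 0. \<epsilon> * energy \<Omega> \<epsilon> (\<phi> \<epsilon>) < b"
proof -
  have s2: "4 * x / sqrt 2 = 2 * (sqrt 2 * x)" for x :: real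
    by (simp add: field_simps)
  have "((\<lambda>s. 4 * (P + s) / sqrt 2 / (1 - s)\<^sup>2) \<longlongrightarrow> 4 * (P + 0) / sqrt 2 / (1 - 0)\<^sup>2) (at_right 0)"
    by (intro tendsto_intros) auto
  then have "((\<lambda>s. 4 * (P + s) / sqrt 2 / (1 - s)\<^sup>2) \<longlongrightarrow> 2 * (sqrt 2 * P)) (at_right 0)" using s2 by simp
  from order_tendstoD(2)[OF this b] have "\<forall>\<^sub>F s in at_right 0. 4 * (P + s) / sqrt 2 / (1 - s)\<^sup>2 < b" .
  moreover have "\<forall>\<^sub>F s in at_right (0::real). s \<in> {0<..<1}" by (rule eventually_at_right_real) simp
  ultimately have "\<forall>\<^sub>F s in at_right 0. 4 * (P + s) / sqrt 2 / (1 - s)\<^sup>2 < b \<and> s \<in> {0<..<1}"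
    by (rule eventually_conj)
  \<comment> \<open>One small number \<open>s\<close> serves both as slack in the layer area and as
    the mollification parameter of the competitor.\<close>
  then obtain s where s: "4 * (P + s) / sqrt 2 / (1 - s)\<^sup>2 < b" "0 < s" "s < 1"
    using eventually_happens[of _ "at_right (0::real)"] trivial_limit_at_right_real by auto
  obtain t0 where t0: "0 < t0" "\<And>t. 0 < t \<Longrightarrow> t \<le> t0 \<Longrightarrow> measure lebesgue {x\<in>\<Omega>. infdist x (- \<Omega>) \<le> t} \<le> (P + s) * t"
    using up[OF s(2)] by blast
  define h where "h = (\<lambda>\<epsilon>. (4 * (P + s) + 4 * (sqrt 2 * \<epsilon>) * measure lebesgue \<Omega> / t0\<^sup>2) / sqrt 2 / (1 - s)\<^sup>2)"
  have le: "\<epsilon> * energy \<Omega> \<epsilon> (\<phi> \<epsilon>) \<le> h \<epsilon>" if \<epsilon>: "0 < \<epsilon>" for \<epsilon>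
  proof -
    obtain \<psi> where \<psi>: "\<psi> \<in> test_functions \<Omega>" "integrable (lebesgue_on \<Omega>) (\<lambda>x. exp (- \<psi> x))"
      "energy \<Omega> \<epsilon> \<psi> \<le> (\<integral>x. 4 / (sqrt 2 * \<epsilon> + infdist x (- \<Omega>))\<^sup>2 \<partial>lebesgue_on \<Omega>) / (1 - s)\<^sup>2"
      using competitor[OF \<Omega> \<epsilon> s(2,3)] by blast
    define I where "I = (\<integral>x. 4 / (sqrt 2 * \<epsilon> + infdist x (- \<Omega>))\<^sup>2 \<partial>lebesgue_on \<Omega>)"
    have "sqrt 2 * \<epsilon> * I \<le> 4 * (P + s) + 4 * (sqrt 2 * \<epsilon>) * measure lebesgue \<Omega> / t0\<^sup>2"
      unfolding I_def using \<epsilon> t0 P s by (intro layer_cake_bound[OF \<Omega>]) auto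
    then have I: "\<epsilon> * I \<le> (4 * (P + s) + 4 * (sqrt 2 * \<epsilon>) * measure lebesgue \<Omega> / t0\<^sup>2) / sqrt 2"
      by (simp add: le_divide_eq mult_ac)
    have "energy \<Omega> \<epsilon> (\<phi> \<epsilon>) \<le> energy \<Omega> \<epsilon> \<psi>"
      by (rule variational_solution_minimizes[OF \<Omega> \<phi>[OF \<epsilon>] \<epsilon> test_functions_subset_sobolev_H10[OF \<Omega>(1) \<psi>(1)] \<psi>(2)])
    also have "\<dots> \<le> I / (1 - s)\<^sup>2" using \<psi>(3) by (simp only: I_def)
    finally have "\<epsilon> * energy \<Omega> \<epsilon> (\<phi> \<epsilon>) \<le> \<epsilon> * (I / (1 - s)\<^sup>2)" using \<epsilon> by (intro mult_left_mono) auto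
    also have "\<dots> = \<epsilon> * I / (1 - s)\<^sup>2" by simp
    also have "\<dots> \<le> h \<epsilon>" unfolding h_def by (rule divide_right_mono[OF I]) simp
    finally show ?thesis .
  qed
  have "(h \<longlongrightarrow> (4 * (P + s) + 4 * (sqrt 2 * 0) * measure lebesgue \<Omega> / t0\<^sup>2) / sqrt 2 / (1 - s)\<^sup>2) (at_right 0)"
    unfolding h_def using t0 s by (intro tendsto_intros) auto
  then have "(h \<longlongrightarrow> 4 * (P + s) / sqrt 2 / (1 - s)\<^sup>2) (at_right 0)" by simp
  from order_tendstoD(2)[OF this s(1)] have "\<forall>\<^sub>F \<epsilon> in at_right 0. h \<epsilon> < b" .
  moreover have "\<forall>\<^sub>F \<epsilon> in at_right 0. (0::real) < \<epsilon>" by (simp add: eventually_at_filter)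
  ultimately show ?thesis by eventually_elim (use le in fastforce)
qed

text \<open>The geometry enters through the layer areas \<open>up\<close> and the fields
  \<open>low\<close>, which pin \<open>P\<close> from two sides: the competitor converts
  \<open>up\<close> into an upper energy bound, and the flux of the fields in \<open>low\<close>
  gives the matching lower bound.\<close>

lemma mass_asymptotics:
  assumes \<Omega>: "open \<Omega>" "bounded \<Omega>" and P: "0 \<le> P"
    and up: "\<And>\<eta>. 0 < \<eta> \<Longrightarrow> \<exists>t0>0. \<forall>t. 0 < t \<and> t \<le> t0 \<longrightarrow> measure lebesgue {x\<in>\<Omega>. infdist x (- \<Omega>) \<le> t} \<le> (P + \<eta>) * t"
    and low: "\<And>\<eta>. 0 < \<eta> \<Longrightarrow> \<exists>(J :: nat set) \<zeta> e. finite J \<and> (\<forall>j\<in>J. \<zeta> j \<in> test_functions UNIV) \<and>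
      (\<forall>x. norm (\<Sum>j\<in>J. \<zeta> j x *\<^sub>R e j) \<le> 1) \<and>
      P - \<eta> \<le> - (\<Sum>j\<in>J. \<integral>x. frechet_derivative (\<zeta> j) (at x) (e j) \<partial>lebesgue_on \<Omega>)"
    and \<phi>: "\<And>\<epsilon>. 0 < \<epsilon> \<Longrightarrow> variational_solution \<Omega> \<epsilon> (\<phi> \<epsilon>)"
  shows "((\<lambda>\<epsilon>. (\<integral>x. exp (- \<phi> \<epsilon> x) \<partial>lebesgue_on \<Omega>) / \<epsilon>) \<longlongrightarrow> sqrt 2 * P) (at_right 0)"
proof (rule mass_from_energy_asymptotics[where E = "\<lambda>\<epsilon>. energy \<Omega> \<epsilon> (\<phi> \<epsilon>)"])
  have \<phi>H: "\<phi> \<epsilon> \<in> sobolev_H10 \<Omega>" "integrable (lebesgue_on \<Omega>) (\<lambda>x. exp (- \<phi> \<epsilon> x))" if "0 < \<epsilon>" for \<epsilon>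
    using \<phi>[OF that] variational_solution_integrable[OF \<Omega> \<phi>[OF that] that] by (auto simp: variational_solution_def)
  show "energy \<Omega> \<mu> (\<phi> \<mu>) \<le> energy \<Omega> \<epsilon> (\<phi> \<epsilon>) + (1 / \<mu>\<^sup>2 - 1 / \<epsilon>\<^sup>2) * (\<integral>x. exp (- \<phi> \<epsilon> x) \<partial>lebesgue_on \<Omega>)"
    if "0 < \<epsilon>" "0 < \<mu>" for \<epsilon> \<mu>
    using variational_solution_minimizes[OF \<Omega> \<phi>[OF that(2)] that(2) \<phi>H[OF that(1)]]
    unfolding energy_parameter_change[OF that, of \<Omega> "\<phi> \<epsilon>"] .
  show "((\<lambda>\<epsilon>. \<epsilon> * energy \<Omega> \<epsilon> (\<phi> \<epsilon>)) \<longlongrightarrow> 2 * (sqrt 2 * P)) (at_right 0)"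
  proof (rule order_tendstoI)
    fix b assume b: "2 * (sqrt 2 * P) < b"
    show "\<forall>\<^sub>F \<epsilon> in at_right 0. \<epsilon> * energy \<Omega> \<epsilon> (\<phi> \<epsilon>) < b"
      by (rule energy_upper_limit[where P = P]) (fact \<Omega> P up \<phi> b)+
  next
    fix b assume b: "b < 2 * (sqrt 2 * P)"
    \<comment> \<open>Chosen so that \<open>sqrt 2 * (2 * (P - \<eta>))\<close> is the midpoint
      between \<open>b\<close> and the claimed limit.\<close>
    define \<eta> where "\<eta> = (2 * (sqrt 2 * P) - b) / (4 * sqrt 2)"
    have \<eta>: "0 < \<eta>" "b < sqrt 2 * (2 * (P - \<eta>))" using b by (auto simp: \<eta>_def field_simps)
    obtain J :: "nat set" and \<zeta> e where J0: "finite J \<and> (\<forall>j\<in>J. \<zeta> j \<in> test_functions UNIV) \<and>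
      (\<forall>x. norm (\<Sum>j\<in>J. \<zeta> j x *\<^sub>R e j) \<le> 1) \<and>
      P - \<eta> \<le> - (\<Sum>j\<in>J. \<integral>x. frechet_derivative (\<zeta> j) (at x) (e j) \<partial>lebesgue_on \<Omega>)"
      using low[OF \<eta>(1)] by (elim exE)
    then have J: "finite J" "\<And>j. j \<in> J \<Longrightarrow> \<zeta> j \<in> test_functions UNIV"
      "\<And>x. norm (\<Sum>j\<in>J. \<zeta> j x *\<^sub>R e j) \<le> 1"
      "P - \<eta> \<le> - (\<Sum>j\<in>J. \<integral>x. frechet_derivative (\<zeta> j) (at x) (e j) \<partial>lebesgue_on \<Omega>)" by simp_all
    have "\<exists>C. \<forall>x. \<bar>frechet_derivative (\<zeta> j) (at x) (e j)\<bar> \<le> C" if "j \<in> J" for j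
      by (rule test_function_bounded[OF J(2)[OF that], of "e j"]) (intro exI allI)
    then have "\<exists>c. \<forall>j\<in>J. \<forall>x. \<bar>frechet_derivative (\<zeta> j) (at x) (e j)\<bar> \<le> c j" by (intro bchoice ballI)
    then obtain c where c: "\<And>j x. j \<in> J \<Longrightarrow> \<bar>frechet_derivative (\<zeta> j) (at x) (e j)\<bar> \<le> c j" by blast
    define C where "C = (\<Sum>j\<in>J. c j)"
    have C: "\<bar>\<Sum>j\<in>J. frechet_derivative (\<zeta> j) (at x) (e j)\<bar> \<le> C" for x
      unfolding C_def by (rule order_trans[OF sum_abs sum_mono]) (rule c)
    have C0: "0 \<le> C" by (rule order_trans[OF abs_ge_zero C])
    define m where "m = measure lebesgue \<Omega>"
    define B where "B = 2 * (sqrt 2 * P) + 1"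
    have "\<forall>\<^sub>F \<epsilon> in at_right 0. \<epsilon> * energy \<Omega> \<epsilon> (\<phi> \<epsilon>) < B"
    proof (rule energy_upper_limit[where P = P])
      show "2 * (sqrt 2 * P) < B" by (simp add: B_def)
    qed (fact \<Omega> P up \<phi>)+
    moreover have "\<forall>\<^sub>F \<epsilon> in at_right 0. (0::real) < \<epsilon>" by (simp add: eventually_at_filter)
    \<comment> \<open>The error term with s = sqrt \<epsilon>: the integral of exp (-u) is
      O(\<epsilon>), so both s and that integral divided by s are O(sqrt \<epsilon>).\<close>
    moreover have "\<forall>\<^sub>F \<epsilon> in at_right 0. b < sqrt 2 * (2 * (P - \<eta>) - 2 * C * (sqrt \<epsilon> * m + sqrt \<epsilon> * B / 4))"
    proof (rule order_tendstoD(1)[OF _ \<eta>(2)])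
      have "((\<lambda>\<epsilon>. sqrt 2 * (2 * (P - \<eta>) - 2 * C * (sqrt \<epsilon> * m + sqrt \<epsilon> * B / 4))) \<longlongrightarrow> 
        sqrt 2 * (2 * (P - \<eta>) - 2 * C * (sqrt 0 * m + sqrt 0 * B / 4))) (at_right 0)"
        by (intro tendsto_intros) auto
      then show "((\<lambda>\<epsilon>. sqrt 2 * (2 * (P - \<eta>) - 2 * C * (sqrt \<epsilon> * m + sqrt \<epsilon> * B / 4))) \<longlongrightarrow> 
        sqrt 2 * (2 * (P - \<eta>))) (at_right 0)" by simp
    qed
    ultimately show "\<forall>\<^sub>F \<epsilon> in at_right 0. b < \<epsilon> * energy \<Omega> \<epsilon> (\<phi> \<epsilon>)"
    proof eventually_elim
      case (elim \<epsilon>)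
      define N where "N = (\<integral>x. exp (- \<phi> \<epsilon> x) \<partial>lebesgue_on \<Omega>)"
      define D where "D = (\<Sum>j\<in>J. \<integral>x. frechet_derivative (\<zeta> j) (at x) (e j) \<partial>lebesgue_on \<Omega>)"
      \<comment> \<open>The energy contains the term N / \<epsilon>^2 and is O(1 / \<epsilon>) by
        the upper bound, hence N is O(\<epsilon>).\<close>
      have "N \<le> \<epsilon> * (\<epsilon> * energy \<Omega> \<epsilon> (\<phi> \<epsilon>))"
        using energy_nonneg_bound[OF elim(2), of \<Omega> "\<phi> \<epsilon>"] by (simp add: N_def power2_eq_square mult.assoc)
      also have "\<dots> \<le> \<epsilon> * B" using elim by (intro mult_left_mono) auto
      finally have "N / (4 * sqrt \<epsilon>) \<le> \<epsilon> * B / (4 * sqrt \<epsilon>)" using elim by (intro divide_right_mono) auto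
      also have "\<dots> = sqrt \<epsilon> * B / 4"
        using elim real_sqrt_mult_self[of \<epsilon>] by (simp add: field_simps)
      finally have "2 * C * (sqrt \<epsilon> * m + N / (4 * sqrt \<epsilon>)) \<le> 2 * C * (sqrt \<epsilon> * m + sqrt \<epsilon> * B / 4)"
        using C0 by (intro mult_left_mono) auto
      then have "2 * (P - \<eta>) - 2 * C * (sqrt \<epsilon> * m + sqrt \<epsilon> * B / 4) \<le> - 2 * D - 2 * C * (sqrt \<epsilon> * m + N / (4 * sqrt \<epsilon>))"
      proof -
        have "P - \<eta> \<le> - D" unfolding D_def by (rule J(4))
        then have "2 * (P - \<eta>) \<le> - 2 * D" using mult_left_mono[of "P - \<eta>" "- D" 2] by simp
        then show ?thesis using \<open>2 * C * (sqrt \<epsilon> * m + N / (4 * sqrt \<epsilon>)) \<le> _\<close> by (rule diff_mono)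
      qed
      then have "sqrt 2 * (2 * (P - \<eta>) - 2 * C * (sqrt \<epsilon> * m + sqrt \<epsilon> * B / 4)) \<le>
         sqrt 2 * (- 2 * D - 2 * C * (sqrt \<epsilon> * m + N / (4 * sqrt \<epsilon>)))" by (intro mult_left_mono) auto
      also have "\<dots> = \<epsilon> * (sqrt 2 / \<epsilon> * (- 2 * D - 2 * C * (sqrt \<epsilon> * m + N / (4 * sqrt \<epsilon>))))" using elim by simp
      also have "\<dots> \<le> \<epsilon> * energy \<Omega> \<epsilon> (\<phi> \<epsilon>)"
        unfolding D_def m_def N_def using elim \<phi>H[OF elim(2)] J C
        by (intro mult_left_mono energy_lower_bound[OF \<Omega>]) auto
      finally show ?case using elim by linarith
    qed
  qed
qed

section \<open>Hausdorff length\<close>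

text \<open>The definition asks for countable covers; a finite cover is padded with empty sets,
  whose diameter is 0.\<close>

lemma hausdorff_length_le:
  fixes A :: "'a::metric_space set"
  assumes "\<And>\<delta>. 0 < \<delta> \<Longrightarrow> \<exists>\<C>. finite \<C> \<and> A \<subseteq> \<Union>\<C> \<and> (\<forall>C\<in>\<C>. bounded C \<and> diameter C \<le> \<delta>) \<and> (\<Sum>C\<in>\<C>. diameter C) \<le> c"
  shows "hausdorff_length A \<le> ennreal c"
  unfolding hausdorff_length_def
proof (rule SUP_least)
  fix \<delta> :: real assume "\<delta> \<in> {0<..}"
  then have \<delta>: "0 < \<delta>" by simp
  obtain \<C> where \<C>: "finite \<C>" "A \<subseteq> \<Union>\<C>" "\<And>C. C \<in> \<C> \<Longrightarrow> bounded C \<and> diameter C \<le> \<delta>" "(\<Sum>C\<in>\<C>. diameter C) \<le> c"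
    using assms[OF \<delta>] by metis
  obtain f where f: "bij_betw f {0..<card \<C>} \<C>" using ex_bij_betw_nat_finite[OF \<C>(1)] by blast
  define D where "D = (\<lambda>i. if i < card \<C> then f i else {})"
  have fD: "f i \<in> \<C>" if "i < card \<C>" for i using f that by (auto simp: bij_betw_def)
  have "A \<subseteq> (\<Union>i. D i)"
  proof
    fix x assume "x \<in> A"
    then obtain C where C: "C \<in> \<C>" "x \<in> C" using \<C>(2) by blast
    moreover have "C \<in> f ` {0..<card \<C>}" using f C(1) by (simp add: bij_betw_def)
    ultimately obtain i where "i < card \<C>" "f i = C" by auto
    then show "x \<in> (\<Union>i. D i)" using C by (auto simp: D_def intro!: exI[of _ i])
  qed
  moreover have "bounded (D i) \<and> diameter (D i) \<le> \<delta>" for i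
    using \<C>(3)[OF fD[of i]] \<delta> by (auto simp: D_def)
  ultimately have mem: "D \<in> {C. A \<subseteq> (\<Union>i. C i) \<and> (\<forall>i. bounded (C i) \<and> diameter (C i) \<le> \<delta>)}" by simp
  have "(\<Sum>i. ennreal (diameter (D i))) = (\<Sum>i\<in>{0..<card \<C>}. ennreal (diameter (D i)))"
    by (rule suminf_finite) (auto simp: D_def)
  also have "\<dots> = (\<Sum>i\<in>{0..<card \<C>}. ennreal (diameter (f i)))" by (rule sum.cong) (auto simp: D_def)
  also have "\<dots> = (\<Sum>C\<in>\<C>. ennreal (diameter C))" using f by (rule sum.reindex_bij_betw)
  also have "\<dots> = ennreal (\<Sum>C\<in>\<C>. diameter C)" using \<C>(3) by (intro sum_ennreal diameter_ge_0) blast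
  also have "\<dots> \<le> ennreal c" using \<C>(4) by (rule ennreal_leI)
  finally show "(INF C\<in>{C. A \<subseteq> (\<Union>i. C i) \<and> (\<forall>i. bounded (C i) \<and> diameter (C i) \<le> \<delta>)}. \<Sum>i. ennreal (diameter (C i))) \<le> ennreal c"
    by (rule INF_lower2[OF mem])
qed

lemma real_set_subset_interval:
  fixes S :: "real set"
  assumes "\<And>s t. s \<in> S \<Longrightarrow> t \<in> S \<Longrightarrow> s - t \<le> d"
  shows "\<exists>a. S \<subseteq> {a..a + d}"
proof (cases "S = {}")
  case False
  then obtain s0 where s0: "s0 \<in> S" by blast
  have bb: "bdd_below S" by (rule bdd_belowI[of _ "s0 - d"]) (use assms[OF s0] in force)
  have "s \<le> Inf S + d" if "s \<in> S" for s
    using cInf_greatest[OF False, of "s - d"] assms[OF that] by force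
  then show ?thesis using cInf_lower[OF _ bb] by (intro exI[of _ "Inf S"]) auto
qed simp

lemma emeasure_real_le_of_spread:
  fixes S :: "real set"
  assumes "\<And>s t. s \<in> S \<Longrightarrow> t \<in> S \<Longrightarrow> s - t \<le> d" "S \<in> sets borel"
  shows "emeasure lborel S \<le> ennreal d"
proof -
  obtain a where "S \<subseteq> {a..a + d}" using real_set_subset_interval[OF assms(1)] by blast
  then have "emeasure lborel S \<le> emeasure lborel {a..a + d}" by (rule emeasure_mono) simp
  also have "\<dots> \<le> ennreal d" by (cases "0 \<le> d") auto
  finally show ?thesis .
qed

lemma disjoint_compact_separated:
  fixes K :: "'j \<Rightarrow> 'a::{heine_borel, real_normed_vector} set"
  assumes "finite J" "\<And>j. j \<in> J \<Longrightarrow> compact (K j)" "\<And>i j. i \<in> J \<Longrightarrow> j \<in> J \<Longrightarrow> i \<noteq> j \<Longrightarrow> K i \<inter> K j = {}"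
  obtains d where "0 < d" "\<And>i j x y. i \<in> J \<Longrightarrow> j \<in> J \<Longrightarrow> i \<noteq> j \<Longrightarrow> x \<in> K i \<Longrightarrow> y \<in> K j \<Longrightarrow> d \<le> dist x y"
proof -
  define Q where "Q = {q \<in> J \<times> J. fst q \<noteq> snd q}"
  have "\<exists>d>0. \<forall>x\<in>K (fst q). \<forall>y\<in>K (snd q). d \<le> dist x y" if "q \<in> Q" for q
  proof -
    have "fst q \<in> J" "snd q \<in> J" "fst q \<noteq> snd q" using that by (auto simp: Q_def)
    then show ?thesis using assms(2,3) by (intro separate_compact_closed compact_imp_closed) auto
  qed
  then obtain d where d: "\<And>q. q \<in> Q \<Longrightarrow> 0 < d q \<and> (\<forall>x\<in>K (fst q). \<forall>y\<in>K (snd q). d q \<le> dist x y)" by metis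
  have "finite Q" using assms(1) by (simp add: Q_def)
  \<comment> \<open>The inserted 1 covers the case of at most one piece, where \<open>Q\<close> is
    empty.\<close>
  define m where "m = Min (insert 1 (d ` Q))"
  show thesis
  proof (rule that[of m])
    show "0 < m" unfolding m_def using \<open>finite Q\<close> d by (subst Min_gr_iff) auto
    fix i j x y assume *: "i \<in> J" "j \<in> J" "i \<noteq> j" "x \<in> K i" "y \<in> K j"
    then have q: "(i, j) \<in> Q" by (simp add: Q_def)
    have "m \<le> d (i, j)" unfolding m_def using \<open>finite Q\<close> q by (intro Min_le) auto
    also have "\<dots> \<le> dist x y" using d[OF q] * by simp
    finally show "m \<le> dist x y" .
  qed
qed

text \<open>Maps that do not increase distances do not increase length, so each piece costs at least
  the measure of its image. Once the mesh is below the mutual distance of the pieces, a covering set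
  meets at most one of them and its diameter is charged only once.\<close>

lemma hausdorff_length_ge:
  fixes K :: "'j \<Rightarrow> 'a::{heine_borel, real_normed_vector} set" and p :: "'j \<Rightarrow> 'a \<Rightarrow> real"
  assumes J: "finite J" "\<And>j. j \<in> J \<Longrightarrow> compact (K j)" "\<And>i j. i \<in> J \<Longrightarrow> j \<in> J \<Longrightarrow> i \<noteq> j \<Longrightarrow> K i \<inter> K j = {}"
    and A: "\<And>j. j \<in> J \<Longrightarrow> K j \<subseteq> A"
    and p: "\<And>j x y. j \<in> J \<Longrightarrow> \<bar>p j x - p j y\<bar> \<le> dist x y"
  shows "(\<Sum>j\<in>J. emeasure lborel (p j ` K j)) \<le> hausdorff_length A"
proof -
  obtain d where d: "0 < d" "\<And>i j x y. i \<in> J \<Longrightarrow> j \<in> J \<Longrightarrow> i \<noteq> j \<Longrightarrow> x \<in> K i \<Longrightarrow> y \<in> K j \<Longrightarrow> d \<le> dist x y"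
    by (rule disjoint_compact_separated[where K = K, OF J]) (assumption | rule that)+
  show ?thesis unfolding hausdorff_length_def
  proof (rule SUP_upper2[of "d / 2"])
    show "d / 2 \<in> {0<..}" using d by simp
    show "(\<Sum>j\<in>J. emeasure lborel (p j ` K j)) \<le> 
      (INF C\<in>{C. A \<subseteq> (\<Union>i. C i) \<and> (\<forall>i. bounded (C i) \<and> diameter (C i) \<le> d / 2)}. \<Sum>i. ennreal (diameter (C i)))"
    proof (rule INF_greatest)
      fix C :: "nat \<Rightarrow> 'a set" assume "C \<in> {C. A \<subseteq> (\<Union>i. C i) \<and> (\<forall>i. bounded (C i) \<and> diameter (C i) \<le> d / 2)}"
      then have C: "A \<subseteq> (\<Union>i. C i)" "\<And>i. bounded (C i)" "\<And>i. diameter (C i) \<le> d / 2" by auto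
      define g where "g = (\<lambda>j i. if C i \<inter> K j = {} then 0 else ennreal (diameter (C i)))"
      have "emeasure lborel (p j ` K j) \<le> (\<Sum>i. g j i)" if j: "j \<in> J" for j
      proof -
        have "\<exists>a. p j ` (C i \<inter> K j) \<subseteq> {a..a + diameter (C i)}" for i
        proof (rule real_set_subset_interval)
          fix s t assume "s \<in> p j ` (C i \<inter> K j)" "t \<in> p j ` (C i \<inter> K j)"
          then obtain x y where "x \<in> C i" "y \<in> C i" "s = p j x" "t = p j y" by auto
          then show "s - t \<le> diameter (C i)"
            using p[OF j, of x y] diameter_bounded_bound[OF C(2)[of i], of x y] by linarith
        qed
        then obtain a where a: "\<And>i. p j ` (C i \<inter> K j) \<subseteq> {a i..a i + diameter (C i)}" by metis
        define I where "I = (\<lambda>i. if C i \<inter> K j = {} then {} else {a i..a i + diameter (C i)})"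
        have "p j ` K j \<subseteq> (\<Union>i. I i)"
        proof
          fix s assume "s \<in> p j ` K j"
          then obtain x where x: "x \<in> K j" "s = p j x" by blast
          then obtain i where "x \<in> C i" using C(1) A[OF j] by blast
          then have "s \<in> I i" using a[of i] x by (auto simp: I_def)
          then show "s \<in> (\<Union>i. I i)" by blast
        qed
        then have "emeasure lborel (p j ` K j) \<le> emeasure lborel (\<Union>i. I i)"
          by (rule emeasure_mono) (auto simp: I_def)
        also have "\<dots> \<le> (\<Sum>i. emeasure lborel (I i))" by (rule emeasure_subadditive_countably) (auto simp: I_def)
        also have "\<dots> = (\<Sum>i. g j i)" by (rule suminf_cong) (auto simp: I_def g_def diameter_ge_0[OF C(2)])
        finally show ?thesis .
      qed
      then have "(\<Sum>j\<in>J. emeasure lborel (p j ` K j)) \<le> (\<Sum>j\<in>J. \<Sum>i. g j i)" by (rule sum_mono)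
      also have "\<dots> = (\<Sum>i. \<Sum>j\<in>J. g j i)" by (rule suminf_sum[symmetric]) simp
      also have "\<dots> \<le> (\<Sum>i. ennreal (diameter (C i)))"
      proof (rule suminf_le)
        fix i
        show "(\<Sum>j\<in>J. g j i) \<le> ennreal (diameter (C i))"
        proof (cases "\<exists>k\<in>J. C i \<inter> K k \<noteq> {}")
          case True
          then obtain k where k: "k \<in> J" "C i \<inter> K k \<noteq> {}" by blast
          have "g j i = 0" if j: "j \<in> J - {k}" for j
          proof (rule ccontr)
            assume "g j i \<noteq> 0"
            then obtain x y where xy: "x \<in> C i" "x \<in> K j" "y \<in> C i" "y \<in> K k" using k by (auto simp: g_def split: if_splits)
            then have "d \<le> dist x y" using d(2)[of j k x y] j k by auto
            also have "\<dots> \<le> d / 2" using diameter_bounded_bound[OF C(2)[of i] xy(1,3)] C(3)[of i] by linarith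
            finally show False using d(1) by simp
          qed
          then have "(\<Sum>j\<in>J. g j i) = g k i" using J(1) k(1) by (simp add: sum.remove)
          then show ?thesis by (simp add: g_def)
        next
          case False
          then show ?thesis by (simp add: g_def)
        qed
      qed auto
      finally show "(\<Sum>j\<in>J. emeasure lborel (p j ` K j)) \<le> (\<Sum>i. ennreal (diameter (C i)))" .
    qed
  qed
qed

section \<open>Flat pieces of the boundary\<close>

text \<open>The rotation by a right angle. For unit \<open>e\<close>, the inner products with
  \<open>perp e\<close> and \<open>e\<close> serve as tangential and normal coordinates
  throughout.\<close>

definition perp :: "real^2 \<Rightarrow> real^2" where "perp e = vector [- e $ 2, e $ 1]"

lemma inner_real2: "(x::real^2) \<bullet> y = x $ 1 * y $ 1 + x $ 2 * y $ 2"
  by (simp add: inner_vec_def sum_2)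

lemma perp_props:
  assumes "norm e = 1"
  shows "norm (perp e) = 1" "perp e \<bullet> e = 0" "e \<bullet> perp e = 0" "(z \<bullet> perp e) *\<^sub>R perp e + (z \<bullet> e) *\<^sub>R e = z"
    "norm z \<le> \<bar>z \<bullet> perp e\<bar> + \<bar>z \<bullet> e\<bar>" "\<bar>z \<bullet> perp e\<bar> \<le> norm z" "\<bar>z \<bullet> e\<bar> \<le> norm z"
proof -
  have e: "e $ 1 * e $ 1 + e $ 2 * e $ 2 = 1"
    using assms by (simp add: norm_eq_1 inner_real2)
  then show n: "norm (perp e) = 1" by (simp add: norm_eq_1 inner_real2 perp_def vector_2)
  show "perp e \<bullet> e = 0" "e \<bullet> perp e = 0" by (simp_all add: inner_real2 perp_def vector_2)
  have "(z $ 1 * - e $ 2 + z $ 2 * e $ 1) * - e $ 2 + (z $ 1 * e $ 1 + z $ 2 * e $ 2) * e $ 1 = z $ 1 * (e $ 1 * e $ 1 + e $ 2 * e $ 2)"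
    "(z $ 1 * - e $ 2 + z $ 2 * e $ 1) * e $ 1 + (z $ 1 * e $ 1 + z $ 2 * e $ 2) * e $ 2 = z $ 2 * (e $ 1 * e $ 1 + e $ 2 * e $ 2)"
    by (simp_all add: algebra_simps)
  then show z: "(z \<bullet> perp e) *\<^sub>R perp e + (z \<bullet> e) *\<^sub>R e = z"
    unfolding e by (auto simp: vec_eq_iff forall_2 inner_real2 perp_def vector_2)
  show "norm z \<le> \<bar>z \<bullet> perp e\<bar> + \<bar>z \<bullet> e\<bar>"
    using norm_triangle_ineq[of "(z \<bullet> perp e) *\<^sub>R perp e" "(z \<bullet> e) *\<^sub>R e"] unfolding z by (simp add: n assms)
  show "\<bar>z \<bullet> perp e\<bar> \<le> norm z" "\<bar>z \<bullet> e\<bar> \<le> norm z"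
    using Cauchy_Schwarz_ineq2[of z "perp e"] Cauchy_Schwarz_ineq2[of z e] n assms by simp_all
qed

text \<open>\<open>flat \<Omega> \<delta> e y r\<close>: in the ball of radius \<open>r\<close> about \<open>y\<close>, the set \<open>\<Omega>\<close> lies above a graph of slope at
  most \<open>\<delta>\<close> in the coordinates in which \<open>e\<close> points upwards.\<close>

definition flat :: "(real^2) set \<Rightarrow> real \<Rightarrow> real^2 \<Rightarrow> real^2 \<Rightarrow> real \<Rightarrow> bool" where
  "flat \<Omega> \<delta> e y r \<longleftrightarrow> norm e = 1 \<and> 0 < r \<and> (\<forall>z\<in>frontier \<Omega> \<inter> ball y r. \<forall>w\<in>ball y r.
     (\<delta> * \<bar>(w - z) \<bullet> perp e\<bar> < (w - z) \<bullet> e \<longrightarrow> w \<in> \<Omega>) \<and>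
     ((w - z) \<bullet> e < - (\<delta> * \<bar>(w - z) \<bullet> perp e\<bar>) \<longrightarrow> w \<notin> \<Omega>))"

text \<open>Two frontier points of an open set both lie outside it, so neither can lie in the upper
  cone of the other.\<close>

lemma flat_graph:
  assumes "flat \<Omega> \<delta> e y r" "open \<Omega>" "z \<in> frontier \<Omega> \<inter> ball y r" "w \<in> frontier \<Omega> \<inter> ball y r"
  shows "\<bar>(w - z) \<bullet> e\<bar> \<le> \<delta> * \<bar>(w - z) \<bullet> perp e\<bar>"
proof (rule ccontr)
  assume neg: "\<not> ?thesis"
  have out: "z \<notin> \<Omega>" "w \<notin> \<Omega>" using assms(2,3,4) by (auto simp: frontier_def interior_open)
  have fl: "\<delta> * \<bar>(v - u) \<bullet> perp e\<bar> < (v - u) \<bullet> e \<Longrightarrow> v \<in> \<Omega>"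
    if "u \<in> frontier \<Omega> \<inter> ball y r" "v \<in> frontier \<Omega> \<inter> ball y r" for u v
    using assms(1) that unfolding flat_def by blast
  have sym: "(z - w) \<bullet> e = - ((w - z) \<bullet> e)" "\<bar>(z - w) \<bullet> perp e\<bar> = \<bar>(w - z) \<bullet> perp e\<bar>"
    by (simp_all add: inner_diff_left abs_minus_commute)
  from neg have "\<delta> * \<bar>(w - z) \<bullet> perp e\<bar> < (w - z) \<bullet> e \<or> \<delta> * \<bar>(z - w) \<bullet> perp e\<bar> < (z - w) \<bullet> e"
    unfolding sym by linarith
  then show False using fl[OF assms(3,4)] fl[OF assms(4,3)] out by blast
qed

lemma flat_dist:
  assumes "flat \<Omega> \<delta> e y r" "open \<Omega>" "z \<in> frontier \<Omega> \<inter> ball y r" "w \<in> frontier \<Omega> \<inter> ball y r"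
  shows "dist w z \<le> (1 + \<delta>) * \<bar>w \<bullet> perp e - z \<bullet> perp e\<bar>"
proof -
  have e: "norm e = 1" using assms(1) by (simp add: flat_def)
  have "dist w z \<le> \<bar>(w - z) \<bullet> perp e\<bar> + \<bar>(w - z) \<bullet> e\<bar>"
    unfolding dist_norm by (rule perp_props(5)[OF e])
  also have "\<dots> \<le> \<bar>(w - z) \<bullet> perp e\<bar> + \<delta> * \<bar>(w - z) \<bullet> perp e\<bar>" using flat_graph[OF assms] by simp
  finally show ?thesis by (simp add: inner_diff_left algebra_simps)
qed

lemma MVT_directional:
  fixes F :: "'a::real_normed_vector \<Rightarrow> real"
  assumes "convex S" "z \<in> S" "w \<in> S" "\<And>x. x \<in> S \<Longrightarrow> (F has_derivative D x) (at x)"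
  obtains x where "x \<in> S" "F w - F z = D x (w - z)"
proof -
  have "\<exists>t. 0 < t \<and> t < 1 \<and> F (z + 1 *\<^sub>R (w - z)) - F (z + 0 *\<^sub>R (w - z)) = (1 - 0) * D (z + t *\<^sub>R (w - z)) (w - z)"
  proof (rule MVT2)
    fix t :: real assume t: "0 \<le> t" "t \<le> 1"
    have "z + t *\<^sub>R (w - z) = (1 - t) *\<^sub>R z + t *\<^sub>R w" by (simp add: algebra_simps)
    then have S: "z + t *\<^sub>R (w - z) \<in> S" using assms(1-3) t by (auto simp: convex_alt)
    have "((\<lambda>t. F (z + t *\<^sub>R (w - z))) has_derivative (\<lambda>s. D (z + t *\<^sub>R (w - z)) (s *\<^sub>R (w - z)))) (at t)"
      by (rule has_derivative_compose[where f = "\<lambda>t. z + t *\<^sub>R (w - z)" and g = F, OF _ assms(4)[OF S]])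
         (auto intro!: derivative_eq_intros)
    then show "((\<lambda>t. F (z + t *\<^sub>R (w - z))) has_real_derivative D (z + t *\<^sub>R (w - z)) (w - z)) (at t)"
      using has_derivative_bounded_linear[OF assms(4)[OF S]]
      by (simp add: has_field_derivative_def linear_simps mult_commute_abs)
  qed simp
  then obtain t where t: "0 < t" "t < 1" "F w - F z = D (z + t *\<^sub>R (w - z)) (w - z)" by auto
  have "z + t *\<^sub>R (w - z) = (1 - t) *\<^sub>R z + t *\<^sub>R w" by (simp add: algebra_simps)
  then have "z + t *\<^sub>R (w - z) \<in> S" using assms(1-3) t by (auto simp: convex_alt)
  then show thesis using that t(3) by blast
qed

text \<open>With \<open>e\<close> the normalised gradient of the defining function at
  \<open>y\<close>, the function increases along every direction of the cone determined by \<delta>,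
  in a ball where the gradient has barely turned. As it vanishes on the frontier, its sign decides
  membership above and below each frontier point.\<close>

lemma flat_of_defining_function:
  assumes W: "open W" "y \<in> W" and F: "\<And>x. x \<in> W \<Longrightarrow> (F has_derivative D x) (at x)"
    and c: "\<And>v. continuous_on W (\<lambda>x. D x v)" and nz: "D y u \<noteq> (0::real)"
    and \<Omega>: "\<And>z. z \<in> W \<Longrightarrow> z \<in> \<Omega> \<longleftrightarrow> 0 < F z" "open \<Omega>" and \<delta>: "0 < \<delta>"
  shows "\<exists>e r. flat \<Omega> \<delta> e y r"
proof -
  have lin: "bounded_linear (D x)" if "x \<in> W" for x using F[OF that] by (rule has_derivative_bounded_linear)
  define g where "g = (\<Sum>b\<in>Basis. D y b *\<^sub>R b)"
  have expand: "D x v = (\<Sum>b\<in>Basis. (v \<bullet> b) * D x b)" if "x \<in> W" for x v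
  proof -
    interpret bounded_linear "D x" using lin[OF that] .
    have "D x v = D x (\<Sum>b\<in>Basis. (v \<bullet> b) *\<^sub>R b)" by (simp add: euclidean_representation)
    also have "\<dots> = (\<Sum>b\<in>Basis. (v \<bullet> b) * D x b)" by (simp only: sum scaleR real_scaleR_def)
    finally show ?thesis .
  qed
  have g: "D y v = g \<bullet> v" for v
    unfolding g_def inner_sum_left by (subst expand[OF W(2)]) (simp add: inner_commute[of v] mult.commute)
  then have g0: "0 < norm g" using nz by auto
  define e where "e = g /\<^sub>R norm g"
  have e: "norm e = 1" using g0 by (simp add: e_def)
  \<comment> \<open>On the cone, the norm of v is at most (1 + 1 / \<delta>) (v \<bullet> e); with
    this tolerance a perturbed gradient loses at most half of the increase g \<bullet> v.\<close>
  define \<kappa> where "\<kappa> = norm g / (2 * (1 + 1 / \<delta>))"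
  have \<kappa>: "0 < \<kappa>" "\<kappa> * (1 + 1 / \<delta>) = norm g / 2"
  proof -
    have c: "0 < c \<Longrightarrow> norm g / (2 * c) * c = norm g / 2 \<and> 0 < norm g / (2 * c)" for c :: real using g0 by simp
    have "0 < 1 + 1 / \<delta>" using \<delta> by (simp add: add_pos_pos)
    from c[OF this] show "0 < \<kappa>" "\<kappa> * (1 + 1 / \<delta>) = norm g / 2" unfolding \<kappa>_def by blast+
  qed
  have "continuous_on W (\<lambda>x. \<Sum>b\<in>Basis. \<bar>D x b - D y b\<bar>)" by (intro continuous_intros c)
  then have "isCont (\<lambda>x. \<Sum>b\<in>Basis. \<bar>D x b - D y b\<bar>) y" using continuous_on_eq_continuous_at[OF W(1)] W(2) by blast
  then have "((\<lambda>x. \<Sum>b\<in>Basis. \<bar>D x b - D y b\<bar>) \<longlongrightarrow> (\<Sum>b\<in>Basis. \<bar>D y b - D y b\<bar>)) (nhds y)"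
    unfolding isCont_def by (rule tendsto_at_iff_tendsto_nhds[of "\<lambda>x. \<Sum>b\<in>Basis. \<bar>D x b - D y b\<bar>" y, THEN iffD1])
  then have "((\<lambda>x. \<Sum>b\<in>Basis. \<bar>D x b - D y b\<bar>) \<longlongrightarrow> 0) (nhds y)" by simp
  then have "\<forall>\<^sub>F x in nhds y. (\<Sum>b\<in>Basis. \<bar>D x b - D y b\<bar>) < \<kappa>"
    using \<kappa>(1) by (rule order_tendstoD(2))
  moreover have "\<forall>\<^sub>F x in nhds y. x \<in> W" using W by (rule eventually_nhds_in_open)
  ultimately have "\<forall>\<^sub>F x in nhds y. (\<Sum>b\<in>Basis. \<bar>D x b - D y b\<bar>) < \<kappa> \<and> x \<in> W" by (rule eventually_conj)
  then obtain r where r: "0 < r" "\<And>x. dist x y < r \<Longrightarrow> (\<Sum>b\<in>Basis. \<bar>D x b - D y b\<bar>) < \<kappa> \<and> x \<in> W"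
    unfolding eventually_nhds_metric by blast
  have bW: "ball y r \<subseteq> W" using r(2) by (auto simp: dist_commute)
  have close: "\<bar>D x v - g \<bullet> v\<bar> \<le> \<kappa> * norm v" if "x \<in> ball y r" for x v
  proof -
    have "D x v - g \<bullet> v = (\<Sum>b\<in>Basis. (v \<bullet> b) * (D x b - D y b))"
    proof -
      have "x \<in> W" using that bW by blast
      have "D x v - g \<bullet> v = (\<Sum>b\<in>Basis. (v \<bullet> b) * D x b) - (\<Sum>b\<in>Basis. (v \<bullet> b) * D y b)"
        unfolding g[symmetric] using expand[OF \<open>x \<in> W\<close>, of v] expand[OF W(2), of v] by (simp only:)
      then show ?thesis by (simp only: sum_subtractf[symmetric] right_diff_distrib)
    qed
    also have "\<bar>\<dots>\<bar> \<le> (\<Sum>b\<in>Basis. \<bar>(v \<bullet> b) * (D x b - D y b)\<bar>)" by (rule sum_abs)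
    also have "\<dots> \<le> (\<Sum>b\<in>Basis. norm v * \<bar>D x b - D y b\<bar>)"
      unfolding abs_mult by (intro sum_mono mult_right_mono Basis_le_norm) auto
    also have "\<dots> = norm v * (\<Sum>b\<in>Basis. \<bar>D x b - D y b\<bar>)" by (simp add: sum_distrib_left)
    also have "\<dots> \<le> norm v * \<kappa>" using r(2)[of x] that by (intro mult_left_mono) (auto simp: dist_commute)
    finally show ?thesis by (simp add: mult.commute)
  qed
  have incr: "F z < F w" if "z \<in> ball y r" "w \<in> ball y r" "\<delta> * \<bar>(w - z) \<bullet> perp e\<bar> < (w - z) \<bullet> e" for z w
  proof -
    let ?d = "w - z"
    note zw = that
    have dF: "(F has_derivative D x) (at x)" if "x \<in> ball y r" for x using F that bW by blast
    obtain x where x: "x \<in> ball y r" "F w - F z = D x ?d"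
      by (rule MVT_directional[OF convex_ball zw(1,2) dF])
    have "0 \<le> \<delta> * \<bar>?d \<bullet> perp e\<bar>" using \<delta> by simp
    then have pos: "0 < ?d \<bullet> e" using zw(3) by linarith
    have "\<bar>?d \<bullet> perp e\<bar> \<le> (?d \<bullet> e) / \<delta>" using zw(3) \<delta> by (simp add: field_simps)
    then have "norm ?d \<le> (?d \<bullet> e) * (1 + 1 / \<delta>)" 
    proof -
      have "norm ?d \<le> (?d \<bullet> e) + (?d \<bullet> e) / \<delta>"
        using perp_props(5)[OF e, of ?d] pos \<open>\<bar>?d \<bullet> perp e\<bar> \<le> (?d \<bullet> e) / \<delta>\<close> by linarith
      then show ?thesis by (simp only: distrib_left mult_1_right times_divide_eq_right)
    qed
    then have "\<kappa> * norm ?d \<le> \<kappa> * ((?d \<bullet> e) * (1 + 1 / \<delta>))" using \<kappa>(1) by (intro mult_left_mono) auto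
    also have "\<dots> = (?d \<bullet> e) * (\<kappa> * (1 + 1 / \<delta>))" by simp
    also have "\<dots> = (?d \<bullet> e) * (norm g / 2)" unfolding \<kappa>(2) ..
    finally have 1: "\<kappa> * norm ?d \<le> (?d \<bullet> e) * (norm g / 2)" .
    define q where "q = (?d \<bullet> e) * (norm g / 2)"
    have "norm g *\<^sub>R e = g" using g0 by (simp add: e_def)
    then have "g \<bullet> ?d = norm g * (e \<bullet> ?d)" by (metis inner_scaleR_left)
    then have q: "g \<bullet> ?d = 2 * q" by (simp add: q_def inner_commute)
    have "0 < q" unfolding q_def using pos g0 by simp
    moreover have "\<bar>D x ?d - 2 * q\<bar> \<le> q" using close[OF x(1), of ?d] 1 unfolding q q_def by linarith
    ultimately have "0 < D x ?d" by linarith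
    then show ?thesis using x(2) by linarith
  qed
  \<comment> \<open>Frontier points lie outside the open set, so F \<le> 0 there; F < 0 would
    persist on a neighbourhood disjoint from \<Omega>.\<close>
  have F0: "F z = 0" if z: "z \<in> frontier \<Omega>" "z \<in> ball y r" for z
  proof -
    have "z \<notin> \<Omega>" using z(1) \<Omega>(2) by (auto simp: frontier_def interior_open)
    then have "F z \<le> 0" using \<Omega>(1)[of z] z bW by force
    moreover have "\<not> F z < 0"
    proof
      assume "F z < 0"
      have "isCont F z" using F[of z] z(2) bW has_derivative_continuous by blast
      then have "(F \<longlongrightarrow> F z) (nhds z)" by (simp add: isCont_def tendsto_at_iff_tendsto_nhds)
      then have "\<forall>\<^sub>F x in nhds z. F x < 0" using \<open>F z < 0\<close> by (rule order_tendstoD(2))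
      moreover have "\<forall>\<^sub>F x in nhds z. x \<in> W" using z(2) bW by (intro eventually_nhds_in_open W) auto
      ultimately have "\<forall>\<^sub>F x in nhds z. F x < 0 \<and> x \<in> W" by (rule eventually_conj)
      then obtain T where T0: "open T" "z \<in> T" "\<forall>x\<in>T. F x < 0 \<and> x \<in> W" unfolding eventually_nhds by (elim exE conjE)
      have T: "open T" "z \<in> T" "T \<inter> \<Omega> = {}"
      proof -
        have "x \<notin> \<Omega>" if "x \<in> T" for x using T0(3) that \<Omega>(1)[of x] by auto
        then show "T \<inter> \<Omega> = {}" by blast
      qed (fact T0)+
      have "z \<in> closure \<Omega>" using z(1) by (simp add: frontier_def)
      then show False using T open_Int_closure_eq_empty[of T \<Omega>] by blast
    qed
    ultimately show ?thesis by simp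
  qed
  have "flat \<Omega> \<delta> e y r"
    unfolding flat_def
  proof (intro conjI ballI impI e r(1))
    fix z w assume z: "z \<in> frontier \<Omega> \<inter> ball y r" and w: "w \<in> ball y r"
    show "w \<in> \<Omega>" if "\<delta> * \<bar>(w - z) \<bullet> perp e\<bar> < (w - z) \<bullet> e"
      using incr[of z w] z w that F0[of z] \<Omega>(1)[of w] bW by auto
    show "w \<notin> \<Omega>" if "(w - z) \<bullet> e < - (\<delta> * \<bar>(w - z) \<bullet> perp e\<bar>)"
    proof -
      have "\<delta> * \<bar>(z - w) \<bullet> perp e\<bar> < (z - w) \<bullet> e"
        using that by (simp add: inner_diff_left abs_minus_commute)
      then show ?thesis using incr[of w z] z w F0[of z] \<Omega>(1)[of w] bW by auto
    qed
  qed
  then show ?thesis by blast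
qed

section \<open>Sectors and their sides\<close>

lemma mem_sector: "w \<in> sector \<theta> \<longleftrightarrow> (\<exists>r t. 0 < r \<and> \<bar>t\<bar> < \<theta> \<and> w $ 1 = r * cos t \<and> w $ 2 = r * sin t)"
  unfolding sector_def by (auto simp: vec_eq_iff forall_2 vector_2)

text \<open>The numbers \<open>a\<close> and \<open>b\<close> are the coordinates along the upper
  side and along its inner normal; at polar angle t they are r cos (\<theta> - t) and r sin
  (\<theta> - t). In a narrow wedge about the side the sign of \<open>b\<close> decides membership:
  \<open>\<tau> < 2 * \<theta>\<close> keeps the wedge off the lower side seen through the sector,
  \<open>\<tau> < 2 * pi - 2 * \<theta>\<close> off the lower side seen through the
  complement.\<close>

lemma sector_near_side:
  fixes \<theta> \<tau> w1 w2 :: real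
  defines "a \<equiv> w1 * cos \<theta> + w2 * sin \<theta>" and "b \<equiv> w1 * sin \<theta> - w2 * cos \<theta>"
  assumes \<theta>: "0 < \<theta>" "\<theta> < pi" and \<tau>: "0 < \<tau>" "\<tau> < pi / 2" "\<tau> < 2 * \<theta>" "\<tau> < 2 * pi - 2 * \<theta>"
    and ab: "0 < a" "\<bar>b\<bar> < tan \<tau> * a"
  shows "(\<exists>r t. 0 < r \<and> \<bar>t\<bar> < \<theta> \<and> w1 = r * cos t \<and> w2 = r * sin t) \<longleftrightarrow> 0 < b"
proof
  assume b: "0 < b"
  define s where "s = arctan (b / a)"
  have ba: "0 < b / a" "b / a < tan \<tau>" using b ab by (auto simp: field_simps)
  have s: "0 < s" "s < \<tau>"
  proof -
    show "0 < s" using ba by (simp add: s_def)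
    have "arctan (b / a) < arctan (tan \<tau>)" using ba(2) by (simp only: arctan_less_iff)
    also have "\<dots> = \<tau>" using \<tau> by (intro arctan_tan) auto
    finally show "s < \<tau>" by (simp add: s_def)
  qed
  have cs: "cos s > 0" using s \<tau> by (intro cos_gt_zero_pi) auto
  define r where "r = a / cos s"
  have ar: "a = r * cos s" using cs by (simp add: r_def)
  have "tan s = b / a" by (simp add: s_def tan_arctan)
  then have "b = a * tan s" using ab by simp
  then have br: "b = r * sin s" using cs by (simp add: r_def tan_def)
  have r: "0 < r" using ab cs by (simp add: r_def)
  have "(w1 * c + w2 * d) * c + (w1 * d - w2 * c) * d = w1 * (c * c + d * d)" 
    "(w1 * c + w2 * d) * d - (w1 * d - w2 * c) * c = w2 * (c * c + d * d)" for c d :: real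
    by (simp_all add: algebra_simps)
  from this[of "cos \<theta>" "sin \<theta>"] have "a * cos \<theta> + b * sin \<theta> = w1" "a * sin \<theta> - b * cos \<theta> = w2"
    unfolding a_def b_def sin_cos_squared_add3 by simp_all
  then have "w1 = a * cos \<theta> + b * sin \<theta>" "w2 = a * sin \<theta> - b * cos \<theta>" by simp_all
  then have "w1 = r * cos (\<theta> - s)" "w2 = r * sin (\<theta> - s)"
    unfolding ar br by (simp_all add: cos_diff sin_diff algebra_simps)
  then show "\<exists>r t. 0 < r \<and> \<bar>t\<bar> < \<theta> \<and> w1 = r * cos t \<and> w2 = r * sin t"
    using r s \<tau> by (intro exI[of _ r] exI[of _ "\<theta> - s"]) auto
next
  assume "\<exists>r t. 0 < r \<and> \<bar>t\<bar> < \<theta> \<and> w1 = r * cos t \<and> w2 = r * sin t"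
  then obtain r t where r: "0 < r" "\<bar>t\<bar> < \<theta>" "w1 = r * cos t" "w2 = r * sin t" by blast
  define s where "s = \<theta> - t"
  have ar: "a = r * cos s" and br: "b = r * sin s"
    unfolding a_def b_def r s_def by (simp_all add: cos_diff sin_diff algebra_simps)
  have s: "0 < s" "s < 2 * \<theta>" using r(2) by (auto simp: s_def)
  have cs: "0 < cos s" using ab(1) r(1) by (simp add: ar zero_less_mult_iff)
  show "0 < b"
  proof (rule ccontr)
    assume "\<not> 0 < b"
    then have "sin s \<le> 0" using r(1) by (simp add: br zero_less_mult_iff)
    then have "pi \<le> s" using sin_gt_zero[of s] s(1) by fastforce
    \<comment> \<open>The angle to the upper side measured through the complement: it would have to
      be below \<open>\<tau>\<close>, but s < 2 \<theta> makes it exceed 2 pi - 2 \<theta>.\<close>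
    define q where "q = 2 * pi - s"
    have q: "0 < q" "q \<le> pi" using \<open>pi \<le> s\<close> s \<theta> by (auto simp: q_def)
    have cq: "cos q = cos s" "sin q = - sin s" by (simp_all add: q_def cos_diff sin_diff)
    have "q < pi / 2"
    proof (rule ccontr)
      assume "\<not> q < pi / 2"
      then have "cos q \<le> 0" using q(2) cos_monotone_0_pi_le[of "pi / 2" q] by simp
      then show False using cs cq by simp
    qed
    have "tan q * a = \<bar>b\<bar>"
      using \<open>sin s \<le> 0\<close> r(1) cs by (simp add: tan_def cq ar br abs_mult)
    then have "tan q * a < tan \<tau> * a" using ab(2) by simp
    then have "tan q < tan \<tau>" using ab(1) by (simp only: mult_less_cancel_right_pos)
    then have "q < \<tau>" using tan_monotone'[of q \<tau>] q \<open>q < pi / 2\<close> \<tau> by simp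
    then show False using s(2) \<tau>(4) by (simp add: q_def)
  qed
qed

text \<open>The argument \<open>s\<close> is 1 or -1 and selects the side of the sector;
  \<open>r\<close> is the distance from the vertex.\<close>

definition ray :: "real \<Rightarrow> real \<Rightarrow> real \<Rightarrow> real^2" where
  "ray \<theta> s r = vector [r * cos \<theta>, s * (r * sin \<theta>)]"

lemma norm_vector_polar: "norm (vector [r * cos t, r * sin t] :: real^2) = \<bar>r\<bar>"
proof -
  have "(r * c) * (r * c) + (r * d) * (r * d) = r * r * (c * c + d * d)" for c d :: real by (simp add: algebra_simps)
  from this[of "cos t" "sin t"] have "(r * cos t) * (r * cos t) + (r * sin t) * (r * sin t) = r * r"
    unfolding sin_cos_squared_add3 by simp
  then show ?thesis by (simp only: norm_eq_sqrt_inner inner_real2 vector_2 real_sqrt_abs2)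
qed

lemma norm_ray:
  assumes "s \<in> {1, - 1}"
  shows "norm (ray \<theta> s r - ray \<theta> s r') = \<bar>r - r'\<bar>"
proof -
  have "ray \<theta> s r - ray \<theta> s r' = vector [(r - r') * cos (s * \<theta>), (r - r') * sin (s * \<theta>)]"
    using assms by (auto simp: ray_def vec_eq_iff forall_2 vector_2 algebra_simps)
  then show ?thesis by (simp add: norm_vector_polar)
qed

text \<open>Reflection in the axis of the sector reduces the lower side to the upper one; the sign
  \<open>s\<close> carries the reflection.\<close>

lemma ray_halfplane:
  assumes \<theta>: "0 < \<theta>" "\<theta> < pi" and s: "s \<in> {1, - 1}" and r: "0 < r"
  obtains W where "open W" "ray \<theta> s r \<in> W" "\<And>w. w \<in> W \<Longrightarrow> w \<in> sector \<theta> \<longleftrightarrow> 0 < w \<bullet> vector [sin \<theta>, - (s * cos \<theta>)]"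
proof -
  define \<tau> where "\<tau> = min (pi / 2) (min (2 * \<theta>) (2 * pi - 2 * \<theta>)) / 2"
  have \<tau>: "0 < \<tau>" "\<tau> < pi / 2" "\<tau> < 2 * \<theta>" "\<tau> < 2 * pi - 2 * \<theta>" using \<theta> by (auto simp: \<tau>_def min_def)
  define a where "a = (\<lambda>w::real^2. w $ 1 * cos \<theta> + (s * w $ 2) * sin \<theta>)"
  define b where "b = (\<lambda>w::real^2. w $ 1 * sin \<theta> - (s * w $ 2) * cos \<theta>)"
  define W where "W = {w. 0 < a w \<and> \<bar>b w\<bar> < tan \<tau> * a w}"
  have "open W" unfolding W_def a_def b_def
    by (intro open_Collect_conj open_Collect_less continuous_intros)
  moreover have "ray \<theta> s r \<in> W"
  proof -
    have "(r * c) * c + (1 * (1 * (r * d))) * d = r * (c * c + d * d)" 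
      "(r * c) * c + (- 1 * (- 1 * (r * d))) * d = r * (c * c + d * d)" for c d :: real by (simp_all add: algebra_simps)
    from this[of "cos \<theta>" "sin \<theta>"] have "a (ray \<theta> s r) = r"
      using s unfolding a_def ray_def vector_2 sin_cos_squared_add3 by auto
    moreover have "b (ray \<theta> s r) = 0" using s by (auto simp: b_def ray_def vector_2)
    ultimately show ?thesis using r \<tau> tan_gt_zero[of \<tau>] by (simp add: W_def)
  qed
  moreover have "w \<in> sector \<theta> \<longleftrightarrow> 0 < w \<bullet> vector [sin \<theta>, - (s * cos \<theta>)]" if "w \<in> W" for w
  proof -
    have "w \<in> sector \<theta> \<longleftrightarrow> (\<exists>r t. 0 < r \<and> \<bar>t\<bar> < \<theta> \<and> w $ 1 = r * cos t \<and> s * w $ 2 = r * sin t)"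
    proof (cases "s = 1")
      case False
      then have s': "s = - 1" using s by simp
      show ?thesis unfolding mem_sector s'
      proof (intro iffI; elim exE conjE)
        fix r t assume *: "0 < r" "\<bar>t\<bar> < \<theta>" "w $ 1 = r * cos t" "w $ 2 = r * sin t"
        then show "\<exists>r t. 0 < r \<and> \<bar>t\<bar> < \<theta> \<and> w $ 1 = r * cos t \<and> - 1 * w $ 2 = r * sin t"
          by (intro exI[of _ r] exI[of _ "- t"]) simp
      next
        fix r t assume *: "0 < r" "\<bar>t\<bar> < \<theta>" "w $ 1 = r * cos t" "- 1 * w $ 2 = r * sin t"
        then show "\<exists>r t. 0 < r \<and> \<bar>t\<bar> < \<theta> \<and> w $ 1 = r * cos t \<and> w $ 2 = r * sin t"
          by (intro exI[of _ r] exI[of _ "- t"]) simp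
      qed
    qed (simp add: mem_sector)
    also have "\<dots> \<longleftrightarrow> 0 < b w"
      unfolding b_def using that by (intro sector_near_side[OF \<theta> \<tau>]) (auto simp: W_def a_def b_def)
    also have "b w = w \<bullet> vector [sin \<theta>, - (s * cos \<theta>)]" by (simp add: b_def inner_real2 vector_2)
    finally show ?thesis .
  qed
  ultimately show thesis by (rule that)
qed

text \<open>Along an approximating sequence the radii converge, being norms, and the angles have a
  convergent subsequence in a compact interval. A limit outside the sector has radius 0 or an
  extreme angle.\<close>

lemma closure_sector_ray:
  assumes "z \<in> closure (sector \<theta>)" "z \<notin> sector \<theta>"
  obtains s r where "s \<in> {1, - 1}" "0 \<le> r" "z = ray \<theta> s r"
proof -
  obtain x where x: "\<And>n. x n \<in> sector \<theta>" "x \<longlonglongrightarrow> z" using assms(1) by (auto simp: closure_sequential)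
  have "\<exists>r t. 0 < r \<and> \<bar>t\<bar> < \<theta> \<and> x n = vector [r * cos t, r * sin t]" for n
    using x(1)[of n] by (auto simp: sector_def)
  then obtain r t where rt: "\<And>n. 0 < r n" "\<And>n. \<bar>t n\<bar> < \<theta>" "\<And>n. x n = vector [r n * cos (t n), r n * sin (t n)]"
    by metis
  have "\<forall>n. t n \<in> {- \<theta>..\<theta>}" using rt(2) by (auto simp: abs_less_iff intro: less_imp_le) (metis less_imp_le minus_less_iff)
  then obtain l \<sigma> where l: "l \<in> {- \<theta>..\<theta>}" "strict_mono (\<sigma> :: nat \<Rightarrow> nat)" "(t \<circ> \<sigma>) \<longlonglongrightarrow> l"
    using compact_Icc[of "- \<theta>" \<theta>] unfolding compact_def by blast
  have rn: "r n = norm (x n)" for n using rt(1)[of n] by (simp add: rt(3) norm_vector_polar)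
  have xs: "(x \<circ> \<sigma>) \<longlonglongrightarrow> z" using x(2) l(2) by (rule LIMSEQ_subseq_LIMSEQ)
  define \<rho> where "\<rho> = norm z"
  have rs: "(\<lambda>n. r (\<sigma> n)) \<longlonglongrightarrow> \<rho>" unfolding rn \<rho>_def using tendsto_norm[OF xs] by (simp add: o_def)
  have ts: "(\<lambda>n. t (\<sigma> n)) \<longlonglongrightarrow> l" using l(3) by (simp add: o_def)
  have "(\<lambda>n. x (\<sigma> n) $ 1) \<longlonglongrightarrow> z $ 1" "(\<lambda>n. x (\<sigma> n) $ 2) \<longlonglongrightarrow> z $ 2"
    using xs by (auto simp: o_def intro: tendsto_vec_nth)
  moreover have "(\<lambda>n. x (\<sigma> n) $ 1) \<longlonglongrightarrow> \<rho> * cos l" "(\<lambda>n. x (\<sigma> n) $ 2) \<longlonglongrightarrow> \<rho> * sin l"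
    unfolding rt(3) vector_2 by (intro tendsto_intros rs ts)+
  ultimately have z: "z $ 1 = \<rho> * cos l" "z $ 2 = \<rho> * sin l" using LIMSEQ_unique by blast+
  have \<rho>: "0 \<le> \<rho>" by (simp add: \<rho>_def)
  have "\<rho> = 0 \<or> \<bar>l\<bar> = \<theta>"
    using assms(2) z \<rho> l(1) unfolding mem_sector by (metis abs_le_iff atLeastAtMost_iff linorder_not_less minus_le_iff order_le_imp_less_or_eq)
  then consider "\<rho> = 0" | "l = \<theta>" | "l = - \<theta>" by (auto simp: abs_if split: if_splits)
  then show thesis
  proof cases
    case 1
    then show ?thesis using z by (intro that[of 1 0]) (auto simp: ray_def vec_eq_iff forall_2 vector_2)
  next
    case 2
    then show ?thesis using z \<rho> by (intro that[of 1 \<rho>]) (auto simp: ray_def vec_eq_iff forall_2 vector_2)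
  next
    case 3
    then show ?thesis using z \<rho> by (intro that[of "- 1" \<rho>]) (auto simp: ray_def vec_eq_iff forall_2 vector_2)
  qed
qed

section \<open>Charts at frontier points\<close>

lemma Ck_on_2_derivative:
  assumes "Ck_on 2 f U" "x \<in> U"
  shows "(f has_derivative frechet_derivative f (at x)) (at x)"
proof -
  have "f differentiable (at x)" using assms by (simp add: numeral_2_eq_2)
  then show ?thesis by (simp add: frechet_derivative_works)
qed

lemma Ck_on_2_continuous:
  assumes "Ck_on 2 f U"
  shows "continuous_on U (\<lambda>x. frechet_derivative f (at x) v)"
proof -
  have "(\<lambda>x. frechet_derivative f (at x) v) differentiable (at x)" if "x \<in> U" for x
    using assms that by (simp add: numeral_2_eq_2)
  then show ?thesis 
    by (intro differentiable_imp_continuous_on) (auto simp: differentiable_on_def intro: differentiable_at_withinI)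
qed

lemma Ck_on_2_lipschitz:
  fixes f :: "'a::euclidean_space \<Rightarrow> 'b::euclidean_space"
  assumes f: "Ck_on 2 f U" and r: "cball x r \<subseteq> U"
  obtains L where "1 \<le> L" "\<And>z w. z \<in> cball x r \<Longrightarrow> w \<in> cball x r \<Longrightarrow> dist (f z) (f w) \<le> L * dist z w"
proof -
  define g where "g = (\<lambda>z. \<Sum>b\<in>Basis. norm (frechet_derivative f (at z) b))"
  have "continuous_on (cball x r) g" unfolding g_def
    by (intro continuous_intros continuous_on_subset[OF Ck_on_2_continuous[OF f] r])
  then have "bounded (g ` cball x r)" by (intro compact_imp_bounded compact_continuous_image compact_cball)
  then obtain B where "\<forall>y\<in>g ` cball x r. norm y \<le> B" unfolding bounded_iff by blast
  then have B: "\<bar>g z\<bar> \<le> B" if "z \<in> cball x r" for z using that by simp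
  show thesis
  proof (rule that[of "max 1 B"])
    fix z w assume zw: "z \<in> cball x r" "w \<in> cball x r"
    have "norm (f z - f w) \<le> max 1 B * norm (z - w)"
    proof (rule differentiable_bound[OF convex_cball _ _ zw])
      fix y assume y: "y \<in> cball x r"
      note d = Ck_on_2_derivative[OF f subsetD[OF r y]]
      show "(f has_derivative frechet_derivative f (at y)) (at y within cball x r)"
        using d by (rule has_derivative_at_withinI)
      have "onorm (frechet_derivative f (at y)) \<le> g y"
        unfolding g_def by (rule onorm_componentwise[OF has_derivative_bounded_linear[OF d]])
      then show "onorm (frechet_derivative f (at y)) \<le> max 1 B" using B[OF y] by simp
    qed
    then show "dist (f z) (f w) \<le> max 1 B * dist z w" by (simp add: dist_norm)
  qed simp
qed


text \<open>Off the centre, frontier points are carried to the open sides of the sector, near which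
  it is a half-plane, so a linear functional of the chart is a defining function. The centre may be
  a corner and is controlled by counting: the frontier near it lies in the Lipschitz image of two
  segments, hence in O(\<rho> / t) balls of radius t.\<close>

lemma chart_at_frontier:
  assumes \<Omega>: "curvilinear_polygon \<Omega>" and x: "x \<in> frontier \<Omega>"
  shows "\<exists>R>0. \<exists>c\<ge>0. (\<forall>y\<in>frontier \<Omega> \<inter> ball x R - {x}. \<forall>\<delta>>0. \<exists>e r. flat \<Omega> \<delta> e y r) \<and>
    (\<forall>\<rho> t. 0 < t \<and> t \<le> \<rho> \<and> \<rho> \<le> R \<longrightarrow>
       (\<exists>F. finite F \<and> real (card F) \<le> c * \<rho> / t \<and> frontier \<Omega> \<inter> cball x \<rho> \<subseteq> (\<Union>q\<in>F. cball q t)))"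
proof -
  have o\<Omega>: "open \<Omega>" using \<Omega> by (simp add: curvilinear_polygon_def)
  have x\<Omega>: "x \<notin> \<Omega>" "x \<in> closure \<Omega>" using x o\<Omega> by (auto simp: frontier_def interior_open)
  from \<Omega> x\<Omega>(2) obtain K where K: "K = UNIV \<or> (\<exists>\<theta>. 0 < \<theta> \<and> \<theta> < pi \<and> K = sector \<theta>)"
    "\<forall>\<^sub>F \<eta> in at_right 0. \<exists>V \<Phi> \<Psi>. C2_diffeomorphism (ball x \<eta>) V \<Phi> \<Psi> \<and> \<Phi> x = 0 \<and> \<Phi> ` (\<Omega> \<inter> ball x \<eta>) = K \<inter> V"
    unfolding curvilinear_polygon_def by (elim conjE bspec[elim_format] exE) blast
  have "\<forall>\<^sub>F \<eta> in at_right (0::real). 0 < \<eta>" by (simp add: eventually_at_filter)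
  from eventually_happens[OF eventually_conj[OF this K(2)]] obtain \<eta> V \<Phi> \<Psi> where \<eta>: "0 < \<eta>"
    and C: "C2_diffeomorphism (ball x \<eta>) V \<Phi> \<Psi>" and \<Phi>x: "\<Phi> x = 0" and im: "\<Phi> ` (\<Omega> \<inter> ball x \<eta>) = K \<inter> V"
    using trivial_limit_at_right_real by blast
  define U where "U = ball x \<eta>"
  have oU: "open U" "x \<in> U" using \<eta> by (auto simp: U_def)
  from C have oV: "open V" and h: "homeomorphism U V \<Phi> \<Psi>" and d\<Phi>: "Ck_on 2 \<Phi> U" and d\<Psi>: "Ck_on 2 \<Psi> V"
    by (auto simp: C2_diffeomorphism_def U_def)
  have \<Psi>\<Phi>: "\<Psi> (\<Phi> z) = z" "\<Phi> z \<in> V" if "z \<in> U" for z using h that by (auto simp: homeomorphism_def)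
  have \<Phi>\<Psi>: "\<Phi> (\<Psi> w) = w" "\<Psi> w \<in> U" if "w \<in> V" for w using h that by (auto simp: homeomorphism_def)
  have c\<Phi>: "continuous_on U \<Phi>" using h by (simp add: homeomorphism_def)
  have memK: "z \<in> \<Omega> \<longleftrightarrow> \<Phi> z \<in> K" if z: "z \<in> U" for z
  proof
    assume "z \<in> \<Omega>"
    then have "\<Phi> z \<in> \<Phi> ` (\<Omega> \<inter> ball x \<eta>)" using z by (auto simp: U_def)
    then show "\<Phi> z \<in> K" using im by blast
  next
    assume "\<Phi> z \<in> K"
    then have "\<Phi> z \<in> \<Phi> ` (\<Omega> \<inter> ball x \<eta>)" using im \<Psi>\<Phi>(2)[OF z] by blast
    then obtain z' where "z' \<in> \<Omega>" "z' \<in> U" "\<Phi> z' = \<Phi> z" by (auto simp: U_def)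
    then show "z \<in> \<Omega>" using \<Psi>\<Phi>(1) z by metis
  qed
  \<comment> \<open>With the whole plane as model the frontier point would belong to the open
    set.\<close>
  have "K \<noteq> UNIV" using memK[OF oU(2)] x\<Omega>(1) by blast
  then obtain \<theta> where \<theta>: "0 < \<theta>" "\<theta> < pi" "K = sector \<theta>" using K(1) by blast
  note mem = memK[unfolded \<theta>(3)]
  have fr: "\<Phi> z \<in> closure (sector \<theta>) \<and> \<Phi> z \<notin> sector \<theta>" if z: "z \<in> frontier \<Omega>" "z \<in> U" for z
  proof
    have "z \<notin> \<Omega>" "z \<in> closure \<Omega>" using z(1) o\<Omega> by (auto simp: frontier_def interior_open)
    then show "\<Phi> z \<notin> sector \<theta>" using mem[OF z(2)] by blast
    show "\<Phi> z \<in> closure (sector \<theta>)"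
    proof (rule ccontr)
      assume a: "\<Phi> z \<notin> closure (sector \<theta>)"
      have "open (U \<inter> \<Phi> -` (- closure (sector \<theta>)))"
        by (rule continuous_open_preimage[OF c\<Phi> oU(1)]) (simp add: open_Compl)
      moreover have "z \<in> U \<inter> \<Phi> -` (- closure (sector \<theta>))" using a z by simp
      ultimately obtain w where "w \<in> \<Omega>" "w \<in> U" "\<Phi> w \<notin> closure (sector \<theta>)"
        using \<open>z \<in> closure \<Omega>\<close> open_Int_closure_eq_empty[of "U \<inter> \<Phi> -` (- closure (sector \<theta>))" \<Omega>] by blast
      then show False using mem[of w] closure_subset[of "sector \<theta>"] by blast
    qed
  qed
  have smooth_pt: "\<exists>e r. flat \<Omega> \<delta> e y r" if y: "y \<in> frontier \<Omega>" "y \<in> U" "y \<noteq> x" and \<delta>: "0 < \<delta>" for y \<delta>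
  proof -
    obtain s r where s: "s \<in> {1, - 1}" "0 \<le> r" "\<Phi> y = ray \<theta> s r"
      using closure_sector_ray fr[OF y(1,2)] by blast
    have "\<Phi> y \<noteq> 0" using \<Psi>\<Phi>(1)[OF y(2)] \<Psi>\<Phi>(1)[OF oU(2)] y(3) \<Phi>x by metis
    then have "r \<noteq> 0" using s(3) by (auto simp: ray_def vec_eq_iff forall_2 vector_2)
    then have r: "0 < r" using s(2) by simp
    define \<nu> :: "real^2" where "\<nu> = vector [sin \<theta>, - (s * cos \<theta>)]"
    obtain W where W: "open W" "\<Phi> y \<in> W" "\<And>w. w \<in> W \<Longrightarrow> w \<in> sector \<theta> \<longleftrightarrow> 0 < w \<bullet> \<nu>"
      unfolding \<nu>_def using ray_halfplane[OF \<theta>(1,2) s(1) r] s(3) by metis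
    have \<nu>: "\<nu> \<bullet> \<nu> = 1"
    proof -
      have "\<nu> \<bullet> \<nu> = cos \<theta> * cos \<theta> + sin \<theta> * sin \<theta>" using s(1) by (auto simp: \<nu>_def inner_real2 vector_2 add.commute simp del: sin_cos_squared_add3)
      then show ?thesis by (simp only: sin_cos_squared_add3)
    qed
    let ?D = "\<lambda>z v. frechet_derivative \<Phi> (at z) v \<bullet> \<nu>"
    \<comment> \<open>By the chain rule for the mutually inverse charts, the derivative of \<Phi>
      maps \<open>v0\<close> to \<nu>; so the defining function has nonzero derivative along
      \<open>v0\<close>.\<close>
    define v0 where "v0 = frechet_derivative \<Psi> (at (\<Phi> y)) \<nu>"
    have id: "frechet_derivative \<Phi> (at y) v0 = \<nu>"
    proof -
      have Vy: "\<Phi> y \<in> V" using \<Psi>\<Phi>(2)[OF y(2)] .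
      have 1: "(\<Phi> has_derivative frechet_derivative \<Phi> (at y)) (at (\<Psi> (\<Phi> y)))"
        using Ck_on_2_derivative[OF d\<Phi> y(2)] \<Psi>\<Phi>(1)[OF y(2)] by simp
      have "((\<lambda>w. \<Phi> (\<Psi> w)) has_derivative (\<lambda>v. frechet_derivative \<Phi> (at y) (frechet_derivative \<Psi> (at (\<Phi> y)) v))) (at (\<Phi> y))"
        by (rule has_derivative_compose[OF Ck_on_2_derivative[OF d\<Psi> Vy] 1])
      moreover have "((\<lambda>w. \<Phi> (\<Psi> w)) has_derivative (\<lambda>v. v)) (at (\<Phi> y))"
        by (rule has_derivative_transform_within_open[OF has_derivative_ident oV Vy]) (simp add: \<Phi>\<Psi>(1))
      ultimately have "(\<lambda>v. frechet_derivative \<Phi> (at y) (frechet_derivative \<Psi> (at (\<Phi> y)) v)) = (\<lambda>v. v)"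
        by (rule has_derivative_unique)
      then show ?thesis unfolding v0_def by (rule fun_cong)
    qed
    show ?thesis
    proof (rule flat_of_defining_function[where W = "U \<inter> \<Phi> -` W" and F = "\<lambda>z. \<Phi> z \<bullet> \<nu>" and D = ?D and u = v0])
      show "open (U \<inter> \<Phi> -` W)" by (rule continuous_open_preimage[OF c\<Phi> oU(1) W(1)])
      show "y \<in> U \<inter> \<Phi> -` W" using y(2) W(2) by simp
      fix z assume "z \<in> U \<inter> \<Phi> -` W"
      then have z: "z \<in> U" "\<Phi> z \<in> W" by auto
      show "((\<lambda>z. \<Phi> z \<bullet> \<nu>) has_derivative ?D z) (at z)"
        using Ck_on_2_derivative[OF d\<Phi> z(1)] by (rule has_derivative_inner_left)
      show "z \<in> \<Omega> \<longleftrightarrow> 0 < \<Phi> z \<bullet> \<nu>" using mem[OF z(1)] W(3)[OF z(2)] by simp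
    next
      show "continuous_on (U \<inter> \<Phi> -` W) (\<lambda>z. ?D z v)" for v
        by (intro continuous_intros continuous_on_subset[OF Ck_on_2_continuous[OF d\<Phi>]]) auto
      show "?D y v0 \<noteq> 0" unfolding id \<nu> by simp
    qed (fact o\<Omega> \<delta>)+
  qed
  have V0: "0 \<in> V" using \<Psi>\<Phi>(2)[OF oU(2)] \<Phi>x by simp
  obtain r1 where r1: "0 < r1" "cball 0 r1 \<subseteq> V" using oV V0 open_contains_cball by blast
  obtain L2 where L2: "1 \<le> L2" "\<And>z w. z \<in> cball 0 r1 \<Longrightarrow> w \<in> cball 0 r1 \<Longrightarrow> dist (\<Psi> z) (\<Psi> w) \<le> L2 * dist z w"
    using Ck_on_2_lipschitz[OF d\<Psi> r1(2)] by blast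
  obtain r2 where r2: "0 < r2" "cball x r2 \<subseteq> U" using oU open_contains_cball by blast
  obtain L1 where L1: "1 \<le> L1" "\<And>z w. z \<in> cball x r2 \<Longrightarrow> w \<in> cball x r2 \<Longrightarrow> dist (\<Phi> z) (\<Phi> w) \<le> L1 * dist z w"
    using Ck_on_2_lipschitz[OF d\<Phi> r2(2)] by blast
  \<comment> \<open>Points within \<open>R\<close> of the centre are mapped into the ball on which
    the inverse chart is Lipschitz.\<close>
  define R where "R = min r2 (r1 / L1)"
  have R: "0 < R" "R \<le> r2" "L1 * R \<le> r1" using r1 r2 L1(1) by (auto simp: R_def min_def field_simps)
  define c where "c = 2 * L1 * L2 + 2"
  have c: "0 \<le> c" using L1(1) L2(1) by (simp add: c_def)
  have A1: "\<exists>e r. flat \<Omega> \<delta> e y r" if "y \<in> frontier \<Omega> \<inter> ball x R - {x}" "0 < \<delta>" for y \<delta>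
  proof -
    note that
    moreover have "ball x R \<subseteq> U" using R(2) r2(2) by (meson ball_subset_cball order_trans subset_ball subset_cball)
    ultimately show "\<exists>e r. flat \<Omega> \<delta> e y r" by (intro smooth_pt) auto
  qed
  have A2: "\<exists>F. finite F \<and> real (card F) \<le> c * \<rho> / t \<and> frontier \<Omega> \<inter> cball x \<rho> \<subseteq> (\<Union>q\<in>F. cball q t)"
    if t: "0 < t" "t \<le> \<rho>" "\<rho> \<le> R" for \<rho> t
  proof -
    define N where "N = nat \<lfloor>L1 * \<rho> * L2 / t\<rfloor>"
    \<comment> \<open>Grid points of mesh t / L2 on both sides of the sector, pulled back by \<Psi>,
      so that the mesh becomes at most t. There are at most 2 (N + 1) of them, and t \<le> \<rho>
      absorbs the additive 2 into c \<rho> / t.\<close>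
    define F where "F = (\<lambda>(s, k). \<Psi> (ray \<theta> s (real k * (t / L2)))) ` ({1, - 1} \<times> {..N})"
    have "finite F" by (simp add: F_def)
    moreover have "real (card F) \<le> c * \<rho> / t"
    proof -
      have "card F \<le> card ({1, - 1 :: real} \<times> {..N})" unfolding F_def by (rule card_image_le) simp
      then have "real (card F) \<le> 2 * (real N + 1)" by simp
      also have "real N \<le> L1 * \<rho> * L2 / t" unfolding N_def using L1(1) L2(1) t by (intro of_nat_floor) auto
      also have "2 * (L1 * \<rho> * L2 / t + 1) \<le> 2 * (L1 * \<rho> * L2 / t + \<rho> / t)"
      proof -
        have "1 \<le> \<rho> / t" using t by simp
        then show ?thesis by (intro mult_left_mono add_left_mono) auto
      qed
      also have "\<dots> = c * \<rho> / t" using t by (simp add: c_def field_simps)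
      finally show ?thesis by simp
    qed
    moreover have "frontier \<Omega> \<inter> cball x \<rho> \<subseteq> (\<Union>q\<in>F. cball q t)"
    proof
      fix z assume "z \<in> frontier \<Omega> \<inter> cball x \<rho>"
      then have z: "z \<in> frontier \<Omega>" "z \<in> cball x \<rho>" by auto
      have z2: "z \<in> cball x r2" using z(2) t(3) R(2) by auto
      then have zU: "z \<in> U" using r2(2) by blast
      obtain s r where s: "s \<in> {1, - 1}" "0 \<le> r" "\<Phi> z = ray \<theta> s r"
        using closure_sector_ray fr[OF z(1) zU] by blast
      have r0: "ray \<theta> s 0 = 0" by (simp add: ray_def vec_eq_iff forall_2 vector_2)
      have nr: "norm (ray \<theta> s q) = \<bar>q\<bar>" for q using norm_ray[OF s(1), of \<theta> q 0] by (simp add: r0)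
      have "r = dist (\<Phi> z) (\<Phi> x)" using s(2) nr[of r] by (simp add: \<Phi>x s(3))
      also have "\<dots> \<le> L1 * dist z x" using L1(2)[OF z2, of x] r2(1) by simp
      also have "\<dots> \<le> L1 * \<rho>" using z(2) L1(1) by (intro mult_left_mono) (auto simp: dist_commute)
      finally have rL: "r \<le> L1 * \<rho>" .
      then have "r \<le> r1" using R(3) t(3) L1(1) mult_left_mono[of \<rho> R L1] by linarith
      define h where "h = t / L2"
      have h: "0 < h" "L2 * h = t" using t L2(1) by (auto simp: h_def)
      define k where "k = nat \<lfloor>r / h\<rfloor>"
      have "real k = of_int \<lfloor>r / h\<rfloor>" using s(2) h by (simp add: k_def)
      then have "real k \<le> r / h" "r / h < real k + 1" by linarith+
      then have k: "real k * h \<le> r" "r < real k * h + h" using h(1) by (auto simp: field_simps)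
      have "r / h \<le> L1 * \<rho> * L2 / t" using rL h(1) t(1) L2(1) unfolding h_def by (simp add: divide_right_mono mult_right_mono)
      then have "k \<le> N" unfolding k_def N_def by (intro nat_mono floor_mono)
      define q where "q = \<Psi> (ray \<theta> s (real k * h))"
      have "q \<in> F" unfolding F_def q_def h_def using s(1) \<open>k \<le> N\<close> by (intro image_eqI[of _ _ "(s, k)"]) auto
      have "dist q z = dist (\<Psi> (ray \<theta> s (real k * h))) (\<Psi> (ray \<theta> s r))"
        using \<Psi>\<Phi>(1)[OF zU] s(3) by (simp add: q_def)
      also have "\<dots> \<le> L2 * dist (ray \<theta> s (real k * h)) (ray \<theta> s r)"
        using nr k h(1) \<open>r \<le> r1\<close> s(2) by (intro L2(2)) (auto simp: dist_norm)
      also have "\<dots> = L2 * \<bar>real k * h - r\<bar>" by (simp add: dist_norm norm_ray[OF s(1)])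
      also have "\<dots> \<le> L2 * h" using k L2(1) by (intro mult_left_mono) auto
      finally have "dist q z \<le> t" using h(2) by simp
      then show "z \<in> (\<Union>q\<in>F. cball q t)" using \<open>q \<in> F\<close> by auto
    qed
    ultimately show "\<exists>F. finite F \<and> real (card F) \<le> c * \<rho> / t \<and> frontier \<Omega> \<inter> cball x \<rho> \<subseteq> (\<Union>q\<in>F. cball q t)" by blast
  qed
  show ?thesis using R(1) c A1 A2 by (intro exI[of _ R] exI[of _ c]) auto
qed

text \<open>The centres of a finite cover by charts form \<open>X\<close>. Smooth points may occur
  among them besides corners, which does no harm: all of \<open>X\<close> is treated by small
  discs.\<close>

lemma frontier_structure:
  assumes \<Omega>: "curvilinear_polygon \<Omega>" "bounded \<Omega>"
  obtains X R c where "finite X" "X \<subseteq> frontier \<Omega>" "0 < R" "0 \<le> c"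
    "\<And>y \<delta>. y \<in> frontier \<Omega> - X \<Longrightarrow> 0 < \<delta> \<Longrightarrow> \<exists>e r. flat \<Omega> \<delta> e y r"
    "\<And>x \<rho> t. x \<in> X \<Longrightarrow> 0 < t \<Longrightarrow> t \<le> \<rho> \<Longrightarrow> \<rho> \<le> R \<Longrightarrow>
       \<exists>F. finite F \<and> real (card F) \<le> c * \<rho> / t \<and> frontier \<Omega> \<inter> cball x \<rho> \<subseteq> (\<Union>q\<in>F. cball q t)"
proof -
  have cf: "compact (frontier \<Omega>)" using \<Omega>(2) by (simp add: compact_frontier_bounded)
  obtain R c where Rc: "\<And>x. x \<in> frontier \<Omega> \<Longrightarrow> 0 < R x \<and> 0 \<le> c x \<and>
    (\<forall>y\<in>frontier \<Omega> \<inter> ball x (R x) - {x}. \<forall>\<delta>>0. \<exists>e r. flat \<Omega> \<delta> e y r) \<and>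
    (\<forall>\<rho> t. 0 < t \<and> t \<le> \<rho> \<and> \<rho> \<le> R x \<longrightarrow>
       (\<exists>F. finite F \<and> real (card F) \<le> c x * \<rho> / t \<and> frontier \<Omega> \<inter> cball x \<rho> \<subseteq> (\<Union>q\<in>F. cball q t)))"
    using chart_at_frontier[OF \<Omega>(1)] by metis
  have "frontier \<Omega> \<subseteq> (\<Union>x\<in>frontier \<Omega>. ball x (R x))" using Rc by force
  then obtain X where X: "X \<subseteq> frontier \<Omega>" "finite X" "frontier \<Omega> \<subseteq> (\<Union>x\<in>X. ball x (R x))"
    using compactE_image[OF cf, of "frontier \<Omega>" "\<lambda>x. ball x (R x)"] by auto
  define R0 where "R0 = Min (insert 1 (R ` X))"
  define c0 where "c0 = (\<Sum>x\<in>X. c x)"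
  show thesis
  proof (rule that[OF X(2,1)])
    show "0 < R0" unfolding R0_def using X Rc by (subst Min_gr_iff) auto
    show "0 \<le> c0" unfolding c0_def using X Rc by (intro sum_nonneg) auto
    fix y and \<delta> :: real assume y: "y \<in> frontier \<Omega> - X" and \<delta>: "0 < \<delta>"
    then obtain x where x: "x \<in> X" "y \<in> ball x (R x)" using X(3) by blast
    then have "y \<in> frontier \<Omega> \<inter> ball x (R x) - {x}" using y by blast
    then show "\<exists>e r. flat \<Omega> \<delta> e y r" using Rc x(1) X(1) \<delta> by blast
  next
    fix x \<rho> t assume x: "x \<in> X" and t: "0 < t" "t \<le> \<rho>" "\<rho> \<le> R0"
    have xf: "x \<in> frontier \<Omega>" using x X(1) by blast
    have "R0 \<le> R x" unfolding R0_def using x X(2) by (intro Min_le) auto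
    then have "0 < t \<and> t \<le> \<rho> \<and> \<rho> \<le> R x" using t by simp
    then obtain F where F: "finite F" "real (card F) \<le> c x * \<rho> / t" "frontier \<Omega> \<inter> cball x \<rho> \<subseteq> (\<Union>q\<in>F. cball q t)"
      using Rc[OF xf] by metis
    have "c x \<le> c0" unfolding c0_def using x X Rc by (intro member_le_sum) auto
    then have "c x * \<rho> / t \<le> c0 * \<rho> / t" using t by (intro divide_right_mono mult_right_mono) auto
    then show "\<exists>F. finite F \<and> real (card F) \<le> c0 * \<rho> / t \<and> frontier \<Omega> \<inter> cball x \<rho> \<subseteq> (\<Union>q\<in>F. cball q t)"
      using F by (intro exI[of _ F]) auto
  qed
qed

section \<open>Approximation of the boundary by flat pieces\<close>

lemma measure_le_of_emeasure_less:
  assumes "S \<in> lmeasurable" "emeasure lebesgue S < ennreal e"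
  shows "measure lebesgue S \<le> e"
proof -
  have "ennreal (measure lebesgue S) < ennreal e" using assms by (simp add: emeasure_eq_measure2)
  then show ?thesis by (simp add: ennreal_less_iff)
qed

text \<open>Inner and outer regularity, each with half of the error. For the flat pieces, the
  compact set will give disjoint parts of the frontier and the open set will leave room to cover
  it.\<close>

lemma borel_sandwich:
  fixes S :: "real set"
  assumes S: "S \<in> sets borel" "bounded S" and e: "0 < e"
  obtains E U where "compact E" "open U" "E \<subseteq> S" "S \<subseteq> U" "U \<in> lmeasurable" "measure lebesgue U \<le> measure lebesgue E + e"
proof -
  have SL: "S \<in> sets lebesgue" using S(1) by simp
  have Slm: "S \<in> lmeasurable" using S by (simp add: bounded_set_imp_lmeasurable)
  have e2: "0 < e / 2" using e by simp
  obtain E where E: "closed E" "E \<subseteq> S" "S - E \<in> lmeasurable" "emeasure lebesgue (S - E) < ennreal (e / 2)"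
    using sets_lebesgue_inner_closed[OF SL e2] by blast
  obtain U where U: "open U" "S \<subseteq> U" "U - S \<in> lmeasurable" "emeasure lebesgue (U - S) < ennreal (e / 2)"
    using sets_lebesgue_outer_open[OF SL e2] by blast
  have cE: "compact E" using E(1,2) S(2) bounded_subset compact_eq_bounded_closed by blast
  then have El: "E \<in> lmeasurable" by (rule lmeasurable_compact)
  have "measure lebesgue S = measure lebesgue (E \<union> (S - E))" using E(2) by (simp add: Un_absorb1)
  also have "\<dots> \<le> measure lebesgue E + measure lebesgue (S - E)" using El E(3) by (intro measure_Un_le) auto
  finally have 1: "measure lebesgue S \<le> measure lebesgue E + e / 2" using measure_le_of_emeasure_less[OF E(3,4)] by linarith
  have US: "U = S \<union> (U - S)" using U(2) by blast
  have "measure lebesgue U = measure lebesgue (S \<union> (U - S))" using US by simp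
  also have "\<dots> \<le> measure lebesgue S + measure lebesgue (U - S)" using Slm U(3) by (intro measure_Un_le) auto
  finally have 2: "measure lebesgue U \<le> measure lebesgue S + e / 2" using measure_le_of_emeasure_less[OF U(3,4)] by linarith
  have "U \<in> lmeasurable" using US Slm U(3) by (metis fmeasurable.Un)
  then show thesis using that[OF cE U(1) E(2) U(2)] 1 2 by linarith
qed

abbreviation shadow :: "real^2 \<Rightarrow> (real^2) set \<Rightarrow> real set" where
  "shadow e A \<equiv> (\<lambda>z. z \<bullet> perp e) ` A"

lemma compact_shadow: "compact A \<Longrightarrow> compact (shadow e A)"
  by (intro compact_continuous_image continuous_intros)

lemma flat_inj:
  assumes "flat \<Omega> \<delta> e y r" "open \<Omega>"
  shows "inj_on (\<lambda>z. z \<bullet> perp e) (frontier \<Omega> \<inter> ball y r)"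
proof (rule inj_onI)
  fix z w assume zw: "z \<in> frontier \<Omega> \<inter> ball y r" "w \<in> frontier \<Omega> \<inter> ball y r" "z \<bullet> perp e = w \<bullet> perp e"
  have "dist z w \<le> 0" using flat_dist[OF assms zw(2,1)] zw(3) by simp
  then show "z = w" by simp
qed

text \<open>Balls around flat points overlap, so their shadows would be counted repeatedly. A
  disjoint Borel partition has the right total, and regularity on the line replaces it by disjoint
  compact pieces \<open>K'\<close> from inside and by covering compact pieces \<open>K\<close> from
  outside, at a loss of \<eta>.\<close>

lemma flat_pieces:
  assumes \<Omega>: "open \<Omega>" and Y: "compact Y" "Y \<subseteq> frontier \<Omega>" "\<And>y. y \<in> Y \<Longrightarrow> \<exists>e r. flat \<Omega> \<delta> e y r" and \<eta>: "0 < \<eta>"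
  obtains N :: nat and y r e K K' where "\<And>j. j < N \<Longrightarrow> flat \<Omega> \<delta> (e j) (y j) (r j)"
    "\<And>j. j < N \<Longrightarrow> compact (K j)" "\<And>j. j < N \<Longrightarrow> K j \<subseteq> frontier \<Omega> \<inter> ball (y j) (r j)"
    "\<And>j. j < N \<Longrightarrow> compact (K' j)" "\<And>j. j < N \<Longrightarrow> K' j \<subseteq> frontier \<Omega> \<inter> ball (y j) (r j)"
    "\<And>i j. i < N \<Longrightarrow> j < N \<Longrightarrow> i \<noteq> j \<Longrightarrow> K' i \<inter> K' j = {}" "Y \<subseteq> (\<Union>j<N. K j)"
    "(\<Sum>j<N. measure lebesgue (shadow (e j) (K j))) \<le> (\<Sum>j<N. measure lebesgue (shadow (e j) (K' j))) + \<eta>"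
proof -
  obtain e0 r0 where fl0: "\<And>y. y \<in> Y \<Longrightarrow> flat \<Omega> \<delta> (e0 y) y (r0 y)" using Y(3) by metis
  have r0: "0 < r0 y" if "y \<in> Y" for y using fl0[OF that] by (simp add: flat_def)
  have "Y \<subseteq> (\<Union>y\<in>Y. ball y (r0 y / 2))" using r0 by force
  then obtain D where D: "D \<subseteq> Y" "finite D" "Y \<subseteq> (\<Union>y\<in>D. ball y (r0 y / 2))"
    using compactE_image[OF Y(1), of Y "\<lambda>y. ball y (r0 y / 2)"] by auto
  define N where "N = card D"
  obtain y where y: "bij_betw y {0..<N} D" unfolding N_def using ex_bij_betw_nat_finite[OF D(2)] by blast
  have yD: "y j \<in> Y" if "j < N" for j using y that D(1) by (auto simp: bij_betw_def)
  define r where "r = (\<lambda>j. r0 (y j))"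
  define e where "e = (\<lambda>j. e0 (y j))"
  have fl: "flat \<Omega> \<delta> (e j) (y j) (r j)" if "j < N" for j using fl0[OF yD[OF that]] by (simp add: e_def r_def)
  have rp: "0 < r j" if "j < N" for j using r0[OF yD[OF that]] by (simp add: r_def)
  define Q where "Q = (\<lambda>j. cball (y j) (r j / 2))"
  have QB: "Q j \<subseteq> ball (y j) (r j)" if "j < N" for j using rp[OF that] by (auto simp: Q_def)
  have covQ: "\<exists>j<N. z \<in> Q j" if z: "z \<in> Y" for z
  proof -
    obtain x where x: "x \<in> D" "z \<in> ball x (r0 x / 2)" using D(3) z by blast
    have "x \<in> y ` {0..<N}" using y x(1) by (simp add: bij_betw_def)
    then obtain j where "j < N" "x = y j" by auto
    then show ?thesis using x(2) by (intro exI[of _ j]) (auto simp: Q_def r_def)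
  qed
  \<comment> \<open>Each point is assigned to the first ball that contains it.\<close>
  define A where "A = (\<lambda>j. (Y \<inter> Q j) - (\<Union>k<j. Q k))"
  have cQ: "compact (Y \<inter> Q j)" for j using Y(1) by (auto simp: Q_def)
  have YB: "Y \<inter> Q j \<subseteq> frontier \<Omega> \<inter> ball (y j) (r j)" if "j < N" for j using Y(2) QB[OF that] by blast
  have Sb: "shadow (e j) (A j) \<in> sets borel \<and> bounded (shadow (e j) (A j))" if j: "j < N" for j
  proof
    have Aeq: "A j = (Y \<inter> Q j) - (Y \<inter> Q j) \<inter> (\<Union>k<j. Q k)" by (auto simp: A_def)
    have "closed (\<Union>k<j. Q k)" unfolding Q_def by (intro closed_UN) auto
    then have c: "compact ((Y \<inter> Q j) \<inter> (\<Union>k<j. Q k))" by (rule compact_Int_closed[OF cQ])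
    \<comment> \<open>Images of Borel sets need not be Borel; here the projection is injective on
      the flat piece, so the image of the difference is a difference of compact images.\<close>
    have "shadow (e j) (A j) = shadow (e j) (Y \<inter> Q j) - shadow (e j) ((Y \<inter> Q j) \<inter> (\<Union>k<j. Q k))"
      unfolding Aeq by (rule inj_on_image_set_diff[OF flat_inj[OF fl[OF j] \<Omega>]]) (use YB[OF j] in blast)+
    moreover have "shadow (e j) (Y \<inter> Q j) \<in> sets borel" "shadow (e j) ((Y \<inter> Q j) \<inter> (\<Union>k<j. Q k)) \<in> sets borel"
      by (rule borel_closed[OF compact_imp_closed[OF compact_shadow[OF cQ]]],
          rule borel_closed[OF compact_imp_closed[OF compact_shadow[OF c]]])
    ultimately show "shadow (e j) (A j) \<in> sets borel" by simp
    have "A j \<subseteq> Y \<inter> Q j" by (auto simp: A_def)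
    then show "bounded (shadow (e j) (A j))"
      by (intro bounded_subset[OF compact_imp_bounded[OF compact_shadow[OF cQ[of j], of "e j"]]] image_mono)
  qed
  define \<eta>' where "\<eta>' = \<eta> / (real N + 1)"
  have \<eta>': "0 < \<eta>'" "real N * \<eta>' \<le> \<eta>" using \<eta> by (auto simp: \<eta>'_def field_simps)
  have "\<exists>E U. compact E \<and> open U \<and> E \<subseteq> shadow (e j) (A j) \<and> shadow (e j) (A j) \<subseteq> U \<and> U \<in> lmeasurable \<and>
     measure lebesgue U \<le> measure lebesgue E + \<eta>'" if "j < N" for j
    by (rule borel_sandwich[OF conjunct1[OF Sb[OF that]] conjunct2[OF Sb[OF that]] \<eta>'(1)]) (intro exI conjI)
  then have "\<forall>j\<in>{..<N}. \<exists>p. compact (fst p) \<and> open (snd p) \<and> fst p \<subseteq> shadow (e j) (A j) \<and> shadow (e j) (A j) \<subseteq> snd p \<and>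
     snd p \<in> lmeasurable \<and> measure lebesgue (snd p) \<le> measure lebesgue (fst p) + \<eta>'" by simp
  then have "\<exists>p. \<forall>j\<in>{..<N}. compact (fst (p j)) \<and> open (snd (p j)) \<and> fst (p j) \<subseteq> shadow (e j) (A j) \<and> shadow (e j) (A j) \<subseteq> snd (p j) \<and>
     snd (p j) \<in> lmeasurable \<and> measure lebesgue (snd (p j)) \<le> measure lebesgue (fst (p j)) + \<eta>'" by (rule bchoice)
  then obtain p where p: "\<forall>j\<in>{..<N}. compact (fst (p j)) \<and> open (snd (p j)) \<and> fst (p j) \<subseteq> shadow (e j) (A j) \<and> shadow (e j) (A j) \<subseteq> snd (p j) \<and>
     snd (p j) \<in> lmeasurable \<and> measure lebesgue (snd (p j)) \<le> measure lebesgue (fst (p j)) + \<eta>'" by (elim exE)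
  define E where "E = (\<lambda>j. fst (p j))"
  define U where "U = (\<lambda>j. snd (p j))"
  have EU: "\<And>j. j < N \<Longrightarrow> compact (E j)" "\<And>j. j < N \<Longrightarrow> open (U j)" "\<And>j. j < N \<Longrightarrow> E j \<subseteq> shadow (e j) (A j)"
    "\<And>j. j < N \<Longrightarrow> shadow (e j) (A j) \<subseteq> U j" "\<And>j. j < N \<Longrightarrow> U j \<in> lmeasurable"
    "\<And>j. j < N \<Longrightarrow> measure lebesgue (U j) \<le> measure lebesgue (E j) + \<eta>'" 
    using bspec[OF p] unfolding E_def U_def lessThan_iff by blast+
  define K' where "K' = (\<lambda>j. (Y \<inter> Q j) \<inter> (\<lambda>z. z \<bullet> perp (e j)) -` E j)"
  have K'A: "K' j \<subseteq> A j" if j: "j < N" for j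
  proof
    fix z assume z: "z \<in> K' j"
    then obtain a where a: "a \<in> A j" "z \<bullet> perp (e j) = a \<bullet> perp (e j)" using EU(3)[OF j] by (auto simp: K'_def)
    have "z \<in> frontier \<Omega> \<inter> ball (y j) (r j)" "a \<in> frontier \<Omega> \<inter> ball (y j) (r j)"
      using z a(1) YB[OF j] by (auto simp: K'_def A_def)
    then have "z = a" using inj_onD[OF flat_inj[OF fl[OF j] \<Omega>] a(2)] by blast
    then show "z \<in> A j" using a(1) by simp
  qed
  have shK': "shadow (e j) (K' j) = E j" if j: "j < N" for j
  proof
    show "shadow (e j) (K' j) \<subseteq> E j" by (auto simp: K'_def)
    show "E j \<subseteq> shadow (e j) (K' j)"
    proof
      fix s assume s: "s \<in> E j"
      then obtain a where "a \<in> A j" "s = a \<bullet> perp (e j)" using EU(3)[OF j] by auto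
      then show "s \<in> shadow (e j) (K' j)" using s by (auto simp: K'_def A_def)
    qed
  qed
  have cK': "compact (K' j)" if j: "j < N" for j
    unfolding K'_def by (intro compact_Int_closed[OF cQ] closed_vimage compact_imp_closed EU(1)[OF j] continuous_intros)
  \<comment> \<open>The open outer approximations of the shadows are pulled back to open sets of the
    plane; as they contain all the \<open>A j\<close>, they cover \<open>Y\<close>.\<close>
  define Op where "Op = (\<lambda>j. ball (y j) (r j) \<inter> (\<lambda>z. z \<bullet> perp (e j)) -` U j)"
  have oOp: "open (Op j)" if "j < N" for j
    unfolding Op_def by (intro open_Int open_ball open_vimage EU(2)[OF that] continuous_intros)
  have "Y \<subseteq> \<Union>(Op ` {..<N})"
  proof
    fix z assume z: "z \<in> Y"
    define j where "j = (LEAST j. j < N \<and> z \<in> Q j)"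
    have j: "j < N \<and> z \<in> Q j" unfolding j_def using covQ[OF z] by (rule LeastI_ex)
    have "z \<notin> Q k" if "k < j" for k
      using not_less_Least[of k "\<lambda>j. j < N \<and> z \<in> Q j"] that j unfolding j_def[symmetric] by auto
    then have "z \<in> A j" using j z by (auto simp: A_def)
    then have "z \<in> Op j" using EU(4)[of j] j QB[of j] by (auto simp: Op_def)
    then show "z \<in> \<Union>(Op ` {..<N})" using j by blast
  qed
  \<comment> \<open>A Lebesgue number of the cover: the points of \<open>Y\<close> whose
    \<open>l\<close>-ball fits into \<open>Op j\<close> form a compact subset of it, and these
    compact sets still cover \<open>Y\<close>.\<close>
  then obtain l where l: "0 < l" "\<And>z. z \<in> Y \<Longrightarrow> \<exists>T\<in>Op ` {..<N}. ball z l \<subseteq> T"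
    using Heine_Borel_lemma[OF Y(1), of "Op ` {..<N}"] oOp by blast
  define K where "K = (\<lambda>j. Y \<inter> (\<Inter>q\<in>- Op j. {z. l \<le> dist z q}))"
  have cK: "compact (K j)" for j
    unfolding K_def by (intro compact_Int_closed[OF Y(1)] closed_INT ballI closed_Collect_le continuous_intros)
  have KOp: "K j \<subseteq> Op j" for j using l(1) by (force simp: K_def)
  have covK: "Y \<subseteq> (\<Union>j<N. K j)"
  proof
    fix z assume z: "z \<in> Y"
    then obtain j where j: "j < N" "ball z l \<subseteq> Op j" using l(2)[OF z] by blast
    then have "z \<in> K j" using z by (force simp: K_def not_less[symmetric])
    then show "z \<in> (\<Union>j<N. K j)" using j by blast
  qed
  have "(\<Sum>j<N. measure lebesgue (shadow (e j) (K j))) \<le> (\<Sum>j<N. measure lebesgue (shadow (e j) (K' j)) + \<eta>')"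
  proof (rule sum_mono)
    fix j assume "j \<in> {..<N}"
    then have j: "j < N" by simp
    have "measure lebesgue (shadow (e j) (K j)) \<le> measure lebesgue (U j)"
      using KOp[of j] EU(5)[OF j] lmeasurable_compact[OF compact_shadow[OF cK]]
      by (intro measure_mono_fmeasurable) (auto simp: Op_def)
    then show "measure lebesgue (shadow (e j) (K j)) \<le> measure lebesgue (shadow (e j) (K' j)) + \<eta>'"
      using EU(6)[OF j] shK'[OF j] by simp
  qed
  also have "\<dots> \<le> (\<Sum>j<N. measure lebesgue (shadow (e j) (K' j))) + \<eta>" using \<eta>'(2) by (simp add: sum.distrib)
  finally have S: "(\<Sum>j<N. measure lebesgue (shadow (e j) (K j))) \<le> (\<Sum>j<N. measure lebesgue (shadow (e j) (K' j))) + \<eta>" .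
  have disj: "K' i \<inter> K' j = {}" if "i < N" "j < N" "i \<noteq> j" for i j
  proof -
    have "A i \<inter> A j = {}" using that(3) by (cases i j rule: linorder_cases) (auto simp: A_def)
    then show ?thesis using K'A[OF that(1)] K'A[OF that(2)] by blast
  qed
  have KB: "K j \<subseteq> frontier \<Omega> \<inter> ball (y j) (r j)" if "j < N" for j using KOp[of j] Y(2) by (auto simp: K_def Op_def)
  have K'B: "K' j \<subseteq> frontier \<Omega> \<inter> ball (y j) (r j)" if "j < N" for j using YB[OF that] by (auto simp: K'_def)
  show thesis by (rule that[OF fl cK KB cK' K'B disj covK S])
qed

text \<open>For compact \<open>E\<close> the closed \<open>h\<close>-neighbourhood, written as a sum
  of sets so that compactness is inherited.\<close>

definition thicken :: "real set \<Rightarrow> real \<Rightarrow> real set" where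
  "thicken E h = {s + u | s u. s \<in> E \<and> u \<in> cball 0 h}"

text \<open>A compact set has a whole neighbourhood inside an open superset of almost the same
  measure.\<close>

lemma thicken_measure:
  assumes E: "compact E" and \<eta>: "0 < \<eta>"
  obtains h0 where "0 < h0" "\<And>h. h \<le> h0 \<Longrightarrow> measure lebesgue (thicken E h) \<le> measure lebesgue E + \<eta>"
proof -
  have "E \<in> sets borel" "bounded E" using E compact_imp_closed compact_imp_bounded by (auto intro: borel_closed)
  then obtain E' U where U: "compact E'" "open U" "E' \<subseteq> E" "E \<subseteq> U" "U \<in> lmeasurable" "measure lebesgue U \<le> measure lebesgue E' + \<eta>"
    by (rule borel_sandwich[OF _ _ \<eta>])
  obtain h0 where h0: "0 < h0" "(\<Union>x\<in>E. cball x h0) \<subseteq> U"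
    using compact_subset_open_imp_cball_epsilon_subset[OF E U(2,4)] by blast
  show thesis
  proof (rule that[OF h0(1)])
    fix h assume h: "h \<le> h0"
    have "thicken E h \<subseteq> U"
    proof
      fix x assume "x \<in> thicken E h"
      then obtain s u where "x = s + u" "s \<in> E" "\<bar>u\<bar> \<le> h" by (auto simp: thicken_def)
      then have "x \<in> cball s h0" using h by (simp add: dist_real_def)
      then show "x \<in> U" using h0(2) \<open>s \<in> E\<close> by blast
    qed
    moreover have "compact (thicken E h)" unfolding thicken_def by (rule compact_sums[OF E compact_cball])
    ultimately have "measure lebesgue (thicken E h) \<le> measure lebesgue U"
      using U(5) lmeasurable_compact by (intro measure_mono_fmeasurable) auto
    also have "\<dots> \<le> measure lebesgue E' + \<eta>" by (rule U(6))
    also have "measure lebesgue E' \<le> measure lebesgue E"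
      using U(3) lmeasurable_compact[OF U(1)] lmeasurable_compact[OF E] by (intro measure_mono_fmeasurable) auto
    finally show "measure lebesgue (thicken E h) \<le> measure lebesgue E + \<eta>" by simp
  qed
qed

lemma compact_thicken: "compact E \<Longrightarrow> compact (thicken E h)"
  unfolding thicken_def by (rule compact_sums[OF _ compact_cball])

section \<open>Covers, layers and fluxes of flat pieces\<close>

text \<open>An upper bound for \<open>hausdorff_length\<close> in terms of finite covers at every
  mesh. In this form finite subadditivity amounts to joining covers.\<close>

definition fine_cover :: "'a::metric_space set \<Rightarrow> real \<Rightarrow> bool" where
  "fine_cover A c \<longleftrightarrow> (\<forall>\<delta>>0. \<exists>\<C>. finite \<C> \<and> A \<subseteq> \<Union>\<C> \<and> (\<forall>C\<in>\<C>. bounded C \<and> diameter C \<le> \<delta>) \<and> (\<Sum>C\<in>\<C>. diameter C) \<le> c)"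

lemma hausdorff_length_fine_cover: "fine_cover A c \<Longrightarrow> hausdorff_length A \<le> ennreal c"
  unfolding fine_cover_def by (intro hausdorff_length_le) blast

lemma fine_cover_subset: "fine_cover A c \<Longrightarrow> B \<subseteq> A \<Longrightarrow> fine_cover B c"
  unfolding fine_cover_def by (meson order_trans)

lemma fine_cover_Un:
  assumes "fine_cover A c" "fine_cover B c'"
  shows "fine_cover (A \<union> B) (c + c')"
  unfolding fine_cover_def
proof (intro allI impI)
  fix \<delta> :: real assume \<delta>: "0 < \<delta>"
  obtain \<C> where C: "finite \<C>" "A \<subseteq> \<Union>\<C>" "\<forall>C\<in>\<C>. bounded C \<and> diameter C \<le> \<delta>" "(\<Sum>C\<in>\<C>. diameter C) \<le> c"
    using assms(1) \<delta> unfolding fine_cover_def by blast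
  obtain \<D> where D: "finite \<D>" "B \<subseteq> \<Union>\<D>" "\<forall>C\<in>\<D>. bounded C \<and> diameter C \<le> \<delta>" "(\<Sum>C\<in>\<D>. diameter C) \<le> c'"
    using assms(2) \<delta> unfolding fine_cover_def by blast
  have "(\<Sum>C\<in>\<C> \<union> \<D>. diameter C) \<le> (\<Sum>C\<in>\<C>. diameter C) + (\<Sum>C\<in>\<D>. diameter C)"
  proof -
    have "0 \<le> (\<Sum>C\<in>\<C> \<inter> \<D>. diameter C)" using C(3) by (intro sum_nonneg diameter_ge_0) blast
    then show ?thesis using sum.union_inter[OF C(1) D(1), of diameter] by linarith
  qed
  then show "\<exists>\<C>. finite \<C> \<and> A \<union> B \<subseteq> \<Union>\<C> \<and> (\<forall>C\<in>\<C>. bounded C \<and> diameter C \<le> \<delta>) \<and> (\<Sum>C\<in>\<C>. diameter C) \<le> c + c'"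
    using C D by (intro exI[of _ "\<C> \<union> \<D>"]) (auto 0 3)
qed

lemma fine_cover_UN:
  fixes N :: nat
  assumes "\<And>j. j < N \<Longrightarrow> fine_cover (K j) (c j)"
  shows "fine_cover (\<Union>j<N. K j) (\<Sum>j<N. c j)"
  using assms
proof (induction N)
  case 0
  show ?case unfolding fine_cover_def by (auto intro!: exI[of _ "{}"])
next
  case (Suc N)
  have "fine_cover ((\<Union>j<N. K j) \<union> K N) ((\<Sum>j<N. c j) + c N)"
    using Suc by (intro fine_cover_Un) auto
  then show ?case by (simp add: lessThan_Suc Un_commute add.commute)
qed

lemma thickenI:
  assumes "s \<in> E" "\<bar>x - s\<bar> \<le> h"
  shows "x \<in> thicken E h"
  unfolding thicken_def
  by (rule CollectI, rule exI[of _ s], rule exI[of _ "x - s"]) (use assms in \<open>simp add: dist_real_def\<close>)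

text \<open>The cells of length \<open>h\<close> that meet \<open>E\<close> lie within distance
  \<open>h\<close> of it, so their total length is controlled by a thickening of
  \<open>E\<close>.\<close>

lemma grid_count:
  fixes E :: "real set"
  assumes E: "compact E" and h: "0 < h"
  obtains G :: "int set" where "finite G" "E \<subseteq> (\<Union>k\<in>G. {of_int k * h..(of_int k + 1) * h})"
    "real (card G) * h \<le> measure lebesgue (thicken E h)"
proof -
  define G where "G = {k :: int. {of_int k * h..(of_int k + 1) * h} \<inter> E \<noteq> {}}"
  obtain M where M: "\<And>s. s \<in> E \<Longrightarrow> \<bar>s\<bar> \<le> M" using compact_imp_bounded[OF E] by (auto simp: bounded_iff)
  have "G \<subseteq> {\<lfloor>- M / h\<rfloor> - 1..\<lceil>M / h\<rceil>}"
  proof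
    fix k assume "k \<in> G"
    then obtain s where s: "of_int k * h \<le> s" "s \<le> (of_int k + 1) * h" "s \<in> E" by (auto simp: G_def)
    have "of_int k * h \<le> M" "- M \<le> (of_int k + 1) * h" using s M[OF s(3)] by linarith+
    then have "of_int k \<le> M / h" "- M / h \<le> of_int k + 1" using h by (auto simp: field_simps)
    then show "k \<in> {\<lfloor>- M / h\<rfloor> - 1..\<lceil>M / h\<rceil>}" by (auto simp: floor_le_iff) linarith+
  qed
  then have fG: "finite G" by (rule finite_subset) simp
  have cov: "E \<subseteq> (\<Union>k\<in>G. {of_int k * h..(of_int k + 1) * h})"
  proof
    fix s assume s: "s \<in> E"
    have m: "s \<in> {of_int \<lfloor>s / h\<rfloor> * h..(of_int \<lfloor>s / h\<rfloor> + 1) * h}"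
      using floor_divide_lower[OF h, of s] floor_divide_upper[OF h, of s] by (simp add: less_imp_le)
    have "\<lfloor>s / h\<rfloor> \<in> G" unfolding G_def using m s by blast
    then show "s \<in> (\<Union>k\<in>G. {of_int k * h..(of_int k + 1) * h})" using m by (rule UN_I)
  qed
  \<comment> \<open>Half-open cells are pairwise disjoint, so their measures add up.\<close>
  define I where "I = (\<lambda>k::int. {of_int k * h..<(of_int k + 1) * h})"
  have Im: "I k \<in> lmeasurable" "measure lebesgue (I k) = h" for k
  proof -
    show "I k \<in> lmeasurable" unfolding I_def by (intro bounded_set_imp_lmeasurable) (auto intro: bounded_subset[OF bounded_closed_interval])
    show "measure lebesgue (I k) = h" unfolding I_def using h by (simp add: algebra_simps)
  qed
  have "pairwise (\<lambda>i j. disjnt (I i) (I j)) G"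
  proof (rule pairwiseI)
    fix i j :: int assume "i \<noteq> j"
    have "I i \<inter> I j = {}" if "i < j" for i j
    proof -
      have "(of_int i + 1) * h \<le> of_int j * h" using that h by (intro mult_right_mono) auto
      then show ?thesis by (auto simp: I_def)
    qed
    then show "disjnt (I i) (I j)" using \<open>i \<noteq> j\<close> by (metis disjnt_def inf_commute linorder_neqE)
  qed
  then have "measure lebesgue (\<Union>k\<in>G. I k) = (\<Sum>k\<in>G. measure lebesgue (I k))"
    by (intro measure_UNION' fG Im)
  then have "real (card G) * h = measure lebesgue (\<Union>k\<in>G. I k)" using Im by simp
  also have "\<dots> \<le> measure lebesgue (thicken E h)"
  proof (rule measure_mono_fmeasurable)
    show "(\<Union>k\<in>G. I k) \<subseteq> thicken E h"
    proof
      fix x assume "x \<in> (\<Union>k\<in>G. I k)"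
      then obtain k where k: "k \<in> G" "x \<in> I k" by blast
      then obtain s where s: "of_int k * h \<le> s" "s \<le> (of_int k + 1) * h" "s \<in> E" by (auto simp: G_def)
      have "\<bar>x - s\<bar> \<le> h" using k(2) s by (auto simp: I_def algebra_simps)
      then show "x \<in> thicken E h" by (rule thickenI[OF s(3)])
    qed
    show "(\<Union>k\<in>G. I k) \<in> sets lebesgue" using Im fG by (intro sets.finite_UN) auto
    show "thicken E h \<in> lmeasurable" by (rule lmeasurable_compact[OF compact_thicken[OF E]])
  qed
  finally show thesis using that[OF fG cov] by blast
qed

text \<open>The piece is cut along a grid on its shadow: over a cell of length \<open>h\<close> a
  graph of slope at most \<delta> has diameter at most (1 + \<delta>) h.\<close>

lemma fine_cover_flat:
  assumes fl: "flat \<Omega> \<delta> e y r" "open \<Omega>" "0 \<le> \<delta>" and K: "compact K" "K \<subseteq> frontier \<Omega> \<inter> ball y r" and \<eta>: "0 < \<eta>"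
  shows "fine_cover K ((1 + \<delta>) * (measure lebesgue (shadow e K) + \<eta>))"
  unfolding fine_cover_def
proof (intro allI impI)
  fix d :: real assume d: "0 < d"
  note cs = compact_shadow[OF K(1), of e]
  obtain h0 where h0: "0 < h0" "\<And>h. h \<le> h0 \<Longrightarrow> measure lebesgue (thicken (shadow e K) h) \<le> measure lebesgue (shadow e K) + \<eta>"
    by (rule thicken_measure[OF cs \<eta>]) (rule that)
  define h where "h = min h0 (d / (1 + \<delta>))"
  have h: "0 < h" "h \<le> h0" using h0(1) d fl(3) by (auto simp: h_def)
  have "h \<le> d / (1 + \<delta>)" by (simp add: h_def)
  then have hd: "(1 + \<delta>) * h \<le> d" using fl(3) by (simp add: pos_le_divide_eq mult.commute)
  obtain G :: "int set" where G: "finite G" "shadow e K \<subseteq> (\<Union>k\<in>G. {of_int k * h..(of_int k + 1) * h})"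
    "real (card G) * h \<le> measure lebesgue (thicken (shadow e K) h)"
    by (rule grid_count[OF cs h(1)])
  define C where "C = (\<lambda>k::int. {z \<in> K. z \<bullet> perp e \<in> {of_int k * h..(of_int k + 1) * h}})"
  have b: "bounded (C k)" for k using compact_imp_bounded[OF K(1)] by (rule bounded_subset) (auto simp: C_def)
  have dm: "diameter (C k) \<le> (1 + \<delta>) * h" for k
  proof (rule diameter_le)
    show "C k \<noteq> {} \<or> 0 \<le> (1 + \<delta>) * h" using h fl(3) by simp
    fix z w assume zw: "z \<in> C k" "w \<in> C k"
    have "dist z w \<le> (1 + \<delta>) * \<bar>z \<bullet> perp e - w \<bullet> perp e\<bar>"
      using zw K(2) by (intro flat_dist[OF fl(1,2)]) (auto simp: C_def)
    also have "\<dots> \<le> (1 + \<delta>) * h" using zw fl(3) by (intro mult_left_mono) (auto simp: C_def algebra_simps)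
    finally show "norm (z - w) \<le> (1 + \<delta>) * h" by (simp add: dist_norm)
  qed
  have "(\<Sum>D\<in>C ` G. diameter D) \<le> (\<Sum>D\<in>C ` G. (1 + \<delta>) * h)" using dm by (intro sum_mono) auto
  also have "\<dots> = real (card (C ` G)) * ((1 + \<delta>) * h)" by simp
  also have "\<dots> \<le> real (card G) * ((1 + \<delta>) * h)" using card_image_le[OF G(1), of C] h fl(3) by (intro mult_right_mono) auto
  also have "\<dots> = (1 + \<delta>) * (real (card G) * h)" by simp
  also have "\<dots> \<le> (1 + \<delta>) * (measure lebesgue (shadow e K) + \<eta>)"
    using G(3) h0(2)[OF h(2)] fl(3) by (intro mult_left_mono) linarith+
  finally have "(\<Sum>D\<in>C ` G. diameter D) \<le> (1 + \<delta>) * (measure lebesgue (shadow e K) + \<eta>)" .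
  moreover have "K \<subseteq> \<Union>(C ` G)" using G(2) by (fastforce simp: C_def)
  moreover have "\<forall>D\<in>C ` G. bounded D \<and> diameter D \<le> d" using b order_trans[OF dm hd] by blast
  ultimately show "\<exists>\<C>. finite \<C> \<and> K \<subseteq> \<Union>\<C> \<and> (\<forall>C\<in>\<C>. bounded C \<and> diameter C \<le> d) \<and>
     (\<Sum>C\<in>\<C>. diameter C) \<le> (1 + \<delta>) * (measure lebesgue (shadow e K) + \<eta>)"
    using G(1) by (intro exI[of _ "C ` G"]) auto
qed

section \<open>Area by slices in a rotated frame\<close>

lemma distr_coordinates:
  "distr (lborel :: (real \<times> real) measure) borel (\<lambda>p. fst p *\<^sub>R axis 1 1 + snd p *\<^sub>R axis 2 1 :: real^2) = lborel"
proof (rule lborel_eqI[symmetric])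
  let ?T = "\<lambda>p::real \<times> real. fst p *\<^sub>R axis 1 1 + snd p *\<^sub>R axis 2 1 :: real^2"
  have T: "?T p $ 1 = fst p" "?T p $ 2 = snd p" for p by (simp_all add: axis_def)
  have B: "(Basis :: (real^2) set) = {axis 1 1, axis 2 1}"
    by (auto simp: Basis_vec_def UNIV_2)
  have Tm: "?T \<in> borel_measurable lborel" by (auto intro!: borel_measurable_continuous_onI continuous_intros)
  fix l u :: "real^2" assume lu: "\<And>b. b \<in> Basis \<Longrightarrow> l \<bullet> b \<le> u \<bullet> b"
  have lu': "l $ 1 \<le> u $ 1" "l $ 2 \<le> u $ 2" using lu[of "axis 1 1"] lu[of "axis 2 1"] by (auto simp: B inner_axis)
  have vim: "?T -` box l u = box (l $ 1, l $ 2) (u $ 1, u $ 2)"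
    by (auto simp: mem_box_cart forall_2 axis_def mem_box Basis_prod_def)
  have ne: "axis 1 1 \<noteq> (axis 2 1 :: real^2)" by (simp add: axis_eq_axis)
  have "emeasure (distr lborel borel ?T) (box l u) = emeasure lborel (box (l $ 1, l $ 2) (u $ 1, u $ 2))"
    using Tm by (subst emeasure_distr) (simp_all add: vim)
  also have "\<dots> = (\<Prod>b\<in>Basis. ((u $ 1, u $ 2) - (l $ 1, l $ 2)) \<bullet> b)"
    by (rule emeasure_lborel_box) (use lu' in \<open>auto simp: Basis_prod_def\<close>)
  also have "\<dots> = (\<Prod>b\<in>Basis. (u - l) \<bullet> b)"
    using ne by (simp add: B Basis_prod_def inner_axis mult.commute)
  finally show "emeasure (distr lborel borel ?T) (box l u) = (\<Prod>b\<in>Basis. (u - l) \<bullet> b)" .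
qed simp

text \<open>Cavalieri's principle: \<open>perp e\<close> and \<open>e\<close> are orthonormal, so
  rotating to the standard axes preserves area, and Fubini on the product plane does the
  slicing.\<close>

lemma emeasure_frame:
  assumes e: "norm e = 1" and A: "A \<in> sets borel" "bounded A"
  shows "emeasure lborel A = (\<integral>\<^sup>+s. emeasure lborel {y. s *\<^sub>R perp e + y *\<^sub>R e \<in> A} \<partial>lborel)"
proof -
  define R where "R = (\<lambda>v::real^2. v $ 1 *\<^sub>R perp e + v $ 2 *\<^sub>R e)"
  have linR: "linear R" unfolding R_def by (rule linearI) (auto simp: algebra_simps)
  have e1: "e \<bullet> e = 1" "perp e \<bullet> perp e = 1" using e perp_props(1)[OF e] by (auto simp: norm_eq_1)
  have oR: "orthogonal_transformation R"
    unfolding orthogonal_transformation_def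
  proof (intro conjI allI linR)
    fix v w
    have "R v \<bullet> R w = v $ 1 * w $ 1 + v $ 2 * w $ 2"
      unfolding R_def by (simp add: inner_add_left inner_add_right perp_props(2,3)[OF e] e1)
    then show "R v \<bullet> R w = v \<bullet> w" by (simp add: inner_real2)
  qed
  have bR: "bij R" using oR by (rule orthogonal_transformation_bij)
  have cR: "continuous_on UNIV R" using linR by (simp add: linear_continuous_on linear_conv_bounded_linear)
  define S where "S = R -` A"
  have Sb: "S \<in> sets borel" unfolding S_def using measurable_sets_borel[OF borel_measurable_continuous_onI[OF cR] A(1)] .
  have Sbd: "bounded S"
  proof -
    obtain M where "\<And>x. x \<in> A \<Longrightarrow> norm x \<le> M" using A(2) by (auto simp: bounded_iff)
    then show ?thesis using orthogonal_transformation_norm[OF oR] by (force simp: bounded_iff S_def)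
  qed
  have RS: "R ` S = A" unfolding S_def using bR by (simp add: bij_is_surj surj_image_vimage_eq)
  have lm: "S \<in> lmeasurable" "A \<in> lmeasurable" using Sb Sbd A by (auto intro!: bounded_set_imp_lmeasurable)
  have eq: "emeasure lborel B = ennreal (measure lebesgue B)" if "B \<in> sets borel" "bounded B" for B :: "(real^2) set"
    using that emeasure_bounded_finite[OF that(2)] 
    by (subst emeasure_eq_ennreal_measure) (auto simp: measure_completion)
  have "emeasure lborel A = emeasure lborel S"
    using measure_orthogonal_image[OF oR lm(1)] eq[OF A] eq[OF Sb Sbd] by (simp only: RS)
  also have "\<dots> = emeasure (distr lborel borel (\<lambda>p. fst p *\<^sub>R axis 1 1 + snd p *\<^sub>R axis 2 1 :: real^2)) S"
    by (simp only: distr_coordinates)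
  also have "\<dots> = emeasure (lborel :: (real \<times> real) measure) ((\<lambda>p. fst p *\<^sub>R axis 1 1 + snd p *\<^sub>R axis 2 1) -` S)"
    using Sb by (subst emeasure_distr) (auto intro!: borel_measurable_continuous_onI continuous_intros)
  also have "\<dots> = emeasure (lborel \<Otimes>\<^sub>M lborel) ((\<lambda>p :: real \<times> real. fst p *\<^sub>R axis 1 1 + snd p *\<^sub>R axis 2 1) -` S)"
    by (simp only: lborel_prod)
  also have "\<dots> = (\<integral>\<^sup>+s. emeasure lborel (Pair s -` ((\<lambda>p :: real \<times> real. fst p *\<^sub>R axis 1 1 + snd p *\<^sub>R axis 2 1) -` S)) \<partial>lborel)"
  proof (rule lborel.emeasure_pair_measure_alt)
    have "(\<lambda>p :: real \<times> real. fst p *\<^sub>R axis 1 1 + snd p *\<^sub>R axis 2 1 :: real^2) -` S \<in> sets borel"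
      by (rule measurable_sets_borel[OF _ Sb]) (intro borel_measurable_continuous_onI continuous_intros)
    then show "(\<lambda>p :: real \<times> real. fst p *\<^sub>R axis 1 1 + snd p *\<^sub>R axis 2 1 :: real^2) -` S \<in> sets (lborel \<Otimes>\<^sub>M lborel)"
      by (simp only: lborel_prod sets_lborel)
  qed
  also have "\<dots> = (\<integral>\<^sup>+s. emeasure lborel {y. s *\<^sub>R perp e + y *\<^sub>R e \<in> A} \<partial>lborel)"
  proof -
    have "Pair s -` ((\<lambda>p :: real \<times> real. fst p *\<^sub>R axis 1 1 + snd p *\<^sub>R axis 2 1) -` S) = {y. s *\<^sub>R perp e + y *\<^sub>R e \<in> A}" for s
      by (auto simp: S_def R_def axis_def)
    then show ?thesis by simp
  qed
  finally show ?thesis .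
qed

text \<open>The layer projects into the shadow thickened by t, and each slice in the direction
  \<open>e\<close> has length at most (1 + 3 \<delta>) t. Only the part inside \<Omega> counts,
  which gives t rather than 2 t.\<close>

lemma tube_measure:
  assumes fl: "flat \<Omega> \<delta> e y r" "open \<Omega>" "0 \<le> \<delta>" and K: "compact K" "K \<subseteq> frontier \<Omega> \<inter> ball y r" and \<eta>: "0 < \<eta>"
  shows "\<exists>t0>0. \<forall>t. 0 < t \<and> t \<le> t0 \<longrightarrow>
    measure lebesgue {x \<in> \<Omega>. \<exists>z\<in>K. dist x z \<le> t} \<le> (1 + 3 * \<delta>) * (measure lebesgue (shadow e K) + \<eta>) * t"
proof -
  have e: "norm e = 1" using fl(1) by (simp add: flat_def)
  note cs = compact_shadow[OF K(1), of e]
  obtain h0 where h0: "0 < h0" "\<And>h. h \<le> h0 \<Longrightarrow> measure lebesgue (thicken (shadow e K) h) \<le> measure lebesgue (shadow e K) + \<eta>"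
    by (rule thicken_measure[OF cs \<eta>]) (rule that)
  have "K \<subseteq> ball y r" using K(2) by blast
  then obtain t1 where t1: "0 < t1" "(\<Union>z\<in>K. cball z t1) \<subseteq> ball y r"
    using compact_subset_open_imp_cball_epsilon_subset[OF K(1) open_ball] by blast
  have main: "measure lebesgue {x \<in> \<Omega>. \<exists>z\<in>K. dist x z \<le> t} \<le> (1 + 3 * \<delta>) * (measure lebesgue (shadow e K) + \<eta>) * t"
    if t: "0 < t" "t \<le> min h0 t1" for t
  proof -
    define A where "A = {x \<in> \<Omega>. \<exists>z\<in>K. dist x z \<le> t}"
    have AC: "A = \<Omega> \<inter> {z + u | z u. z \<in> K \<and> u \<in> cball 0 t}"
    proof (intro equalityI subsetI)
      fix x assume "x \<in> A"
      then obtain z where "x \<in> \<Omega>" "z \<in> K" "dist x z \<le> t" by (auto simp: A_def)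
      then show "x \<in> \<Omega> \<inter> {z + u | z u. z \<in> K \<and> u \<in> cball 0 t}"
        by - (rule IntI, assumption, rule CollectI, rule exI[of _ z], rule exI[of _ "x - z"], simp add: dist_norm norm_minus_commute)
    qed (auto simp: A_def dist_norm intro!: bexI)
    have cC: "compact {z + u | z u. z \<in> K \<and> u \<in> cball 0 t}" by (rule compact_sums[OF K(1) compact_cball])
    have Ab: "A \<in> sets borel" "bounded A"
    proof -
      show "A \<in> sets borel" unfolding AC using fl(2) borel_closed[OF compact_imp_closed[OF cC]] by (intro sets.Int) auto
      show "bounded A" unfolding AC using compact_imp_bounded[OF cC] by (rule bounded_subset) blast
    qed
    have inB: "x \<in> ball y r" if "z \<in> K" "dist x z \<le> t" for x z 
    proof -
      have "x \<in> cball z t1" using that(2) t by (simp add: dist_commute)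
      then show ?thesis using t1(2) that(1) by blast
    qed
    \<comment> \<open>The top is within t of the height of some w in \<open>K\<close>, the bottom at
      most \<delta> t below the height of some z in \<open>K\<close>, and these heights differ by at
      most 2 \<delta> t, since both points project to within t of \<open>s\<close>.\<close>
    have spread: "b - a \<le> (1 + 3 * \<delta>) * t" 
      if ab: "s *\<^sub>R perp e + a *\<^sub>R e \<in> A" "s *\<^sub>R perp e + b *\<^sub>R e \<in> A" for s a b
    proof -
      have co: "(s *\<^sub>R perp e + q *\<^sub>R e) \<bullet> e = q" "(s *\<^sub>R perp e + q *\<^sub>R e) \<bullet> perp e = s" for q
        using perp_props(1-3)[OF e] e by (simp_all add: inner_add_left dot_square_norm)
      obtain z where z: "z \<in> K" "dist (s *\<^sub>R perp e + a *\<^sub>R e) z \<le> t" "s *\<^sub>R perp e + a *\<^sub>R e \<in> \<Omega>" using ab(1) by (auto simp: A_def)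
      obtain w where w: "w \<in> K" "dist (s *\<^sub>R perp e + b *\<^sub>R e) w \<le> t" using ab(2) by (auto simp: A_def)
      have "\<not> (s *\<^sub>R perp e + a *\<^sub>R e - z) \<bullet> e < - (\<delta> * \<bar>(s *\<^sub>R perp e + a *\<^sub>R e - z) \<bullet> perp e\<bar>)"
        using fl(1) z inB[OF z(1,2)] K(2) unfolding flat_def by blast
      then have 1: "- (\<delta> * \<bar>s - z \<bullet> perp e\<bar>) \<le> a - z \<bullet> e" by (simp add: inner_diff_left co)
      have 2: "\<bar>s - z \<bullet> perp e\<bar> \<le> t" 
        using perp_props(6)[OF e, of "s *\<^sub>R perp e + a *\<^sub>R e - z"] z(2) by (simp add: inner_diff_left co dist_norm)
      have 3: "\<bar>s - w \<bullet> perp e\<bar> \<le> t" "\<bar>b - w \<bullet> e\<bar> \<le> t"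
        using perp_props(6,7)[OF e, of "s *\<^sub>R perp e + b *\<^sub>R e - w"] w(2) by (auto simp: inner_diff_left co dist_norm)
      have "\<bar>(w - z) \<bullet> e\<bar> \<le> \<delta> * \<bar>(w - z) \<bullet> perp e\<bar>" using z(1) w(1) K(2) by (intro flat_graph[OF fl(1,2)]) auto
      moreover have "\<delta> * \<bar>(w - z) \<bullet> perp e\<bar> \<le> \<delta> * (2 * t)"
        using 2 3(1) fl(3) by (intro mult_left_mono) (auto simp: inner_diff_left)
      moreover have "\<delta> * \<bar>s - z \<bullet> perp e\<bar> \<le> \<delta> * t" using 2 fl(3) by (rule mult_left_mono)
      ultimately have "b - a \<le> t + \<delta> * (2 * t) + \<delta> * t" using 1 3(2) by (simp add: inner_diff_left abs_le_iff)
      then show ?thesis by (simp add: algebra_simps)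
    qed
    have slice: "{q. s *\<^sub>R perp e + q *\<^sub>R e \<in> A} \<in> sets borel" for s
    proof -
      have "(\<lambda>q. s *\<^sub>R perp e + q *\<^sub>R e) -` A \<in> sets borel"
        by (rule measurable_sets_borel[OF _ Ab(1)]) (intro borel_measurable_continuous_onI continuous_intros)
      then show ?thesis by (simp add: vimage_def)
    qed
    define E where "E = thicken (shadow e K) t"
    have cE: "compact E" unfolding E_def by (rule compact_thicken[OF cs])
    have "emeasure lborel A = (\<integral>\<^sup>+s. emeasure lborel {q. s *\<^sub>R perp e + q *\<^sub>R e \<in> A} \<partial>lborel)"
      by (rule emeasure_frame[OF e Ab])
    also have "\<dots> \<le> (\<integral>\<^sup>+s. ennreal ((1 + 3 * \<delta>) * t) * indicator E s \<partial>lborel)"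
    proof (rule nn_integral_mono)
      fix s
      show "emeasure lborel {q. s *\<^sub>R perp e + q *\<^sub>R e \<in> A} \<le> ennreal ((1 + 3 * \<delta>) * t) * indicator E s"
      proof (cases "s \<in> E")
        case True
        have "emeasure lborel {q. s *\<^sub>R perp e + q *\<^sub>R e \<in> A} \<le> ennreal ((1 + 3 * \<delta>) * t)"
          by (rule emeasure_real_le_of_spread[OF _ slice]) (use spread in auto)
        then show ?thesis using True by simp
      next
        case False
        have "s *\<^sub>R perp e + q *\<^sub>R e \<notin> A" for q
        proof
          assume "s *\<^sub>R perp e + q *\<^sub>R e \<in> A"
          then obtain z where z: "z \<in> K" "dist (s *\<^sub>R perp e + q *\<^sub>R e) z \<le> t" by (auto simp: A_def)
          have "(s *\<^sub>R perp e + q *\<^sub>R e) \<bullet> perp e = s"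
            using perp_props(1-3)[OF e] by (simp add: inner_add_left dot_square_norm)
          then have "\<bar>s - z \<bullet> perp e\<bar> \<le> t"
            using perp_props(6)[OF e, of "s *\<^sub>R perp e + q *\<^sub>R e - z"] z(2) by (simp add: inner_diff_left dist_norm)
          then have "s \<in> E" unfolding E_def using z(1) by (intro thickenI[of "z \<bullet> perp e"]) auto
          then show False using False by blast
        qed
        then show ?thesis by simp
      qed
    qed
    also have "\<dots> = ennreal ((1 + 3 * \<delta>) * t) * emeasure lborel E"
      using borel_closed[OF compact_imp_closed[OF cE]] by (intro nn_integral_cmult_indicator) simp
    also have "emeasure lborel E = ennreal (measure lebesgue E)"
      using emeasure_bounded_finite[OF compact_imp_bounded[OF cE]] borel_closed[OF compact_imp_closed[OF cE]]
      by (subst emeasure_eq_ennreal_measure) (auto simp: measure_completion)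
    also have "emeasure lborel A = ennreal (measure lebesgue A)"
      using emeasure_bounded_finite[OF Ab(2)] Ab(1) by (subst emeasure_eq_ennreal_measure) (auto simp: measure_completion)
    also have "ennreal ((1 + 3 * \<delta>) * t) * ennreal (measure lebesgue E) = ennreal ((1 + 3 * \<delta>) * t * measure lebesgue E)"
      using fl(3) t by (subst ennreal_mult) auto
    finally have "measure lebesgue A \<le> (1 + 3 * \<delta>) * t * measure lebesgue E"
      using fl(3) t by (subst (asm) ennreal_le_iff) auto
    also have "\<dots> \<le> (1 + 3 * \<delta>) * t * (measure lebesgue (shadow e K) + \<eta>)"
      unfolding E_def using fl(3) t by (intro mult_left_mono h0(2)) auto
    finally show ?thesis unfolding A_def by (simp add: mult_ac)
  qed
  show ?thesis using main h0(1) t1(1) by (intro exI[of _ "min h0 t1"]) auto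
qed

text \<open>Moving \<open>\<Omega>\<close> by \<open>h e\<close> sweeps out, above each point of the shadow of \<open>K\<close>, a segment of length \<open>h\<close>.\<close>

lemma directional_derivative_shadow:
  assumes fl: "flat \<Omega> \<delta> e y r" and \<Omega>: "open \<Omega>" "bounded \<Omega>" and K: "compact K" "K \<subseteq> frontier \<Omega> \<inter> ball y r"
    and \<zeta>: "smooth \<zeta>" "\<And>x. 0 \<le> \<zeta> x" "\<And>x. \<zeta> x \<le> 1" and L: "compact L" "L \<subseteq> ball y r" "\<And>x. x \<notin> L \<Longrightarrow> \<zeta> x = 0"
    and \<sigma>: "0 < \<sigma>" "\<And>x z. z \<in> K \<Longrightarrow> dist x z \<le> \<sigma> \<Longrightarrow> \<zeta> x = 1"
  shows "measure lebesgue (shadow e K) \<le> - (\<integral>x. frechet_derivative \<zeta> (at x) e \<partial>lebesgue_on \<Omega>)"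
proof -
  have e: "norm e = 1" using fl by (simp add: flat_def)
  have co: "(s *\<^sub>R perp e + q *\<^sub>R e) \<bullet> e = q" "(s *\<^sub>R perp e + q *\<^sub>R e) \<bullet> perp e = s" for s q
    using perp_props(1-3)[OF e] e by (simp_all add: inner_add_left dot_square_norm)
  note cs = compact_shadow[OF K(1), of e]
  obtain t1 where t1: "0 < t1" "(\<Union>z\<in>L. cball z t1) \<subseteq> ball y r"
    using compact_subset_open_imp_cball_epsilon_subset[OF L(1) open_ball L(2)] by blast
  have KL: "z \<in> L" if "z \<in> K" for z using \<sigma>(2)[OF that, of z] \<sigma>(1) L(3)[of z] by force
  \<comment> \<open>Steps of at most \<sigma> stay where the cutoff is 1, steps of at most
    \<open>t1\<close> stay in the flat ball, and steps of at most 1 suit the dominated convergence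
    argument.\<close>
  define m where "m = min 1 (min \<sigma> t1)"
  have m: "0 < m" "m \<le> 1" "m \<le> \<sigma>" "m \<le> t1" using \<sigma>(1) t1(1) by (auto simp: m_def)
  define h where "h = (\<lambda>n. m / real (Suc n))"
  have h: "0 < h n" "h n \<le> m" for n using m(1) by (auto simp: h_def field_simps)
  have hlim: "h \<longlonglongrightarrow> 0" 
    using tendsto_mult_right_zero[OF LIMSEQ_inverse_real_of_nat, of m] by (simp add: h_def divide_inverse)
  have [measurable]: "\<Omega> \<in> sets borel" using \<Omega>(1) by simp
  have \<Omega>L: "\<Omega> \<in> sets lebesgue" using \<Omega> by simp
  define g where "g = (indicator \<Omega> :: real^2 \<Rightarrow> real)"
  have [measurable]: "g \<in> borel_measurable borel" by (simp add: g_def)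
  have c\<zeta>: "continuous_on UNIV \<zeta>" by (rule smooth_derivative(3)[OF \<zeta>(1)])
  have [measurable]: "\<zeta> \<in> borel_measurable borel" using c\<zeta> by (rule borel_measurable_continuous_onI)
  have i\<zeta>: "integrable lborel \<zeta>" by (rule integrable_continuous_compact_support[OF c\<zeta> L(1,3)])
  have bdd: "integrable lborel (\<lambda>x. a x * f x)" if "integrable lborel f" "a \<in> borel_measurable borel" "\<And>x. \<bar>a x\<bar> \<le> 1"
    for a f :: "real^2 \<Rightarrow> real"
  proof (rule Bochner_Integration.integrable_bound[OF that(1)])
    show "AE x in lborel. norm (a x * f x) \<le> norm (f x)"
      using that(3) by (intro AE_I2) (simp add: abs_mult mult_left_le_one_le)
  qed (use that in measurable)
  have g01: "0 \<le> g x" "\<bar>g x\<bar> \<le> 1" for x by (auto simp: g_def indicator_def)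
  have step: "h n * measure lebesgue (shadow e K) \<le> (\<integral>x. g x * (\<zeta> x - \<zeta> (x + h n *\<^sub>R e)) \<partial>lborel)" for n
  proof -
    define t where "t = h n"
    have t: "0 < t" "t \<le> \<sigma>" "t \<le> t1" using h[of n] m by (auto simp: t_def)
    have shift: "integrable lborel (\<lambda>x. f (x + s))" "(\<integral>x. f (x + s) \<partial>lborel) = (\<integral>x. f x \<partial>lborel)" 
      if "integrable lborel f" for f :: "real^2 \<Rightarrow> real" and s
      using that integrable_distr_eq[of "(+) s" lborel borel f] integral_distr[of "(+) s" lborel borel f]
      by (auto simp: lborel_distr_plus add.commute)
    have i1: "integrable lborel (\<lambda>x. g x * \<zeta> x)" "integrable lborel (\<lambda>x. g x * \<zeta> (x + t *\<^sub>R e))"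
      "integrable lborel (\<lambda>x. g (x - t *\<^sub>R e) * \<zeta> x)"
      using bdd[OF i\<zeta>, of g] bdd[OF shift(1)[OF i\<zeta>, of "t *\<^sub>R e"], of g] bdd[OF i\<zeta>, of "\<lambda>x. g (x - t *\<^sub>R e)"] g01 by auto
    have "(\<integral>x. g x * (\<zeta> x - \<zeta> (x + t *\<^sub>R e)) \<partial>lborel) = (\<integral>x. g x * \<zeta> x \<partial>lborel) - (\<integral>x. g x * \<zeta> (x + t *\<^sub>R e) \<partial>lborel)"
      using i1 by (simp add: right_diff_distrib)
    \<comment> \<open>Translation moves the difference from the smooth cutoff to the indicator of
      \<Omega>, where its sign is visible.\<close>
    also have "(\<integral>x. g x * \<zeta> (x + t *\<^sub>R e) \<partial>lborel) = (\<integral>x. g (x - t *\<^sub>R e) * \<zeta> x \<partial>lborel)"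
      using shift(2)[OF i1(3), of "t *\<^sub>R e"] by simp
    also have "(\<integral>x. g x * \<zeta> x \<partial>lborel) - (\<integral>x. g (x - t *\<^sub>R e) * \<zeta> x \<partial>lborel) = (\<integral>x. (g x - g (x - t *\<^sub>R e)) * \<zeta> x \<partial>lborel)"
      using i1 by (simp add: left_diff_distrib)
    finally have eq: "(\<integral>x. g x * (\<zeta> x - \<zeta> (x + t *\<^sub>R e)) \<partial>lborel) = (\<integral>x. (g x - g (x - t *\<^sub>R e)) * \<zeta> x \<partial>lborel)" .
    define A where "A = \<Omega> \<inter> {z + u | z u. z \<in> K \<and> u \<in> (\<lambda>s. s *\<^sub>R e) ` {0..t}}"
    have cC: "compact {z + u | z u. z \<in> K \<and> u \<in> (\<lambda>s. s *\<^sub>R e) ` {0..t}}"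
      by (intro compact_sums[OF K(1)] compact_continuous_image continuous_intros compact_Icc)
    have Ab: "A \<in> sets borel" "bounded A"
    proof -
      show "A \<in> sets borel" unfolding A_def using borel_closed[OF compact_imp_closed[OF cC]] by (intro sets.Int) auto
      show "bounded A" unfolding A_def using compact_imp_bounded[OF cC] by (rule bounded_subset) blast
    qed
    have inB: "x \<in> ball y r" if "z \<in> L" "dist x z \<le> t" for x z
    proof -
      have "x \<in> cball z t1" using that(2) t by (simp add: dist_commute)
      then show ?thesis using t1(2) that(1) by blast
    qed
    have up: "w \<in> \<Omega>" if "z \<in> frontier \<Omega>" "z \<in> ball y r" "w \<in> ball y r" "w = z + s *\<^sub>R e" "0 < s" for z w s
      using fl that e perp_props(3)[OF e] unfolding flat_def by (auto simp: dot_square_norm)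
    have down: "w \<notin> \<Omega>" if "z \<in> frontier \<Omega>" "z \<in> ball y r" "w \<in> ball y r" "w = z - s *\<^sub>R e" "0 \<le> s" for z w s
    proof (cases "s = 0")
      case True
      then show ?thesis using that \<Omega>(1) by (auto simp: frontier_def interior_open)
    next
      case False
      then show ?thesis using fl that e perp_props(3)[OF e] unfolding flat_def by (auto simp: dot_square_norm)
    qed
    \<comment> \<open>Near the support of the cutoff, short moves in direction \<open>e\<close> do
      not leave \<Omega>, so the difference of indicators is nonnegative; on the set swept out of
      \<open>K\<close> it equals 1, and so does the cutoff.\<close>
    have lower: "indicator A x \<le> (g x - g (x - t *\<^sub>R e)) * \<zeta> x" for x
    proof (cases "x \<in> A")
      case True
      then obtain z w where zw: "x \<in> \<Omega>" "x = z + w" "z \<in> K" "w \<in> (\<lambda>s. s *\<^sub>R e) ` {0..t}" unfolding A_def by blast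
      then obtain s where "w = s *\<^sub>R e" "s \<in> {0..t}" by blast
      then have z: "z \<in> K" "x = z + s *\<^sub>R e" "0 \<le> s" "s \<le> t" "x \<in> \<Omega>" using zw by simp_all
      have d: "dist x z \<le> \<sigma>" using z t e by (simp add: dist_norm)
      have "dist (x - t *\<^sub>R e) z \<le> t"
      proof -
        have "x - t *\<^sub>R e - z = (s - t) *\<^sub>R e" using z(2) by (simp add: algebra_simps)
        then show ?thesis using z(3,4) e by (simp add: dist_norm)
      qed
      then have "x - t *\<^sub>R e \<notin> \<Omega>" using z K(2) inB[OF KL[OF z(1)]]
        by (intro down[of z _ "t - s"]) (auto simp: algebra_simps)
      then show ?thesis using \<sigma>(2)[OF z(1) d] z(5) True by (simp add: g_def)
    next
      case False
      have "0 \<le> (g x - g (x - t *\<^sub>R e)) * \<zeta> x"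
      proof (cases "x \<in> L")
        case xL: True
        have B: "x \<in> ball y r" "x - t *\<^sub>R e \<in> ball y r" using inB[OF xL, of x] inB[OF xL, of "x - t *\<^sub>R e"] t e by (auto simp: dist_norm)
        have "x \<in> \<Omega>" if in\<Omega>: "x - t *\<^sub>R e \<in> \<Omega>"
        proof (rule ccontr)
          assume "x \<notin> \<Omega>"
          \<comment> \<open>Leaving \<Omega> on the way up would force a frontier crossing, which
            puts the starting point below a frontier point and hence outside \<Omega>.\<close>
          then have "closed_segment (x - t *\<^sub>R e) x \<inter> frontier \<Omega> \<noteq> {}"
            using in\<Omega> by (intro connected_Int_frontier connected_segment) auto
          then obtain z where z: "z \<in> closed_segment (x - t *\<^sub>R e) x" "z \<in> frontier \<Omega>" by blast
          have zB: "z \<in> ball y r" using closed_segment_subset[OF B(2,1) convex_ball] z(1) by blast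
          obtain u where u: "0 \<le> u" "u \<le> 1" "z = (1 - u) *\<^sub>R (x - t *\<^sub>R e) + u *\<^sub>R x" using z(1) by (auto simp: in_segment)
          have "x - t *\<^sub>R e = z - (u * t) *\<^sub>R e" unfolding u(3) by (simp add: algebra_simps)
          from down[OF z(2) zB B(2) this] have "x - t *\<^sub>R e \<notin> \<Omega>" using u(1) t(1) by simp
          then show False using in\<Omega> by blast
        qed
        then have "0 \<le> g x - g (x - t *\<^sub>R e)" by (auto simp: g_def indicator_def)
        then show ?thesis using \<zeta>(2) by simp
      next
        case False
        then show ?thesis using L(3) by simp
      qed
      then show ?thesis using False by simp
    qed
    have slice: "{q. s *\<^sub>R perp e + q *\<^sub>R e \<in> A} \<in> sets borel" for s
    proof -
      have "(\<lambda>q. s *\<^sub>R perp e + q *\<^sub>R e) -` A \<in> sets borel"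
        by (rule measurable_sets_borel[OF _ Ab(1)]) (intro borel_measurable_continuous_onI continuous_intros)
      then show ?thesis by (simp add: vimage_def)
    qed
    have "ennreal t * emeasure lborel (shadow e K) = (\<integral>\<^sup>+s. ennreal t * indicator (shadow e K) s \<partial>lborel)"
      using borel_closed[OF compact_imp_closed[OF cs]] by (subst nn_integral_cmult_indicator) auto
    also have "\<dots> \<le> (\<integral>\<^sup>+s. emeasure lborel {q. s *\<^sub>R perp e + q *\<^sub>R e \<in> A} \<partial>lborel)"
    proof (rule nn_integral_mono)
      fix s
      show "ennreal t * indicator (shadow e K) s \<le> emeasure lborel {q. s *\<^sub>R perp e + q *\<^sub>R e \<in> A}"
      proof (cases "s \<in> shadow e K")
        case True
        then obtain z where z: "z \<in> K" "s = z \<bullet> perp e" by blast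
        define q0 where "q0 = z \<bullet> e"
        have zeq: "z = s *\<^sub>R perp e + q0 *\<^sub>R e" using perp_props(4)[OF e, of z] by (simp add: q0_def z(2))
        \<comment> \<open>The slice of the swept set above a point of the shadow contains an
          interval of length t; its lower end is the frontier point itself, which does not belong to
          \<Omega>.\<close>
        have "{q0<..q0 + t} \<subseteq> {q. s *\<^sub>R perp e + q *\<^sub>R e \<in> A}"
        proof
          fix q assume "q \<in> {q0<..q0 + t}"
          then have q: "q0 < q" "q \<le> q0 + t" by auto
          have x: "s *\<^sub>R perp e + q *\<^sub>R e = z + (q - q0) *\<^sub>R e" unfolding zeq by (simp add: algebra_simps)
          have "dist (z + (q - q0) *\<^sub>R e) z \<le> t" using q e by (simp add: dist_norm)
          then have mO: "z + (q - q0) *\<^sub>R e \<in> \<Omega>" using z(1) K(2) q inB[OF KL[OF z(1)]] by (intro up[of z _ "q - q0"]) auto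
          have "(q - q0) *\<^sub>R e \<in> (\<lambda>s. s *\<^sub>R e) ` {0..t}" using q by (intro image_eqI[of _ _ "q - q0"]) auto
          then have "z + (q - q0) *\<^sub>R e \<in> A" unfolding A_def using mO z(1) by blast
          then show "q \<in> {q. s *\<^sub>R perp e + q *\<^sub>R e \<in> A}" by (simp only: mem_Collect_eq x)
        qed
        then have "emeasure lborel {q0<..q0 + t} \<le> emeasure lborel {q. s *\<^sub>R perp e + q *\<^sub>R e \<in> A}"
          by (rule emeasure_mono) (use slice in simp)
        then show ?thesis using True t by simp
      qed simp
    qed
    also have "\<dots> = emeasure lborel A" by (rule emeasure_frame[OF e Ab, symmetric])
    finally have em: "ennreal t * emeasure lborel (shadow e K) \<le> emeasure lborel A" .
    have "emeasure lborel (shadow e K) = ennreal (measure lebesgue (shadow e K))"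
      using emeasure_bounded_finite[OF compact_imp_bounded[OF cs]] borel_closed[OF compact_imp_closed[OF cs]]
      by (subst emeasure_eq_ennreal_measure) (auto simp: measure_completion)
    moreover have "emeasure lborel A = ennreal (measure lborel A)"
      using emeasure_bounded_finite[OF Ab(2)] by (subst emeasure_eq_ennreal_measure) auto
    ultimately have "ennreal (t * measure lebesgue (shadow e K)) \<le> ennreal (measure lborel A)"
      using em t by (simp only: ennreal_mult[OF less_imp_le[OF t(1)] measure_nonneg])
    then have "t * measure lebesgue (shadow e K) \<le> measure lborel A" by (subst (asm) ennreal_le_iff) auto
    also have "\<dots> = (\<integral>x. indicator A x \<partial>lborel)" using Ab by simp
    also have "\<dots> \<le> (\<integral>x. (g x - g (x - t *\<^sub>R e)) * \<zeta> x \<partial>lborel)"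
    proof (rule integral_mono)
      show "integrable lborel (indicator A :: real^2 \<Rightarrow> real)"
        using Ab emeasure_bounded_finite[OF Ab(2)] by (intro integrable_real_indicator) auto
      show "integrable lborel (\<lambda>x. (g x - g (x - t *\<^sub>R e)) * \<zeta> x)" using i1 by (simp add: left_diff_distrib)
    qed (rule lower)
    finally show ?thesis unfolding eq[symmetric] by (simp add: t_def)
  qed
  have lim: "(\<lambda>n. \<integral>x. g x * ((\<zeta> (x + h n *\<^sub>R e) - \<zeta> x) / h n) \<partial>lborel) \<longlonglongrightarrow> (\<integral>x. g x * frechet_derivative \<zeta> (at x) e \<partial>lborel)"
  proof (rule difference_quotient_integral_tendsto[OF smooth_derivative(1)[OF \<zeta>(1)] smooth_derivative(4)[OF \<zeta>(1)] L(1,3)])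
    show "h n \<le> 1" for n using h(2)[of n] m(2) by linarith
  qed (use g01 h hlim in auto)
  have "(\<integral>x. g x * ((\<zeta> (x + h n *\<^sub>R e) - \<zeta> x) / h n) \<partial>lborel) \<le> - measure lebesgue (shadow e K)" for n
  proof -
    have "(\<integral>x. g x * ((\<zeta> (x + h n *\<^sub>R e) - \<zeta> x) / h n) \<partial>lborel) = (\<integral>x. - (g x * (\<zeta> x - \<zeta> (x + h n *\<^sub>R e))) / h n \<partial>lborel)"
      by (rule Bochner_Integration.integral_cong) (auto simp: algebra_simps)
    also have "\<dots> = - (\<integral>x. g x * (\<zeta> x - \<zeta> (x + h n *\<^sub>R e)) \<partial>lborel) / h n"
      by (simp only: integral_divide_zero Bochner_Integration.integral_minus)
    also have "\<dots> \<le> - (h n * measure lebesgue (shadow e K)) / h n"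
      using step[of n] h(1)[of n] by (intro divide_right_mono) auto
    also have "\<dots> = - measure lebesgue (shadow e K)" using h(1)[of n] by (simp only: mult_minus_right[symmetric] nonzero_mult_div_cancel_left less_imp_neq[symmetric] not_False_eq_True)
    finally show ?thesis .
  qed
  then have "(\<integral>x. g x * frechet_derivative \<zeta> (at x) e \<partial>lborel) \<le> - measure lebesgue (shadow e K)"
    by (intro LIMSEQ_le_const2[OF lim]) auto
  moreover have "(\<integral>x. frechet_derivative \<zeta> (at x) e \<partial>lebesgue_on \<Omega>) = (\<integral>x. g x * frechet_derivative \<zeta> (at x) e \<partial>lborel)"
  proof -
    have "(\<lambda>x. g x * frechet_derivative \<zeta> (at x) e) \<in> borel_measurable borel"
      using borel_measurable_continuous_onI[OF smooth_derivative(4)[OF \<zeta>(1)]] by simp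
    then show ?thesis using \<Omega>L by (subst integral_restrict_space) (auto simp: g_def integral_completion)
  qed
  ultimately show ?thesis by linarith
qed

section \<open>Assembling the boundary\<close>

lemma tube_lmeasurable:
  fixes \<Omega> :: "'a::euclidean_space set"
  assumes "open \<Omega>" "bounded \<Omega>" "compact K"
  shows "{x \<in> \<Omega>. \<exists>z\<in>K. dist x z \<le> t} \<in> lmeasurable"
proof (cases "K = {}")
  case False
  have "(\<exists>z\<in>K. dist x z \<le> t) \<longleftrightarrow> infdist x K \<le> t" for x
    using infdist_attains_inf[OF compact_imp_closed[OF assms(3)] False, of x] infdist_le[of _ K x] by (metis order_trans)
  then have eq: "{x \<in> \<Omega>. \<exists>z\<in>K. dist x z \<le> t} = \<Omega> \<inter> {x. infdist x K \<le> t}" by auto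
  have "closed {x. infdist x K \<le> t}" by (intro closed_Collect_le continuous_intros)
  then have "\<Omega> \<inter> {x. infdist x K \<le> t} \<in> sets borel" using assms(1) by (intro sets.Int) (auto intro: borel_closed)
  then show ?thesis unfolding eq using assms(2) by (intro bounded_set_imp_lmeasurable) (auto intro: bounded_subset)
qed simp

text \<open>The number of balls times their radius is at most card X * c * \<rho>, uniformly in the
  radius t; a small \<rho> thus makes the discs around the centres negligible for length and layer
  area alike.\<close>

lemma corner_cover:
  assumes X: "finite X" and R: "0 < R" and c: "0 \<le> c" and \<eta>: "0 < \<eta>"
    and F: "\<And>x \<rho> t. x \<in> X \<Longrightarrow> 0 < t \<Longrightarrow> t \<le> \<rho> \<Longrightarrow> \<rho> \<le> R \<Longrightarrow>
       \<exists>F. finite F \<and> real (card F) \<le> c * \<rho> / t \<and> \<Gamma> \<inter> cball x \<rho> \<subseteq> (\<Union>q\<in>F. cball q t)"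
  obtains \<rho> where "0 < \<rho>" "\<And>t. 0 < t \<Longrightarrow> t \<le> \<rho> \<Longrightarrow>
    \<exists>F. finite F \<and> real (card F) * t \<le> \<eta> \<and> (\<Union>x\<in>X. \<Gamma> \<inter> cball x \<rho>) \<subseteq> (\<Union>q\<in>F. cball q t)"
proof -
  define \<rho> where "\<rho> = min R (\<eta> / (real (card X) * c + 1))"
  have den: "0 < real (card X) * c + 1" using c by (simp add: add_nonneg_pos)
  have \<rho>: "0 < \<rho>" "\<rho> \<le> R" using R \<eta> den by (auto simp: \<rho>_def)
  have "\<rho> \<le> \<eta> / (real (card X) * c + 1)" by (simp add: \<rho>_def)
  then have "\<rho> * (real (card X) * c + 1) \<le> \<eta>" using den by (simp add: pos_le_divide_eq)
  then have \<rho>\<eta>: "real (card X) * (c * \<rho>) \<le> \<eta>" using \<rho>(1) by (simp add: algebra_simps)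
  show thesis
  proof (rule that[OF \<rho>(1)])
    fix t :: real assume t: "0 < t" "t \<le> \<rho>"
    have "\<forall>x\<in>X. \<exists>F. finite F \<and> real (card F) \<le> c * \<rho> / t \<and> \<Gamma> \<inter> cball x \<rho> \<subseteq> (\<Union>q\<in>F. cball q t)"
      using F[OF _ t \<rho>(2)] by blast
    then obtain G where G: "\<forall>x\<in>X. finite (G x) \<and> real (card (G x)) \<le> c * \<rho> / t \<and> \<Gamma> \<inter> cball x \<rho> \<subseteq> (\<Union>q\<in>G x. cball q t)"
      by (rule bchoice[THEN exE])
    have "real (card (\<Union>x\<in>X. G x)) \<le> (\<Sum>x\<in>X. real (card (G x)))"
      using card_UN_le[OF X, of G] by (metis of_nat_le_iff of_nat_sum)
    also have "\<dots> \<le> (\<Sum>x\<in>X. c * \<rho> / t)" using G by (intro sum_mono) blast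
    also have "\<dots> = real (card X) * (c * \<rho>) / t" by simp
    also have "\<dots> \<le> \<eta> / t" using \<rho>\<eta> t by (intro divide_right_mono) auto
    finally have "real (card (\<Union>x\<in>X. G x)) * t \<le> \<eta>" using t by (simp add: pos_le_divide_eq)
    moreover have "(\<Union>x\<in>X. \<Gamma> \<inter> cball x \<rho>) \<subseteq> (\<Union>q\<in>(\<Union>x\<in>X. G x). cball q t)" using G by blast
    moreover have "finite (\<Union>x\<in>X. G x)" using X G by blast
    ultimately show "\<exists>F. finite F \<and> real (card F) * t \<le> \<eta> \<and> (\<Union>x\<in>X. \<Gamma> \<inter> cball x \<rho>) \<subseteq> (\<Union>q\<in>F. cball q t)" by blast
  qed
qed

lemma fine_cover_cballs:
  fixes C :: "'a::euclidean_space set"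
  assumes "0 < \<rho>" "\<And>t. 0 < t \<Longrightarrow> t \<le> \<rho> \<Longrightarrow> \<exists>F. finite F \<and> real (card F) * t \<le> \<eta> \<and> C \<subseteq> (\<Union>q\<in>F. cball q t)"
  shows "fine_cover C (2 * \<eta>)"
  unfolding fine_cover_def
proof (intro allI impI)
  fix d :: real assume d: "0 < d"
  define t where "t = min \<rho> (d / 2)"
  have t: "0 < t" "t \<le> \<rho>" "2 * t \<le> d" using assms(1) d by (auto simp: t_def)
  obtain F where F: "finite F" "real (card F) * t \<le> \<eta>" "C \<subseteq> (\<Union>q\<in>F. cball q t)" using assms(2)[OF t(1,2)] by blast
  define \<C> where "\<C> = (\<lambda>q. cball q t) ` F"
  have dm: "diameter D = 2 * t" if "D \<in> \<C>" for D using that t by (auto simp: \<C>_def)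
  have "(\<Sum>D\<in>\<C>. diameter D) = (\<Sum>D\<in>\<C>. 2 * t)" by (rule sum.cong) (auto simp: dm)
  also have "\<dots> = real (card \<C>) * (2 * t)" by simp
  also have "\<dots> \<le> real (card F) * (2 * t)" unfolding \<C>_def using card_image_le[OF F(1), of "\<lambda>q. cball q t"] t by (intro mult_right_mono) auto
  also have "\<dots> \<le> 2 * \<eta>" using F(2) by simp
  finally have s: "(\<Sum>D\<in>\<C>. diameter D) \<le> 2 * \<eta>" .
  have "finite \<C>" "C \<subseteq> \<Union>\<C>" using F by (auto simp: \<C>_def)
  moreover have "\<forall>D\<in>\<C>. bounded D \<and> diameter D \<le> d" using dm t(3) by (auto simp: \<C>_def)
  ultimately show "\<exists>\<C>. finite \<C> \<and> C \<subseteq> \<Union>\<C> \<and> (\<forall>C\<in>\<C>. bounded C \<and> diameter C \<le> d) \<and> (\<Sum>C\<in>\<C>. diameter C) \<le> 2 * \<eta>"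
    using s by (intro exI[of _ \<C>]) blast
qed

text \<open>Points within t of a ball of radius t lie in the concentric ball of radius 2 t, of area
  4 pi t^2, and the number of balls times t is at most \<eta>.\<close>

lemma tube_cballs:
  fixes \<Omega> :: "(real^2) set"
  assumes \<Omega>: "open \<Omega>" "bounded \<Omega>" and t: "0 < t" and F: "finite F" "real (card F) * t \<le> \<eta>" "C \<subseteq> (\<Union>q\<in>F. cball q t)"
  obtains B where "B \<in> lmeasurable" "{x \<in> \<Omega>. \<exists>z\<in>C. dist x z \<le> t} \<subseteq> B" "measure lebesgue B \<le> 4 * pi * \<eta> * t"
proof -
  define B where "B = (\<Union>q\<in>F. cball q (2 * t))"
  have "{x \<in> \<Omega>. \<exists>z\<in>C. dist x z \<le> t} \<subseteq> B"
  proof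
    fix x assume "x \<in> {x \<in> \<Omega>. \<exists>z\<in>C. dist x z \<le> t}"
    then obtain z where z: "z \<in> C" "dist x z \<le> t" by blast
    then obtain q where q: "q \<in> F" "z \<in> cball q t" using F(3) by blast
    have "dist q x \<le> 2 * t" using q(2) z(2) dist_triangle[of q x z] by (simp add: dist_commute)
    then show "x \<in> B" using q(1) by (auto simp: B_def)
  qed
  moreover have Bl: "B \<in> lmeasurable" unfolding B_def by (intro lmeasurable_compact compact_UN F(1) compact_cball)
  moreover have "measure lebesgue B \<le> 4 * pi * \<eta> * t"
  proof -
    have "measure lebesgue B \<le> (\<Sum>q\<in>F. measure lebesgue (cball q (2 * t)))"
      unfolding B_def by (rule measure_UNION_le[OF F(1)]) simp
    also have "\<dots> = (\<Sum>q\<in>F. (2 * t)\<^sup>2 * pi)"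
    proof (rule sum.cong[OF refl])
      fix q :: "real^2"
      have "measure lebesgue (cball q (2 * t)) = measure lborel (cball q (2 * t))" by (simp add: measure_completion)
      also have "\<dots> = (2 * t)\<^sup>2 * pi" using t by (simp add: content_cball_conv_ball circle_area)
      finally show "measure lebesgue (cball q (2 * t)) = (2 * t)\<^sup>2 * pi" .
    qed
    also have "\<dots> = (4 * pi * t) * (real (card F) * t)" by (simp add: power2_eq_square)
    also have "\<dots> \<le> (4 * pi * t) * \<eta>" using F(2) t by (intro mult_left_mono) auto
    finally show ?thesis by (simp add: mult_ac)
  qed
  ultimately show thesis using that by blast
qed

text \<open>The segment to a nearest point of the complement meets the frontier no farther away than
  its end.\<close>

lemma boundary_layer_subset:
  fixes \<Omega> :: "'a::euclidean_space set"
  assumes \<Omega>: "open \<Omega>" "bounded \<Omega>" and cov: "frontier \<Omega> \<subseteq> A"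
  shows "{x \<in> \<Omega>. infdist x (- \<Omega>) \<le> t} \<subseteq> {x \<in> \<Omega>. \<exists>z\<in>A. dist x z \<le> t}"
proof
  fix x assume "x \<in> {x \<in> \<Omega>. infdist x (- \<Omega>) \<le> t}"
  then have x: "x \<in> \<Omega>" "infdist x (- \<Omega>) \<le> t" by auto
  have "- \<Omega> \<noteq> {}"
  proof
    assume "- \<Omega> = {}"
    then have "\<Omega> = UNIV" by blast
    then show False using \<Omega>(2) not_bounded_UNIV by simp
  qed
  then obtain q where q: "q \<in> - \<Omega>" "infdist x (- \<Omega>) = dist x q"
    using infdist_attains_inf[of "- \<Omega>" x] \<Omega>(1) by (auto simp: closed_Compl)
  have "closed_segment x q \<inter> frontier \<Omega> \<noteq> {}"
    using x(1) q(1) by (intro connected_Int_frontier connected_segment) auto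
  then obtain z where z: "z \<in> closed_segment x q" "z \<in> frontier \<Omega>" by blast
  have "dist x z \<le> dist x q" using dist_in_closed_segment[OF z(1)] by (simp add: dist_commute)
  then have "dist x z \<le> t" using x(2) q(2) by simp
  then show "x \<in> {x \<in> \<Omega>. \<exists>z\<in>A. dist x z \<le> t}" using x(1) z(2) cov by blast
qed

lemma disjoint_cutoffs:
  fixes K :: "'j \<Rightarrow> 'a::euclidean_space set"
  assumes J: "finite J" "\<And>j. j \<in> J \<Longrightarrow> compact (K j)" "\<And>j. j \<in> J \<Longrightarrow> K j \<noteq> {}"
    "\<And>i j. i \<in> J \<Longrightarrow> j \<in> J \<Longrightarrow> i \<noteq> j \<Longrightarrow> K i \<inter> K j = {}"
    and B: "\<And>j. j \<in> J \<Longrightarrow> open (B j)" "\<And>j. j \<in> J \<Longrightarrow> K j \<subseteq> B j"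
  obtains \<zeta> \<sigma> L where "0 < \<sigma>" "\<And>j. j \<in> J \<Longrightarrow> smooth (\<zeta> j)" "\<And>j x. j \<in> J \<Longrightarrow> 0 \<le> \<zeta> j x" "\<And>j x. j \<in> J \<Longrightarrow> \<zeta> j x \<le> (1::real)"
    "\<And>j x z. j \<in> J \<Longrightarrow> z \<in> K j \<Longrightarrow> dist x z \<le> \<sigma> \<Longrightarrow> \<zeta> j x = 1"
    "\<And>j. j \<in> J \<Longrightarrow> compact (L j)" "\<And>j. j \<in> J \<Longrightarrow> L j \<subseteq> B j" "\<And>j x. j \<in> J \<Longrightarrow> x \<notin> L j \<Longrightarrow> \<zeta> j x = 0"
    "\<And>i j x. i \<in> J \<Longrightarrow> j \<in> J \<Longrightarrow> \<zeta> i x \<noteq> 0 \<Longrightarrow> \<zeta> j x \<noteq> 0 \<Longrightarrow> i = j"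
proof -
  obtain d where d: "0 < d" "\<And>i j x y. i \<in> J \<Longrightarrow> j \<in> J \<Longrightarrow> i \<noteq> j \<Longrightarrow> x \<in> K i \<Longrightarrow> y \<in> K j \<Longrightarrow> d \<le> dist x y"
    by (rule disjoint_compact_separated[where K = K, OF J(1,2,4)]) (assumption | rule that)+
  have "\<forall>j\<in>J. \<exists>\<rho>>0. (\<Union>z\<in>K j. cball z \<rho>) \<subseteq> B j"
  proof
    fix j assume j: "j \<in> J"
    show "\<exists>\<rho>>0. (\<Union>z\<in>K j. cball z \<rho>) \<subseteq> B j"
      by (rule compact_subset_open_imp_cball_epsilon_subset[OF J(2)[OF j] B(1)[OF j] B(2)[OF j]]) blast
  qed
  then obtain \<rho> where \<rho>: "\<forall>j\<in>J. 0 < \<rho> j \<and> (\<Union>z\<in>K j. cball z (\<rho> j)) \<subseteq> B j" by (rule bchoice[THEN exE])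
  \<comment> \<open>Supports reach up to 4 \<open>\<sigma>\<close>: being at most
    \<open>\<rho> j\<close> this stays inside \<open>B j\<close>, and 8 \<open>\<sigma>\<close> < d
    keeps any two supports apart.\<close>
  define \<sigma> where "\<sigma> = min (d / 16) (Min (insert 1 (\<rho> ` J)) / 4)"
  have \<sigma>: "0 < \<sigma>" "8 * \<sigma> < d"
  proof -
    have "0 < Min (insert 1 (\<rho> ` J))" using J(1) \<rho> by (subst Min_gr_iff) auto
    then show "0 < \<sigma>" using d(1) by (simp add: \<sigma>_def)
    show "8 * \<sigma> < d" using d(1) by (simp add: \<sigma>_def min_def)
  qed
  have \<sigma>\<rho>: "4 * \<sigma> \<le> \<rho> j" if j: "j \<in> J" for j
  proof -
    have "Min (insert 1 (\<rho> ` J)) \<le> \<rho> j" using J(1) j by (intro Min_le) auto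
    then show ?thesis by (simp add: \<sigma>_def min_def)
  qed
  have "\<forall>j\<in>J. \<exists>\<zeta> :: 'a \<Rightarrow> real. smooth \<zeta> \<and> (\<forall>x. 0 \<le> \<zeta> x \<and> \<zeta> x \<le> 1 \<and> (infdist x (K j) \<le> \<sigma> \<longrightarrow> \<zeta> x = 1) \<and>
      (4 * \<sigma> \<le> infdist x (K j) \<longrightarrow> \<zeta> x = 0))"
  proof
    fix j assume j: "j \<in> J"
    obtain \<zeta> :: "'a \<Rightarrow> real" where "smooth \<zeta>" "\<And>x. 0 \<le> \<zeta> x" "\<And>x. \<zeta> x \<le> 1" "\<And>x. infdist x (K j) \<le> \<sigma> \<Longrightarrow> \<zeta> x = 1"
      "\<And>x. 4 * \<sigma> \<le> infdist x (K j) \<Longrightarrow> \<zeta> x = 0"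
      by (rule smooth_cutoff[OF compact_imp_bounded[OF J(2)[OF j]] J(3)[OF j] \<sigma>(1)]) (rule that)
    then show "\<exists>\<zeta> :: 'a \<Rightarrow> real. smooth \<zeta> \<and> (\<forall>x. 0 \<le> \<zeta> x \<and> \<zeta> x \<le> 1 \<and> (infdist x (K j) \<le> \<sigma> \<longrightarrow> \<zeta> x = 1) \<and>
      (4 * \<sigma> \<le> infdist x (K j) \<longrightarrow> \<zeta> x = 0))" by (intro exI[of _ \<zeta>]) blast
  qed
  then obtain \<zeta> :: "'j \<Rightarrow> 'a \<Rightarrow> real" where \<zeta>: "\<forall>j\<in>J. smooth (\<zeta> j) \<and> (\<forall>x. 0 \<le> \<zeta> j x \<and> \<zeta> j x \<le> 1 \<and> (infdist x (K j) \<le> \<sigma> \<longrightarrow> \<zeta> j x = 1) \<and>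
      (4 * \<sigma> \<le> infdist x (K j) \<longrightarrow> \<zeta> j x = 0))" by (rule bchoice[THEN exE])
  have near: "\<exists>z\<in>K j. dist x z \<le> 4 * \<sigma>" if "j \<in> J" "infdist x (K j) \<le> 4 * \<sigma>" for j x
    using infdist_attains_inf[OF compact_imp_closed[OF J(2)[OF that(1)]] J(3)[OF that(1)], of x] that(2) by metis
  define L where "L = (\<lambda>j. {x. infdist x (K j) \<le> 4 * \<sigma>})"
  show thesis
  proof (rule that[OF \<sigma>(1)])
    fix j assume j: "j \<in> J"
    show "smooth (\<zeta> j)" using \<zeta> j by blast
    show "0 \<le> \<zeta> j x" "\<zeta> j x \<le> 1" for x using \<zeta> j by blast+
    show "\<zeta> j x = 1" if "z \<in> K j" "dist x z \<le> \<sigma>" for x z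
    proof -
      have "infdist x (K j) \<le> \<sigma>" using infdist_le[OF that(1), of x] that(2) by linarith
      then show ?thesis using \<zeta> j by blast
    qed
    show "compact (L j)" unfolding L_def using \<sigma>(1) by (intro compact_infdist_le[OF J(3)[OF j] J(2)[OF j]]) simp
    show "L j \<subseteq> B j"
    proof
      fix x assume "x \<in> L j"
      then obtain z where z: "z \<in> K j" "dist x z \<le> 4 * \<sigma>" using near[OF j, of x] by (auto simp: L_def)
      then have "x \<in> cball z (\<rho> j)" using \<sigma>\<rho>[OF j] by (simp add: dist_commute)
      then show "x \<in> B j" using \<rho> j z(1) by blast
    qed
    show "\<zeta> j x = 0" if "x \<notin> L j" for x
    proof -
      have "4 * \<sigma> \<le> infdist x (K j)" using that by (simp add: L_def)
      then show ?thesis using \<zeta> j by blast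
    qed
  next
    fix i j x assume ij: "i \<in> J" "j \<in> J" "\<zeta> i x \<noteq> 0" "\<zeta> j x \<noteq> 0"
    have "\<not> 4 * \<sigma> \<le> infdist x (K i)" "\<not> 4 * \<sigma> \<le> infdist x (K j)" using \<zeta> ij by blast+
    then have "infdist x (K i) \<le> 4 * \<sigma>" "infdist x (K j) \<le> 4 * \<sigma>" by linarith+
    then obtain z w where zw: "z \<in> K i" "dist x z \<le> 4 * \<sigma>" "w \<in> K j" "dist x w \<le> 4 * \<sigma>" using near ij(1,2) by metis
    show "i = j"
    proof (rule ccontr)
      assume "i \<noteq> j"
      then have "d \<le> dist z w" using d(2) ij(1,2) zw by blast
      also have "\<dots> \<le> 8 * \<sigma>" using dist_triangle[of z w x] zw(2,4) by (simp add: dist_commute)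
      finally show False using \<sigma>(2) by simp
    qed
  qed
qed

text \<open>Each cutoff is multiplied by its own inner direction \<open>e j\<close>; disjoint
  supports keep the norm of the sum at most 1, and each summand contributes at least the shadow of
  its piece.\<close>

lemma normal_field:
  fixes N :: nat
  assumes \<Omega>: "open \<Omega>" "bounded \<Omega>" and fl: "\<And>j. j < N \<Longrightarrow> flat \<Omega> \<delta> (e j) (y j) (r j)"
    and K: "\<And>j. j < N \<Longrightarrow> compact (K j)" "\<And>j. j < N \<Longrightarrow> K j \<subseteq> frontier \<Omega> \<inter> ball (y j) (r j)"
    "\<And>i j. i < N \<Longrightarrow> j < N \<Longrightarrow> i \<noteq> j \<Longrightarrow> K i \<inter> K j = {}"
  shows "\<exists>(J :: nat set) \<zeta>. finite J \<and> (\<forall>j\<in>J. \<zeta> j \<in> test_functions UNIV) \<and>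
      (\<forall>x. norm (\<Sum>j\<in>J. \<zeta> j x *\<^sub>R e j) \<le> 1) \<and>
      (\<Sum>j<N. measure lebesgue (shadow (e j) (K j))) \<le> - (\<Sum>j\<in>J. \<integral>x. frechet_derivative (\<zeta> j) (at x) (e j) \<partial>lebesgue_on \<Omega>)"
proof -
  \<comment> \<open>Empty pieces are dropped, since cutoffs are built around nonempty sets; their
    shadows have measure 0.\<close>
  define J where "J = {j. j < N \<and> K j \<noteq> {}}"
  have JN: "j < N" if "j \<in> J" for j using that by (simp add: J_def)
  have fJ: "finite J" by (simp add: J_def)
  obtain \<zeta> :: "nat \<Rightarrow> real^2 \<Rightarrow> real" and \<sigma> L where \<sigma>: "0 < \<sigma>" and \<zeta>: "\<And>j. j \<in> J \<Longrightarrow> smooth (\<zeta> j)" "\<And>j x. j \<in> J \<Longrightarrow> 0 \<le> \<zeta> j x" "\<And>j x. j \<in> J \<Longrightarrow> \<zeta> j x \<le> 1"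
    "\<And>j x z. j \<in> J \<Longrightarrow> z \<in> K j \<Longrightarrow> dist x z \<le> \<sigma> \<Longrightarrow> \<zeta> j x = 1"
    "\<And>j. j \<in> J \<Longrightarrow> compact (L j)" "\<And>j. j \<in> J \<Longrightarrow> L j \<subseteq> ball (y j) (r j)" "\<And>j x. j \<in> J \<Longrightarrow> x \<notin> L j \<Longrightarrow> \<zeta> j x = 0"
    "\<And>i j x. i \<in> J \<Longrightarrow> j \<in> J \<Longrightarrow> \<zeta> i x \<noteq> 0 \<Longrightarrow> \<zeta> j x \<noteq> 0 \<Longrightarrow> i = j"
  proof (rule disjoint_cutoffs[where J = J and K = K and B = "\<lambda>j. ball (y j) (r j)"])
    show "finite J" by (rule fJ)
    show "compact (K j)" if "j \<in> J" for j using K(1) JN[OF that] .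
    show "K j \<noteq> {}" if "j \<in> J" for j using that by (simp add: J_def)
    show "K i \<inter> K j = {}" if "i \<in> J" "j \<in> J" "i \<noteq> j" for i j using K(3) JN that by blast
    show "open (ball (y j) (r j))" for j by simp
    show "K j \<subseteq> ball (y j) (r j)" if "j \<in> J" for j using K(2)[OF JN[OF that]] by blast
  qed (rule that)
  have tf: "\<zeta> j \<in> test_functions UNIV" if "j \<in> J" for j
    by (rule test_functionI[OF \<zeta>(1)[OF that] \<zeta>(5)[OF that] subset_UNIV \<zeta>(7)[OF that]])
  have nrm: "norm (\<Sum>j\<in>J. \<zeta> j x *\<^sub>R e j) \<le> 1" for x
  proof (cases "\<exists>k\<in>J. \<zeta> k x \<noteq> 0")
    case True
    then obtain k where k: "k \<in> J" "\<zeta> k x \<noteq> 0" by blast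
    have z: "\<zeta> j x *\<^sub>R e j = 0" if "j \<in> J - {k}" for j using \<zeta>(8)[of j k x] that k by auto
    then have "(\<Sum>j\<in>J. \<zeta> j x *\<^sub>R e j) = \<zeta> k x *\<^sub>R e k" 
      unfolding sum.remove[OF fJ k(1)] by (subst sum.neutral) (use z in auto)
    moreover have "norm (e k) = 1" using fl[OF JN[OF k(1)]] by (simp add: flat_def)
    ultimately show ?thesis using \<zeta>(2,3)[OF k(1), of x] by simp
  next
    case False
    then have "(\<Sum>j\<in>J. \<zeta> j x *\<^sub>R e j) = 0" by (intro sum.neutral) auto
    then show ?thesis by simp
  qed
  have "(\<Sum>j<N. measure lebesgue (shadow (e j) (K j))) = (\<Sum>j\<in>J. measure lebesgue (shadow (e j) (K j)))"
    by (rule sum.mono_neutral_right) (auto simp: J_def)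
  also have "\<dots> \<le> (\<Sum>j\<in>J. - (\<integral>x. frechet_derivative (\<zeta> j) (at x) (e j) \<partial>lebesgue_on \<Omega>))"
  proof (rule sum_mono)
    fix j assume j: "j \<in> J"
    show "measure lebesgue (shadow (e j) (K j)) \<le> - (\<integral>x. frechet_derivative (\<zeta> j) (at x) (e j) \<partial>lebesgue_on \<Omega>)"
      using j \<zeta> \<sigma> by (intro directional_derivative_shadow[OF fl[OF JN[OF j]] \<Omega> K(1)[OF JN[OF j]] K(2)[OF JN[OF j]] \<zeta>(1)[OF j], of "L j" \<sigma>]) auto
  qed
  finally show ?thesis using fJ tf nrm by (intro exI[of _ J] exI[of _ \<zeta>]) (simp add: sum_negf)
qed

text \<open>\<open>S\<close> is the total shadow of covering pieces and bounds length and layer area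
  from above; \<open>S'\<close> is that of disjoint pieces and bounds length and flux from below. As
  \<open>S\<close> exceeds \<open>S'\<close> by at most \<eta>, both are close to the length of the
  frontier.\<close>

lemma boundary_estimates:
  assumes \<Omega>: "curvilinear_polygon \<Omega>" "bounded \<Omega>" and \<eta>: "0 < \<eta>"
  obtains S S' where "hausdorff_length (frontier \<Omega>) \<le> ennreal ((1 + \<eta>) * (S + \<eta>) + 2 * \<eta>)"
    "ennreal S' \<le> hausdorff_length (frontier \<Omega>)" "0 \<le> S" "0 \<le> S'" "S \<le> S' + \<eta>"
    "\<exists>t0>0. \<forall>t. 0 < t \<and> t \<le> t0 \<longrightarrow>
       measure lebesgue {x \<in> \<Omega>. infdist x (- \<Omega>) \<le> t} \<le> ((1 + 3 * \<eta>) * (S + \<eta>) + 4 * pi * \<eta>) * t"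
    "\<exists>(J :: nat set) \<zeta> e. finite J \<and> (\<forall>j\<in>J. \<zeta> j \<in> test_functions UNIV) \<and>
      (\<forall>x. norm (\<Sum>j\<in>J. \<zeta> j x *\<^sub>R e j) \<le> 1) \<and>
      S' \<le> - (\<Sum>j\<in>J. \<integral>x. frechet_derivative (\<zeta> j) (at x) (e j) \<partial>lebesgue_on \<Omega>)"
proof -
  let ?\<Gamma> = "frontier \<Omega>"
  have o\<Omega>: "open \<Omega>" using \<Omega>(1) by (simp add: curvilinear_polygon_def)
  have cf: "compact ?\<Gamma>" using \<Omega>(2) by (simp add: compact_frontier_bounded)
  obtain X R c where X: "finite X" "X \<subseteq> ?\<Gamma>" "0 < R" "0 \<le> c"
    "\<And>y \<delta>. y \<in> ?\<Gamma> - X \<Longrightarrow> 0 < \<delta> \<Longrightarrow> \<exists>e r. flat \<Omega> \<delta> e y r"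
    "\<And>x \<rho> t. x \<in> X \<Longrightarrow> 0 < t \<Longrightarrow> t \<le> \<rho> \<Longrightarrow> \<rho> \<le> R \<Longrightarrow>
       \<exists>F. finite F \<and> real (card F) \<le> c * \<rho> / t \<and> ?\<Gamma> \<inter> cball x \<rho> \<subseteq> (\<Union>q\<in>F. cball q t)"
    by (rule frontier_structure[OF \<Omega>]) (rule that)
  obtain \<rho> where \<rho>: "0 < \<rho>" "\<And>t. 0 < t \<Longrightarrow> t \<le> \<rho> \<Longrightarrow>
    \<exists>F. finite F \<and> real (card F) * t \<le> \<eta> \<and> (\<Union>x\<in>X. ?\<Gamma> \<inter> cball x \<rho>) \<subseteq> (\<Union>q\<in>F. cball q t)"
    by (rule corner_cover[OF X(1,3,4) \<eta> X(6)]) (assumption | rule that)+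
  define C where "C = (\<Union>x\<in>X. ?\<Gamma> \<inter> cball x \<rho>)"
  define Y where "Y = ?\<Gamma> - (\<Union>x\<in>X. ball x \<rho>)"
  have cY: "compact Y" unfolding Y_def by (intro compact_diff cf open_UN ballI open_ball)
  have Y: "Y \<subseteq> ?\<Gamma>" "\<Gamma>' \<in> Y \<Longrightarrow> \<exists>e r. flat \<Omega> \<eta> e \<Gamma>' r" for \<Gamma>'
  proof -
    show "Y \<subseteq> ?\<Gamma>" by (auto simp: Y_def)
    assume "\<Gamma>' \<in> Y"
    then have "\<Gamma>' \<in> ?\<Gamma> - X" using \<rho>(1) by (auto simp: Y_def)
    then show "\<exists>e r. flat \<Omega> \<eta> e \<Gamma>' r" by (rule X(5)[OF _ \<eta>])
  qed
  have \<Gamma>: "?\<Gamma> \<subseteq> Y \<union> C" by (auto simp: Y_def C_def)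
  obtain N :: nat and y r e K K' where fl: "\<And>j. j < N \<Longrightarrow> flat \<Omega> \<eta> (e j) (y j) (r j)"
    and K: "\<And>j. j < N \<Longrightarrow> compact (K j)" "\<And>j. j < N \<Longrightarrow> K j \<subseteq> ?\<Gamma> \<inter> ball (y j) (r j)"
    and K': "\<And>j. j < N \<Longrightarrow> compact (K' j)" "\<And>j. j < N \<Longrightarrow> K' j \<subseteq> ?\<Gamma> \<inter> ball (y j) (r j)"
    "\<And>i j. i < N \<Longrightarrow> j < N \<Longrightarrow> i \<noteq> j \<Longrightarrow> K' i \<inter> K' j = {}" and YK: "Y \<subseteq> (\<Union>j<N. K j)"
    and SS: "(\<Sum>j<N. measure lebesgue (shadow (e j) (K j))) \<le> (\<Sum>j<N. measure lebesgue (shadow (e j) (K' j))) + \<eta>"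
    by (rule flat_pieces[OF o\<Omega> cY Y \<eta>]) (assumption | rule that)+
  define S where "S = (\<Sum>j<N. measure lebesgue (shadow (e j) (K j)))"
  define S' where "S' = (\<Sum>j<N. measure lebesgue (shadow (e j) (K' j)))"
  \<comment> \<open>The error is shared among the pieces; the added 1 covers N = 0.\<close>
  define \<eta>' where "\<eta>' = \<eta> / (real N + 1)"
  have \<eta>': "0 < \<eta>'" "real N * \<eta>' \<le> \<eta>" using \<eta> by (auto simp: \<eta>'_def field_simps)
  have cov: "?\<Gamma> \<subseteq> (\<Union>j<N. K j) \<union> C" using \<Gamma> YK by blast
  have sum\<eta>: "(\<Sum>j<N. measure lebesgue (shadow (e j) (K j)) + \<eta>') \<le> S + \<eta>"
    using \<eta>'(2) by (simp add: sum.distrib S_def)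
  have 1: "hausdorff_length ?\<Gamma> \<le> ennreal ((1 + \<eta>) * (S + \<eta>) + 2 * \<eta>)"
  proof -
    have "fine_cover ((\<Union>j<N. K j) \<union> C) ((\<Sum>j<N. (1 + \<eta>) * (measure lebesgue (shadow (e j) (K j)) + \<eta>')) + 2 * \<eta>)"
    proof (intro fine_cover_Un fine_cover_UN)
      show "fine_cover (K j) ((1 + \<eta>) * (measure lebesgue (shadow (e j) (K j)) + \<eta>'))" if "j < N" for j
        by (rule fine_cover_flat[OF fl[OF that] o\<Omega> less_imp_le[OF \<eta>] K(1)[OF that] K(2)[OF that] \<eta>'(1)])
      show "fine_cover C (2 * \<eta>)" unfolding C_def by (rule fine_cover_cballs[OF \<rho>])
    qed
    then have "hausdorff_length ?\<Gamma> \<le> ennreal ((\<Sum>j<N. (1 + \<eta>) * (measure lebesgue (shadow (e j) (K j)) + \<eta>')) + 2 * \<eta>)"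
      by (intro hausdorff_length_fine_cover fine_cover_subset[OF _ cov])
    also have "\<dots> \<le> ennreal ((1 + \<eta>) * (S + \<eta>) + 2 * \<eta>)"
      unfolding sum_distrib_left[symmetric] using sum\<eta> \<eta> by (intro ennreal_leI add_right_mono mult_left_mono) auto
    finally show ?thesis .
  qed
  have em: "emeasure lborel (shadow (e j) (K' j)) = ennreal (measure lebesgue (shadow (e j) (K' j)))" if "j < N" for j
  proof -
    have c: "compact (shadow (e j) (K' j))" by (rule compact_shadow[OF K'(1)[OF that]])
    have s: "shadow (e j) (K' j) \<in> sets lborel" using borel_closed[OF compact_imp_closed[OF c]] unfolding sets_lborel .
    have "emeasure lborel (shadow (e j) (K' j)) \<noteq> top"
      by (rule less_imp_neq[OF emeasure_bounded_finite[OF compact_imp_bounded[OF c], unfolded infinity_ennreal_def]])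
    from emeasure_eq_ennreal_measure[OF this] show ?thesis unfolding measure_completion[OF s] .
  qed
  have 2: "ennreal S' \<le> hausdorff_length ?\<Gamma>"
  proof -
    have "ennreal S' = (\<Sum>j<N. ennreal (measure lebesgue (shadow (e j) (K' j))))"
      unfolding S'_def by (rule sum_ennreal[symmetric]) simp
    also have "\<dots> = (\<Sum>j<N. emeasure lborel (shadow (e j) (K' j)))" by (rule sum.cong) (auto simp: em)
    also have "\<dots> \<le> hausdorff_length ?\<Gamma>"
    proof (rule hausdorff_length_ge)
      fix j x z assume "j \<in> {..<N}"
      then have "norm (e j) = 1" using fl by (simp add: flat_def)
      from perp_props(6)[OF this, of "x - z"] show "\<bar>x \<bullet> perp (e j) - z \<bullet> perp (e j)\<bar> \<le> dist x z"
        by (simp add: inner_diff_left dist_norm)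
    qed (use K' in auto)
    finally show ?thesis .
  qed
  have 6: "\<exists>t0>0. \<forall>t. 0 < t \<and> t \<le> t0 \<longrightarrow>
       measure lebesgue {x \<in> \<Omega>. infdist x (- \<Omega>) \<le> t} \<le> ((1 + 3 * \<eta>) * (S + \<eta>) + 4 * pi * \<eta>) * t"
  proof -
    have "\<forall>j\<in>{..<N}. \<exists>t0>0. \<forall>t. 0 < t \<and> t \<le> t0 \<longrightarrow>
      measure lebesgue {x \<in> \<Omega>. \<exists>z\<in>K j. dist x z \<le> t} \<le> (1 + 3 * \<eta>) * (measure lebesgue (shadow (e j) (K j)) + \<eta>') * t"
    proof
      fix j assume "j \<in> {..<N}"
      then have j: "j < N" by simp
      show "\<exists>t0>0. \<forall>t. 0 < t \<and> t \<le> t0 \<longrightarrow>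
        measure lebesgue {x \<in> \<Omega>. \<exists>z\<in>K j. dist x z \<le> t} \<le> (1 + 3 * \<eta>) * (measure lebesgue (shadow (e j) (K j)) + \<eta>') * t"
        by (rule tube_measure[OF fl[OF j] o\<Omega> less_imp_le[OF \<eta>] K(1)[OF j] K(2)[OF j] \<eta>'(1)])
    qed
    then obtain T where T: "\<forall>j\<in>{..<N}. 0 < T j \<and> (\<forall>t. 0 < t \<and> t \<le> T j \<longrightarrow>
      measure lebesgue {x \<in> \<Omega>. \<exists>z\<in>K j. dist x z \<le> t} \<le> (1 + 3 * \<eta>) * (measure lebesgue (shadow (e j) (K j)) + \<eta>') * t)"
      by (rule bchoice[THEN exE])
    define t0 where "t0 = Min (insert \<rho> (T ` {..<N}))"
    have t0: "0 < t0" "t0 \<le> \<rho>" "\<And>j. j < N \<Longrightarrow> t0 \<le> T j"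
    proof -
      show "0 < t0" unfolding t0_def using T \<rho>(1) by (subst Min_gr_iff) auto
      show "t0 \<le> \<rho>" unfolding t0_def by (intro Min_le) auto
      show "t0 \<le> T j" if "j < N" for j unfolding t0_def using that by (intro Min_le) auto
    qed
    show ?thesis
    proof (intro exI[of _ t0] conjI t0(1) allI impI)
      fix t assume "0 < t \<and> t \<le> t0"
      then have t: "0 < t" "t \<le> t0" by auto
      obtain F where F: "finite F" "real (card F) * t \<le> \<eta>" "C \<subseteq> (\<Union>q\<in>F. cball q t)"
        using \<rho>(2)[of t] t t0(2) unfolding C_def by auto
      obtain B where B: "B \<in> lmeasurable" "{x \<in> \<Omega>. \<exists>z\<in>C. dist x z \<le> t} \<subseteq> B" "measure lebesgue B \<le> 4 * pi * \<eta> * t"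
        by (rule tube_cballs[OF o\<Omega> \<Omega>(2) t(1) F])
      define A where "A = (\<lambda>j. {x \<in> \<Omega>. \<exists>z\<in>K j. dist x z \<le> t})"
      have Am: "A j \<in> lmeasurable" if "j < N" for j unfolding A_def by (rule tube_lmeasurable[OF o\<Omega> \<Omega>(2) K(1)[OF that]])
      have UAm: "(\<Union>j<N. A j) \<in> lmeasurable" using Am by (intro fmeasurable.finite_UN) auto
      have sub: "{x \<in> \<Omega>. infdist x (- \<Omega>) \<le> t} \<subseteq> (\<Union>j<N. A j) \<union> B"
      proof
        fix x assume "x \<in> {x \<in> \<Omega>. infdist x (- \<Omega>) \<le> t}"
        from subsetD[OF boundary_layer_subset[OF o\<Omega> \<Omega>(2) cov] this]
        obtain z where z: "x \<in> \<Omega>" "z \<in> (\<Union>j<N. K j) \<union> C" "dist x z \<le> t" by blast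
        from z(2) show "x \<in> (\<Union>j<N. A j) \<union> B"
        proof
          assume "z \<in> (\<Union>j<N. K j)"
          then obtain j where "j < N" "z \<in> K j" by blast
          then show ?thesis using z(1,3) unfolding A_def by blast
        next
          assume "z \<in> C"
          then show ?thesis using z(1,3) by (intro UnI2 subsetD[OF B(2)]) blast
        qed
      qed
      have "closed {x. infdist x (- \<Omega>) \<le> t}" by (intro closed_Collect_le continuous_intros)
      then have "\<Omega> \<inter> {x. infdist x (- \<Omega>) \<le> t} \<in> sets borel" using o\<Omega> by (intro sets.Int) (auto intro: borel_closed)
      then have "\<Omega> \<inter> {x. infdist x (- \<Omega>) \<le> t} \<in> lmeasurable"
        using \<Omega>(2) by (intro bounded_set_imp_lmeasurable) (auto intro: bounded_subset)
      moreover have "\<Omega> \<inter> {x. infdist x (- \<Omega>) \<le> t} = {x \<in> \<Omega>. infdist x (- \<Omega>) \<le> t}" by blast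
      ultimately have L: "{x \<in> \<Omega>. infdist x (- \<Omega>) \<le> t} \<in> sets lebesgue" by (metis fmeasurableD)
      have "measure lebesgue {x \<in> \<Omega>. infdist x (- \<Omega>) \<le> t} \<le> measure lebesgue ((\<Union>j<N. A j) \<union> B)"
        by (rule measure_mono_fmeasurable[OF sub L]) (intro fmeasurable.Un UAm B(1))
      also have "\<dots> \<le> measure lebesgue (\<Union>j<N. A j) + measure lebesgue B"
        using UAm B(1) by (intro measure_Un_le) auto
      also have "measure lebesgue (\<Union>j<N. A j) \<le> (\<Sum>j<N. measure lebesgue (A j))"
        using Am by (intro measure_UNION_le) auto
      also have "\<dots> \<le> (\<Sum>j<N. (1 + 3 * \<eta>) * (measure lebesgue (shadow (e j) (K j)) + \<eta>') * t)"
      proof (rule sum_mono)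
        fix j assume j: "j \<in> {..<N}"
        have "t \<le> T j" using t(2) t0(3)[of j] j by auto
        then show "measure lebesgue (A j) \<le> (1 + 3 * \<eta>) * (measure lebesgue (shadow (e j) (K j)) + \<eta>') * t"
          using T j t(1) unfolding A_def by blast
      qed
      also have "\<dots> = (1 + 3 * \<eta>) * (\<Sum>j<N. measure lebesgue (shadow (e j) (K j)) + \<eta>') * t"
        by (simp only: sum_distrib_left sum_distrib_right)
      also have "\<dots> \<le> (1 + 3 * \<eta>) * (S + \<eta>) * t"
        using sum\<eta> \<eta> t(1) by (intro mult_right_mono mult_left_mono) auto
      finally have "measure lebesgue {x \<in> \<Omega>. infdist x (- \<Omega>) \<le> t} \<le> (1 + 3 * \<eta>) * (S + \<eta>) * t + measure lebesgue B"
        by simp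
      also have "\<dots> \<le> (1 + 3 * \<eta>) * (S + \<eta>) * t + 4 * pi * \<eta> * t" by (rule add_left_mono[OF B(3)])
      also have "\<dots> = ((1 + 3 * \<eta>) * (S + \<eta>) + 4 * pi * \<eta>) * t" by (simp only: distrib_right)
      finally show "measure lebesgue {x \<in> \<Omega>. infdist x (- \<Omega>) \<le> t} \<le> ((1 + 3 * \<eta>) * (S + \<eta>) + 4 * pi * \<eta>) * t" .
    qed
  qed
  have 7: "\<exists>(J :: nat set) \<zeta> e. finite J \<and> (\<forall>j\<in>J. \<zeta> j \<in> test_functions UNIV) \<and>
      (\<forall>x. norm (\<Sum>j\<in>J. \<zeta> j x *\<^sub>R e j) \<le> 1) \<and>
      S' \<le> - (\<Sum>j\<in>J. \<integral>x. frechet_derivative (\<zeta> j) (at x) (e j) \<partial>lebesgue_on \<Omega>)"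
    unfolding S'_def
    by (rule exE[OF normal_field[where N = N and e = e and y = y and r = r and K = K' and \<delta> = \<eta>, OF o\<Omega> \<Omega>(2) fl K']])
      (assumption | (elim exE, intro exI, assumption))+
  have 345: "0 \<le> S" "0 \<le> S'" "S \<le> S' + \<eta>" using SS by (auto simp: S_def S'_def intro: sum_nonneg)
  show thesis by (rule that[OF 1 2 345 6 7])
qed

text \<open>Every vertical line through a disc in \<Omega> must leave the bounded set and so meets
  the frontier; the projection to the first axis therefore contains an interval. Positivity is what
  turns the limit into an asymptotic equivalence.\<close>

lemma hausdorff_length_frontier_pos:
  fixes \<Omega> :: "(real^2) set"
  assumes \<Omega>: "open \<Omega>" "bounded \<Omega>" "\<Omega> \<noteq> {}"
  shows "0 < hausdorff_length (frontier \<Omega>)"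
proof -
  have cf: "compact (frontier \<Omega>)" using \<Omega>(2) by (simp add: compact_frontier_bounded)
  obtain x0 r where r: "0 < r" "cball x0 r \<subseteq> \<Omega>" using \<Omega>(1,3) open_contains_cball by blast
  define p where "p = (\<lambda>x::real^2. x $ 1)"
  obtain M where M: "\<And>x. x \<in> \<Omega> \<Longrightarrow> norm x \<le> M" using \<Omega>(2) by (auto simp: bounded_iff)
  have hit: "p x \<in> p ` frontier \<Omega>" if x: "x \<in> \<Omega>" for x
  proof -
    \<comment> \<open>A vertical shift by more than twice the bound \<open>M\<close> certainly
      leaves \<Omega>.\<close>
    define w where "w = x + (2 * \<bar>M\<bar> + 1) *\<^sub>R axis 2 1"
    have "2 * \<bar>M\<bar> + 1 = norm (w - x)" by (simp add: w_def norm_axis_1)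
    also have "\<dots> \<le> norm w + norm x" by (rule norm_triangle_ineq4)
    finally have "M < norm w" using M[OF x] by linarith
    then have "w \<notin> \<Omega>" using M[of w] by force
    then have "closed_segment x w \<inter> frontier \<Omega> \<noteq> {}"
      using x by (intro connected_Int_frontier connected_segment) auto
    then obtain z where z: "z \<in> closed_segment x w" "z \<in> frontier \<Omega>" by blast
    then obtain u where "z = (1 - u) *\<^sub>R x + u *\<^sub>R w" by (auto simp: in_segment)
    then have "p z = p x" by (simp add: p_def w_def axis_def algebra_simps)
    then show ?thesis using z(2) by (metis image_eqI)
  qed
  have sub: "{x0 $ 1..x0 $ 1 + r} \<subseteq> p ` frontier \<Omega>"
  proof
    fix s assume s: "s \<in> {x0 $ 1..x0 $ 1 + r}"
    define x where "x = x0 + (s - x0 $ 1) *\<^sub>R axis 1 1"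
    have "x \<in> cball x0 r" using s by (simp add: x_def dist_norm norm_axis_1)
    then have "p x \<in> p ` frontier \<Omega>" using hit r(2) by blast
    moreover have "p x = s" by (simp add: p_def x_def axis_def)
    ultimately show "s \<in> p ` frontier \<Omega>" by simp
  qed
  have cp: "compact (p ` frontier \<Omega>)" unfolding p_def by (intro compact_continuous_image cf continuous_intros)
  have "0 < ennreal r" using r by simp
  also have "ennreal r = emeasure lborel {x0 $ 1..x0 $ 1 + r}" using r by simp
  also have "\<dots> \<le> emeasure lborel (p ` frontier \<Omega>)"
    using borel_closed[OF compact_imp_closed[OF cp]] by (intro emeasure_mono sub) simp
  also have "\<dots> \<le> hausdorff_length (frontier \<Omega>)"
  proof -
    have "(\<Sum>j\<in>{()}. emeasure lborel (p ` frontier \<Omega>)) \<le> hausdorff_length (frontier \<Omega>)"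
    proof (rule hausdorff_length_ge)
      show "\<bar>p x - p y\<bar> \<le> dist x y" for x y
        using component_le_norm_cart[of "x - y" 1] by (simp add: p_def dist_norm)
    qed (use cf in auto)
    then show ?thesis by simp
  qed
  finally show ?thesis .
qed

theorem proposition5p2:
  fixes \<Upsilon> :: "(real^2) set" and \<phi> :: "real \<Rightarrow> real^2 \<Rightarrow> real"
  assumes "curvilinear_polygon \<Upsilon>" and "connected \<Upsilon>" and "\<Upsilon> \<noteq> {}" and "bounded \<Upsilon>"
    and "(\<nexists>c. reentrant_corner \<Upsilon> c) \<or>
         (\<exists>c \<theta>0 \<alpha>. {c'. reentrant_corner \<Upsilon> c'} = {c} \<and>
            has_opening \<Upsilon> c (2 * \<theta>0) \<and> 2 * \<theta>0 = pi / \<alpha> \<and> 1/2 < \<alpha> \<and> \<alpha> < 1 \<and>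
            sides_locally_straight \<Upsilon> c \<and> \<Upsilon> \<subseteq> (+) c ` tangent_cone \<Upsilon> c)"
    and "\<And>\<epsilon>. 0 < \<epsilon> \<Longrightarrow> variational_solution \<Upsilon> \<epsilon> (\<phi> \<epsilon>)"
  shows "(\<lambda>\<epsilon>. \<integral>x. exp (- \<phi> \<epsilon> x) / \<epsilon>\<^sup>2 \<partial>lebesgue_on \<Upsilon>)
           \<sim>[at_right 0] (\<lambda>\<epsilon>. sqrt 2 * perimeter \<Upsilon> / \<epsilon>)"
proof -
  have o: "open \<Upsilon>" using assms(1) by (simp add: curvilinear_polygon_def)
  define P where "P = perimeter \<Upsilon>"
  \<comment> \<open>\<open>perimeter\<close> would send an infinite length to 0, so finiteness is
    secured before it can stand for the Hausdorff length.\<close>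
  have fin: "hausdorff_length (frontier \<Upsilon>) < top"
    by (rule boundary_estimates[OF assms(1,4) zero_less_one]) (erule le_less_trans, simp)
  then have HP: "hausdorff_length (frontier \<Upsilon>) = ennreal P" by (simp add: P_def perimeter_def)
  have P: "0 < P" using hausdorff_length_frontier_pos[OF o assms(4,3)] by (simp add: HP)
  have "((\<lambda>\<epsilon>. (\<integral>x. exp (- \<phi> \<epsilon> x) \<partial>lebesgue_on \<Upsilon>) / \<epsilon>) \<longlongrightarrow> sqrt 2 * P) (at_right 0)"
  proof (rule mass_asymptotics[OF o assms(4)])
    fix \<beta> :: real assume \<beta>: "0 < \<beta>"
    \<comment> \<open>With \<eta> \<le> 1 the excess in the layer estimate is at most 3 \<eta> P + 8
      \<eta> from the flat pieces plus 16 \<eta>, which exceeds 4 pi \<eta>, from the discs: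
      together \<eta> (3 P + 24). The flux estimate loses less.\<close>
    define \<eta> where "\<eta> = min 1 (\<beta> / (3 * P + 24))"
    have \<eta>: "0 < \<eta>" "\<eta> \<le> 1" using \<beta> P by (auto simp: \<eta>_def)
    have "\<eta> \<le> \<beta> / (3 * P + 24)" by (simp add: \<eta>_def)
    then have \<eta>\<beta>: "\<eta> * (3 * P + 24) \<le> \<beta>" using P by (simp add: pos_le_divide_eq)
    have \<eta>\<eta>: "\<eta> * \<eta> \<le> \<eta> * 1" using \<eta> by (intro mult_left_mono) auto
    obtain S S' where S: "hausdorff_length (frontier \<Upsilon>) \<le> ennreal ((1 + \<eta>) * (S + \<eta>) + 2 * \<eta>)"
      "ennreal S' \<le> hausdorff_length (frontier \<Upsilon>)" "0 \<le> S" "0 \<le> S'" "S \<le> S' + \<eta>"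
      and up: "\<exists>t0>0. \<forall>t. 0 < t \<and> t \<le> t0 \<longrightarrow>
       measure lebesgue {x \<in> \<Upsilon>. infdist x (- \<Upsilon>) \<le> t} \<le> ((1 + 3 * \<eta>) * (S + \<eta>) + 4 * pi * \<eta>) * t"
      and low: "\<exists>(J :: nat set) \<zeta> e. finite J \<and> (\<forall>j\<in>J. \<zeta> j \<in> test_functions UNIV) \<and>
      (\<forall>x. norm (\<Sum>j\<in>J. \<zeta> j x *\<^sub>R e j) \<le> 1) \<and>
      S' \<le> - (\<Sum>j\<in>J. \<integral>x. frechet_derivative (\<zeta> j) (at x) (e j) \<partial>lebesgue_on \<Upsilon>)"
      by (rule boundary_estimates[OF assms(1,4) \<eta>(1)]) (rule that)
    have S'P: "S' \<le> P" using S(2) P unfolding HP by (simp add: ennreal_le_iff)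
    have PS: "P \<le> (1 + \<eta>) * (S + \<eta>) + 2 * \<eta>" using S(1,3) \<eta> unfolding HP by (subst (asm) ennreal_le_iff) auto
    show "\<exists>t0>0. \<forall>t. 0 < t \<and> t \<le> t0 \<longrightarrow> measure lebesgue {x \<in> \<Upsilon>. infdist x (- \<Upsilon>) \<le> t} \<le> (P + \<beta>) * t"
    proof -
      have "(1 + 3 * \<eta>) * (S + \<eta>) \<le> (1 + 3 * \<eta>) * (P + 2 * \<eta>)" using S(5) S'P \<eta> by (intro mult_left_mono) auto
      also have "\<dots> = P + 3 * (\<eta> * P) + 2 * \<eta> + 6 * (\<eta> * \<eta>)" by (simp add: algebra_simps)
      also have "\<dots> \<le> P + 3 * (\<eta> * P) + 8 * \<eta>" using \<eta>\<eta> by linarith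
      finally have a: "(1 + 3 * \<eta>) * (S + \<eta>) \<le> P + 3 * (\<eta> * P) + 8 * \<eta>" .
      have "4 * pi * \<eta> \<le> 16 * \<eta>" using pi_less_4 \<eta>(1) by (intro mult_right_mono) auto
      then have "(1 + 3 * \<eta>) * (S + \<eta>) + 4 * pi * \<eta> \<le> P + \<eta> * (3 * P + 24)" using a by (simp add: algebra_simps)
      then have le: "(1 + 3 * \<eta>) * (S + \<eta>) + 4 * pi * \<eta> \<le> P + \<beta>" using \<eta>\<beta> by linarith
      obtain t0 where t0: "0 < t0" "\<And>t. 0 < t \<Longrightarrow> t \<le> t0 \<Longrightarrow>
        measure lebesgue {x \<in> \<Upsilon>. infdist x (- \<Upsilon>) \<le> t} \<le> ((1 + 3 * \<eta>) * (S + \<eta>) + 4 * pi * \<eta>) * t" using up by blast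
      have "measure lebesgue {x \<in> \<Upsilon>. infdist x (- \<Upsilon>) \<le> t} \<le> (P + \<beta>) * t" if "0 < t" "t \<le> t0" for t
        using t0(2)[OF that] mult_right_mono[OF le, of t] that(1) by linarith
      then show ?thesis using t0(1) by blast
    qed
    have "P - \<beta> \<le> S'"
    proof -
      have "P \<le> (1 + \<eta>) * (S' + 2 * \<eta>) + 2 * \<eta>"
        using PS mult_left_mono[of "S + \<eta>" "S' + 2 * \<eta>" "1 + \<eta>"] S(5) \<eta> by linarith
      also have "\<dots> = S' + \<eta> * S' + 4 * \<eta> + 2 * (\<eta> * \<eta>)" by (simp add: algebra_simps)
      also have "\<dots> \<le> S' + \<eta> * P + 6 * \<eta>" using \<eta>\<eta> mult_left_mono[OF S'P, of \<eta>] \<eta>(1) by linarith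
      also have "\<dots> \<le> S' + \<eta> * (3 * P + 24)" using P \<eta>(1) mult_pos_pos[OF \<eta>(1) P] by (simp add: algebra_simps)
      finally show ?thesis using \<eta>\<beta> by linarith
    qed
    show "\<exists>(J :: nat set) \<zeta> e. finite J \<and> (\<forall>j\<in>J. \<zeta> j \<in> test_functions UNIV) \<and>
      (\<forall>x. norm (\<Sum>j\<in>J. \<zeta> j x *\<^sub>R e j) \<le> 1) \<and>
      P - \<beta> \<le> - (\<Sum>j\<in>J. \<integral>x. frechet_derivative (\<zeta> j) (at x) (e j) \<partial>lebesgue_on \<Upsilon>)"
      using low \<open>P - \<beta> \<le> S'\<close> order_trans[OF \<open>P - \<beta> \<le> S'\<close>] by (elim exE conjE) (intro exI conjI, assumption+)
  qed (use P assms(6) in auto)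
  then have "((\<lambda>\<epsilon>. (\<integral>x. exp (- \<phi> \<epsilon> x) \<partial>lebesgue_on \<Upsilon>) / \<epsilon> / (sqrt 2 * P)) \<longlongrightarrow> sqrt 2 * P / (sqrt 2 * P)) (at_right 0)"
    using P by (intro tendsto_divide tendsto_const) auto
  then have lim: "((\<lambda>\<epsilon>. (\<integral>x. exp (- \<phi> \<epsilon> x) \<partial>lebesgue_on \<Upsilon>) / \<epsilon> / (sqrt 2 * P)) \<longlongrightarrow> 1) (at_right 0)"
    using P by simp
  show ?thesis
  proof (rule asymp_equivI', rule Lim_transform_eventually[OF lim])
    have "\<forall>\<^sub>F \<epsilon> in at_right 0. (0::real) < \<epsilon>" by (simp add: eventually_at_filter)
    then show "\<forall>\<^sub>F \<epsilon> in at_right 0. (\<integral>x. exp (- \<phi> \<epsilon> x) \<partial>lebesgue_on \<Upsilon>) / \<epsilon> / (sqrt 2 * P) =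
      (\<integral>x. exp (- \<phi> \<epsilon> x) / \<epsilon>\<^sup>2 \<partial>lebesgue_on \<Upsilon>) / (sqrt 2 * perimeter \<Upsilon> / \<epsilon>)"
    proof (rule eventually_mono)
      fix \<epsilon> :: real assume "0 < \<epsilon>"
      then show "(\<integral>x. exp (- \<phi> \<epsilon> x) \<partial>lebesgue_on \<Upsilon>) / \<epsilon> / (sqrt 2 * P) =
        (\<integral>x. exp (- \<phi> \<epsilon> x) / \<epsilon>\<^sup>2 \<partial>lebesgue_on \<Upsilon>) / (sqrt 2 * perimeter \<Upsilon> / \<epsilon>)"
        unfolding integral_divide_zero P_def[symmetric] by (simp add: power2_eq_square)
    qed
  qed
qed

end
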